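(* Let $\mathcal H$ be an arbitrary (real or complex) Hilbert space, let $1<p<\infty$ with $p\notin\mathbb N$, and let $m=[p]$. Then the function $H\mapsto \|H\|_p^p$, $H\in\mathcal S^p$, is $m$-times Fréchet differentiable away from zero.
   Context: $\mathcal S^p$ is the Schatten-von Neumann class of compact operators on $\mathcal H$ with norm $\|H\|_p=(\operatorname{tr}|H|^p)^{1/p}$; it is regarded as a Banach space over the field of real numbers. $[p]$ denotes the integral part of $p$. "Away from zero" means at every point $H\neq 0$ of $\mathcal S^p$. *)

theory Defs
  imports "HOL-Analysis.Analysis"
begin

section \<open>Real and complex Hilbert spaces\<close>

text \<open>
  The two cases are treated together: the scalar field \<open>K\<close> is one of the sets \<open>\<real>\<close> and \<open>UNIV\<close> of
  complex numbers, and all scalars (in particular values of the inner product) are elements of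
  \<open>K\<close>. Nothing is assumed of \<open>scale c\<close> for \<open>c \<notin> K\<close>. Completeness, the topology and the underlying
  real vector space come from the class \<open>banach\<close>.
\<close>

locale hilbert_space =
  fixes K :: "complex set"
    and scale :: "complex \<Rightarrow> 'a::banach \<Rightarrow> 'a"
    and ip :: "'a \<Rightarrow> 'a \<Rightarrow> complex"
  assumes scalars: "K = \<real> \<or> K = UNIV"
    and scale_of_real: "scale (complex_of_real r) x = r *\<^sub>R x"
    and scale_add_right: "c \<in> K \<Longrightarrow> scale c (x + y) = scale c x + scale c y"
    and scale_add_left: "c \<in> K \<Longrightarrow> d \<in> K \<Longrightarrow> scale (c + d) x = scale c x + scale d x"
    and scale_scale: "c \<in> K \<Longrightarrow> d \<in> K \<Longrightarrow> scale c (scale d x) = scale (c * d) x"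
    and ip_in_scalars: "ip x y \<in> K"
    and ip_commute: "ip y x = cnj (ip x y)"
    and ip_add_left: "ip (x + y) z = ip x z + ip y z"
    and ip_scale_left: "c \<in> K \<Longrightarrow> ip (scale c x) y = c * ip x y"
    and ip_self: "ip x x = complex_of_real ((norm x)\<^sup>2)"

text \<open>Every complete real inner product space is an instance with \<open>K = \<real>\<close>.\<close>

lemma hilbert_space_real:
  "hilbert_space \<real> (\<lambda>c x. Re c *\<^sub>R x)
     (\<lambda>x y::'a::{real_inner,banach}. complex_of_real (x \<bullet> y))"
  by unfold_locales
    (auto simp: scaleR_add_right scaleR_add_left inner_add_left dot_square_norm
       intro: inner_commute elim!: Reals_cases)

lemma hilbert_space_complex: "hilbert_space UNIV (*) (\<lambda>x y. x * cnj y)"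
  by unfold_locales (auto simp: algebra_simps scaleR_conv_of_real
      complex_norm_square [symmetric])


section \<open>Schatten-von Neumann classes\<close>

context hilbert_space
begin

text \<open>Elements of \<open>'a \<Rightarrow>\<^sub>L 'a\<close> are only real-linear.\<close>

definition K_linear :: "('a \<Rightarrow>\<^sub>L 'a) \<Rightarrow> bool" where
  "K_linear H \<longleftrightarrow> (\<forall>c\<in>K. \<forall>x. blinfun_apply H (scale c x) = scale c (blinfun_apply H x))"

definition compact_op :: "('a \<Rightarrow>\<^sub>L 'a) \<Rightarrow> bool" where
  "compact_op H \<longleftrightarrow> K_linear H \<and> compact (closure (blinfun_apply H ` cball 0 1))"

definition adj :: "('a \<Rightarrow>\<^sub>L 'a) \<Rightarrow> ('a \<Rightarrow>\<^sub>L 'a)" where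
  "adj H = (THE G. \<forall>x y. ip (blinfun_apply H x) y = ip x (blinfun_apply G y))"

text \<open>Over the reals, symmetry does not follow from nonnegativity of the quadratic form.\<close>

definition positive_op :: "('a \<Rightarrow>\<^sub>L 'a) \<Rightarrow> bool" where
  "positive_op A \<longleftrightarrow> K_linear A \<and>
     (\<forall>x y. ip (blinfun_apply A x) y = ip x (blinfun_apply A y)) \<and>
     (\<forall>x. 0 \<le> Re (ip (blinfun_apply A x) x))"

definition abs_op :: "('a \<Rightarrow>\<^sub>L 'a) \<Rightarrow> ('a \<Rightarrow>\<^sub>L 'a)" where
  "abs_op H = (THE A. positive_op A \<and> A o\<^sub>L A = adj H o\<^sub>L H)"

definition orth_proj :: "'a set \<Rightarrow> 'a \<Rightarrow> 'a" where
  "orth_proj M x = (THE y. y \<in> M \<and> (\<forall>z\<in>M. ip (x - y) z = 0))"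

definition eigenspace :: "('a \<Rightarrow>\<^sub>L 'a) \<Rightarrow> real \<Rightarrow> 'a set" where
  "eigenspace A l = {x. blinfun_apply A x = l *\<^sub>R x}"

text \<open>
  The power \<open>A\<^sup>p\<close>, \<open>p > 0\<close>, of a compact positive operator by its spectral decomposition
  \<open>A = (\<Sum>l. l P\<^sub>l)\<close>. If \<open>l\<close> is not an eigenvalue, its eigenspace is \<open>{0}\<close> and the summand vanishes;
  the kernel of \<open>A\<close> contributes nothing because \<open>0\<^sup>p = 0\<close>.
\<close>

definition op_powr :: "('a \<Rightarrow>\<^sub>L 'a) \<Rightarrow> real \<Rightarrow> 'a \<Rightarrow> 'a" where
  "op_powr A p x = (\<Sum>\<^sub>\<infinity>l\<in>{0<..}. (l powr p) *\<^sub>R orth_proj (eigenspace A l) x)"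

definition orthonormal_basis :: "'a set \<Rightarrow> bool" where
  "orthonormal_basis B \<longleftrightarrow>
     (\<forall>e\<in>B. norm e = 1) \<and>
     (\<forall>e\<in>B. \<forall>f\<in>B. e \<noteq> f \<longrightarrow> ip e f = 0) \<and>
     (\<forall>x. (\<forall>e\<in>B. ip x e = 0) \<longrightarrow> x = 0)"

definition has_trace :: "('a \<Rightarrow> 'a) \<Rightarrow> complex \<Rightarrow> bool" where
  "has_trace T t \<longleftrightarrow> (\<forall>B. orthonormal_basis B \<longrightarrow> ((\<lambda>e. ip (T e) e) has_sum t) B)"

definition trace :: "('a \<Rightarrow> 'a) \<Rightarrow> complex" where
  "trace T = (THE t. has_trace T t)"

definition schatten_class :: "real \<Rightarrow> ('a \<Rightarrow>\<^sub>L 'a) set" where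
  "schatten_class p = {H. compact_op H \<and> (\<exists>t. has_trace (op_powr (abs_op H) p) t)}"

definition schatten_norm :: "real \<Rightarrow> ('a \<Rightarrow>\<^sub>L 'a) \<Rightarrow> real" where
  "schatten_norm p H = Re (trace (op_powr (abs_op H) p)) powr (1 / p)"

end


section \<open>Higher Frechet differentiability\<close>

text \<open>
  The normed space is given by a subspace \<open>V\<close> of a real vector space and a norm \<open>N\<close> on \<open>V\<close>, since
  the Schatten norm depends on the real parameter \<open>p\<close> and cannot be attached to a type.
  A \<open>k\<close>-linear map on \<open>V\<close> is a function of lists of length \<open>k\<close>.
\<close>

definition bounded_multilinear_on ::
  "'v::real_vector set \<Rightarrow> ('v \<Rightarrow> real) \<Rightarrow> nat \<Rightarrow> ('v list \<Rightarrow> 'w::real_normed_vector) \<Rightarrow> bool" where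
  "bounded_multilinear_on V N k T \<longleftrightarrow>
     (\<forall>xs ys. \<forall>u\<in>V. \<forall>v\<in>V. \<forall>a b.
        set xs \<subseteq> V \<and> set ys \<subseteq> V \<and> length xs + length ys + 1 = k \<longrightarrow>
        T (xs @ (a *\<^sub>R u + b *\<^sub>R v) # ys) = a *\<^sub>R T (xs @ u # ys) + b *\<^sub>R T (xs @ v # ys)) \<and>
     (\<exists>C. \<forall>vs. set vs \<subseteq> V \<and> length vs = k \<longrightarrow> norm (T vs) \<le> C * prod_list (map N vs))"

text \<open>
  \<open>L\<close> is the Frechet derivative at \<open>x\<close> of \<open>F\<close>, a map from the open set \<open>U \<subseteq> V\<close> into the
  bounded \<open>k\<close>-linear maps with the operator norm. As usual, bounded linear maps from
  \<open>V\<close> into this space are identified with bounded \<open>(k + 1)\<close>-linear maps, the direction \<open>h\<close> of the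
  derivative being the first argument; the final inequality says that the operator norm of the
  remainder is at most \<open>\<epsilon> * N h\<close>.
\<close>

definition has_frechet_derivative_on ::
  "'v::real_vector set \<Rightarrow> ('v \<Rightarrow> real) \<Rightarrow> 'v set \<Rightarrow> nat \<Rightarrow>
     ('v \<Rightarrow> 'v list \<Rightarrow> 'w::real_normed_vector) \<Rightarrow> ('v list \<Rightarrow> 'w) \<Rightarrow> 'v \<Rightarrow> bool" where
  "has_frechet_derivative_on V N U k F L x \<longleftrightarrow>
     bounded_multilinear_on V N (Suc k) L \<and>
     (\<forall>\<epsilon>>0. \<exists>\<delta>>0. \<forall>h\<in>V. x + h \<in> U \<and> N h < \<delta> \<longrightarrow>
        (\<forall>vs. set vs \<subseteq> V \<and> length vs = k \<longrightarrow>
           norm (F (x + h) vs - F x vs - L (h # vs)) \<le> \<epsilon> * N h * prod_list (map N vs)))"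

text \<open>\<open>D k\<close> is the \<open>k\<close>-th derivative of \<open>f\<close>.\<close>

definition times_frechet_differentiable_on ::
  "nat \<Rightarrow> 'v::real_vector set \<Rightarrow> ('v \<Rightarrow> real) \<Rightarrow> 'v set \<Rightarrow> ('v \<Rightarrow> 'w::real_normed_vector) \<Rightarrow> bool" where
  "times_frechet_differentiable_on m V N U f \<longleftrightarrow>
     (\<exists>D. (\<forall>x\<in>U. D 0 x [] = f x) \<and>
          (\<forall>k<m. \<forall>x\<in>U. has_frechet_derivative_on V N U k (D k) (D (Suc k) x) x))"

end

theory Submission
  imports Defs
begin

text \<open>
  Replacing \<open>H\<close> by the operator \<open>X: (x, y) \<mapsto> (H y, - H\<^sup>* x)\<close> on the real Hilbert space \<open>'a \<times> 'a\<close>, one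
  may work with skew operators, for which \<open>(1 + X)\<inverse>\<close> is a contraction. Up to a constant factor,
  \<open>\<parallel>H\<parallel>\<^sup>p\<close> is the integral of \<open>s\<^bsup>p-1\<^esup> tr (R(X/s))\<close> over \<open>s > 0\<close>, where \<open>R(Y)\<close> is \<open>(1 + Y)\<inverse>\<close> minus its
  Taylor polynomial of degree \<open>m\<close>. The identity
  \<open>(1 + X')\<inverse> - (1 + X)\<inverse> = - (1 + X')\<inverse> (X' - X) (1 + X)\<inverse>\<close> and its analogue for Taylor remainders
  express the increments of this integral, and of the multilinear integrals that arise from it, exactly
  through integrals of the same kind with one more argument and a remainder of one degree less. Hence
  it suffices to bound these integrals by Schatten norms and to show that they depend continuously on
  the points at which the resolvents are taken.

  For the bound write \<open>p = k + \<theta> + n\<close> with \<open>n\<close> arguments and \<open>0 < \<theta> < 1\<close>. For \<open>0 < \<alpha> < 1\<close> all signed sums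
  of \<open>s\<^sup>\<alpha> (X/s) (1 + X/s)\<inverse>\<close> over \<open>s = 2\<^sup>j s\<^sub>0\<close> are bounded in the Schatten class of exponent \<open>p / \<alpha>\<close>; this
  passes to products by averaging over the signs and Hoelder's inequality, until exponent \<open>1\<close> is
  reached and the traces are absolutely summable over \<open>j\<close>.
\<close>


section \<open>Operators on a Hilbert space\<close>

text \<open>Skewness makes the integral formula available: the spectrum of X is imaginary, so (1 +
  X/s)^(-1) exists for every real s > 0, which fails for a general H. The passage from H to X is
  only real-linear, because the adjoint is conjugate-linear; this is why the analysis takes place
  over the reals. The obstacle is that estimates scale by scale do not close: for a general X in the
  Schatten class, the norms of s^\<alpha> (X/s)(1 + X/s)^(-1) need not be summable over dyadic s.
  The scales are therefore summed for each singular value w separately, where s^\<alpha> min(1, w/s)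
  decays geometrically on both sides of s = w, and only then is a Schatten norm taken. Decay on both
  sides requires exponents strictly between 0 and 1, and this is where p being no integer enters.
  Each differentiation lowers the degree of the Taylor remainder by one and spends one power of s on
  the new argument; after m steps the degree is 0 and the weight is s^\<theta> with respect to ds/s,
  for which the integral still converges.\<close>

context hilbert_space
begin

section \<open>Inner product calculus over the scalars \<open>K\<close>\<close>

lemma of_real_in_scalars [simp]: "complex_of_real r \<in> K"
  using scalars by auto

lemma scalars_closed:
  assumes "c \<in> K" "d \<in> K"
  shows "c + d \<in> K" "c * d \<in> K" "- c \<in> K" "cnj c \<in> K" "c / d \<in> K" "cnj c / d \<in> K"
  using scalars assms by (auto simp: Reals_cnj_iff)

lemma ip_scaleR_left: "ip (r *\<^sub>R x) y = r *\<^sub>R ip x y"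
  using ip_scale_left [of "complex_of_real r" x y] by (simp add: scale_of_real scaleR_conv_of_real)

lemma ip_add_right: "ip x (y + z) = ip x y + ip x z"
  by (metis complex_cnj_add ip_add_left ip_commute)

lemma ip_scale_right: "c \<in> K \<Longrightarrow> ip x (scale c y) = cnj c * ip x y"
  by (metis complex_cnj_mult ip_commute ip_scale_left)

lemma ip_scaleR_right: "ip x (r *\<^sub>R y) = r *\<^sub>R ip x y"
  by (metis complex_cnj_scaleR ip_commute ip_scaleR_left)

lemma ip_zero [simp]: "ip 0 x = 0" "ip x 0 = 0"
  using ip_scaleR_left [of 0 0 x] ip_scaleR_right [of x 0 0] by auto

lemma ip_minus_left: "ip (- x) y = - ip x y"
  using ip_scaleR_left [of "-1"] by simp

lemma ip_minus_right: "ip x (- y) = - ip x y"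
  using ip_scaleR_right [of _ "-1"] by simp

lemma ip_diff_left: "ip (x - y) z = ip x z - ip y z"
  using ip_add_left [of x "- y"] by (simp add: ip_minus_left)

lemma ip_diff_right: "ip x (y - z) = ip x y - ip x z"
  using ip_add_right [of x y "- z"] by (simp add: ip_minus_right)

lemma scale_simps [simp]: "scale 1 x = x" "scale 0 x = 0" "scale (-1) x = - x"
  "c \<in> K \<Longrightarrow> scale c 0 = 0"
  using scale_of_real [of 1 x] scale_of_real [of 0 x] scale_of_real [of "-1" x]
    scale_add_right [of c 0 0] by auto

lemma ip_self_zero_iff: "ip x x = 0 \<longleftrightarrow> x = 0"
  by (simp add: ip_self)

lemma ip_eqI_right: "(\<And>z. ip z x = ip z y) \<Longrightarrow> x = y"
  using ip_self_zero_iff [of "x - y"] by (simp add: ip_diff_right)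

lemma ip_Re_commute: "Re (ip x y) = Re (ip y x)"
  using ip_commute [of x y] by simp

lemma norm_diff_sq: "(norm (x - y))\<^sup>2 = (norm x)\<^sup>2 + (norm y)\<^sup>2 - 2 * Re (ip x y)"
proof -
  have "complex_of_real ((norm (x - y))\<^sup>2) = ip x x + ip y y - (ip x y + ip y x)"
    unfolding ip_self [symmetric] by (simp add: ip_diff_left ip_diff_right)
  then have "Re (complex_of_real ((norm (x - y))\<^sup>2)) = Re (ip x x + ip y y - (ip x y + ip y x))"
    by simp
  then show ?thesis
    using ip_Re_commute [of x y] by (simp add: ip_self)
qed

lemma norm_add_sq: "(norm (x + y))\<^sup>2 = (norm x)\<^sup>2 + (norm y)\<^sup>2 + 2 * Re (ip x y)"
  using norm_diff_sq [of x "- y"] by (simp add: ip_minus_right)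

lemma norm_scale: "c \<in> K \<Longrightarrow> norm (scale c x) = cmod c * norm x"
proof -
  assume c: "c \<in> K"
  have "complex_of_real ((norm (scale c x))\<^sup>2) = c * cnj c * ip x x"
    unfolding ip_self [symmetric] using c by (simp add: ip_scale_left ip_scale_right)
  also have "\<dots> = complex_of_real ((cmod c * norm x)\<^sup>2)"
    by (simp only: complex_norm_square [symmetric] ip_self of_real_mult power_mult_distrib)
  finally have "(norm (scale c x))\<^sup>2 = (cmod c * norm x)\<^sup>2"
    by (simp only: of_real_eq_iff)
  then show ?thesis by simp
qed

lemma ip_norm_le: "cmod (ip x y) \<le> norm x * norm y"
proof (cases "y = 0")
  case False
  \<comment> \<open>The coefficient of the projection of \<open>x\<close> onto \<open>y\<close>. It
    has to lie in \<open>K\<close>, since the laws for \<open>scale\<close> and \<open>ip\<close>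
    are available only for scalars in \<open>K\<close>.\<close>
  define c where "c = ip x y / complex_of_real ((norm y)\<^sup>2)"
  have c: "c \<in> K" unfolding c_def by (rule scalars_closed(5) [OF ip_in_scalars of_real_in_scalars])
  have "0 \<le> (norm (x - scale c y))\<^sup>2" by simp
  also have "\<dots> = (norm x)\<^sup>2 + (cmod c * norm y)\<^sup>2 - 2 * Re (cnj c * ip x y)"
    using c by (simp add: norm_diff_sq norm_scale ip_scale_right)
  also have "(cmod c * norm y)\<^sup>2 = (cmod (ip x y))\<^sup>2 / (norm y)\<^sup>2"
  proof -
    have "cmod c = cmod (ip x y) / (norm y)\<^sup>2" by (simp add: c_def norm_divide norm_power)
    then show ?thesis using False by (simp add: power2_eq_square)
  qed
  also have "cnj c * ip x y = complex_of_real ((cmod (ip x y))\<^sup>2 / (norm y)\<^sup>2)"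
    using complex_norm_square [of "ip x y"] by (simp add: c_def mult.commute)
  finally have "(cmod (ip x y))\<^sup>2 / (norm y)\<^sup>2 \<le> (norm x)\<^sup>2" by simp
  then have "(cmod (ip x y))\<^sup>2 \<le> (norm x * norm y)\<^sup>2"
    using False by (simp add: field_simps power_mult_distrib)
  then show ?thesis by (rule power2_le_imp_le) simp
qed simp

lemma bounded_bilinear_ip: "bounded_bilinear ip"
  by unfold_locales
    (auto simp: ip_add_left ip_add_right ip_scaleR_left ip_scaleR_right
      intro!: exI [of _ 1] ip_norm_le)

lemma bounded_linear_scale: "c \<in> K \<Longrightarrow> bounded_linear (scale c)"
proof (rule bounded_linear_intro [where K = "cmod c"])
  fix r x assume c: "c \<in> K"
  then show "scale c (r *\<^sub>R x) = r *\<^sub>R scale c x"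
    by (simp add: scale_of_real [symmetric] scale_scale mult.commute)
qed (auto simp: scale_add_right norm_scale)

lemmas ip_sum_left = bounded_bilinear.sum_left [OF bounded_bilinear_ip]
lemmas ip_sum_right = bounded_bilinear.sum_right [OF bounded_bilinear_ip]

section \<open>Projections, Riesz representation and adjoints\<close>

definition K_subspace :: "'a set \<Rightarrow> bool" where
  "K_subspace M \<longleftrightarrow> 0 \<in> M \<and> (\<forall>x\<in>M. \<forall>y\<in>M. x + y \<in> M) \<and> (\<forall>c\<in>K. \<forall>x\<in>M. scale c x \<in> M)"

lemma K_subspace_scaleR: "K_subspace M \<Longrightarrow> x \<in> M \<Longrightarrow> r *\<^sub>R x \<in> M"
  unfolding K_subspace_def by (metis of_real_in_scalars scale_of_real)

lemma K_subspace_diff: "K_subspace M \<Longrightarrow> x \<in> M \<Longrightarrow> y \<in> M \<Longrightarrow> x - y \<in> M"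
  using K_subspace_scaleR [of M y "-1"] unfolding K_subspace_def by fastforce

lemma parallelogram: "(norm (x - y :: 'a))\<^sup>2 = 2 * (norm x)\<^sup>2 + 2 * (norm y)\<^sup>2 - (norm (x + y))\<^sup>2"
  using norm_diff_sq [of x y] norm_add_sq [of x y] by simp

text \<open>A minimizing sequence for the distance from \<open>x\<close> to \<open>M\<close> is
  Cauchy by the parallelogram law, since the midpoint of two of its members is again in
  \<open>M\<close>. Completeness supplies the minimizer, and first-order optimality is
  orthogonality.\<close>

lemma projection_exists:
  assumes M: "K_subspace M" "closed M"
  shows "\<exists>y\<in>M. \<forall>z\<in>M. ip (x - y) z = 0"
proof -
  define d where "d = Inf ((\<lambda>y. (norm (x - y))\<^sup>2) ` M)"
  have ne: "M \<noteq> {}" using M by (auto simp: K_subspace_def)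
  have bdd: "bdd_below ((\<lambda>y. (norm (x - y))\<^sup>2) ` M)" by (rule bdd_belowI2 [of _ 0]) simp
  have d_le: "d \<le> (norm (x - y))\<^sup>2" if "y \<in> M" for y
    unfolding d_def using bdd that by (rule cINF_lower)
  have "\<exists>y\<in>M. (norm (x - y))\<^sup>2 < d + 1 / real (Suc n)" for n
    using cINF_less_iff [OF ne bdd, of "d + 1 / real (Suc n)"] unfolding d_def by auto
  then obtain y where y: "\<And>n. y n \<in> M" "\<And>n. (norm (x - y n))\<^sup>2 < d + 1 / real (Suc n)"
    by metis
  have close: "(norm (y i - y j))\<^sup>2 \<le> 2 / real (Suc i) + 2 / real (Suc j)" for i j
  proof -
    have mid: "(1/2) *\<^sub>R (y i + y j) \<in> M"
      using M y by (intro K_subspace_scaleR) (auto simp: K_subspace_def)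
    have "(x - y j) + (x - y i) = 2 *\<^sub>R (x - (1/2) *\<^sub>R (y i + y j))"
      by (simp add: algebra_simps scaleR_2)
    then have "(norm ((x - y j) + (x - y i)))\<^sup>2 = 4 * (norm (x - (1/2) *\<^sub>R (y i + y j)))\<^sup>2"
      by (simp add: power_mult_distrib)
    with d_le [OF mid] have "(norm ((x - y j) + (x - y i)))\<^sup>2 \<ge> 4 * d" by simp
    moreover have "y i - y j = (x - y j) - (x - y i)" by simp
    ultimately have "(norm (y i - y j))\<^sup>2 \<le> 2 * (norm (x - y j))\<^sup>2 + 2 * (norm (x - y i))\<^sup>2 - 4 * d"
      by (simp only: parallelogram)
    with y(2)[of i] y(2)[of j] show ?thesis by simp
  qed
  have "Cauchy y"
  proof (rule metric_CauchyI)
    fix e :: real assume "e > 0"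
    then obtain N where N: "4 / e\<^sup>2 < real N" using reals_Archimedean2 by blast
    have "dist (y i) (y j) < e" if "i \<ge> N" "j \<ge> N" for i j
    proof -
      have "2 / real (Suc i) < e\<^sup>2 / 2" if "i \<ge> N" for i
      proof -
        have "4 / e\<^sup>2 < real (Suc i)" using N that by simp
        then show ?thesis using \<open>e > 0\<close> by (simp add: field_simps)
      qed
      from this [OF \<open>i \<ge> N\<close>] this [OF \<open>j \<ge> N\<close>] close [of i j]
      have "(norm (y i - y j))\<^sup>2 < e\<^sup>2" by simp
      then show ?thesis using \<open>e > 0\<close> by (simp add: dist_norm power2_less_imp_less)
    qed
    then show "\<exists>N. \<forall>i\<ge>N. \<forall>j\<ge>N. dist (y i) (y j) < e" by blast
  qed
  then obtain l where l: "y \<longlonglongrightarrow> l" using Cauchy_convergent convergent_def by blast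
  then have lM: "l \<in> M" using M(2) y(1) closed_sequentially by blast
  have "(\<lambda>n. (norm (x - y n))\<^sup>2) \<longlonglongrightarrow> (norm (x - l))\<^sup>2" by (intro tendsto_intros l)
  moreover have "(\<lambda>n. d + 1 / real (Suc n)) \<longlonglongrightarrow> d + 0"
    by (intro tendsto_intros LIMSEQ_Suc lim_1_over_n)
  ultimately have "(norm (x - l))\<^sup>2 \<le> d + 0"
    by (rule LIMSEQ_le) (use y(2) less_imp_le in blast)
  then have min: "(norm (x - l))\<^sup>2 \<le> (norm (x - z))\<^sup>2" if "z \<in> M" for z
    using d_le [OF that] by linarith
  have "ip (x - l) z = 0" if z: "z \<in> M" for z
  proof (cases "z = 0")
    case False
    \<comment> \<open>Moving the minimizer by the best multiple of \<open>z\<close> would lower the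
      squared distance by |\<open>ip (x - l) z\<close>|^2 / (\<open>norm z\<close>)^2, so this
      quantity vanishes.\<close>
    define c where "c = ip (x - l) z / complex_of_real ((norm z)\<^sup>2)"
    have c: "c \<in> K" unfolding c_def by (rule scalars_closed(5) [OF ip_in_scalars of_real_in_scalars])
    have "l + scale c z \<in> M" using lM z c M by (auto simp: K_subspace_def)
    from min [OF this] have "(norm (x - l))\<^sup>2 \<le> (norm ((x - l) - scale c z))\<^sup>2"
      by (simp add: algebra_simps)
    also have "\<dots> = (norm (x - l))\<^sup>2 + (cmod c * norm z)\<^sup>2 - 2 * Re (cnj c * ip (x - l) z)"
      using c by (simp add: norm_diff_sq norm_scale ip_scale_right)
    also have "(cmod c * norm z)\<^sup>2 = (cmod (ip (x - l) z))\<^sup>2 / (norm z)\<^sup>2"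
    proof -
      have "cmod c = cmod (ip (x - l) z) / (norm z)\<^sup>2" by (simp add: c_def norm_divide norm_power)
      then show ?thesis using False by (simp add: power2_eq_square)
    qed
    also have "cnj c * ip (x - l) z = complex_of_real ((cmod (ip (x - l) z))\<^sup>2 / (norm z)\<^sup>2)"
      using complex_norm_square [of "ip (x - l) z"] by (simp add: c_def mult.commute)
    finally have "(cmod (ip (x - l) z))\<^sup>2 / (norm z)\<^sup>2 \<le> 0" by simp
    then show ?thesis using False by (simp add: divide_le_0_iff)
  qed simp
  with lM show ?thesis by blast
qed

lemma orth_proj_eqI:
  assumes "K_subspace M" "y \<in> M" "\<forall>z\<in>M. ip (x - y) z = 0"
  shows "orth_proj M x = y"
  unfolding orth_proj_def
proof (rule the_equality)
  fix y' assume y': "y' \<in> M \<and> (\<forall>z\<in>M. ip (x - y') z = 0)"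
  have "y' - y \<in> M" using K_subspace_diff assms y' by blast
  then have "ip (x - y) (y' - y) - ip (x - y') (y' - y) = 0" using assms y' by auto
  then have "ip (y' - y) (y' - y) = 0" by (simp add: ip_diff_left)
  then show "y' = y" by (simp add: ip_self_zero_iff)
qed (use assms in auto)

lemma K_subspace_Ker:
  assumes "\<And>x y. f (x + y) = f x + (f y :: complex)" "\<And>c x. c \<in> K \<Longrightarrow> f (scale c x) = c * f x"
  shows "K_subspace {x. f x = 0}"
proof -
  have "f 0 = 0" using assms(2)[of 0 0] of_real_in_scalars [of 0] by simp
  then show ?thesis using assms by (simp add: K_subspace_def)
qed

text \<open>The representing vector is a multiple of a vector \<open>u\<close> orthogonal to the
  kernel of \<open>f\<close>. Because the values of \<open>f\<close> lie in \<open>K\<close>, so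
  does the coefficient, which lets one argument serve the real and the complex case.\<close>

lemma riesz:
  assumes f: "bounded_linear f" "\<And>c x. c \<in> K \<Longrightarrow> f (scale c x) = c * f x" "\<And>x. f x \<in> K"
  shows "\<exists>y. \<forall>x. f x = ip x y"
proof (cases "\<forall>x. f x = 0")
  case True then show ?thesis by (intro exI [of _ 0]) auto
next
  case False
  then obtain x0 where x0: "f x0 \<noteq> 0" by blast
  interpret f: bounded_linear f by fact
  let ?M = "{x. f x = 0}"
  have M: "K_subspace ?M" using f.add f(2) by (intro K_subspace_Ker)
  have "closed ?M" by (intro closed_Collect_eq linear_continuous_on f continuous_on_const)
  from projection_exists [OF M this, of x0] obtain y where y: "f y = 0" "\<And>z. f z = 0 \<Longrightarrow> ip (x0 - y) z = 0"
    by auto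
  define u where "u = x0 - y"
  have fu: "f u \<noteq> 0" using x0 y by (simp add: u_def f.diff)
  then have u0: "u \<noteq> 0" by (auto simp: f.zero)
  have perp: "ip z u = 0" if "f z = 0" for z
    using y(2)[OF that] ip_commute [of u z] by (simp add: u_def)
  define c where "c = cnj (f u) / complex_of_real ((norm u)\<^sup>2)"
  have c: "c \<in> K" unfolding c_def by (rule scalars_closed(6) [OF f(3) of_real_in_scalars])
  show ?thesis
  proof (intro exI [of _ "scale c u"] allI)
    fix x
    define a where "a = f x / f u"
    have a: "a \<in> K" unfolding a_def by (rule scalars_closed(5) [OF f(3) f(3)])
    have "f (x - scale a u) = 0" using a fu by (simp add: f.diff f(2) a_def)
    from perp [OF this] have "ip x u = a * ip u u" using a by (simp add: ip_diff_left ip_scale_left)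
    then show "f x = ip x (scale c u)"
      using c u0 fu by (simp add: ip_scale_right c_def a_def ip_self)
  qed
qed

lemma adj_exists:
  assumes "K_linear H"
  shows "\<exists>G. \<forall>x y. ip (blinfun_apply H x) y = ip x (blinfun_apply G y)"
proof -
  have "\<exists>z. \<forall>x. ip (blinfun_apply H x) y = ip x z" for y
  proof (rule riesz)
    show "bounded_linear (\<lambda>x. ip (blinfun_apply H x) y)"
      by (intro bounded_linear_compose [OF bounded_bilinear.bounded_linear_left [OF bounded_bilinear_ip]]
          blinfun.bounded_linear_right)
  qed (use assms in \<open>auto simp: K_linear_def ip_scale_left ip_in_scalars\<close>)
  then obtain g where g: "\<And>x y. ip (blinfun_apply H x) y = ip x (g y)" by metis
  have "bounded_linear g"
  proof (rule bounded_linear_intro [where K = "norm H"])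
    show "g (x + y) = g x + g y" for x y
      by (rule ip_eqI_right) (simp add: g [symmetric] ip_add_right)
    show "g (r *\<^sub>R x) = r *\<^sub>R g x" for r x
      by (rule ip_eqI_right) (simp add: g [symmetric] ip_scaleR_right)
    show "norm (g x) \<le> norm x * norm H" for x
    proof -
      have "complex_of_real ((norm (g x))\<^sup>2) = ip (blinfun_apply H (g x)) x"
        by (simp add: g ip_self)
      then have "(norm (g x))\<^sup>2 = cmod (ip (blinfun_apply H (g x)) x)"
        by (metis abs_power2 norm_of_real real_norm_def)
      also have "\<dots> \<le> norm (blinfun_apply H (g x)) * norm x" by (rule ip_norm_le)
      also have "\<dots> \<le> (norm H * norm (g x)) * norm x" by (intro mult_right_mono norm_blinfun) simp
      finally have *: "norm (g x) * norm (g x) \<le> (norm x * norm H) * norm (g x)"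
        by (simp add: power2_eq_square mult_ac)
      show ?thesis
      proof (cases "norm (g x) = 0")
        case False
        then have "norm (g x) > 0" by simp
        with * show ?thesis by (simp only: mult_le_cancel_right_pos)
      qed simp
    qed
  qed
  then show ?thesis using g by (intro exI [of _ "Blinfun g"]) (simp add: bounded_linear_Blinfun_apply)
qed

lemma adj_unique:
  assumes "\<And>x y. ip (blinfun_apply H x) y = ip x (blinfun_apply G y)"
  shows "adj H = G"
  unfolding adj_def
proof (rule the_equality)
  fix G' assume "\<forall>x y. ip (blinfun_apply H x) y = ip x (blinfun_apply G' y)"
  then have "blinfun_apply G' y = blinfun_apply G y" for y
    using assms by (intro ip_eqI_right) metis
  then show "G' = G" by (rule blinfun_eqI)
qed (use assms in auto)

lemma ip_adj:
  assumes "K_linear H"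
  shows "ip (blinfun_apply H x) y = ip x (blinfun_apply (adj H) y)"
  using adj_exists [OF assms] adj_unique by blast

lemma ip_adj':
  assumes "K_linear H"
  shows "ip (blinfun_apply (adj H) x) y = ip x (blinfun_apply H y)"
  by (metis assms ip_adj ip_commute)

lemma K_linear_adj:
  assumes "K_linear H"
  shows "K_linear (adj H)"
  unfolding K_linear_def
proof (intro ballI allI)
  fix c x assume c: "c \<in> K"
  show "blinfun_apply (adj H) (scale c x) = scale c (blinfun_apply (adj H) x)"
    by (rule ip_eqI_right) (use c assms in \<open>simp add: ip_adj [symmetric] ip_scale_right\<close>)
qed

lemma adj_lincomb:
  assumes "K_linear A" "K_linear B"
  shows "adj (a *\<^sub>R A + b *\<^sub>R B) = a *\<^sub>R adj A + b *\<^sub>R adj B"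
  by (rule adj_unique)
    (simp add: blinfun.add_left blinfun.scaleR_left ip_add_left ip_scaleR_left ip_adj assms
      ip_add_right ip_scaleR_right)

end

section \<open>Compact operators between normed spaces\<close>

definition compact_map :: "('a::real_normed_vector \<Rightarrow>\<^sub>L 'b::real_normed_vector) \<Rightarrow> bool" where
  "compact_map A \<longleftrightarrow>
     (\<forall>x::nat \<Rightarrow> 'a. bounded (range x) \<longrightarrow>
        (\<exists>r l. strict_mono r \<and> (\<lambda>n. blinfun_apply A (x (r n))) \<longlonglongrightarrow> l))"

lemma compact_mapE:
  assumes "compact_map A" "\<And>n::nat. norm (x n) \<le> C"
  obtains r l where "strict_mono r" "(\<lambda>n. blinfun_apply A (x (r n))) \<longlonglongrightarrow> l"
proof -
  have "bounded (range x)" using assms(2) by (auto simp: bounded_iff)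
  then show ?thesis using assms(1) that unfolding compact_map_def by blast
qed

lemma compact_map_compose_left: "compact_map A \<Longrightarrow> compact_map (B o\<^sub>L A)"
  unfolding compact_map_def using blinfun.tendsto [OF tendsto_const, of _ _ sequentially B] by fastforce

lemma compact_map_compose_right:
  fixes A :: "'b::real_normed_vector \<Rightarrow>\<^sub>L 'c::real_normed_vector"
    and B :: "'a::real_normed_vector \<Rightarrow>\<^sub>L 'b"
  assumes "compact_map A"
  shows "compact_map (A o\<^sub>L B)"
  unfolding compact_map_def
proof (intro allI impI)
  fix x :: "nat \<Rightarrow> 'a" assume "bounded (range x)"
  then have "bounded (range (\<lambda>n. blinfun_apply B (x n)))"
    using bounded_linear_image [OF _ blinfun.bounded_linear_right, of "range x" B]
    by (simp add: image_image)
  then show "\<exists>r l. strict_mono r \<and> (\<lambda>n. blinfun_apply (A o\<^sub>L B) (x (r n))) \<longlonglongrightarrow> l"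
    using assms [unfolded compact_map_def, rule_format] by auto
qed

lemma compact_map_add:
  fixes A B :: "'a::real_normed_vector \<Rightarrow>\<^sub>L 'b::real_normed_vector"
  assumes "compact_map A" "compact_map B"
  shows "compact_map (A + B)"
  unfolding compact_map_def
proof (intro allI impI)
  fix x :: "nat \<Rightarrow> 'a" assume "bounded (range x)"
  then obtain C where C: "\<And>n. norm (x n) \<le> C" by (auto simp: bounded_iff)
  obtain r l where r: "strict_mono r" "(\<lambda>n. blinfun_apply A (x (r n))) \<longlonglongrightarrow> l"
    using compact_mapE [of A x C] assms C by blast
  obtain r' l' where r': "strict_mono r'" "(\<lambda>n. blinfun_apply B (x (r (r' n)))) \<longlonglongrightarrow> l'"
    using compact_mapE [of B "\<lambda>n. x (r n)" C] assms C by blast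
  have "(\<lambda>n. blinfun_apply A (x (r (r' n)))) \<longlonglongrightarrow> l"
    using LIMSEQ_subseq_LIMSEQ [OF r(2) r'(1)] by (simp add: o_def)
  then have "(\<lambda>n. blinfun_apply (A + B) (x ((r \<circ> r') n))) \<longlonglongrightarrow> l + l'"
    using r'(2) by (simp add: blinfun.add_left tendsto_add)
  then show "\<exists>r l. strict_mono r \<and> (\<lambda>n. blinfun_apply (A + B) (x (r n))) \<longlonglongrightarrow> l"
    using strict_mono_o [OF r(1) r'(1)] by blast
qed

lemma compact_map_scaleR: "compact_map A \<Longrightarrow> compact_map (c *\<^sub>R A)"
  unfolding compact_map_def using tendsto_scaleR [OF tendsto_const, of _ _ sequentially c]
  by (fastforce simp: blinfun.scaleR_left)

lemma compact_map_zero: "compact_map 0"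
  unfolding compact_map_def using strict_mono_id by (auto intro!: exI [of _ id])

lemma compact_map_sum: "(\<And>i. i \<in> I \<Longrightarrow> compact_map (A i)) \<Longrightarrow> compact_map (\<Sum>i\<in>I. A i)"
  by (induction I rule: infinite_finite_induct) (auto simp: compact_map_zero compact_map_add)

text \<open>Rescaling maps a bounded sequence into the unit ball. The sequential notion drops
  linearity over \<open>K\<close> and allows different spaces on the two sides, so that it also
  makes sense for operators composed with the embeddings and projections of a product space.\<close>

lemma compact_mapI:
  fixes H :: "'a::real_normed_vector \<Rightarrow>\<^sub>L 'b::real_normed_vector"
  assumes "compact (closure (blinfun_apply H ` cball 0 1))"
  shows "compact_map H"
  unfolding compact_map_def
proof (intro allI impI)
  fix x :: "nat \<Rightarrow> 'a" assume "bounded (range x)"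
  then obtain C where C: "C > 0" "\<And>n. norm (x n) \<le> C" by (auto simp: bounded_pos)
  define y where "y n = (1 / C) *\<^sub>R x n" for n
  have "blinfun_apply H (y n) \<in> closure (blinfun_apply H ` cball 0 1)" for n
    using C by (intro closure_subset [THEN subsetD] imageI) (simp add: y_def)
  then obtain l r where "strict_mono r" "((\<lambda>n. blinfun_apply H (y n)) \<circ> r) \<longlonglongrightarrow> l"
    using assms unfolding compact_def by metis
  then have "(\<lambda>n. C *\<^sub>R blinfun_apply H (y (r n))) \<longlonglongrightarrow> C *\<^sub>R l"
    by (intro tendsto_intros) (simp add: o_def)
  then have "(\<lambda>n. blinfun_apply H (x (r n))) \<longlonglongrightarrow> C *\<^sub>R l"
    using C by (simp add: y_def blinfun.scaleR_right)
  with \<open>strict_mono r\<close> show "\<exists>r l. strict_mono r \<and> (\<lambda>n. blinfun_apply H (x (r n))) \<longlonglongrightarrow> l"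
    by blast
qed

lemma has_sum_dist_iff:
  fixes f :: "'a \<Rightarrow> 'b::{comm_monoid_add, metric_space}"
  shows "(f has_sum x) A \<longleftrightarrow> (\<forall>e>0. \<exists>X. finite X \<and> X \<subseteq> A \<and>
     (\<forall>Y. finite Y \<and> X \<subseteq> Y \<and> Y \<subseteq> A \<longrightarrow> dist (sum f Y) x < e))"
  unfolding has_sum_def tendsto_iff eventually_finite_subsets_at_top ..

section \<open>Orthonormal sets and Fourier expansions\<close>

context hilbert_space
begin

definition orthonormal_set :: "'a set \<Rightarrow> bool" where
  "orthonormal_set S \<longleftrightarrow> (\<forall>e\<in>S. norm e = 1) \<and> (\<forall>e\<in>S. \<forall>f\<in>S. e \<noteq> f \<longrightarrow> ip e f = 0)"

lemma orthonormal_basis_set: "orthonormal_basis B \<Longrightarrow> orthonormal_set B"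
  by (simp add: orthonormal_basis_def orthonormal_set_def)

lemma orthonormal_ip: "orthonormal_set S \<Longrightarrow> e \<in> S \<Longrightarrow> f \<in> S \<Longrightarrow> ip e f = (if e = f then 1 else 0)"
  by (simp add: orthonormal_set_def ip_self)

text \<open>Zorn's lemma inside a reservoir \<open>P\<close> of allowed vectors: all vectors for the
  extension to a basis, eigenvectors for the spectral theorem. As \<open>P\<close> need not be
  closed under normalization, maximality is stated for vectors of norm one.\<close>

lemma maximal_orthonormal_set:
  assumes "orthonormal_set S0" "S0 \<subseteq> P"
  obtains S where "orthonormal_set S" "S0 \<subseteq> S" "S \<subseteq> P"
    "\<And>x. x \<in> P \<Longrightarrow> (\<forall>e\<in>S. ip x e = 0) \<Longrightarrow> norm x \<noteq> 1"
proof -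
  let ?A = "{S. orthonormal_set S \<and> S0 \<subseteq> S \<and> S \<subseteq> P}"
  have "\<exists>M\<in>?A. \<forall>X\<in>?A. M \<subseteq> X \<longrightarrow> X = M"
  proof (rule subset_Zorn_nonempty)
    fix C assume C: "C \<noteq> {}" "subset.chain ?A C"
    then have sub: "C \<subseteq> ?A" and ch: "\<And>S T. S \<in> C \<Longrightarrow> T \<in> C \<Longrightarrow> S \<subseteq> T \<or> T \<subseteq> S"
      by (auto simp: subset_chain_def)
    have "ip e f = 0" if "e \<in> S" "S \<in> C" "f \<in> T" "T \<in> C" "e \<noteq> f" for e f S T
      using ch [OF that(2,4)] sub that unfolding orthonormal_set_def by blast
    moreover have "norm e = 1" if "e \<in> S" "S \<in> C" for e S
      using sub that unfolding orthonormal_set_def by blast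
    ultimately have "orthonormal_set (\<Union>C)" unfolding orthonormal_set_def by blast
    moreover have "S0 \<subseteq> \<Union>C" using C(1) sub by blast
    ultimately show "\<Union>C \<in> ?A" using sub by blast
  qed (use assms in auto)
  then obtain S where S: "orthonormal_set S" "S0 \<subseteq> S" "S \<subseteq> P"
    and max: "\<And>X. orthonormal_set X \<Longrightarrow> S0 \<subseteq> X \<Longrightarrow> X \<subseteq> P \<Longrightarrow> S \<subseteq> X \<Longrightarrow> X = S" by auto
  have "norm x \<noteq> 1" if x: "x \<in> P" "\<forall>e\<in>S. ip x e = 0" for x
  proof
    assume 1: "norm x = 1"
    have "ip e x = 0" if "e \<in> S" for e using x(2) that ip_commute [of e x] by simp
    then have "orthonormal_set (insert x S)" using S(1) x 1 unfolding orthonormal_set_def by auto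
    then have "insert x S = S" using max S x by blast
    then have "ip x x = 0" using x(2) by blast
    then show False using 1 by (simp add: ip_self)
  qed
  then show ?thesis using that S by blast
qed

lemma orthonormal_basis_extend:
  assumes "orthonormal_set S"
  obtains B where "orthonormal_basis B" "S \<subseteq> B"
proof -
  obtain B where B: "orthonormal_set B" "S \<subseteq> B"
    "\<And>x. x \<in> UNIV \<Longrightarrow> (\<forall>e\<in>B. ip x e = 0) \<Longrightarrow> norm x \<noteq> 1"
    using maximal_orthonormal_set [OF assms, of UNIV] by (metis subset_UNIV)
  have "x = 0" if "\<forall>e\<in>B. ip x e = 0" for x
  proof (rule ccontr)
    assume "x \<noteq> 0"
    then have "norm ((1 / norm x) *\<^sub>R x) = 1" by simp
    moreover have "\<forall>e\<in>B. ip ((1 / norm x) *\<^sub>R x) e = 0" using that by (simp add: ip_scaleR_left)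
    ultimately show False using B(3) by blast
  qed
  then have "orthonormal_basis B" using B(1) by (simp add: orthonormal_basis_def orthonormal_set_def)
  with B(2) that show ?thesis by blast
qed

lemma orthonormal_basis_exists: "\<exists>B. orthonormal_basis B"
  using orthonormal_basis_extend [of "{}"] by (auto simp: orthonormal_set_def)

lemma bessel_identity:
  assumes "orthonormal_set S" "finite F" "F \<subseteq> S"
  shows "(norm (x - (\<Sum>e\<in>F. scale (ip x e) e)))\<^sup>2 = (norm x)\<^sup>2 - (\<Sum>e\<in>F. (cmod (ip x e))\<^sup>2)"
proof -
  let ?s = "\<Sum>e\<in>F. scale (ip x e) e"
  have xs: "ip x ?s = of_real (\<Sum>e\<in>F. (cmod (ip x e))\<^sup>2)"
    by (simp add: ip_sum_right ip_scale_right ip_in_scalars complex_norm_square mult.commute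
        del: of_real_power)
  have "ip ?s e = ip x e" if "e \<in> F" for e
  proof -
    have "ip ?s e = (\<Sum>f\<in>F. ip x f * (if f = e then 1 else 0))"
      unfolding ip_sum_left
    proof (rule sum.cong)
      fix f assume "f \<in> F"
      then have "ip f e = (if f = e then 1 else 0)" using assms that by (intro orthonormal_ip [of S]) auto
      then show "ip (scale (ip x f) f) e = ip x f * (if f = e then 1 else 0)"
        by (simp add: ip_scale_left ip_in_scalars)
    qed simp
    also have "\<dots> = ip x e" using assms(2) that by (simp add: if_distrib cong: if_cong)
    finally show ?thesis .
  qed
  then have "ip ?s ?s = ip x ?s"
    by (subst (1 2) ip_sum_right) (simp add: ip_scale_right ip_in_scalars)
  with xs have "(norm ?s)\<^sup>2 = (\<Sum>e\<in>F. (cmod (ip x e))\<^sup>2)"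
    unfolding ip_self using of_real_eq_iff by metis
  then show ?thesis using xs by (simp add: norm_diff_sq)
qed

lemma bessel:
  assumes "orthonormal_set S" "finite F" "F \<subseteq> S"
  shows "(\<Sum>e\<in>F. (cmod (ip x e))\<^sup>2) \<le> (norm x)\<^sup>2"
  using bessel_identity [OF assms, of x] by (metis diff_ge_0_iff_ge zero_le_power2)

text \<open>The vectors that equal their Fourier series form a closed \<open>K\<close>-subspace
  containing \<open>B\<close>, and this is everything because only 0 is orthogonal to
  \<open>B\<close>. Closedness rests on the remainders \<open>x - s F x\<close> being contractions
  in \<open>x\<close>, uniformly in the finite set \<open>F\<close>.\<close>

lemma fourier_expansion:
  assumes B: "orthonormal_basis B"
  shows "((\<lambda>e. scale (ip x e) e) has_sum x) B"
proof -
  note S = orthonormal_basis_set [OF B]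
  define s where "s F x = (\<Sum>e\<in>F. scale (ip x e) e)" for F x
  have s_diff: "s F (x - y) = s F x - s F y" for F x y
  proof -
    have "scale (ip (x - y) e) e = scale (ip x e) e - scale (ip y e) e" for e
      using scale_add_left [of "ip (x - y) e" "ip y e" e]
      by (simp add: ip_in_scalars ip_add_left [symmetric])
    then show ?thesis by (simp add: s_def sum_subtractf)
  qed
  have contr: "norm (x - s F x) \<le> norm x" if "finite F" "F \<subseteq> B" for F x
  proof -
    have "0 \<le> (\<Sum>e\<in>F. (cmod (ip x e))\<^sup>2)" by (simp add: sum_nonneg)
    with bessel_identity [OF S that, of x] have "(norm (x - s F x))\<^sup>2 \<le> (norm x)\<^sup>2"
      unfolding s_def by linarith
    then show ?thesis by (rule power2_le_imp_le) simp
  qed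
  define M where "M = {x. ((\<lambda>e. scale (ip x e) e) has_sum x) B}"
  have "K_subspace M"
    unfolding K_subspace_def
  proof (intro conjI ballI)
    show "0 \<in> M" by (simp add: M_def)
    fix x assume "x \<in> M"
    then have x: "((\<lambda>e. scale (ip x e) e) has_sum x) B" by (simp add: M_def)
    show "x + y \<in> M" if "y \<in> M" for y
    proof -
      have "((\<lambda>e. scale (ip y e) e) has_sum y) B" using that by (simp add: M_def)
      from has_sum_add [OF x this] show ?thesis
        by (simp add: M_def ip_add_left scale_add_left ip_in_scalars)
    qed
    show "scale c x \<in> M" if c: "c \<in> K" for c
      using has_sum_bounded_linear [OF bounded_linear_scale [OF c] x] c
      by (simp add: M_def ip_scale_left scale_scale ip_in_scalars o_def)
  qed
  moreover have "closed M"
    unfolding closed_sequential_limits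
  proof (intro allI impI; elim conjE)
    fix y l assume y: "\<forall>n. y n \<in> M" "y \<longlonglongrightarrow> l"
    show "l \<in> M" unfolding M_def mem_Collect_eq has_sum_dist_iff
    proof (intro allI impI)
      fix e :: real assume "e > 0"
      then have "eventually (\<lambda>n. dist (y n) l < e / 2) sequentially"
        using y(2) half_gt_zero tendstoD by blast
      then obtain n where n: "dist (y n) l < e / 2" by (auto simp: eventually_sequentially)
      have "((\<lambda>e. scale (ip (y n) e) e) has_sum y n) B" using y(1) by (simp add: M_def)
      then obtain X where X: "finite X" "X \<subseteq> B"
        "\<And>Y. finite Y \<Longrightarrow> X \<subseteq> Y \<Longrightarrow> Y \<subseteq> B \<Longrightarrow> dist (sum (\<lambda>e. scale (ip (y n) e) e) Y) (y n) < e / 2"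
        using \<open>e > 0\<close> unfolding has_sum_dist_iff by (meson half_gt_zero)
      have "dist (s Y l) l < e" if Y: "finite Y" "X \<subseteq> Y" "Y \<subseteq> B" for Y
      proof -
        have "l - s Y l = ((l - y n) - s Y (l - y n)) + (y n - s Y (y n))" by (simp add: s_diff)
        then have "norm (l - s Y l) \<le> norm (l - y n) + norm (y n - s Y (y n))"
          using norm_triangle_mono [OF contr [OF Y(1,3), of "l - y n"] order_refl] by metis
        also have "\<dots> < e" using n X(3) [OF Y] by (simp add: dist_norm s_def norm_minus_commute)
        finally show ?thesis by (simp add: dist_norm norm_minus_commute)
      qed
      then show "\<exists>X. finite X \<and> X \<subseteq> B \<and> (\<forall>Y. finite Y \<and> X \<subseteq> Y \<and> Y \<subseteq> B \<longrightarrow>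
          dist (\<Sum>e\<in>Y. scale (ip l e) e) l < e)"
        using X(1,2) unfolding s_def by blast
    qed
  qed
  moreover have BM: "B \<subseteq> M"
  proof
    fix b assume b: "b \<in> B"
    have "((\<lambda>e. scale (ip b e) e) has_sum sum (\<lambda>e. scale (ip b e) e) {b}) {b}" by (rule has_sum_finite) simp
    then have "((\<lambda>e. scale (ip b e) e) has_sum b) {b}" using S b by (simp add: orthonormal_ip)
    then have "((\<lambda>e. scale (ip b e) e) has_sum b) B"
      by (rule has_sum_cong_neutral [THEN iffD1, rotated -1]) (use S b in \<open>auto simp: orthonormal_ip\<close>)
    then show "b \<in> M" by (simp add: M_def)
  qed
  ultimately obtain y where y: "y \<in> M" "\<forall>z\<in>M. ip (x - y) z = 0" using projection_exists by blast
  then have "x - y = 0" using B BM unfolding orthonormal_basis_def by blast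
  then have "x = y" by simp
  with y(1) show ?thesis by (simp add: M_def)
qed

lemma parseval:
  assumes "orthonormal_basis B"
  shows "((\<lambda>e. ip x e * ip e z) has_sum ip x z) B"
proof -
  have "bounded_linear (\<lambda>x. ip x z)"
    by (rule bounded_bilinear.bounded_linear_left [OF bounded_bilinear_ip])
  from has_sum_bounded_linear [OF this fourier_expansion [OF assms, of x]] show ?thesis
    by (simp add: o_def ip_scale_left ip_in_scalars)
qed

lemma parseval_norm:
  assumes "orthonormal_basis B"
  shows "((\<lambda>e. (cmod (ip x e))\<^sup>2) has_sum (norm x)\<^sup>2) B"
proof -
  have "((\<lambda>e. Re (ip x e * ip e x)) has_sum Re (ip x x)) B"
    using has_sum_Re [OF parseval [OF assms, of x x]] .
  moreover have "ip x e * ip e x = complex_of_real ((cmod (ip x e))\<^sup>2)" for e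
    using ip_commute [of e x] complex_norm_square [of "ip x e"] by simp
  ultimately show ?thesis by (simp add: ip_self)
qed

section \<open>Spectral theorem for compact positive operators\<close>

definition symmetric_op :: "('a \<Rightarrow>\<^sub>L 'a) \<Rightarrow> bool" where
  "symmetric_op A \<longleftrightarrow> (\<forall>x y. ip (blinfun_apply A x) y = ip x (blinfun_apply A y))"

text \<open>The eigenvalue is the supremum \<open>l\<close> of the Rayleigh quotient
  \<open>q\<close> on the unit sphere of \<open>M\<close>. For \<open>l\<close> > 0, nonnegativity
  of \<open>q\<close> at x - (1/l) A x bounds the square of the norm of A x by
  \<open>l * q x\<close>, so a maximizing sequence consists of approximate eigenvectors, and
  compactness makes a subsequence converge.\<close>

lemma eigenvector_exists:
  assumes sym: "symmetric_op A" and pos: "\<And>x. 0 \<le> Re (ip (blinfun_apply A x) x)"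
    and cpt: "compact_map A"
    and M: "K_subspace M" "closed M" "\<And>x. x \<in> M \<Longrightarrow> blinfun_apply A x \<in> M"
    and nz: "x0 \<in> M" "x0 \<noteq> 0"
  shows "\<exists>e\<in>M. norm e = 1 \<and> (\<exists>l\<ge>0. blinfun_apply A e = l *\<^sub>R e)"
proof -
  define q where "q x = Re (ip (blinfun_apply A x) x)" for x
  define U where "U = {x \<in> M. norm x = 1}"
  define l where "l = Sup (q ` U)"
  have u0: "(1 / norm x0) *\<^sub>R x0 \<in> U"
    using nz M by (auto simp: U_def intro: K_subspace_scaleR)
  then have ne: "U \<noteq> {}" by blast
  have q_le: "q x \<le> norm A" if "x \<in> U" for x
  proof -
    have "q x \<le> cmod (ip (blinfun_apply A x) x)" unfolding q_def by (rule complex_Re_le_cmod)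
    also have "\<dots> \<le> norm (blinfun_apply A x) * norm x" by (rule ip_norm_le)
    also have "\<dots> \<le> norm A" using norm_blinfun [of A x] that by (simp add: U_def)
    finally show ?thesis .
  qed
  then have bdd: "bdd_above (q ` U)" by (rule bdd_aboveI2)
  have q_l: "q x \<le> l" if "x \<in> U" for x unfolding l_def using that bdd by (rule cSUP_upper)
  have l0: "l \<ge> 0" using q_l [OF u0] pos by (auto simp: q_def intro: order_trans)
  have q_scale: "q (r *\<^sub>R x) = r\<^sup>2 * q x" for r x
    by (simp add: q_def blinfun.scaleR_right ip_scaleR_left ip_scaleR_right power2_eq_square)
  have q_M: "q x \<le> l * (norm x)\<^sup>2" if "x \<in> M" for x
  proof (cases "x = 0")
    case False
    then have "(1 / norm x) *\<^sub>R x \<in> U" using that M by (auto simp: U_def intro: K_subspace_scaleR)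
    from q_l [OF this] False show ?thesis by (simp add: q_scale field_simps)
  qed (simp add: q_def blinfun.zero_right)
  have q_diff: "q (x - t *\<^sub>R blinfun_apply A x) =
      q x - 2 * t * (norm (blinfun_apply A x))\<^sup>2 + t\<^sup>2 * q (blinfun_apply A x)" for x t
  proof -
    have "ip (blinfun_apply A (blinfun_apply A x)) x = complex_of_real ((norm (blinfun_apply A x))\<^sup>2)"
      using sym by (simp add: symmetric_op_def ip_self)
    then show ?thesis
      by (simp add: q_def blinfun.diff_right blinfun.scaleR_right ip_diff_left ip_diff_right
          ip_scaleR_left ip_scaleR_right ip_self power2_eq_square algebra_simps)
  qed
  have A_sq: "(norm (blinfun_apply A x))\<^sup>2 \<le> l * q x" if x: "x \<in> M" for x
  proof (cases "l = 0")
    case True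
    have "q x = 0" "q (blinfun_apply A x) = 0"
      using q_M [OF x] q_M [OF M(3) [OF x]] True pos by (auto simp: q_def intro!: antisym)
    moreover have "0 \<le> q (x - 1 *\<^sub>R blinfun_apply A x)" unfolding q_def by (rule pos)
    ultimately show ?thesis unfolding q_diff by simp
  next
    case False
    have "0 \<le> q (x - (1 / l) *\<^sub>R blinfun_apply A x)" unfolding q_def by (rule pos)
    also have "\<dots> \<le> q x - 2 * (1 / l) * (norm (blinfun_apply A x))\<^sup>2 +
        (1 / l)\<^sup>2 * (l * (norm (blinfun_apply A x))\<^sup>2)"
      unfolding q_diff by (intro add_left_mono mult_left_mono q_M M x) simp
    finally show ?thesis using False l0 by (simp add: field_simps power2_eq_square)
  qed
  show ?thesis
  proof (cases "l = 0")
    case True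
    define e where "e = (1 / norm x0) *\<^sub>R x0"
    have "e \<in> M" "norm e = 1" using u0 by (auto simp: U_def e_def)
    moreover have "blinfun_apply A e = 0 *\<^sub>R e" using A_sq [OF \<open>e \<in> M\<close>] True by simp
    ultimately show ?thesis using order_refl by blast
  next
    case False
    then have lpos: "l > 0" using l0 by simp
    have "\<exists>x\<in>U. l - 1 / real (Suc n) < q x" for n
    proof -
      have "l - 1 / real (Suc n) < l" by simp
      then show ?thesis unfolding l_def using less_cSUP_iff [OF ne bdd] by blast
    qed
    then obtain x where x: "\<And>n. x n \<in> U" "\<And>n. l - 1 / real (Suc n) < q (x n)" by metis
    have n1: "\<And>n. norm (x n) = 1" and xM: "\<And>n. x n \<in> M" using x(1) by (auto simp: U_def)
    have est: "(norm (blinfun_apply A (x n) - l *\<^sub>R x n))\<^sup>2 \<le> l * (1 / real (Suc n))" for n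
    proof -
      have "(norm (blinfun_apply A (x n) - l *\<^sub>R x n))\<^sup>2 = (norm (blinfun_apply A (x n)))\<^sup>2 + l\<^sup>2 - 2 * l * q (x n)"
        using l0 n1 [of n] by (simp add: norm_diff_sq ip_scaleR_right q_def)
      also have "\<dots> \<le> l\<^sup>2 - l * q (x n)" using A_sq [OF xM, of n] by simp
      also have "\<dots> = l * (l - q (x n))" by (simp add: power2_eq_square algebra_simps)
      also have "\<dots> \<le> l * (1 / real (Suc n))" using x(2)[of n] lpos by (intro mult_left_mono) auto
      finally show ?thesis .
    qed
    obtain r y where r: "strict_mono r" "(\<lambda>n. blinfun_apply A (x (r n))) \<longlonglongrightarrow> y"
      by (rule compact_mapE [OF cpt, of x 1]) (use n1 in auto)
    have "(\<lambda>n. l * (1 / real (Suc n))) \<longlonglongrightarrow> l * 0"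
      by (intro tendsto_intros LIMSEQ_Suc lim_1_over_n)
    then have lim: "(\<lambda>n. l * (1 / real (Suc n))) \<longlonglongrightarrow> 0" by simp
    have "(\<lambda>n. (norm (blinfun_apply A (x n) - l *\<^sub>R x n))\<^sup>2) \<longlonglongrightarrow> 0"
      by (rule tendsto_sandwich [OF always_eventually always_eventually tendsto_const lim])
        (use est in auto)
    then have "(\<lambda>n. sqrt ((norm (blinfun_apply A (x n) - l *\<^sub>R x n))\<^sup>2)) \<longlonglongrightarrow> sqrt 0"
      by (rule tendsto_real_sqrt)
    then have "(\<lambda>n. blinfun_apply A (x n) - l *\<^sub>R x n) \<longlonglongrightarrow> 0"
      by (simp add: tendsto_norm_zero_iff)
    from LIMSEQ_subseq_LIMSEQ [OF this r(1)]
    have "(\<lambda>n. blinfun_apply A (x (r n)) - (blinfun_apply A (x (r n)) - l *\<^sub>R x (r n))) \<longlonglongrightarrow> y - 0"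
      by (intro tendsto_diff r(2)) (simp add: o_def)
    then have "(\<lambda>n. (1 / l) *\<^sub>R (l *\<^sub>R x (r n))) \<longlonglongrightarrow> (1 / l) *\<^sub>R y"
      by (intro tendsto_intros) simp
    then have xe: "(\<lambda>n. x (r n)) \<longlonglongrightarrow> (1 / l) *\<^sub>R y" using False by simp
    define e where "e = (1 / l) *\<^sub>R y"
    note xe = xe [folded e_def]
    have "e \<in> M" using closed_sequentially [OF M(2) _ xe] xM by blast
    moreover have "(\<lambda>n. 1) \<longlonglongrightarrow> norm e" using tendsto_norm [OF xe] n1 by simp
    then have "norm e = 1" using LIMSEQ_unique tendsto_const by blast
    moreover have "blinfun_apply A e = y"
      by (rule LIMSEQ_unique [OF blinfun.tendsto [OF tendsto_const xe] r(2)])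
    then have "blinfun_apply A e = l *\<^sub>R e" using False by (simp add: e_def)
    ultimately show ?thesis using l0 by blast
  qed
qed

theorem spectral_basis:
  assumes sym: "symmetric_op A" and pos: "\<And>x. 0 \<le> Re (ip (blinfun_apply A x) x)"
    and cpt: "compact_map A"
  obtains B where "orthonormal_basis B" "\<And>e. e \<in> B \<Longrightarrow> \<exists>l\<ge>0. blinfun_apply A e = l *\<^sub>R e"
proof -
  define P where "P = {e. \<exists>l\<ge>0. blinfun_apply A e = l *\<^sub>R e}"
  obtain B where B: "orthonormal_set B" "B \<subseteq> P"
    and max: "\<And>x. x \<in> P \<Longrightarrow> (\<forall>e\<in>B. ip x e = 0) \<Longrightarrow> norm x \<noteq> 1"
    using maximal_orthonormal_set [of "{}" P] by (auto simp: orthonormal_set_def)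
  define M where "M = {x. \<forall>e\<in>B. ip x e = 0}"
  have "K_subspace M" by (simp add: K_subspace_def M_def ip_add_left ip_scale_left)
  moreover have "closed M"
  proof -
    have "M = (\<Inter>e\<in>B. {x. ip x e = 0})" by (auto simp: M_def)
    then show ?thesis
      by (auto intro!: closed_INT closed_Collect_eq linear_continuous_on continuous_on_const
          bounded_bilinear.bounded_linear_left [OF bounded_bilinear_ip])
  qed
  moreover have "blinfun_apply A x \<in> M" if x: "x \<in> M" for x
    unfolding M_def
  proof (intro CollectI ballI)
    fix e assume e: "e \<in> B"
    then obtain l where "blinfun_apply A e = l *\<^sub>R e" using B(2) by (auto simp: P_def)
    then show "ip (blinfun_apply A x) e = 0"
      using sym x e by (simp add: symmetric_op_def M_def ip_scaleR_right)
  qed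
  ultimately have "x = 0" if "x \<in> M" for x
    using eigenvector_exists [OF sym pos cpt, of M x] that max unfolding P_def M_def by blast
  then have "orthonormal_basis B"
    using B(1) by (auto simp: orthonormal_basis_def orthonormal_set_def M_def)
  then show ?thesis using that B(2) unfolding P_def by blast
qed

lemma singular_basis:
  assumes H: "K_linear H" "compact_map H"
  obtains B w where "orthonormal_basis B" "\<And>e. w e \<ge> (0::real)"
    "\<And>e. e \<in> B \<Longrightarrow> blinfun_apply (adj H) (blinfun_apply H e) = (w e)\<^sup>2 *\<^sub>R e"
proof -
  have "symmetric_op (adj H o\<^sub>L H)"
    using H(1) by (simp add: symmetric_op_def ip_adj ip_adj')
  moreover have "0 \<le> Re (ip (blinfun_apply (adj H o\<^sub>L H) x) x)" for x
    using H(1) by (simp add: ip_adj' ip_self)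
  moreover have "compact_map (adj H o\<^sub>L H)" by (rule compact_map_compose_left [OF H(2)])
  ultimately obtain B where B: "orthonormal_basis B"
    "\<And>e. e \<in> B \<Longrightarrow> \<exists>l\<ge>0. blinfun_apply (adj H o\<^sub>L H) e = l *\<^sub>R e"
    using spectral_basis by blast
  have "\<exists>l. blinfun_apply (adj H) (blinfun_apply H e) = l\<^sup>2 *\<^sub>R e" if e: "e \<in> B" for e
  proof -
    obtain l where "l \<ge> 0" "blinfun_apply (adj H o\<^sub>L H) e = l *\<^sub>R e" using B(2) e by blast
    then show ?thesis by (intro exI [of _ "sqrt l"]) simp
  qed
  then obtain w where w: "\<And>e. e \<in> B \<Longrightarrow> blinfun_apply (adj H) (blinfun_apply H e) = (w e)\<^sup>2 *\<^sub>R e"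
    by metis
  \<comment> \<open>The absolute value makes \<open>w\<close> nonnegative everywhere, also off
    \<open>B\<close>, where the choice leaves it arbitrary.\<close>
  show ?thesis by (rule that [of B "\<lambda>e. \<bar>w e\<bar>"]) (use B(1) w in auto)
qed

end


section \<open>Inequalities for finite sums\<close>

text \<open>Bernoulli's inequality: the convex function x^s lies above its tangent at 1. It is
  Young's inequality with second factor 1.\<close>

lemma powr_tangent:
  fixes x s :: real
  assumes "x \<ge> 0" "s \<ge> 1"
  shows "1 + s * (x - 1) \<le> x powr s"
proof (cases "s = 1")
  case False
  then have s: "s > 1" using assms by simp
  then have "x * 1 \<le> x powr s / s + 1 powr (s / (s - 1)) / (s / (s - 1))"
    using assms by (intro Youngs_inequality) (auto simp: field_simps)
  then have "s * x \<le> s * (x powr s / s + (s - 1) / s)"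
    using s by (intro mult_left_mono) auto
  also have "\<dots> = x powr s + (s - 1)" using s by (simp add: field_simps)
  finally show ?thesis by (simp add: algebra_simps)
qed (use assms in simp)

text \<open>Average the tangent inequality at the mean \<open>S\<close>. A total weight below 1 is
  allowed because the missing weight may be thought of as sitting at the value 0.\<close>

lemma jensen_powr:
  fixes v u :: "'i \<Rightarrow> real"
  assumes "finite F" "s \<ge> 1" and v: "\<And>e. e \<in> F \<Longrightarrow> v e \<ge> 0" and u: "\<And>e. e \<in> F \<Longrightarrow> u e \<ge> 0"
    and "(\<Sum>e\<in>F. u e) \<le> 1"
  shows "(\<Sum>e\<in>F. v e * u e) powr s \<le> (\<Sum>e\<in>F. v e powr s * u e)"
proof (cases "(\<Sum>e\<in>F. v e * u e) = 0")
  case True then show ?thesis using v u by (simp add: sum_nonneg)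
next
  case False
  define S where "S = (\<Sum>e\<in>F. v e * u e)"
  have "S \<ge> 0" unfolding S_def using v u by (intro sum_nonneg) auto
  then have S: "S > 0" using False by (simp add: S_def)
  have *: "S powr s * (1 + s * (v e / S - 1)) \<le> v e powr s" if "e \<in> F" for e
  proof -
    have "S powr s * (1 + s * (v e / S - 1)) \<le> S powr s * (v e / S) powr s"
      using v that S assms(2) by (intro mult_left_mono powr_tangent) auto
    then show ?thesis using S v [OF that] by (simp add: powr_divide)
  qed
  \<comment> \<open>The total weight enters with the nonpositive coefficient 1 - s, so an upper
    bound for it gives a lower bound for the product.\<close>
  have "S powr s * ((1 - s) * 1) \<le> S powr s * ((1 - s) * (\<Sum>e\<in>F. u e))"
    using assms(2,5) by (intro mult_left_mono mult_left_mono_neg) auto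
  then have "S powr s \<le> S powr s * ((1 - s) * (\<Sum>e\<in>F. u e)) + S powr s * s"
    by (simp add: algebra_simps)
  also have "\<dots> = S powr s * ((1 - s) * (\<Sum>e\<in>F. u e)) + S powr s * s / S * (\<Sum>e\<in>F. v e * u e)"
    using S by (simp add: S_def [symmetric])
  also have "\<dots> = (\<Sum>e\<in>F. S powr s * (1 + s * (v e / S - 1)) * u e)"
    by (simp add: sum_distrib_left sum.distrib [symmetric] algebra_simps)
  also have "\<dots> \<le> (\<Sum>e\<in>F. v e powr s * u e)"
    using * u by (intro sum_mono mult_right_mono) auto
  finally show ?thesis by (simp add: S_def)
qed

lemma sum_abs_mult_le_one:
  fixes a b :: "'i \<Rightarrow> real"
  assumes "(\<Sum>e\<in>F. (a e)\<^sup>2) \<le> 1" "(\<Sum>e\<in>F. (b e)\<^sup>2) \<le> 1"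
  shows "(\<Sum>e\<in>F. \<bar>a e * b e\<bar>) \<le> 1"
proof -
  have "\<bar>a e * b e\<bar> \<le> ((a e)\<^sup>2 + (b e)\<^sup>2) / 2" for e
    using sum_squares_bound [of "\<bar>a e\<bar>" "\<bar>b e\<bar>"] by (simp add: abs_mult)
  then have "(\<Sum>e\<in>F. \<bar>a e * b e\<bar>) \<le> (\<Sum>e\<in>F. ((a e)\<^sup>2 + (b e)\<^sup>2) / 2)" by (intro sum_mono)
  also have "\<dots> = ((\<Sum>e\<in>F. (a e)\<^sup>2) + (\<Sum>e\<in>F. (b e)\<^sup>2)) / 2"
    by (simp add: sum.distrib sum_divide_distrib add_divide_distrib)
  finally show ?thesis using assms by simp
qed

text \<open>The matrix \<open>(|a i e * b i e|)\<close> is doubly substochastic.\<close>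

lemma substochastic_powr:
  fixes w :: "'e \<Rightarrow> real" and a b :: "'i \<Rightarrow> 'e \<Rightarrow> real"
  assumes fin: "finite I" "finite F" and q: "q \<ge> 1"
    and row: "\<And>i. i \<in> I \<Longrightarrow> (\<Sum>e\<in>F. (a i e)\<^sup>2) \<le> 1" "\<And>i. i \<in> I \<Longrightarrow> (\<Sum>e\<in>F. (b i e)\<^sup>2) \<le> 1"
    and col: "\<And>e. e \<in> F \<Longrightarrow> (\<Sum>i\<in>I. (a i e)\<^sup>2) \<le> 1" "\<And>e. e \<in> F \<Longrightarrow> (\<Sum>i\<in>I. (b i e)\<^sup>2) \<le> 1"
  shows "(\<Sum>i\<in>I. \<bar>\<Sum>e\<in>F. w e * (a i e * b i e)\<bar> powr q) \<le> (\<Sum>e\<in>F. \<bar>w e\<bar> powr q)"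
proof -
  have "\<bar>\<Sum>e\<in>F. w e * (a i e * b i e)\<bar> powr q \<le> (\<Sum>e\<in>F. \<bar>w e\<bar> powr q * \<bar>a i e * b i e\<bar>)" if "i \<in> I" for i
  proof -
    have "\<bar>\<Sum>e\<in>F. w e * (a i e * b i e)\<bar> \<le> (\<Sum>e\<in>F. \<bar>w e\<bar> * \<bar>a i e * b i e\<bar>)"
      by (rule order_trans [OF sum_abs]) (simp add: abs_mult)
    then have "\<bar>\<Sum>e\<in>F. w e * (a i e * b i e)\<bar> powr q \<le> (\<Sum>e\<in>F. \<bar>w e\<bar> * \<bar>a i e * b i e\<bar>) powr q"
      using q by (intro powr_mono2) auto
    also have "\<dots> \<le> (\<Sum>e\<in>F. \<bar>w e\<bar> powr q * \<bar>a i e * b i e\<bar>)"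
      using fin q row [OF that] by (intro jensen_powr sum_abs_mult_le_one) auto
    finally show ?thesis .
  qed
  then have "(\<Sum>i\<in>I. \<bar>\<Sum>e\<in>F. w e * (a i e * b i e)\<bar> powr q)
      \<le> (\<Sum>i\<in>I. \<Sum>e\<in>F. \<bar>w e\<bar> powr q * \<bar>a i e * b i e\<bar>)" by (rule sum_mono)
  also have "\<dots> = (\<Sum>e\<in>F. \<bar>w e\<bar> powr q * (\<Sum>i\<in>I. \<bar>a i e * b i e\<bar>))"
    by (subst sum.swap) (simp add: sum_distrib_left)
  also have "\<dots> \<le> (\<Sum>e\<in>F. \<bar>w e\<bar> powr q * 1)"
    using col by (intro sum_mono mult_left_mono sum_abs_mult_le_one) auto
  finally show ?thesis by simp
qed

text \<open>Convexity of t^q at the average of |x|/C and |y|/D with weights C/(C+D) and D/(C+D). The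
  bounds \<open>C\<close> and \<open>D\<close> are arbitrary numbers rather than norms, so estimates
  can be added without forming a supremum; the value 0 is treated apart because of the
  division.\<close>

lemma minkowski_powr:
  fixes x y :: "'i \<Rightarrow> real"
  assumes "finite I" "q \<ge> 1" "C \<ge> 0" "D \<ge> 0"
    and x: "(\<Sum>i\<in>I. \<bar>x i\<bar> powr q) \<le> C powr q" and y: "(\<Sum>i\<in>I. \<bar>y i\<bar> powr q) \<le> D powr q"
  shows "(\<Sum>i\<in>I. \<bar>x i + y i\<bar> powr q) \<le> (C + D) powr q"
proof -
  have zero: "z i = 0" if "(\<Sum>i\<in>I. \<bar>z i\<bar> powr q) \<le> 0 powr q" "i \<in> I" for z :: "'i \<Rightarrow> real" and i
  proof -
    have "(\<Sum>i\<in>I. \<bar>z i\<bar> powr q) = 0" using that by (intro antisym sum_nonneg) auto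
    then show ?thesis using that(2) assms(1) by (subst (asm) sum_nonneg_eq_0_iff) auto
  qed
  consider "C = 0" | "D = 0" | "C > 0" "D > 0" using assms by fastforce
  then show ?thesis
  proof cases
    case 1
    have "x i = 0" if "i \<in> I" for i by (rule zero [OF _ that]) (use x 1 in simp)
    then have "(\<Sum>i\<in>I. \<bar>x i + y i\<bar> powr q) = (\<Sum>i\<in>I. \<bar>y i\<bar> powr q)"
      by (intro sum.cong) auto
    then show ?thesis using y 1 by simp
  next
    case 2
    have "y i = 0" if "i \<in> I" for i by (rule zero [OF _ that]) (use y 2 in simp)
    then have "(\<Sum>i\<in>I. \<bar>x i + y i\<bar> powr q) = (\<Sum>i\<in>I. \<bar>x i\<bar> powr q)"
      by (intro sum.cong) auto
    then show ?thesis using x 2 by simp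
  next
    case 3
    define t where "t = C / (C + D)"
    have t: "0 \<le> t" "t \<le> 1" "1 - t = D / (C + D)" using 3 by (auto simp: t_def field_simps)
    have conv: "(a * t + b * (1 - t)) powr q \<le> a powr q * t + b powr q * (1 - t)"
      if "a \<ge> 0" "b \<ge> 0" for a b
      using jensen_powr [of UNIV q "\<lambda>c. if c then a else b" "\<lambda>c. if c then t else 1 - t"] that t assms(2)
      by (simp add: UNIV_bool add.commute)
    have "\<bar>x i + y i\<bar> powr q \<le> (C + D) powr q * ((\<bar>x i\<bar> / C) powr q * t + (\<bar>y i\<bar> / D) powr q * (1 - t))" for i
    proof -
      have "\<bar>x i\<bar> / C * t + \<bar>y i\<bar> / D * (1 - t) = (\<bar>x i\<bar> + \<bar>y i\<bar>) / (C + D)"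
        using 3 unfolding t(3) by (simp add: t_def add_divide_distrib)
      then have "\<bar>x i + y i\<bar> \<le> (C + D) * (\<bar>x i\<bar> / C * t + \<bar>y i\<bar> / D * (1 - t))" using 3 by simp
      then have "\<bar>x i + y i\<bar> powr q \<le> ((C + D) * (\<bar>x i\<bar> / C * t + \<bar>y i\<bar> / D * (1 - t))) powr q"
        using assms(2) by (intro powr_mono2) auto
      also have "\<dots> = (C + D) powr q * (\<bar>x i\<bar> / C * t + \<bar>y i\<bar> / D * (1 - t)) powr q"
        by (simp add: powr_mult)
      also have "\<dots> \<le> (C + D) powr q * ((\<bar>x i\<bar> / C) powr q * t + (\<bar>y i\<bar> / D) powr q * (1 - t))"
        using 3 by (intro mult_left_mono conv) auto
      finally show ?thesis .
    qed
    then have "(\<Sum>i\<in>I. \<bar>x i + y i\<bar> powr q)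
      \<le> (\<Sum>i\<in>I. (C + D) powr q * ((\<bar>x i\<bar> / C) powr q * t + (\<bar>y i\<bar> / D) powr q * (1 - t)))"
      by (rule sum_mono)
    also have "\<dots> = (C + D) powr q * ((\<Sum>i\<in>I. \<bar>x i\<bar> powr q) / C powr q * t + (\<Sum>i\<in>I. \<bar>y i\<bar> powr q) / D powr q * (1 - t))"
      by (simp add: powr_divide sum_divide_distrib sum_distrib_left sum_distrib_right distrib_left sum.distrib)
    also have "\<dots> \<le> (C + D) powr q * (1 * t + 1 * (1 - t))"
      using 3 x y t by (intro mult_left_mono add_mono mult_right_mono) auto
    finally show ?thesis by simp
  qed
qed

text \<open>Young's inequality with exponents p/r and q/r, after normalizing by \<open>C\<close> and
  \<open>D\<close>. The exponent \<open>r\<close> may lie below 1, where the left side is no longer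
  the power of a norm.\<close>

lemma holder_powr:
  fixes x y :: "'i \<Rightarrow> real"
  assumes "finite I" "p > 0" "q > 0" "r > 0" "1 / p + 1 / q = 1 / r" "C \<ge> 0" "D \<ge> 0"
    and nonneg: "\<And>i. i \<in> I \<Longrightarrow> x i \<ge> 0" "\<And>i. i \<in> I \<Longrightarrow> y i \<ge> 0"
    and x: "(\<Sum>i\<in>I. x i powr p) \<le> C powr p" and y: "(\<Sum>i\<in>I. y i powr q) \<le> D powr q"
  shows "(\<Sum>i\<in>I. (x i * y i) powr r) \<le> (C * D) powr r"
proof -
  have zero: "z i = 0" if "(\<Sum>i\<in>I. z i powr s) \<le> 0 powr s" "i \<in> I" for z :: "'i \<Rightarrow> real" and i s
  proof -
    have "(\<Sum>i\<in>I. z i powr s) = 0" using that by (intro antisym sum_nonneg) auto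
    then show ?thesis using that(2) assms(1) by (subst (asm) sum_nonneg_eq_0_iff) auto
  qed
  consider "C = 0" | "D = 0" | "C > 0" "D > 0" using assms by fastforce
  then show ?thesis
  proof cases
    case 1
    have "x i = 0" if "i \<in> I" for i by (rule zero [OF _ that]) (use x 1 in simp)
    then show ?thesis using 1 by simp
  next
    case 2
    have "y i = 0" if "i \<in> I" for i by (rule zero [OF _ that]) (use y 2 in simp)
    then show ?thesis using 2 by simp
  next
    case 3
    have "r / p + r / q = r * (1 / p + 1 / q)" by (simp add: distrib_left)
    then have rpq: "r / p + r / q = 1" using assms(4,5) by simp
    have "(x i * y i) powr r \<le> (C * D) powr r * ((x i / C) powr p * (r / p) + (y i / D) powr q * (r / q))"
      if i: "i \<in> I" for i
    proof (cases "x i = 0 \<or> y i = 0")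
      case True
      then show ?thesis using assms by auto
    next
      case False
      then have pos: "x i > 0" "y i > 0" using nonneg [OF i] by auto
      have "((x i / C) powr p) powr (r / p) * ((y i / D) powr q) powr (r / q)
          \<le> (r / p) * (x i / C) powr p + (r / q) * (y i / D) powr q"
        using pos 3 assms rpq by (intro Youngs_inequality_0) auto
      moreover have "((x i / C) powr p) powr (r / p) * ((y i / D) powr q) powr (r / q)
          = (x i * y i) powr r / (C * D) powr r"
        using assms by (simp add: powr_powr powr_divide powr_mult)
      ultimately show ?thesis using 3 by (simp add: field_simps)
    qed
    then have "(\<Sum>i\<in>I. (x i * y i) powr r) \<le>
        (\<Sum>i\<in>I. (C * D) powr r * ((x i / C) powr p * (r / p) + (y i / D) powr q * (r / q)))"
      by (rule sum_mono)
    also have "\<dots> = (C * D) powr r * ((\<Sum>i\<in>I. x i powr p) / C powr p * (r / p) + (\<Sum>i\<in>I. y i powr q) / D powr q * (r / q))"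
      using nonneg
      by (simp add: powr_divide sum_divide_distrib sum_distrib_left sum_distrib_right distrib_left sum.distrib)
    also have "\<dots> \<le> (C * D) powr r * (1 * (r / p) + 1 * (r / q))"
      using 3 x y assms by (intro mult_left_mono add_mono mult_right_mono) auto
    finally show ?thesis using rpq by simp
  qed
qed

text \<open>Carries an inequality for partial sums over to the limits of finitely many unconditional
  series. \<open>S\<close> is a set that contains all partial sums and on which \<Phi> is
  continuous; it is a half-line where \<Phi> is a power of a nonnegative quantity.\<close>

lemma has_sum_finite_bound:
  fixes f :: "'i \<Rightarrow> 'e \<Rightarrow> real" and \<Phi> :: "real \<Rightarrow> real"
  assumes "finite I" and f: "\<And>i. i \<in> I \<Longrightarrow> (f i has_sum L i) B"
    and \<Phi>: "continuous_on S \<Phi>" "\<And>i. i \<in> I \<Longrightarrow> L i \<in> S"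
      "\<And>i F. i \<in> I \<Longrightarrow> finite F \<Longrightarrow> F \<subseteq> B \<Longrightarrow> sum (f i) F \<in> S"
    and le: "\<And>F. finite F \<Longrightarrow> F \<subseteq> B \<Longrightarrow> (\<Sum>i\<in>I. \<Phi> (sum (f i) F)) \<le> K"
  shows "(\<Sum>i\<in>I. \<Phi> (L i)) \<le> K"
proof (rule tendsto_upperbound)
  show "((\<lambda>F. \<Sum>i\<in>I. \<Phi> (sum (f i) F)) \<longlongrightarrow> (\<Sum>i\<in>I. \<Phi> (L i))) (finite_subsets_at_top B)"
  proof (intro tendsto_sum)
    fix i assume i: "i \<in> I"
    show "((\<lambda>F. \<Phi> (sum (f i) F)) \<longlongrightarrow> \<Phi> (L i)) (finite_subsets_at_top B)"
    proof (rule continuous_on_tendsto_compose [OF \<Phi>(1)])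
      show "(sum (f i) \<longlongrightarrow> L i) (finite_subsets_at_top B)" using f [OF i] by (simp add: has_sum_def)
      show "\<forall>\<^sub>F F in finite_subsets_at_top B. sum (f i) F \<in> S"
        using \<Phi>(3) [OF i] by (intro eventually_finite_subsets_at_top_weakI)
    qed (use \<Phi>(2) i in auto)
  qed
  show "\<forall>\<^sub>F F in finite_subsets_at_top B. (\<Sum>i\<in>I. \<Phi> (sum (f i) F)) \<le> K"
    using le by (intro eventually_finite_subsets_at_top_weakI)
qed simp


section \<open>Schatten bounds on a real Hilbert space\<close>

text \<open>The inner product is a parameter and not that of a type class: it will be the real part
  of \<open>ip\<close>, or the sum of two such parts on pairs, on types that are only known to be
  Banach spaces.\<close>

locale real_hilbert =
  fixes r :: "'b::banach \<Rightarrow> 'b \<Rightarrow> real"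
  assumes r_add_left: "r (x + y) z = r x z + r y z"
    and r_scaleR_left: "r (c *\<^sub>R x) y = c * r x y"
    and r_commute: "r x y = r y x"
    and r_self: "r x x = (norm x)\<^sup>2"

sublocale real_hilbert \<subseteq> R: hilbert_space "\<real>" "\<lambda>c x. Re c *\<^sub>R x" "\<lambda>x y. complex_of_real (r x y)"
  by unfold_locales
    (auto simp: scaleR_add_right scaleR_add_left r_add_left r_scaleR_left r_self
      intro: r_commute elim!: Reals_cases)

context real_hilbert
begin

abbreviation onb :: "'b set \<Rightarrow> bool" where "onb \<equiv> R.orthonormal_basis"

lemma bounded_bilinear_r: "bounded_bilinear r"
proof
  show "\<exists>K. \<forall>a b. norm (r a b) \<le> norm a * norm b * K"
    using R.ip_norm_le by (intro exI [of _ 1]) simp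
  show "r a (b + b') = r a b + r a b'" for a b b' by (metis r_add_left r_commute)
  show "r a (c *\<^sub>R b) = c *\<^sub>R r a b" for a b c by (metis r_scaleR_left r_commute real_scaleR_def)
qed (simp_all add: r_add_left r_scaleR_left)

lemma r_norm_le: "\<bar>r x y\<bar> \<le> norm x * norm y"
  using R.ip_norm_le [of x y] by (simp add: norm_of_real)

lemmas r_simps = bounded_bilinear.add_left [OF bounded_bilinear_r]
  bounded_bilinear.add_right [OF bounded_bilinear_r]
  bounded_bilinear.diff_left [OF bounded_bilinear_r]
  bounded_bilinear.diff_right [OF bounded_bilinear_r]
  bounded_bilinear.minus_left [OF bounded_bilinear_r]
  bounded_bilinear.minus_right [OF bounded_bilinear_r]
  bounded_bilinear.scaleR_left [OF bounded_bilinear_r]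
  bounded_bilinear.scaleR_right [OF bounded_bilinear_r]
  bounded_bilinear.zero_left [OF bounded_bilinear_r]
  bounded_bilinear.zero_right [OF bounded_bilinear_r]

lemmas r_sum_left = bounded_bilinear.sum_left [OF bounded_bilinear_r]
lemmas r_sum_right = bounded_bilinear.sum_right [OF bounded_bilinear_r]

lemma K_linear_real [simp]: "R.K_linear A"
  by (simp add: R.K_linear_def blinfun.scaleR_right)

abbreviation radj :: "('b \<Rightarrow>\<^sub>L 'b) \<Rightarrow> ('b \<Rightarrow>\<^sub>L 'b)" where "radj \<equiv> R.adj"

lemma r_adjoint: "r (blinfun_apply A x) y = r x (blinfun_apply (radj A) y)"
  using R.ip_adj [of A x y] by simp

lemma r_adjoint': "r (blinfun_apply (radj A) x) y = r x (blinfun_apply A y)"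
  using R.ip_adj' [of A x y] by simp

lemma adjoint_eqI: "(\<And>x y. r (blinfun_apply A x) y = r x (blinfun_apply G y)) \<Longrightarrow> radj A = G"
  by (rule R.adj_unique) simp

lemma adjoint_adjoint [simp]: "radj (radj A) = A"
  by (rule adjoint_eqI) (rule r_adjoint')

lemma adjoint_compose: "radj (A o\<^sub>L B) = radj B o\<^sub>L radj A"
  by (rule adjoint_eqI) (simp add: r_adjoint)

lemma norm_adjoint_apply_le: "norm (blinfun_apply (radj A) x) \<le> norm A * norm x"
proof -
  let ?y = "blinfun_apply (radj A) x"
  have "(norm ?y)\<^sup>2 = r (blinfun_apply A ?y) x" by (simp add: r_adjoint r_self)
  also have "\<dots> \<le> norm (blinfun_apply A ?y) * norm x" using r_norm_le abs_le_D1 by blast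
  also have "\<dots> \<le> (norm A * norm ?y) * norm x" by (intro mult_right_mono norm_blinfun) simp
  finally have *: "norm ?y * norm ?y \<le> (norm A * norm x) * norm ?y" by (simp add: power2_eq_square mult_ac)
  show ?thesis
  proof (cases "norm ?y = 0")
    case False
    then have "norm ?y > 0" by simp
    with * show ?thesis by (simp only: mult_le_cancel_right_pos)
  qed simp
qed

section \<open>Parseval's identity, Bessel systems and the Schatten bound\<close>

lemma parseval_r: "onb B \<Longrightarrow> ((\<lambda>e. r x e * r e z) has_sum r x z) B"
  using has_sum_Re [OF R.parseval [of B x z]] by simp

lemma parseval_norm_r: "onb B \<Longrightarrow> ((\<lambda>e. (r x e)\<^sup>2) has_sum (norm x)\<^sup>2) B"
  using R.parseval_norm [of B x] by (simp add: norm_of_real)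

text \<open>These are the images of orthonormal families under contractions. Unlike orthonormality,
  the condition survives a further contraction, which makes the ideal property of the Schatten bound
  immediate.\<close>

definition bessel_on :: "'i set \<Rightarrow> ('i \<Rightarrow> 'b) \<Rightarrow> bool" where
  "bessel_on I a \<longleftrightarrow> (\<forall>x. (\<Sum>i\<in>I. (r (a i) x)\<^sup>2) \<le> (norm x)\<^sup>2)"

lemma bessel_on_norm_le:
  assumes "bessel_on I a" "finite I" "i \<in> I"
  shows "norm (a i) \<le> 1"
proof -
  have "(r (a i) (a i))\<^sup>2 \<le> (\<Sum>i'\<in>I. (r (a i') (a i))\<^sup>2)"
    using assms by (intro member_le_sum) auto
  also have "\<dots> \<le> (norm (a i))\<^sup>2" using assms by (simp add: bessel_on_def)
  finally have "(norm (a i))\<^sup>2 * (norm (a i))\<^sup>2 \<le> 1 * (norm (a i))\<^sup>2"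
    by (simp add: r_self power2_eq_square)
  then have "(norm (a i))\<^sup>2 \<le> 1"
    by (metis mult_le_cancel_right_pos not_less zero_le_power2 order_le_less zero_le_one)
  then show ?thesis by (simp add: power2_le_imp_le abs_square_le_1)
qed

lemma bessel_on_sum_le_one:
  assumes "bessel_on I a" "norm x \<le> 1"
  shows "(\<Sum>i\<in>I. (r (a i) x)\<^sup>2) \<le> 1" "(\<Sum>i\<in>I. (r x (a i))\<^sup>2) \<le> 1"
proof -
  have "(\<Sum>i\<in>I. (r (a i) x)\<^sup>2) \<le> (norm x)\<^sup>2" using assms by (simp add: bessel_on_def)
  also have "\<dots> \<le> 1" using assms by (simp add: power_le_one)
  finally show "(\<Sum>i\<in>I. (r (a i) x)\<^sup>2) \<le> 1" "(\<Sum>i\<in>I. (r x (a i))\<^sup>2) \<le> 1"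
    by (simp_all add: r_commute)
qed

lemma bessel_on_orthonormal:
  assumes "R.orthonormal_set S" "finite F" "F \<subseteq> S"
  shows "bessel_on F (\<lambda>e. e)"
  using R.bessel [OF assms] by (simp add: bessel_on_def norm_of_real r_commute)

lemma bessel_on_onb: "onb B \<Longrightarrow> finite F \<Longrightarrow> F \<subseteq> B \<Longrightarrow> bessel_on F (\<lambda>e. e)"
  using bessel_on_orthonormal R.orthonormal_basis_set by blast

lemma bessel_on_reindex:
  assumes "bij_betw h J I"
  shows "bessel_on J (\<lambda>j. a (h j)) \<longleftrightarrow> bessel_on I a"
  unfolding bessel_on_def
  using sum.reindex_bij_betw [OF assms, of "\<lambda>i. (r (a i) _)\<^sup>2"] by simp

lemma bessel_on_image:
  assumes "bessel_on I a" "norm T \<le> k" "k > 0"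
  shows "bessel_on I (\<lambda>i. (1 / k) *\<^sub>R blinfun_apply T (a i))"
  unfolding bessel_on_def
proof
  fix x
  have "(\<Sum>i\<in>I. (r ((1 / k) *\<^sub>R blinfun_apply T (a i)) x)\<^sup>2)
      = (\<Sum>i\<in>I. (r (a i) (blinfun_apply (radj T) x))\<^sup>2) / k\<^sup>2"
    by (simp add: r_simps r_adjoint power_divide sum_divide_distrib)
  also have "\<dots> \<le> (norm (blinfun_apply (radj T) x))\<^sup>2 / k\<^sup>2"
    using assms by (intro divide_right_mono) (auto simp: bessel_on_def)
  also have "\<dots> \<le> (k * norm x)\<^sup>2 / k\<^sup>2"
    using order_trans [OF norm_adjoint_apply_le [of T x] mult_right_mono [OF assms(2)]]
    by (intro divide_right_mono power_mono) auto
  also have "\<dots> = (norm x)\<^sup>2" using assms(3) by (simp add: power_mult_distrib)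
  finally show "(\<Sum>i\<in>I. (r ((1 / k) *\<^sub>R blinfun_apply T (a i)) x)\<^sup>2) \<le> (norm x)\<^sup>2" .
qed

text \<open>\<open>schatten q C A\<close> says that \<open>A\<close> is compact with Schatten \<open>q\<close>-norm at most \<open>C\<close>. The norm is
  the supremum over pairs of finite Bessel systems.\<close>

definition schatten :: "real \<Rightarrow> real \<Rightarrow> ('b \<Rightarrow>\<^sub>L 'b) \<Rightarrow> bool" where
  "schatten q C A \<longleftrightarrow> compact_map A \<and> 0 \<le> C \<and>
     (\<forall>n::nat. \<forall>a b. bessel_on {..<n} a \<longrightarrow> bessel_on {..<n} b \<longrightarrow>
        (\<Sum>i<n. \<bar>r (blinfun_apply A (a i)) (b i)\<bar> powr q) \<le> C powr q)"

lemma schattenI: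
  assumes "compact_map A" "0 \<le> C"
    "\<And>(n::nat) a b. bessel_on {..<n} a \<Longrightarrow> bessel_on {..<n} b \<Longrightarrow>
        (\<Sum>i<n. \<bar>r (blinfun_apply A (a i)) (b i)\<bar> powr q) \<le> C powr q"
  shows "schatten q C A"
  using assms by (simp add: schatten_def)

lemma schatten_compact: "schatten q C A \<Longrightarrow> compact_map A"
  and schatten_nonneg: "schatten q C A \<Longrightarrow> 0 \<le> C"
  by (simp_all add: schatten_def)

lemma schatten_sum_le:
  assumes "schatten q C A" "finite I" "bessel_on I a" "bessel_on I b"
  shows "(\<Sum>i\<in>I. \<bar>r (blinfun_apply A (a i)) (b i)\<bar> powr q) \<le> C powr q"
proof -
  obtain h where h: "bij_betw h {..<card I} I"
    using ex_bij_betw_nat_finite [OF assms(2)] by (auto simp: lessThan_atLeast0)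
  have "(\<Sum>i<card I. \<bar>r (blinfun_apply A (a (h i))) (b (h i))\<bar> powr q) \<le> C powr q"
    using assms bessel_on_reindex [OF h] by (simp add: schatten_def)
  then show ?thesis
    using sum.reindex_bij_betw [OF h, of "\<lambda>i. \<bar>r (blinfun_apply A (a i)) (b i)\<bar> powr q"] by simp
qed

lemma schatten_mono: "schatten q C A \<Longrightarrow> C \<le> D \<Longrightarrow> q > 0 \<Longrightarrow> schatten q D A"
  by (rule schattenI, simp add: schatten_compact, use schatten_nonneg in force)
    (rule order_trans [OF schatten_sum_le powr_mono2], auto dest: schatten_nonneg)

lemma schatten_add:
  assumes "schatten q C A" "schatten q D B" "q \<ge> 1"
  shows "schatten q (C + D) (A + B)"
proof (rule schattenI)
  fix n :: nat and a b assume ab: "bessel_on {..<n} a" "bessel_on {..<n} b"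
  have "(\<Sum>i<n. \<bar>r (blinfun_apply A (a i)) (b i) + r (blinfun_apply B (a i)) (b i)\<bar> powr q) \<le> (C + D) powr q"
    using assms ab by (intro minkowski_powr schatten_sum_le schatten_nonneg [of q]) auto
  then show "(\<Sum>i<n. \<bar>r (blinfun_apply (A + B) (a i)) (b i)\<bar> powr q) \<le> (C + D) powr q"
    by (simp add: blinfun.add_left r_simps)
qed (simp_all add: compact_map_add schatten_compact [OF assms(1)] schatten_compact [OF assms(2)]
    schatten_nonneg [OF assms(1)] schatten_nonneg [OF assms(2)])

lemma schatten_scaleR:
  assumes "schatten q C A"
  shows "schatten q (\<bar>c\<bar> * C) (c *\<^sub>R A)"
proof (rule schattenI)
  fix n :: nat and a b assume ab: "bessel_on {..<n} a" "bessel_on {..<n} b"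
  show "(\<Sum>i<n. \<bar>r (blinfun_apply (c *\<^sub>R A) (a i)) (b i)\<bar> powr q) \<le> (\<bar>c\<bar> * C) powr q"
    using schatten_sum_le [OF assms _ ab]
    by (simp add: blinfun.scaleR_left r_simps abs_mult powr_mult sum_distrib_left [symmetric] mult_left_mono)
qed (simp_all add: compact_map_scaleR schatten_compact [OF assms] schatten_nonneg [OF assms])

lemma schatten_minus: "schatten q C A \<Longrightarrow> schatten q C (- A)"
  using schatten_scaleR [of q C A "-1"] by simp

lemma schatten_diff: "schatten q C A \<Longrightarrow> schatten q D B \<Longrightarrow> q \<ge> 1 \<Longrightarrow> schatten q (C + D) (A - B)"
  using schatten_add [OF _ schatten_minus, of q C A D B] by simp

lemma schatten_zero: "schatten q 0 0"
  by (simp add: schatten_def compact_map_zero r_simps)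

lemma schatten_sum:
  assumes "finite I" "\<And>i. i \<in> I \<Longrightarrow> schatten q (C i) (A i)" "q \<ge> 1"
  shows "schatten q (\<Sum>i\<in>I. C i) (\<Sum>i\<in>I. A i)"
  using assms(1,2) by (induction I rule: finite_induct) (auto simp: schatten_zero schatten_add assms(3))

text \<open>Schauder's theorem, with the Hilbert space shortcut: the squared norm of the adjoint at
  z is the inner product of A (adj A) z with z, so convergence of A (adj A) along a subsequence
  forces the images under the adjoint to be Cauchy.\<close>

lemma compact_map_adjoint:
  assumes "compact_map A"
  shows "compact_map (radj A)"
  unfolding compact_map_def
proof (intro allI impI)
  fix x :: "nat \<Rightarrow> 'b" assume "bounded (range x)"
  then obtain C where C: "C > 0" "\<And>n. norm (x n) \<le> C" by (auto simp: bounded_pos)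
  obtain s l where s: "strict_mono s" "(\<lambda>n. blinfun_apply (A o\<^sub>L radj A) (x (s n))) \<longlonglongrightarrow> l"
    by (rule compact_mapE [OF compact_map_compose_right [OF assms] C(2)])
  let ?y = "\<lambda>n. blinfun_apply (radj A) (x (s n))"
  have "Cauchy ?y"
  proof (rule metric_CauchyI)
    fix e :: real assume e: "e > 0"
    then have "e\<^sup>2 / (2 * C) > 0" using C by simp
    with LIMSEQ_imp_Cauchy [OF s(2)] obtain N where
      N: "\<And>m n. m \<ge> N \<Longrightarrow> n \<ge> N \<Longrightarrow>
        dist (blinfun_apply (A o\<^sub>L radj A) (x (s m))) (blinfun_apply (A o\<^sub>L radj A) (x (s n))) < e\<^sup>2 / (2 * C)"
      unfolding Cauchy_def by meson
    have "dist (?y m) (?y n) < e" if "m \<ge> N" "n \<ge> N" for m n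
    proof -
      define z where "z = x (s m) - x (s n)"
      have "(norm (blinfun_apply (radj A) z))\<^sup>2 = r (blinfun_apply (A o\<^sub>L radj A) z) z"
        by (simp add: r_adjoint r_self)
      also have "\<dots> \<le> norm (blinfun_apply (A o\<^sub>L radj A) z) * norm z"
        using r_norm_le abs_le_D1 by blast
      also have "\<dots> \<le> norm (blinfun_apply (A o\<^sub>L radj A) z) * (2 * C)"
        using C(2)[of "s m"] C(2)[of "s n"] norm_triangle_ineq4 [of "x (s m)" "x (s n)"]
        by (intro mult_left_mono) (auto simp: z_def)
      also have "\<dots> < e\<^sup>2 / (2 * C) * (2 * C)"
        using N [OF that] C by (intro mult_strict_right_mono) (auto simp: z_def blinfun.diff_right dist_norm)
      finally have "(norm (blinfun_apply (radj A) z))\<^sup>2 < e\<^sup>2" using C by simp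
      then have "norm (blinfun_apply (radj A) z) < e" by (rule power2_less_imp_less) (use e in simp)
      then show ?thesis by (simp add: z_def blinfun.diff_right dist_norm)
    qed
    then show "\<exists>N. \<forall>m\<ge>N. \<forall>n\<ge>N. dist (?y m) (?y n) < e" by blast
  qed
  then show "\<exists>s l. strict_mono s \<and> (\<lambda>n. blinfun_apply (radj A) (x (s n))) \<longlonglongrightarrow> l"
    using s(1) Cauchy_convergent_iff convergent_def by blast
qed

lemma schatten_adjoint:
  assumes "schatten q C A"
  shows "schatten q C (radj A)"
proof -
  have "r (blinfun_apply (radj A) x) y = r (blinfun_apply A y) x" for x y
    by (metis r_adjoint' r_commute)
  then show ?thesis
    using schatten_compact [OF assms] schatten_nonneg [OF assms]
    by (intro schattenI compact_map_adjoint) (simp_all add: schatten_sum_le [OF assms])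
qed

text \<open>The contraction T/k maps Bessel systems to Bessel systems, so composition with
  \<open>T\<close> costs exactly the factor \<open>k\<close>.\<close>

lemma schatten_compose_right:
  assumes A: "schatten q C A" and T: "norm T \<le> k" and "q > 0"
  shows "schatten q (k * C) (A o\<^sub>L T)"
proof (cases "k = 0")
  case True
  with T have "T = 0" by simp
  then have "A o\<^sub>L T = 0" by (intro blinfun_eqI) (simp add: blinfun.zero_right)
  then show ?thesis using True schatten_zero by simp
next
  case False
  have k: "k > 0" using T False norm_ge_zero [of T] by linarith
  show ?thesis
  proof (rule schattenI)
    fix n :: nat and a b assume ab: "bessel_on {..<n} a" "bessel_on {..<n} b"
    have "(\<Sum>i<n. \<bar>r (blinfun_apply A ((1 / k) *\<^sub>R blinfun_apply T (a i))) (b i)\<bar> powr q) \<le> C powr q"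
      using k ab by (intro schatten_sum_le [OF A] bessel_on_image T) auto
    moreover have "\<bar>r (blinfun_apply (A o\<^sub>L T) (a i)) (b i)\<bar> powr q
        = k powr q * \<bar>r (blinfun_apply A ((1 / k) *\<^sub>R blinfun_apply T (a i))) (b i)\<bar> powr q" for i
      using k by (simp add: blinfun.scaleR_right r_simps abs_mult powr_mult powr_divide)
    ultimately show "(\<Sum>i<n. \<bar>r (blinfun_apply (A o\<^sub>L T) (a i)) (b i)\<bar> powr q) \<le> (k * C) powr q"
      using k by (simp add: sum_distrib_left [symmetric] powr_mult)
  qed (use k in \<open>simp_all add: compact_map_compose_right schatten_compact [OF A] schatten_nonneg [OF A]\<close>)
qed

lemma norm_adjoint_le: "norm (radj T) \<le> norm T"
  by (rule norm_blinfun_bound) (auto simp: norm_adjoint_apply_le)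

lemma schatten_compose_left:
  assumes A: "schatten q C A" and T: "norm T \<le> k" and "q > 0"
  shows "schatten q (k * C) (T o\<^sub>L A)"
proof -
  have "schatten q (k * C) (radj A o\<^sub>L radj T)"
    using assms norm_adjoint_le order_trans
    by (intro schatten_compose_right schatten_adjoint) blast+
  from schatten_adjoint [OF this] show ?thesis by (simp add: adjoint_compose)
qed

text \<open>Every single entry is at most \<open>C\<close>, so the surplus power q' - q of an entry
  can be replaced by that of \<open>C\<close>; no constant is lost.\<close>

lemma schatten_exponent_mono:
  assumes A: "schatten q C A" and "0 < q" "q \<le> q'"
  shows "schatten q' C A"
proof (rule schattenI)
  fix n :: nat and a b assume ab: "bessel_on {..<n} a" "bessel_on {..<n} b"
  let ?x = "\<lambda>i. \<bar>r (blinfun_apply A (a i)) (b i)\<bar>"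
  have C: "C \<ge> 0" by (rule schatten_nonneg [OF A])
  have le: "(\<Sum>i<n. ?x i powr q) \<le> C powr q" using schatten_sum_le [OF A _ ab] by simp
  have "?x i \<le> C" if "i < n" for i
  proof -
    have "?x i powr q \<le> (\<Sum>i<n. ?x i powr q)" using that by (intro member_le_sum) auto
    with le have "?x i powr q \<le> C powr q" by simp
    then show ?thesis using assms C by (meson abs_ge_zero not_le powr_less_mono2)
  qed
  then have pt: "?x i powr (q' - q) \<le> C powr (q' - q)" if "i < n" for i
    using assms that by (intro powr_mono2) auto
  have "(\<Sum>i<n. ?x i powr q') = (\<Sum>i<n. ?x i powr q * ?x i powr (q' - q))"
    by (simp add: powr_add [symmetric])
  also have "\<dots> \<le> (\<Sum>i<n. ?x i powr q * C powr (q' - q))"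
    using pt by (intro sum_mono mult_left_mono) auto
  also have "\<dots> \<le> C powr q * C powr (q' - q)"
    unfolding sum_distrib_right [symmetric] using le by (intro mult_right_mono) auto
  also have "\<dots> = C powr q'" by (simp add: powr_add [symmetric])
  finally show "(\<Sum>i<n. ?x i powr q') \<le> C powr q'" .
qed (simp_all add: schatten_compact [OF A] schatten_nonneg [OF A])

lemma abs_r_apply_le:
  assumes "norm A \<le> k" "norm x \<le> 1" "norm y \<le> 1"
  shows "\<bar>r (blinfun_apply A x) y\<bar> \<le> k"
proof -
  have k: "0 \<le> k" using assms(1) norm_ge_zero [of A] by linarith
  have "\<bar>r (blinfun_apply A x) y\<bar> \<le> norm (blinfun_apply A x) * norm y" by (rule r_norm_le)
  also have "\<dots> \<le> (norm A * norm x) * norm y" by (intro mult_right_mono norm_blinfun) simp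
  also have "\<dots> \<le> (k * 1) * 1" using assms k by (intro mult_mono) auto
  finally show ?thesis by simp
qed

text \<open>The operator norm bounds the entries and pays for q - 1 of their q powers, the trace
  norm pays for the last one. Used for differences that are of trace class with a bound singular at
  s = 0: only the power 1/q of the singularity is left.\<close>

lemma schatten_interpolate:
  assumes A: "schatten 1 D A" and n: "norm A \<le> k" and q: "q \<ge> 1"
  shows "schatten q (k powr (1 - 1 / q) * D powr (1 / q)) A"
proof (rule schattenI)
  fix n :: nat and a b assume ab: "bessel_on {..<n} a" "bessel_on {..<n} b"
  let ?x = "\<lambda>i. \<bar>r (blinfun_apply A (a i)) (b i)\<bar>"
  have D: "D \<ge> 0" by (rule schatten_nonneg [OF A])
  have k: "k \<ge> 0" using n norm_ge_zero [of A] by linarith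
  have le: "(\<Sum>i<n. ?x i) \<le> D" using schatten_sum_le [OF A _ ab] D by simp
  have "?x i \<le> k" if "i < n" for i
    using that ab by (intro abs_r_apply_le n bessel_on_norm_le [of "{..<n}"]) auto
  then have "(\<Sum>i<n. ?x i powr q) \<le> (\<Sum>i<n. k powr (q - 1) * ?x i)"
  proof (intro sum_mono)
    fix i assume "i \<in> {..<n}" and x: "\<And>i. i < n \<Longrightarrow> ?x i \<le> k"
    have "?x i powr q = ?x i powr (q - 1) * ?x i powr 1" unfolding powr_add [symmetric] by simp
    also have "\<dots> \<le> k powr (q - 1) * ?x i"
      using q x \<open>i \<in> {..<n}\<close> by (intro mult_mono powr_mono2) auto
    finally show "?x i powr q \<le> k powr (q - 1) * ?x i" .
  qed
  also have "\<dots> \<le> k powr (q - 1) * D"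
    unfolding sum_distrib_left [symmetric] using le by (intro mult_left_mono) auto
  also have "\<dots> = (k powr (1 - 1 / q) * D powr (1 / q)) powr q"
    using q D by (simp add: powr_mult powr_powr left_diff_distrib)
  finally show "(\<Sum>i<n. ?x i powr q) \<le> (k powr (1 - 1 / q) * D powr (1 / q)) powr q" .
qed (simp_all add: schatten_compact [OF A] schatten_nonneg [OF A])

section \<open>Singular value decomposition\<close>

lemma svd:
  assumes "compact_map A"
  obtains B w g where "onb B" "\<And>e. w e \<ge> (0::real)"
    "\<And>e. e \<in> B \<Longrightarrow> blinfun_apply A e = w e *\<^sub>R g e"
    "\<And>e. e \<in> B \<Longrightarrow> blinfun_apply (radj A) (blinfun_apply A e) = (w e)\<^sup>2 *\<^sub>R e"
    "\<And>F. finite F \<Longrightarrow> F \<subseteq> B \<Longrightarrow> bessel_on F g"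
    "\<And>e. e \<in> B \<Longrightarrow> w e \<noteq> 0 \<Longrightarrow> norm (g e) = 1"
proof -
  obtain B w where B: "onb B" "\<And>e. w e \<ge> (0::real)"
    and AA: "\<And>e. e \<in> B \<Longrightarrow> blinfun_apply (radj A) (blinfun_apply A e) = (w e)\<^sup>2 *\<^sub>R e"
    using R.singular_basis [OF K_linear_real assms] by metis
  have ip: "r (blinfun_apply A e) (blinfun_apply A f) = (w e)\<^sup>2 * r e f" if "e \<in> B" for e f
    by (simp add: AA r_adjoint' [symmetric] r_simps that)
  have ee: "r e f = (if e = f then 1 else 0)" if "e \<in> B" "f \<in> B" for e f
    using R.orthonormal_ip [OF R.orthonormal_basis_set [OF B(1)] that] by (auto split: if_splits)
  \<comment> \<open>Division by zero gives 0: where \<open>w e = 0\<close> the vector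
    \<open>g e\<close> vanishes. Thus \<open>g\<close> is orthonormal on the remaining part of
    \<open>B\<close> and a Bessel system on every finite part.\<close>
  define g where "g e = (1 / w e) *\<^sub>R blinfun_apply A e" for e
  have gg: "r (g e) (g f) = (if e = f \<and> w e \<noteq> 0 then 1 else 0)" if "e \<in> B" "f \<in> B" for e f
    using that by (auto simp: g_def r_simps ip ee power2_eq_square)
  have Ae: "blinfun_apply A e = w e *\<^sub>R g e" if "e \<in> B" for e
  proof (cases "w e = 0")
    case True
    then have "r (blinfun_apply A e) (blinfun_apply A e) = 0" using ip [OF that] by simp
    then show ?thesis using True by (simp add: r_self)
  qed (simp add: g_def)
  have n1: "norm (g e) = 1" if "e \<in> B" "w e \<noteq> 0" for e
  proof -
    have "(norm (g e))\<^sup>2 = 1\<^sup>2" using gg [OF that(1,1)] that(2) by (simp add: r_self)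
    then show ?thesis by (rule power2_eq_imp_eq) auto
  qed
  have "bessel_on F g" if F: "finite F" "F \<subseteq> B" for F
    unfolding bessel_on_def
  proof
    fix x
    define F' where "F' = {e \<in> F. w e \<noteq> 0}"
    have inj: "inj_on g F'"
    proof (rule inj_onI)
      fix e f assume ef: "e \<in> F'" "f \<in> F'" "g e = g f"
      then have eB: "e \<in> B" "f \<in> B" "w e \<noteq> 0" using F by (auto simp: F'_def)
      then have "r (g e) (g f) = 1" using gg [OF eB(1,1)] ef(3) by simp
      then show "e = f" using gg [OF eB(1,2)] by (metis zero_neq_one)
    qed
    have FB: "e \<in> B" "w e \<noteq> 0" if "e \<in> F'" for e using that F by (auto simp: F'_def)
    have "r (g e) (g f) = 0" if "e \<in> F'" "f \<in> F'" "g e \<noteq> g f" for e f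
      using gg [OF FB(1) FB(1), OF that(1,2)] that(3) by (metis)
    then have "R.orthonormal_set (g ` F')"
      using n1 FB unfolding R.orthonormal_set_def by auto
    then have "bessel_on (g ` F') (\<lambda>e. e)" using F by (intro bessel_on_orthonormal) (auto simp: F'_def)
    then have "(\<Sum>e\<in>F'. (r (g e) x)\<^sup>2) \<le> (norm x)\<^sup>2"
      by (simp add: bessel_on_def sum.reindex [OF inj])
    moreover have "(\<Sum>e\<in>F. (r (g e) x)\<^sup>2) = (\<Sum>e\<in>F'. (r (g e) x)\<^sup>2)"
      using F by (intro sum.mono_neutral_right) (auto simp: F'_def g_def r_simps)
    ultimately show "(\<Sum>e\<in>F. (r (g e) x)\<^sup>2) \<le> (norm x)\<^sup>2" by simp
  qed
  then show ?thesis using that B Ae AA n1 by blast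
qed

lemma r_apply_expansion:
  assumes "onb B"
  shows "((\<lambda>e. r x e * r (blinfun_apply A e) y) has_sum r (blinfun_apply A x) y) B"
  using parseval_r [OF assms, of x "blinfun_apply (radj A) y"] by (simp add: r_adjoint)

text \<open>Expanding the entries in \<open>B\<close> turns each of the two terms into a doubly
  substochastic combination of its coefficients; Minkowski's inequality adds them. Two terms occur
  because \<open>cay ((1 / s) *\<^sub>R X)\<close> maps a singular vector \<open>e\<close> into the
  span of \<open>e\<close> and \<open>g e\<close>.\<close>

lemma schatten_of_two_diagonals:
  assumes A: "compact_map A" and B: "onb B"
    and Ae: "\<And>e. e \<in> B \<Longrightarrow> blinfun_apply A e = u e *\<^sub>R g e + v e *\<^sub>R h e"
    and gh: "\<And>F. finite F \<Longrightarrow> F \<subseteq> B \<Longrightarrow> bessel_on F g" "\<And>F. finite F \<Longrightarrow> F \<subseteq> B \<Longrightarrow> bessel_on F h"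
    and le: "\<And>F. finite F \<Longrightarrow> F \<subseteq> B \<Longrightarrow> (\<Sum>e\<in>F. \<bar>u e\<bar> powr q) \<le> C powr q"
      "\<And>F. finite F \<Longrightarrow> F \<subseteq> B \<Longrightarrow> (\<Sum>e\<in>F. \<bar>v e\<bar> powr q) \<le> D powr q"
    and q: "q \<ge> 1" and CD: "C \<ge> 0" "D \<ge> 0"
  shows "schatten q (C + D) A"
proof (rule schattenI)
  fix n :: nat and a b assume ab: "bessel_on {..<n} a" "bessel_on {..<n} b"
  have na: "norm (a i) \<le> 1" "norm (b i) \<le> 1" if "i < n" for i
    using ab that by (auto intro: bessel_on_norm_le)
  have *: "(\<Sum>i<n. \<bar>\<Sum>e\<in>F. w e * (r (a i) e * r (f e) (b i))\<bar> powr q) \<le> (\<Sum>e\<in>F. \<bar>w e\<bar> powr q)"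
    if F: "finite F" "F \<subseteq> B" and f: "bessel_on F f" for F w f
  proof (rule substochastic_powr)
    fix i assume i: "i \<in> {..<n}"
    show "(\<Sum>e\<in>F. (r (a i) e)\<^sup>2) \<le> 1" "(\<Sum>e\<in>F. (r (f e) (b i))\<^sup>2) \<le> 1"
      using bessel_on_sum_le_one [OF bessel_on_onb [OF B F]] bessel_on_sum_le_one [OF f] na i
      by auto
  next
    fix e assume e: "e \<in> F"
    have "norm e \<le> 1" "norm (f e) \<le> 1"
      using bessel_on_norm_le [OF bessel_on_onb [OF B F]] bessel_on_norm_le [OF f] F e by auto
    then show "(\<Sum>i<n. (r (a i) e)\<^sup>2) \<le> 1" "(\<Sum>i<n. (r (f e) (b i))\<^sup>2) \<le> 1"
      using bessel_on_sum_le_one ab by auto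
  qed (use q F in auto)
  show "(\<Sum>i<n. \<bar>r (blinfun_apply A (a i)) (b i)\<bar> powr q) \<le> (C + D) powr q"
  proof (rule has_sum_finite_bound [where S = UNIV and \<Phi> = "\<lambda>x. \<bar>x\<bar> powr q"
        and f = "\<lambda>i e. r (a i) e * r (blinfun_apply A e) (b i)" and B = B])
    show "continuous_on UNIV (\<lambda>x::real. \<bar>x\<bar> powr q)"
      using q by (intro continuous_on_powr' continuous_intros) auto
    fix F assume F: "finite F" "F \<subseteq> B"
    have "(\<Sum>i<n. \<bar>(\<Sum>e\<in>F. u e * (r (a i) e * r (g e) (b i))) + (\<Sum>e\<in>F. v e * (r (a i) e * r (h e) (b i)))\<bar> powr q)
        \<le> (C + D) powr q"
      by (rule minkowski_powr [OF _ q CD order_trans [OF * le(1)] order_trans [OF * le(2)]])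
        (simp_all add: F gh)
    moreover have "(\<Sum>e\<in>F. r (a i) e * r (blinfun_apply A e) (b i))
        = (\<Sum>e\<in>F. u e * (r (a i) e * r (g e) (b i))) + (\<Sum>e\<in>F. v e * (r (a i) e * r (h e) (b i)))" for i
      unfolding sum.distrib [symmetric]
    proof (rule sum.cong)
      fix e assume "e \<in> F"
      then have "e \<in> B" using F by auto
      then show "r (a i) e * r (blinfun_apply A e) (b i) =
          u e * (r (a i) e * r (g e) (b i)) + v e * (r (a i) e * r (h e) (b i))"
        by (simp add: Ae r_simps algebra_simps)
    qed simp
    ultimately show "(\<Sum>i<n. \<bar>\<Sum>e\<in>F. r (a i) e * r (blinfun_apply A e) (b i)\<bar> powr q) \<le> (C + D) powr q"
      by simp
  qed (auto intro: r_apply_expansion [OF B])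
qed (use A CD in auto)

lemma schatten_of_diagonal:
  assumes A: "compact_map A" and B: "onb B"
    and Ae: "\<And>e. e \<in> B \<Longrightarrow> blinfun_apply A e = w e *\<^sub>R g e"
    and g: "\<And>F. finite F \<Longrightarrow> F \<subseteq> B \<Longrightarrow> bessel_on F g"
    and le: "\<And>F. finite F \<Longrightarrow> F \<subseteq> B \<Longrightarrow> (\<Sum>e\<in>F. \<bar>w e\<bar> powr q) \<le> C powr q"
    and q: "q \<ge> 1" and C: "C \<ge> 0"
  shows "schatten q C A"
proof -
  have "schatten q (C + 0) A"
    using assms by (intro schatten_of_two_diagonals [where u = w and v = "\<lambda>_. 0" and g = g and h = g]) auto
  then show ?thesis by simp
qed

text \<open>The vectors \<open>e\<close> and \<open>g e\<close> form the pair of Bessel systems at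
  which the entries of \<open>A\<close> are its singular values.\<close>

lemma schatten_singular_values:
  assumes A: "schatten q C A" and B: "onb B" and w: "\<And>e. w e \<ge> (0::real)"
    and Ae: "\<And>e. e \<in> B \<Longrightarrow> blinfun_apply A e = w e *\<^sub>R g e"
    and g: "\<And>F. finite F \<Longrightarrow> F \<subseteq> B \<Longrightarrow> bessel_on F g"
    and n: "\<And>e. e \<in> B \<Longrightarrow> w e \<noteq> 0 \<Longrightarrow> norm (g e) = 1"
    and F: "finite F" "F \<subseteq> B"
  shows "(\<Sum>e\<in>F. w e powr q) \<le> C powr q"
proof -
  have "(\<Sum>e\<in>F. \<bar>r (blinfun_apply A e) (g e)\<bar> powr q) \<le> C powr q"
    by (rule schatten_sum_le [OF A F(1) bessel_on_onb [OF B F] g [OF F]])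
  moreover have "\<bar>r (blinfun_apply A e) (g e)\<bar> = w e" if "e \<in> F" for e
    using that F Ae [of e] n [of e] w [of e] by (cases "w e = 0") (auto simp: r_simps r_self)
  ultimately show ?thesis by simp
qed

end

lemma has_sum_finite_sum:
  fixes f :: "'i \<Rightarrow> 'e \<Rightarrow> 'c::topological_comm_monoid_add"
  assumes "finite I" "\<And>i. i \<in> I \<Longrightarrow> (f i has_sum s i) B"
  shows "((\<lambda>e. \<Sum>i\<in>I. f i e) has_sum (\<Sum>i\<in>I. s i)) B"
  using assms by (induction I rule: finite_induct) (auto intro: has_sum_add)

section \<open>Hoelder's inequality for Schatten bounds\<close>

context real_hilbert
begin

text \<open>In the singular basis, the squared norm of a column is an average of the squares of the
  \<open>w e\<close> with weights \<open>(r (a i) e)\<^sup>2\<close> of total at most 1. Jensen's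
  inequality is applied to the power q/2, whence the condition that q is at least 2.\<close>

lemma schatten_column:
  assumes A: "schatten q C A" and q: "q \<ge> 2" and I: "finite I" "bessel_on I a"
  shows "(\<Sum>i\<in>I. norm (blinfun_apply A (a i)) powr q) \<le> C powr q"
proof -
  obtain B w g where B: "onb B" "\<And>e. w e \<ge> (0::real)"
    and Ae: "\<And>e. e \<in> B \<Longrightarrow> blinfun_apply A e = w e *\<^sub>R g e"
    and AA: "\<And>e. e \<in> B \<Longrightarrow> blinfun_apply (radj A) (blinfun_apply A e) = (w e)\<^sup>2 *\<^sub>R e"
    and g: "\<And>F. finite F \<Longrightarrow> F \<subseteq> B \<Longrightarrow> bessel_on F g"
    and n: "\<And>e. e \<in> B \<Longrightarrow> w e \<noteq> 0 \<Longrightarrow> norm (g e) = 1"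
    by (rule svd [OF schatten_compact [OF A]]) (rule that)
  have norm_A: "((\<lambda>e. (w e)\<^sup>2 * (r x e)\<^sup>2) has_sum (norm (blinfun_apply A x))\<^sup>2) B" for x
  proof -
    have 1: "((\<lambda>e. r x e * r (blinfun_apply (radj A o\<^sub>L A) e) x) has_sum r (blinfun_apply (radj A o\<^sub>L A) x) x) B"
      by (rule r_apply_expansion [OF B(1)])
    have 2: "r (blinfun_apply (radj A o\<^sub>L A) x) x = (norm (blinfun_apply A x))\<^sup>2"
      by (simp add: r_adjoint' r_self)
    have 3: "r x e * r (blinfun_apply (radj A o\<^sub>L A) e) x = (w e)\<^sup>2 * (r x e)\<^sup>2" if "e \<in> B" for e
      using that by (simp add: AA r_simps power2_eq_square r_commute [of e x])
    show ?thesis using 1 unfolding 2 by (rule has_sum_cong [THEN iffD1, rotated]) (rule 3)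
  qed
  have sq: "(x\<^sup>2) powr (q / 2) = x powr q" if "x \<ge> 0" for x :: real
    using that powr_powr [of x 2 "q / 2"] by simp
  have "(\<Sum>i\<in>I. ((norm (blinfun_apply A (a i)))\<^sup>2) powr (q / 2)) \<le> C powr q"
  proof (rule has_sum_finite_bound [where S = "{0..}" and \<Phi> = "\<lambda>x. x powr (q / 2)"
        and f = "\<lambda>i e. (w e)\<^sup>2 * (r (a i) e)\<^sup>2" and B = B])
    show "continuous_on {0..} (\<lambda>x::real. x powr (q / 2))"
      using q by (intro continuous_on_powr' continuous_intros) auto
    fix F assume F: "finite F" "F \<subseteq> B"
    have "(\<Sum>e\<in>F. (w e)\<^sup>2 * (r (a i) e)\<^sup>2) powr (q / 2) \<le> (\<Sum>e\<in>F. w e powr q * (r (a i) e)\<^sup>2)" if "i \<in> I" for i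
    proof -
      have "(\<Sum>e\<in>F. (r (a i) e)\<^sup>2) \<le> 1"
        using bessel_on_sum_le_one(2) [OF bessel_on_onb [OF B(1) F]] bessel_on_norm_le [OF I(2,1) that] by auto
      then have "(\<Sum>e\<in>F. (w e)\<^sup>2 * (r (a i) e)\<^sup>2) powr (q / 2) \<le> (\<Sum>e\<in>F. ((w e)\<^sup>2) powr (q / 2) * (r (a i) e)\<^sup>2)"
        using F q by (intro jensen_powr) auto
      then show ?thesis using B(2) by (simp add: sq)
    qed
    then have "(\<Sum>i\<in>I. (\<Sum>e\<in>F. (w e)\<^sup>2 * (r (a i) e)\<^sup>2) powr (q / 2)) \<le> (\<Sum>i\<in>I. \<Sum>e\<in>F. w e powr q * (r (a i) e)\<^sup>2)"
      by (rule sum_mono)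
    also have "\<dots> = (\<Sum>e\<in>F. w e powr q * (\<Sum>i\<in>I. (r (a i) e)\<^sup>2))"
      by (subst sum.swap) (simp add: sum_distrib_left)
    also have "\<dots> \<le> (\<Sum>e\<in>F. w e powr q * 1)"
    proof (intro sum_mono mult_left_mono)
      fix e assume "e \<in> F"
      then have "norm e \<le> 1" using bessel_on_norm_le [OF bessel_on_onb [OF B(1) F] F(1)] by auto
      then show "(\<Sum>i\<in>I. (r (a i) e)\<^sup>2) \<le> 1" by (rule bessel_on_sum_le_one(1) [OF I(2)])
    qed simp
    also have "\<dots> \<le> C powr q"
      using schatten_singular_values [OF A B Ae g n F] by simp
    finally show "(\<Sum>i\<in>I. (\<Sum>e\<in>F. (w e)\<^sup>2 * (r (a i) e)\<^sup>2) powr (q / 2)) \<le> C powr q" .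
  qed (auto intro: norm_A I sum_nonneg)
  then show ?thesis by (simp add: sq)
qed

text \<open>An entry of the product is at most the norm of a column of \<open>B\<close> times that
  of a column of the adjoint of \<open>A\<close>. The column estimates are what requires both
  exponents to be at least 2.\<close>

lemma schatten_holder_ge2:
  assumes A: "schatten p C A" and B: "schatten q D B" and pq: "p \<ge> 2" "q \<ge> 2" "1 / p + 1 / q = 1 / s"
    and s: "s > 0"
  shows "schatten s (C * D) (A o\<^sub>L B)"
proof (rule schattenI)
  fix n :: nat and a b assume ab: "bessel_on {..<n} a" "bessel_on {..<n} b"
  have "\<bar>r (blinfun_apply (A o\<^sub>L B) (a i)) (b i)\<bar> \<le> norm (blinfun_apply (radj A) (b i)) * norm (blinfun_apply B (a i))" for i
    using r_norm_le [of "blinfun_apply B (a i)" "blinfun_apply (radj A) (b i)"]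
    by (simp add: r_adjoint mult.commute)
  then have "(\<Sum>i<n. \<bar>r (blinfun_apply (A o\<^sub>L B) (a i)) (b i)\<bar> powr s)
      \<le> (\<Sum>i<n. (norm (blinfun_apply (radj A) (b i)) * norm (blinfun_apply B (a i))) powr s)"
    using s by (intro sum_mono powr_mono2) auto
  also have "\<dots> \<le> (C * D) powr s"
    using pq s schatten_nonneg [OF A] schatten_nonneg [OF B]
      schatten_column [OF schatten_adjoint [OF A] pq(1) _ ab(2)] schatten_column [OF B pq(2) _ ab(1)]
    by (intro holder_powr [of _ p q]) simp_all
  finally show "(\<Sum>i<n. \<bar>r (blinfun_apply (A o\<^sub>L B) (a i)) (b i)\<bar> powr s) \<le> (C * D) powr s" .
qed (simp_all add: schatten_nonneg [OF A] schatten_nonneg [OF B] compact_map_compose_right schatten_compact [OF A])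

definition rank_one :: "'b \<Rightarrow> 'b \<Rightarrow> ('b \<Rightarrow>\<^sub>L 'b)" where
  "rank_one u v = Blinfun (\<lambda>x. r v x *\<^sub>R u)"

lemma rank_one_apply: "blinfun_apply (rank_one u v) x = r v x *\<^sub>R u"
proof -
  have "bounded_linear (\<lambda>x. r v x *\<^sub>R u)"
    by (intro bounded_linear_compose [OF bounded_linear_scaleR_left]
        bounded_bilinear.bounded_linear_right [OF bounded_bilinear_r])
  then show ?thesis by (simp add: rank_one_def bounded_linear_Blinfun_apply)
qed

lemma compact_map_rank_one: "compact_map (rank_one u v)"
  unfolding compact_map_def
proof (intro allI impI)
  fix x :: "nat \<Rightarrow> 'b" assume "bounded (range x)"
  then have "bounded ((\<lambda>x. r v x) ` range x)"
    by (intro bounded_linear_image bounded_bilinear.bounded_linear_right [OF bounded_bilinear_r])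
  then have "bounded (range (\<lambda>n. r v (x n)))" by (simp add: image_image)
  then obtain l s where s: "strict_mono s" "((\<lambda>n. r v (x n)) \<circ> s) \<longlonglongrightarrow> l"
    using bounded_imp_convergent_subsequence by blast
  then have "(\<lambda>n. blinfun_apply (rank_one u v) (x (s n))) \<longlonglongrightarrow> l *\<^sub>R u"
    unfolding rank_one_apply by (intro tendsto_intros) (simp add: o_def)
  with s(1) show "\<exists>s l. strict_mono s \<and> (\<lambda>n. blinfun_apply (rank_one u v) (x (s n))) \<longlonglongrightarrow> l" by blast
qed

text \<open>Finite-rank test operators for duality; with coefficients 1 and an orthonormal family on
  both sides, the orthogonal projection onto its span.\<close>

definition rank_sum :: "'i set \<Rightarrow> ('i \<Rightarrow> real) \<Rightarrow> ('i \<Rightarrow> 'b) \<Rightarrow> ('i \<Rightarrow> 'b) \<Rightarrow> ('b \<Rightarrow>\<^sub>L 'b)" where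
  "rank_sum I c a b = (\<Sum>i\<in>I. c i *\<^sub>R rank_one (a i) (b i))"

lemma rank_sum_apply: "blinfun_apply (rank_sum I c a b) x = (\<Sum>i\<in>I. (c i * r (b i) x) *\<^sub>R a i)"
  by (simp add: rank_sum_def blinfun.sum_left blinfun.scaleR_left rank_one_apply)

lemma compact_map_rank_sum: "compact_map (rank_sum I c a b)"
  unfolding rank_sum_def by (intro compact_map_sum compact_map_scaleR compact_map_rank_one)

lemma schatten_rank_sum:
  assumes I: "finite I" "bessel_on I a" "bessel_on I b" and q: "q \<ge> 1"
  shows "schatten q ((\<Sum>i\<in>I. \<bar>c i\<bar> powr q) powr (1 / q)) (rank_sum I c a b)"
proof (rule schattenI)
  fix n :: nat and x y assume xy: "bessel_on {..<n} x" "bessel_on {..<n} y"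
  have "(\<Sum>k<n. \<bar>\<Sum>i\<in>I. c i * (r (b i) (x k) * r (a i) (y k))\<bar> powr q) \<le> (\<Sum>i\<in>I. \<bar>c i\<bar> powr q)"
  proof (rule substochastic_powr)
    fix k assume k: "k \<in> {..<n}"
    have nk: "norm (x k) \<le> 1" "norm (y k) \<le> 1"
      using bessel_on_norm_le [OF xy(1) _ k] bessel_on_norm_le [OF xy(2) _ k] by auto
    show "(\<Sum>i\<in>I. (r (b i) (x k))\<^sup>2) \<le> 1" by (rule bessel_on_sum_le_one(1) [OF I(3) nk(1)])
    show "(\<Sum>i\<in>I. (r (a i) (y k))\<^sup>2) \<le> 1" by (rule bessel_on_sum_le_one(1) [OF I(2) nk(2)])
  next
    fix i assume i: "i \<in> I"
    have ni: "norm (a i) \<le> 1" "norm (b i) \<le> 1"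
      using bessel_on_norm_le [OF I(2,1) i] bessel_on_norm_le [OF I(3,1) i] by auto
    show "(\<Sum>k<n. (r (b i) (x k))\<^sup>2) \<le> 1" by (rule bessel_on_sum_le_one(2) [OF xy(1) ni(2)])
    show "(\<Sum>k<n. (r (a i) (y k))\<^sup>2) \<le> 1" by (rule bessel_on_sum_le_one(2) [OF xy(2) ni(1)])
  qed (use I q in auto)
  also have "(\<Sum>i\<in>I. \<bar>c i\<bar> powr q) = ((\<Sum>i\<in>I. \<bar>c i\<bar> powr q) powr (1 / q)) powr q"
    using q by (simp add: powr_powr sum_nonneg)
  also have "(\<Sum>k<n. \<bar>\<Sum>i\<in>I. c i * (r (b i) (x k) * r (a i) (y k))\<bar> powr q)
      = (\<Sum>k<n. \<bar>r (blinfun_apply (rank_sum I c a b) (x k)) (y k)\<bar> powr q)"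
    by (simp add: rank_sum_apply r_sum_left r_simps mult.assoc)
  finally show "(\<Sum>k<n. \<bar>r (blinfun_apply (rank_sum I c a b) (x k)) (y k)\<bar> powr q)
      \<le> ((\<Sum>i\<in>I. \<bar>c i\<bar> powr q) powr (1 / q)) powr q" .
qed (simp_all add: compact_map_rank_sum)

lemma norm_rank_sum_le:
  assumes I: "finite I" "bessel_on I a" "bessel_on I b" and c: "\<And>i. i \<in> I \<Longrightarrow> \<bar>c i\<bar> \<le> 1"
  shows "norm (rank_sum I c a b) \<le> 1"
proof (rule norm_blinfun_bound)
  fix x
  let ?y = "blinfun_apply (rank_sum I c a b) x"
  have eq: "(norm ?y)\<^sup>2 = (\<Sum>i\<in>I. (c i * r (b i) x) * r (a i) ?y)"
    unfolding r_self [symmetric] by (subst (1) rank_sum_apply) (simp add: r_sum_left r_simps)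
  have "((norm ?y)\<^sup>2)\<^sup>2 \<le> (\<Sum>i\<in>I. (c i * r (b i) x)\<^sup>2) * (\<Sum>i\<in>I. (r (a i) ?y)\<^sup>2)"
    unfolding eq by (rule Cauchy_Schwarz_ineq_sum)
  also have "\<dots> \<le> (norm x)\<^sup>2 * (norm ?y)\<^sup>2"
  proof (intro mult_mono)
    have "(c i * r (b i) x)\<^sup>2 \<le> (r (b i) x)\<^sup>2" if "i \<in> I" for i
    proof -
      have "(c i)\<^sup>2 \<le> 1" using c [OF that] by (simp add: abs_square_le_1)
      then show ?thesis by (simp add: power_mult_distrib mult_left_le_one_le)
    qed
    then have "(\<Sum>i\<in>I. (c i * r (b i) x)\<^sup>2) \<le> (\<Sum>i\<in>I. (r (b i) x)\<^sup>2)" by (rule sum_mono)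
    also have "\<dots> \<le> (norm x)\<^sup>2" using I(3) by (simp add: bessel_on_def)
    finally show "(\<Sum>i\<in>I. (c i * r (b i) x)\<^sup>2) \<le> (norm x)\<^sup>2" .
  qed (use I(2) in \<open>auto simp: bessel_on_def intro: sum_nonneg\<close>)
  finally have "((norm ?y)\<^sup>2)\<^sup>2 \<le> (norm x * norm ?y)\<^sup>2" by (simp add: power_mult_distrib)
  then have "(norm ?y)\<^sup>2 \<le> norm x * norm ?y" by (rule power2_le_imp_le) simp
  then have *: "norm ?y * norm ?y \<le> norm x * norm ?y" by (simp add: power2_eq_square)
  show "norm ?y \<le> 1 * norm x"
  proof (cases "norm ?y = 0")
    case False
    then have "norm ?y > 0" by simp
    with * show ?thesis by (simp only: mult_le_cancel_right_pos mult_1)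
  qed simp
qed simp

text \<open>Trace duality: the sum is the trace of \<open>A\<close> times
  \<open>T o\<^sub>L rank_sum I c a b\<close>. Expanded in the singular basis of \<open>A\<close> it
  becomes a sum of singular values times entries, to which the inequality for sums applies.
  \<open>T\<close> is kept apart from \<open>A\<close> so that it can be grouped with the test
  operator.\<close>

lemma schatten_pairing:
  assumes I: "finite I" and A: "schatten p C A" and N: "schatten p' D (T o\<^sub>L rank_sum I c a b)"
    and p: "p > 0" "p' > 0" "1 / p + 1 / p' = 1"
  shows "\<bar>\<Sum>i\<in>I. c i * r (blinfun_apply (A o\<^sub>L T) (a i)) (b i)\<bar> \<le> C * D"
proof -
  obtain B w g where B: "onb B" "\<And>e. w e \<ge> (0::real)"
    and Ae: "\<And>e. e \<in> B \<Longrightarrow> blinfun_apply A e = w e *\<^sub>R g e"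
    and g: "\<And>F. finite F \<Longrightarrow> F \<subseteq> B \<Longrightarrow> bessel_on F g"
    and n: "\<And>e. e \<in> B \<Longrightarrow> w e \<noteq> 0 \<Longrightarrow> norm (g e) = 1"
    by (rule svd [OF schatten_compact [OF A]]) (rule that)
  let ?N = "T o\<^sub>L rank_sum I c a b"
  let ?f = "\<lambda>e. \<Sum>i\<in>I. c i * (r (blinfun_apply T (a i)) e * r (blinfun_apply A e) (b i))"
  have sum: "(?f has_sum (\<Sum>i\<in>I. c i * r (blinfun_apply (A o\<^sub>L T) (a i)) (b i))) B"
    by (intro has_sum_finite_sum has_sum_cmult_right I) (simp add: r_apply_expansion [OF B(1)])
  have f: "?f e = w e * r (blinfun_apply ?N (g e)) e" if "e \<in> B" for e
    using that by (simp add: Ae rank_sum_apply blinfun.sum_right blinfun.scaleR_right r_simps r_sum_left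
        sum_distrib_left r_commute [of "g e"] mult_ac)
  have "(\<Sum>_\<in>{()}. \<bar>\<Sum>i\<in>I. c i * r (blinfun_apply (A o\<^sub>L T) (a i)) (b i)\<bar>) \<le> C * D"
  proof (rule has_sum_finite_bound [where S = UNIV and \<Phi> = abs and f = "\<lambda>_. ?f" and B = B])
    show "continuous_on UNIV (abs :: real \<Rightarrow> real)" by (intro continuous_intros)
    fix F assume F: "finite F" "F \<subseteq> B"
    have "\<bar>sum ?f F\<bar> = \<bar>\<Sum>e\<in>F. w e * r (blinfun_apply ?N (g e)) e\<bar>"
      using f F by (intro arg_cong [where f = abs] sum.cong) auto
    also have "\<dots> \<le> (\<Sum>e\<in>F. (w e * \<bar>r (blinfun_apply ?N (g e)) e\<bar>) powr 1)"
      using B(2) by (intro order_trans [OF sum_abs]) (simp add: abs_mult)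
    also have "\<dots> \<le> (C * D) powr 1"
      using p F schatten_nonneg [OF A] schatten_nonneg [OF N] B(2)
        schatten_singular_values [OF A B Ae g n F]
        schatten_sum_le [OF N F(1) g [OF F] bessel_on_onb [OF B(1) F]]
      by (intro holder_powr [of _ p p']) auto
    finally show "(\<Sum>_\<in>{()}. \<bar>sum ?f F\<bar>) \<le> C * D"
      using schatten_nonneg [OF A] schatten_nonneg [OF N] by simp
  qed (use sum in auto)
  then show ?thesis by simp
qed

text \<open>Duality moves the problem to exponents of at least 2. For s > 1, testing the product
  against a finite-rank operator of the conjugate exponent s' leaves the pairing of \<open>A\<close>
  with \<open>B\<close> times that operator. Both q and s' are at least 2, so
  \<open>schatten_holder_ge2\<close> puts this product into the class whose exponent is conjugate to
  p.\<close>

lemma schatten_holder_lt2: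
  assumes A: "schatten p C A" and B: "schatten q D B"
    and p: "1 < p" "p < 2" and q: "q > 0" "1 / p + 1 / q = 1 / s" and s: "s \<ge> 1"
  shows "schatten s (C * D) (A o\<^sub>L B)"
proof (rule schattenI)
  have C: "C \<ge> 0" and D: "D \<ge> 0" using schatten_nonneg [OF A] schatten_nonneg [OF B] by auto
  have q2: "q > 2"
  proof -
    have "1 / p > 1 / 2" using p by (simp add: field_simps)
    moreover have "1 / s \<le> 1" using s by simp
    ultimately have "1 / q < 1 / 2" using q(2) by linarith
    then show ?thesis using q(1) by (simp add: field_simps)
  qed
  fix n :: nat and a b assume ab: "bessel_on {..<n} a" "bessel_on {..<n} b"
  define x where "x i = r (blinfun_apply (A o\<^sub>L B) (a i)) (b i)" for i
  define \<Sigma> where "\<Sigma> = (\<Sum>i<n. \<bar>x i\<bar> powr s)"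
  have "\<Sigma> \<ge> 0" by (simp add: \<Sigma>_def sum_nonneg)
  have "\<Sigma> \<le> (C * D) powr s"
  proof (cases "s = 1")
    case True
    \<comment> \<open>For s = 1 the conjugate exponent is infinite: the coefficients are signs and
      the test operator serves as a contraction.\<close>
    let ?M = "rank_sum {..<n} (\<lambda>i. sgn (x i)) a b"
    have "norm ?M \<le> 1" using ab by (intro norm_rank_sum_le) (auto simp: sgn_if)
    from schatten_compose_right [OF B this q(1)] have "schatten q D (B o\<^sub>L ?M)" by simp
    from schatten_pairing [OF _ A this _ q(1)] have "\<bar>\<Sum>i<n. sgn (x i) * x i\<bar> \<le> C * D"
      using p q True by (simp add: x_def)
    moreover have "sgn (x i) * x i = \<bar>x i\<bar>" for i by (metis abs_sgn mult.commute)
    ultimately show ?thesis using True C D by (simp add: \<Sigma>_def sum_nonneg)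
  next
    case False
    then have s1: "s > 1" using s by simp
    define s' where "s' = s / (s - 1)"
    have s': "s' > 0" "1 / s' = 1 - 1 / s" using s1 by (auto simp: s'_def field_simps)
    have "1 / q > 0" using q(1) by simp
    then have "1 / s > 1 / p" using q(2) by linarith
    then have "s < p" using p s by (simp add: field_simps)
    then have s'2: "s' \<ge> 2" using s1 p by (simp add: s'_def field_simps)
    \<comment> \<open>The extremal sequence for the pairing of exponents s and s': c x = |x|^s and
      |c|^s' = |x|^s. The resulting inequality can be divided by \<Sigma>^(1/s').\<close>
    define c where "c i = sgn (x i) * \<bar>x i\<bar> powr (s - 1)" for i
    have cx: "c i * x i = \<bar>x i\<bar> powr s" for i
    proof -
      have "c i * x i = \<bar>x i\<bar> powr (s - 1) * \<bar>x i\<bar> powr 1"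
        by (cases "x i" "0::real" rule: linorder_cases) (simp_all add: c_def)
      also have "\<dots> = \<bar>x i\<bar> powr (s - 1 + 1)" by (simp only: powr_add)
      finally show ?thesis by simp
    qed
    have cs: "\<bar>c i\<bar> powr s' = \<bar>x i\<bar> powr s" for i
    proof (cases "x i = 0")
      case False
      have "(s - 1) * s' = s" using s1 by (simp add: s'_def)
      then show ?thesis using False by (simp add: c_def abs_mult powr_powr)
    qed (use s in \<open>simp add: c_def\<close>)
    let ?M = "rank_sum {..<n} c a b"
    have "schatten s' ((\<Sum>i<n. \<bar>c i\<bar> powr s') powr (1 / s')) ?M"
      using ab s'2 by (intro schatten_rank_sum) auto
    then have M: "schatten s' (\<Sigma> powr (1 / s')) ?M" by (simp add: cs \<Sigma>_def)
    define p' where "p' = p / (p - 1)"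
    have p': "p' > 0" "1 / p' = 1 - 1 / p" using p by (auto simp: p'_def field_simps)
    have "schatten p' (D * \<Sigma> powr (1 / s')) (B o\<^sub>L ?M)"
      using q2 s'2 q(2) p' s' by (intro schatten_holder_ge2 [OF B M]) auto
    from schatten_pairing [OF _ A this] have "\<bar>\<Sum>i<n. c i * x i\<bar> \<le> C * (D * \<Sigma> powr (1 / s'))"
      using p p' by (simp add: x_def)
    then have le: "\<Sigma> \<le> C * (D * \<Sigma> powr (1 / s'))" by (simp add: cx \<Sigma>_def)
    show ?thesis
    proof (cases "\<Sigma> = 0")
      case False
      then have pos: "\<Sigma> > 0" using \<open>\<Sigma> \<ge> 0\<close> by simp
      have "\<Sigma> = \<Sigma> powr (1 / s) * \<Sigma> powr (1 / s')"
        using pos s' by (simp add: powr_add [symmetric])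
      with le have "\<Sigma> powr (1 / s) * \<Sigma> powr (1 / s') \<le> (C * D) * \<Sigma> powr (1 / s')" by (simp add: mult_ac)
      then have "\<Sigma> powr (1 / s) \<le> C * D" using pos by (simp add: mult_le_cancel_right)
      then have "(\<Sigma> powr (1 / s)) powr s \<le> (C * D) powr s" using s by (intro powr_mono2) auto
      then show ?thesis using s pos by (simp add: powr_powr)
    qed simp
  qed
  then show "(\<Sum>i<n. \<bar>r (blinfun_apply (A o\<^sub>L B) (a i)) (b i)\<bar> powr s) \<le> (C * D) powr s"
    by (simp add: \<Sigma>_def x_def)
qed (simp_all add: schatten_nonneg [OF A] schatten_nonneg [OF B] compact_map_compose_right schatten_compact [OF A])

theorem schatten_holder:
  assumes A: "schatten p C A" and B: "schatten q D B"
    and pq: "p > 0" "q > 0" "1 / p + 1 / q = 1 / s" and s: "s \<ge> 1"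
  shows "schatten s (C * D) (A o\<^sub>L B)"
proof -
  have le1: "1 / s \<le> 1" "1 / p > 0" "1 / q > 0" using s pq by simp_all
  then have "1 / p < 1" "1 / q < 1" using pq(3) by linarith+
  then have g1: "p > 1" "q > 1" using pq(1,2) by (simp_all add: field_simps)
  consider "p \<ge> 2" "q \<ge> 2" | "p < 2" | "q < 2" by linarith
  then show ?thesis
  proof cases
    case 1 then show ?thesis using schatten_holder_ge2 [OF A B] pq s by simp
  next
    case 2 then show ?thesis using schatten_holder_lt2 [OF A B] g1 pq s by simp
  next
    case 3
    have "schatten s (D * C) (radj B o\<^sub>L radj A)"
      using 3 g1 pq s by (intro schatten_holder_lt2 [OF schatten_adjoint [OF B] schatten_adjoint [OF A]]) auto
    from schatten_adjoint [OF this] show ?thesis by (simp add: adjoint_compose mult.commute)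
  qed
qed

section \<open>The trace\<close>

definition optrace :: "('b \<Rightarrow>\<^sub>L 'b) \<Rightarrow> real" where
  "optrace Z = infsum (\<lambda>e. r (blinfun_apply Z e) e) (SOME B. onb B)"

lemma schatten_trace_finite:
  assumes Z: "schatten 1 C Z" and B: "onb B" and F: "finite F" "F \<subseteq> B"
  shows "(\<Sum>e\<in>F. \<bar>r (blinfun_apply Z e) e\<bar>) \<le> C"
  using schatten_sum_le [OF Z F(1) bessel_on_onb [OF B F] bessel_on_onb [OF B F]] schatten_nonneg [OF Z]
  by simp

text \<open>Both sides are iterated sums of w e * r (g e) b * r b e. The double series converges
  absolutely, because for fixed \<open>e\<close> the absolute sum over \<open>b\<close> is at most
  \<open>w e\<close>, and the \<open>w e\<close> have a finite sum. As the right side does not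
  involve \<open>B\<close>, the trace is independent of the basis.\<close>

lemma schatten_trace_infsum:
  assumes Z: "schatten 1 C Z" and B: "onb B" and B': "onb B'" and w: "\<And>e. w e \<ge> (0::real)"
    and Ze: "\<And>e. e \<in> B' \<Longrightarrow> blinfun_apply Z e = w e *\<^sub>R g e"
    and g: "\<And>F. finite F \<Longrightarrow> F \<subseteq> B' \<Longrightarrow> bessel_on F g"
    and n: "\<And>e. e \<in> B' \<Longrightarrow> w e \<noteq> 0 \<Longrightarrow> norm (g e) = 1"
  shows "infsum (\<lambda>b. r (blinfun_apply Z b) b) B = infsum (\<lambda>e. w e * r (g e) e) B'"
proof -
  let ?h = "\<lambda>b e. w e * (r (g e) b * r b e)"
  have "(\<lambda>(b, e). \<bar>?h b e\<bar>) summable_on B \<times> B'"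
  proof (rule nonneg_bdd_above_summable_on)
    show "bdd_above (sum (\<lambda>(b, e). \<bar>?h b e\<bar>) ` {F. F \<subseteq> B \<times> B' \<and> finite F})"
    proof (rule bdd_aboveI2)
      fix F assume "F \<in> {F. F \<subseteq> B \<times> B' \<and> finite F}"
      then have F: "F \<subseteq> B \<times> B'" "finite F" by auto
      define F1 F2 where "F1 = fst ` F" and "F2 = snd ` F"
      have fin: "finite F1" "finite F2" "F1 \<subseteq> B" "F2 \<subseteq> B'" and sub: "F \<subseteq> F1 \<times> F2"
        using F by (auto simp: F1_def F2_def rev_image_eqI)
      have "sum (\<lambda>(b, e). \<bar>?h b e\<bar>) F \<le> sum (\<lambda>(b, e). \<bar>?h b e\<bar>) (F1 \<times> F2)"
        using fin sub by (intro sum_mono2) auto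
      also have "\<dots> = (\<Sum>e\<in>F2. \<Sum>b\<in>F1. \<bar>?h b e\<bar>)"
        by (subst sum.swap) (simp add: sum.cartesian_product)
      also have "\<dots> = (\<Sum>e\<in>F2. w e * (\<Sum>b\<in>F1. \<bar>r (g e) b * r b e\<bar>))"
        using w by (simp add: abs_mult sum_distrib_left)
      also have "\<dots> \<le> (\<Sum>e\<in>F2. w e * 1)"
      proof (intro sum_mono mult_left_mono w)
        fix e assume e: "e \<in> F2"
        have "norm (g e) \<le> 1" "norm e \<le> 1"
          using bessel_on_norm_le [OF g [OF fin(2,4)] fin(2) e]
            bessel_on_norm_le [OF bessel_on_onb [OF B' fin(2,4)] fin(2) e] by auto
        then show "(\<Sum>b\<in>F1. \<bar>r (g e) b * r b e\<bar>) \<le> 1"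
          using bessel_on_sum_le_one [OF bessel_on_onb [OF B fin(1,3)]] by (intro sum_abs_mult_le_one) auto
      qed
      also have "\<dots> \<le> C"
        using schatten_singular_values [OF Z B' w Ze g n fin(2,4)] w schatten_nonneg [OF Z] by simp
      finally show "sum (\<lambda>(b, e). \<bar>?h b e\<bar>) F \<le> C" .
    qed
  qed auto
  then have sm: "(\<lambda>(b, e). ?h b e) summable_on B \<times> B'"
    by (intro abs_summable_summable [where f = "\<lambda>(b, e). ?h b e"]) (simp add: case_prod_unfold)
  have "infsum (\<lambda>b. r (blinfun_apply Z b) b) B = infsum (\<lambda>b. infsum (\<lambda>e. ?h b e) B') B"
  proof (rule infsum_cong)
    fix b
    have "((\<lambda>e. r b e * r (blinfun_apply Z e) b) has_sum r (blinfun_apply Z b) b) B'"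
      by (rule r_apply_expansion [OF B'])
    then have "r (blinfun_apply Z b) b = infsum (\<lambda>e. r b e * r (blinfun_apply Z e) b) B'"
      by (rule infsumI [symmetric])
    also have "\<dots> = infsum (\<lambda>e. ?h b e) B'"
      by (rule infsum_cong) (simp add: Ze r_simps)
    finally show "r (blinfun_apply Z b) b = infsum (\<lambda>e. ?h b e) B'" .
  qed
  also have "\<dots> = infsum (\<lambda>e. infsum (\<lambda>b. ?h b e) B) B'"
    by (rule infsum_swap_banach [OF sm])
  also have "\<dots> = infsum (\<lambda>e. w e * r (g e) e) B'"
  proof (rule infsum_cong)
    fix e
    show "infsum (\<lambda>b. ?h b e) B = w e * r (g e) e"
      by (intro infsumI has_sum_cmult_right parseval_r [OF B])
  qed
  finally show ?thesis .
qed

lemma has_sum_optrace: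
  assumes Z: "schatten 1 C Z" and B: "onb B"
  shows "((\<lambda>e. r (blinfun_apply Z e) e) has_sum optrace Z) B"
proof -
  have "(\<lambda>e. \<bar>r (blinfun_apply Z e) e\<bar>) summable_on B"
    by (rule nonneg_bdd_above_summable_on)
      (use schatten_trace_finite [OF Z B] in \<open>auto intro!: bdd_aboveI2\<close>)
  then have "(\<lambda>e. r (blinfun_apply Z e) e) summable_on B" by (intro abs_summable_summable [where f = "\<lambda>e. r (blinfun_apply Z e) e"]) simp
  then have "((\<lambda>e. r (blinfun_apply Z e) e) has_sum infsum (\<lambda>e. r (blinfun_apply Z e) e) B) B" by simp
  moreover have "infsum (\<lambda>e. r (blinfun_apply Z e) e) B = optrace Z"
  proof -
    obtain B' w g where 1: "onb B'" "\<And>e. w e \<ge> (0::real)"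
      "\<And>e. e \<in> B' \<Longrightarrow> blinfun_apply Z e = w e *\<^sub>R g e"
      "\<And>F. finite F \<Longrightarrow> F \<subseteq> B' \<Longrightarrow> bessel_on F g"
      "\<And>e. e \<in> B' \<Longrightarrow> w e \<noteq> 0 \<Longrightarrow> norm (g e) = 1"
      by (rule svd [OF schatten_compact [OF Z]]) (rule that)
    have s: "onb (SOME B. onb B)" using R.orthonormal_basis_exists by (rule someI_ex)
    show ?thesis
      unfolding optrace_def
      by (rule trans [OF schatten_trace_infsum [OF Z B 1] schatten_trace_infsum [OF Z s 1, symmetric]])
  qed
  ultimately show ?thesis by simp
qed

lemma optrace_abs_le:
  assumes Z: "schatten 1 C Z"
  shows "\<bar>optrace Z\<bar> \<le> C"
proof -
  obtain B where B: "onb B" using R.orthonormal_basis_exists by blast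
  have "(\<Sum>_\<in>{()}. \<bar>optrace Z\<bar>) \<le> C"
  proof (rule has_sum_finite_bound [where S = UNIV and \<Phi> = abs and f = "\<lambda>_ e. r (blinfun_apply Z e) e" and B = B])
    fix F assume F: "finite F" "F \<subseteq> B"
    show "(\<Sum>_\<in>{()}. \<bar>\<Sum>e\<in>F. r (blinfun_apply Z e) e\<bar>) \<le> C"
      using order_trans [OF sum_abs schatten_trace_finite [OF Z B F]] by simp
  qed (auto intro: has_sum_optrace [OF Z B] continuous_intros)
  then show ?thesis by simp
qed

lemma optrace_add: "schatten 1 C Y \<Longrightarrow> schatten 1 D Z \<Longrightarrow> optrace (Y + Z) = optrace Y + optrace Z"
proof -
  assume Y: "schatten 1 C Y" and Z: "schatten 1 D Z"
  obtain B where B: "onb B" using R.orthonormal_basis_exists by blast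
  have "((\<lambda>e. r (blinfun_apply (Y + Z) e) e) has_sum optrace Y + optrace Z) B"
    using has_sum_add [OF has_sum_optrace [OF Y B] has_sum_optrace [OF Z B]]
    by (simp add: blinfun.add_left r_simps)
  from has_sum_unique [OF has_sum_optrace [OF schatten_add [OF Y Z order_refl] B] this] show ?thesis .
qed

lemma optrace_scaleR: "schatten 1 C Z \<Longrightarrow> optrace (c *\<^sub>R Z) = c * optrace Z"
proof -
  assume Z: "schatten 1 C Z"
  obtain B where B: "onb B" using R.orthonormal_basis_exists by blast
  have "((\<lambda>e. r (blinfun_apply (c *\<^sub>R Z) e) e) has_sum c * optrace Z) B"
    using has_sum_cmult_right [OF has_sum_optrace [OF Z B], of c]
    by (simp add: blinfun.scaleR_left r_simps)
  from has_sum_unique [OF has_sum_optrace [OF schatten_scaleR [OF Z] B] this] show ?thesis .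
qed

lemma optrace_diff: "schatten 1 C Y \<Longrightarrow> schatten 1 D Z \<Longrightarrow> optrace (Y - Z) = optrace Y - optrace Z"
  using optrace_add [OF _ schatten_minus, of C Y D Z] optrace_scaleR [of D Z "-1"] by simp

end


section \<open>Resolvents of skew operators\<close>

lemma geometric_sum_le:
  fixes J :: "int set" and s \<beta> c :: real
  assumes "finite J" "s > 0" "\<beta> > 0" and le: "\<And>j. j \<in> J \<Longrightarrow> s * 2 powr j \<le> c"
  shows "(\<Sum>j\<in>J. (s * 2 powr j) powr \<beta>) \<le> c powr \<beta> / (1 - 2 powr (- \<beta>))"
proof (cases "J = {}")
  case True
  have "2 powr (- \<beta>) < (1::real)" using assms by (simp add: powr_less_one)
  then show ?thesis using True by simp
next
  case False
  define m where "m = Max J"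
  have m: "m \<in> J" "\<And>j. j \<in> J \<Longrightarrow> j \<le> m" using False assms(1) by (auto simp: m_def)
  define x where "x = 2 powr (- \<beta>)"
  have x: "0 < x" "x < 1" using assms by (auto simp: x_def powr_less_one)
  \<comment> \<open>Measured from the largest index, the terms are powers of the ratio 2^(-\<beta>).
    Comparison with the full geometric series makes the bound independent of the size of
    \<open>J\<close>.\<close>
  have each: "(s * 2 powr j) powr \<beta> = (s * 2 powr m) powr \<beta> * x ^ nat (m - j)" if "j \<in> J" for j
  proof -
    have "x ^ nat (m - j) = x powr real (nat (m - j))" using x by (simp add: powr_realpow)
    also have "\<dots> = 2 powr (\<beta> * (real_of_int j - m))"
      using m(2) [OF that] by (simp add: x_def powr_powr algebra_simps)
    finally have "x ^ nat (m - j) = 2 powr (\<beta> * (real_of_int j - m))" .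
    then show ?thesis using assms
      by (simp add: powr_mult powr_powr powr_add [symmetric] algebra_simps)
  qed
  have inj: "inj_on (\<lambda>j. nat (m - j)) J"
  proof (rule inj_onI)
    fix i j assume "i \<in> J" "j \<in> J" "nat (m - i) = nat (m - j)"
    then show "i = j" using m(2) [of i] m(2) [of j] by simp
  qed
  have "(\<Sum>j\<in>J. (s * 2 powr j) powr \<beta>) = (s * 2 powr m) powr \<beta> * (\<Sum>j\<in>J. x ^ nat (m - j))"
    by (simp add: each sum_distrib_left)
  also have "(\<Sum>j\<in>J. x ^ nat (m - j)) = (\<Sum>k\<in>(\<lambda>j. nat (m - j)) ` J. x ^ k)"
    by (simp add: sum.reindex [OF inj])
  also have "\<dots> \<le> (\<Sum>k. x ^ k)"
    using x assms(1) by (intro sum_le_suminf summable_geometric) auto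
  also have "\<dots> = 1 / (1 - x)" using x by (simp add: suminf_geometric)
  also have "(s * 2 powr m) powr \<beta> * (1 / (1 - x)) \<le> c powr \<beta> * (1 / (1 - x))"
    using x le [OF m(1)] assms by (intro mult_right_mono powr_mono2) auto
  finally show ?thesis using assms by (simp add: x_def mult_left_mono)
qed

lemma geometric_sum_ge:
  fixes J :: "int set" and s \<beta> c :: real
  assumes "finite J" "s > 0" "\<beta> > 0" "c > 0" and ge: "\<And>j. j \<in> J \<Longrightarrow> s * 2 powr j \<ge> c"
  shows "(\<Sum>j\<in>J. (s * 2 powr j) powr (- \<beta>)) \<le> c powr (- \<beta>) / (1 - 2 powr (- \<beta>))"
proof -
  have inv: "(1 / s) * 2 powr real_of_int (- j) = 1 / (s * 2 powr j)" for j
    by (simp add: powr_minus_divide)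
  have inj: "inj_on uminus J" by (simp add: inj_on_def)
  have "(\<Sum>j\<in>J. (s * 2 powr j) powr (- \<beta>)) = (\<Sum>j\<in>uminus ` J. ((1 / s) * 2 powr real_of_int j) powr \<beta>)"
    using assms(2) unfolding sum.reindex [OF inj] o_def inv
    by (simp add: powr_minus_divide powr_divide)
  also have "\<dots> \<le> (1 / c) powr \<beta> / (1 - 2 powr (- \<beta>))"
  proof (rule geometric_sum_le)
    fix j assume "j \<in> uminus ` J"
    then obtain i where i: "i \<in> J" "j = - i" by auto
    show "1 / s * 2 powr real_of_int j \<le> 1 / c"
      unfolding i(2) inv using ge [OF i(1)] assms(4) by (intro divide_left_mono) auto
  qed (use assms in auto)
  also have "(1 / c) powr \<beta> = c powr (- \<beta>)"
    using assms by (simp add: powr_minus_divide powr_divide)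
  finally show ?thesis .
qed

text \<open>The sums of the geometric series with ratios 2^(-\<alpha>) and 2^(-(1 - \<alpha>)): the
  first collects the scales below a given value, the second those above it. Both series converge
  exactly for 0 < \<alpha> < 1.\<close>

definition dyadic_const :: "real \<Rightarrow> real" where
  "dyadic_const \<alpha> = 1 / (1 - 2 powr (- \<alpha>)) + 1 / (1 - 2 powr (- (1 - \<alpha>)))"

lemma dyadic_const_pos: "0 < \<alpha> \<Longrightarrow> \<alpha> < 1 \<Longrightarrow> dyadic_const \<alpha> > 0"
  unfolding dyadic_const_def by (intro add_pos_pos divide_pos_pos) (auto simp: powr_less_one)

text \<open>The scale s = w separates two geometric series. Below it the minimum is 1 and s^\<alpha>
  decreases towards 0; above it s^\<alpha> w/s = w s^(\<alpha> - 1) decreases towards infinity. Both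
  are largest at s = w, with value w^\<alpha>.\<close>

lemma dyadic_sum_min:
  fixes J :: "int set" and s \<alpha> w :: real
  assumes "finite J" "s > 0" "0 < \<alpha>" "\<alpha> < 1" "w \<ge> 0"
  shows "(\<Sum>j\<in>J. (s * 2 powr j) powr \<alpha> * min 1 (w / (s * 2 powr j))) \<le> dyadic_const \<alpha> * w powr \<alpha>"
proof (cases "w = 0")
  case True
  then show ?thesis by simp
next
  case False
  then have w: "w > 0" using assms by simp
  let ?t = "\<lambda>j. s * 2 powr real_of_int j"
  define J1 J2 where "J1 = {j\<in>J. ?t j \<le> w}" and "J2 = {j\<in>J. ?t j > w}"
  have fin: "finite J1" "finite J2" using assms by (auto simp: J1_def J2_def)
  have "(\<Sum>j\<in>J. ?t j powr \<alpha> * min 1 (w / ?t j))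
      = (\<Sum>j\<in>J1. ?t j powr \<alpha> * min 1 (w / ?t j)) + (\<Sum>j\<in>J2. ?t j powr \<alpha> * min 1 (w / ?t j))"
    using assms(1) by (subst sum.union_disjoint [symmetric]) (auto simp: J1_def J2_def intro!: sum.cong)
  also have "(\<Sum>j\<in>J1. ?t j powr \<alpha> * min 1 (w / ?t j)) \<le> (\<Sum>j\<in>J1. ?t j powr \<alpha>)"
    by (intro sum_mono) (simp add: mult_left_le)
  also have "\<dots> \<le> w powr \<alpha> / (1 - 2 powr (- \<alpha>))"
    using assms fin by (intro geometric_sum_le) (auto simp: J1_def)
  also have "(\<Sum>j\<in>J2. ?t j powr \<alpha> * min 1 (w / ?t j)) \<le> (\<Sum>j\<in>J2. w * ?t j powr (- (1 - \<alpha>)))"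
  proof (intro sum_mono)
    fix j assume "j \<in> J2"
    have t: "?t j > 0" using assms by simp
    have "?t j powr \<alpha> * min 1 (w / ?t j) \<le> ?t j powr \<alpha> * (w / ?t j)" by (intro mult_left_mono) auto
    also have "\<dots> = w * (?t j powr \<alpha> / ?t j powr 1)" using t by simp
    also have "\<dots> = w * ?t j powr (- (1 - \<alpha>))" by (simp only: powr_diff [symmetric]) simp
    finally show "?t j powr \<alpha> * min 1 (w / ?t j) \<le> w * ?t j powr (- (1 - \<alpha>))" .
  qed
  also have "\<dots> = w * (\<Sum>j\<in>J2. ?t j powr (- (1 - \<alpha>)))" by (simp add: sum_distrib_left)
  also have "\<dots> \<le> w * (w powr (- (1 - \<alpha>)) / (1 - 2 powr (- (1 - \<alpha>))))"
    using assms fin w by (intro mult_left_mono geometric_sum_ge) (auto simp: J2_def)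
  also have "\<dots> = w powr \<alpha> / (1 - 2 powr (- (1 - \<alpha>)))"
  proof -
    have "w * w powr (- (1 - \<alpha>)) = w powr 1 * w powr (- (1 - \<alpha>))" using w by simp
    also have "\<dots> = w powr \<alpha>" by (simp only: powr_add [symmetric]) simp
    finally show ?thesis by simp
  qed
  finally show ?thesis by (simp add: dyadic_const_def algebra_simps)
qed

section \<open>Resolvent and Cayley transform of a skew operator\<close>

lemma blinfun_compose_simps:
  "A o\<^sub>L (B + C) = (A o\<^sub>L B) + (A o\<^sub>L C)" "(A + B) o\<^sub>L C = (A o\<^sub>L C) + (B o\<^sub>L C)"
  "A o\<^sub>L (B - C) = (A o\<^sub>L B) - (A o\<^sub>L C)" "(A - B) o\<^sub>L C = (A o\<^sub>L C) - (B o\<^sub>L C)"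
  "A o\<^sub>L (- B) = - (A o\<^sub>L B)" "(- A) o\<^sub>L B = - (A o\<^sub>L B)"
  "A o\<^sub>L (c *\<^sub>R B) = c *\<^sub>R (A o\<^sub>L B)" "(c *\<^sub>R A) o\<^sub>L B = c *\<^sub>R (A o\<^sub>L B)"
  "id_blinfun o\<^sub>L A = A" "A o\<^sub>L id_blinfun = A" "(A o\<^sub>L B) o\<^sub>L C = A o\<^sub>L (B o\<^sub>L C)"
  "0 o\<^sub>L A = 0" "A o\<^sub>L 0 = 0"
  by (auto intro!: blinfun_eqI simp: blinfun.add_right blinfun.add_left blinfun.diff_left
      blinfun.diff_right blinfun.minus_left blinfun.minus_right blinfun.scaleR_left
      blinfun.scaleR_right blinfun.zero_right)

lemma blinfun_compose_assoc: "(A o\<^sub>L B) o\<^sub>L C = A o\<^sub>L (B o\<^sub>L C)"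
  by (rule blinfun_eqI) simp

lemmas blinfun_compose_sum_left = bounded_bilinear.sum_left [OF bounded_bilinear_blinfun_compose]
lemmas blinfun_compose_sum_right = bounded_bilinear.sum_right [OF bounded_bilinear_blinfun_compose]

context real_hilbert
begin

definition skew :: "('b \<Rightarrow>\<^sub>L 'b) \<Rightarrow> bool" where
  "skew X \<longleftrightarrow> (\<forall>x y. r (blinfun_apply X x) y = - r x (blinfun_apply X y))"

lemma skew_r: "skew X \<Longrightarrow> r (blinfun_apply X x) y = - r x (blinfun_apply X y)"
  by (simp add: skew_def)

lemma skew_r_self: "skew X \<Longrightarrow> r (blinfun_apply X x) x = 0" "skew X \<Longrightarrow> r x (blinfun_apply X x) = 0"
  using skew_r [of X x x] by (simp_all add: r_commute)

lemma skew_adjoint: "skew X \<Longrightarrow> radj X = - X"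
  by (rule adjoint_eqI) (simp add: skew_r r_simps blinfun.minus_left)

lemma skew_diff: "skew X \<Longrightarrow> skew Y \<Longrightarrow> skew (X - Y)"
  and skew_scaleR: "skew X \<Longrightarrow> skew (c *\<^sub>R X)"
  by (simp_all add: skew_def blinfun.add_left blinfun.diff_left blinfun.scaleR_left r_simps)

lemma norm_add_skew:
  assumes "skew X"
  shows "(norm (x + blinfun_apply X x))\<^sup>2 = (norm x)\<^sup>2 + (norm (blinfun_apply X x))\<^sup>2"
  using R.norm_add_sq [of x "blinfun_apply X x"] by (simp add: skew_r_self assms)

text \<open>As \<open>X x\<close> is orthogonal to \<open>x\<close>, the operator 1 + X does not
  decrease norms, so it is injective with closed range. A vector z orthogonal to the range is
  orthogonal to z + X z, hence to itself.\<close>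

lemma skew_resolvent_exists:
  assumes X: "skew X"
  shows "\<exists>R. (id_blinfun + X) o\<^sub>L R = id_blinfun \<and> R o\<^sub>L (id_blinfun + X) = id_blinfun \<and> norm R \<le> 1"
proof -
  let ?f = "blinfun_apply (id_blinfun + X)"
  have f: "?f x = x + blinfun_apply X x" for x by (simp add: blinfun.add_left)
  have ge: "norm x \<le> norm (?f x)" for x
    by (rule power2_le_imp_le) (simp_all add: f norm_add_skew [OF X])
  have bl: "bounded_linear ?f" by (rule blinfun.bounded_linear_right)
  have "complete (?f ` UNIV)"
    by (rule complete_isometric_image [where e = 1 and s = UNIV and f = ?f]) (simp_all only: zero_less_one subspace_UNIV bl mult_1 ge complete_UNIV, simp)
  then have cl: "closed (range ?f)" by (rule complete_imp_closed)
  have sub: "R.K_subspace (range ?f)"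
    unfolding R.K_subspace_def
  proof (intro conjI ballI)
    show "0 \<in> range ?f" by (rule range_eqI [of _ _ 0]) (simp add: blinfun.zero_right)
    fix x assume "x \<in> range ?f"
    then obtain u where u: "x = ?f u" by blast
    show "x + y \<in> range ?f" if "y \<in> range ?f" for y
    proof -
      obtain v where "y = ?f v" using \<open>y \<in> range ?f\<close> by blast
      then have "x + y = ?f (u + v)" by (simp only: u blinfun.add_right)
      then show ?thesis by blast
    qed
    show "Re c *\<^sub>R x \<in> range ?f" for c
      unfolding u by (rule range_eqI [of _ _ "Re c *\<^sub>R u"]) (simp only: blinfun.scaleR_right)
  qed
  have "z \<in> range ?f" for z
  proof -
    obtain y where y: "y \<in> range ?f" "\<And>v. v \<in> range ?f \<Longrightarrow> r (z - y) v = 0"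
      using R.projection_exists [OF sub cl, of z] by auto
    have "r (z - y) (?f (z - y)) = 0" by (rule y(2)) simp
    then have "r (z - y) (z - y) = 0" by (simp add: f r_simps skew_r_self [OF X])
    then have "z = y" by (simp add: r_self)
    with y(1) show ?thesis by simp
  qed
  then have ex: "\<exists>x. ?f x = z" for z by (blast intro: sym)
  define g where "g z = (SOME x. ?f x = z)" for z
  have g: "?f (g z) = z" for z unfolding g_def by (rule someI_ex [OF ex])
  have inj: "x = y" if "?f x = ?f y" for x y
    using ge [of "x - y"] that by (simp only: blinfun.diff_right) simp
  have gf: "g (?f x) = x" for x by (rule inj) (simp only: g)
  have ng: "norm (g z) \<le> norm z" for z using ge [of "g z"] by (simp only: g)
  have "bounded_linear g"
  proof (rule bounded_linear_intro [where K = 1])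
    show "g (x + y) = g x + g y" for x y by (rule inj) (simp only: blinfun.add_right g)
    show "g (c *\<^sub>R x) = c *\<^sub>R g x" for c x by (rule inj) (simp only: blinfun.scaleR_right g)
  qed (simp add: ng)
  then have ap: "blinfun_apply (Blinfun g) = g" by (rule bounded_linear_Blinfun_apply)
  show ?thesis
  proof (intro exI [of _ "Blinfun g"] conjI)
    show "(id_blinfun + X) o\<^sub>L Blinfun g = id_blinfun" by (rule blinfun_eqI) (simp add: ap g del: blinfun_apply_id_blinfun, simp add: g)
    show "Blinfun g o\<^sub>L (id_blinfun + X) = id_blinfun" by (rule blinfun_eqI) (simp only: blinfun_apply_blinfun_compose ap gf, simp)
    show "norm (Blinfun g) \<le> 1" by (rule norm_blinfun_bound) (simp_all add: ap ng)
  qed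
qed

definition resolvent :: "('b \<Rightarrow>\<^sub>L 'b) \<Rightarrow> ('b \<Rightarrow>\<^sub>L 'b)" where
  "resolvent X = (SOME R. (id_blinfun + X) o\<^sub>L R = id_blinfun \<and> R o\<^sub>L (id_blinfun + X) = id_blinfun \<and> norm R \<le> 1)"

lemma
  assumes "skew X"
  shows resolvent_right: "(id_blinfun + X) o\<^sub>L resolvent X = id_blinfun"
    and resolvent_left: "resolvent X o\<^sub>L (id_blinfun + X) = id_blinfun"
    and norm_resolvent_le: "norm (resolvent X) \<le> 1"
  using someI_ex [OF skew_resolvent_exists [OF assms]] unfolding resolvent_def by auto

text \<open>An affine image of the Cayley transform: (1 - X)(1 + X)^(-1) = 1 - 2
  \<open>cay X\<close>. Unlike the resolvent it is compact whenever \<open>X\<close> is, and it is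
  minus the Taylor remainder of degree 0 of the resolvent.\<close>

definition cay :: "('b \<Rightarrow>\<^sub>L 'b) \<Rightarrow> ('b \<Rightarrow>\<^sub>L 'b)" where
  "cay X = X o\<^sub>L resolvent X"

lemma resolvent_eq: "skew X \<Longrightarrow> resolvent X = id_blinfun - cay X"
  using resolvent_right [of X] by (simp add: cay_def blinfun_compose_simps algebra_simps)

lemma cay_eq: "skew X \<Longrightarrow> cay X = id_blinfun - resolvent X"
  by (simp add: resolvent_eq)

lemma resolvent_diff:
  assumes "skew X" "skew Y"
  shows "resolvent Y - resolvent X = - (resolvent Y o\<^sub>L ((Y - X) o\<^sub>L resolvent X))"
proof -
  have Y: "resolvent Y o\<^sub>L ((id_blinfun + Y) o\<^sub>L resolvent X) = resolvent X"
    by (simp only: blinfun_compose_assoc [symmetric] resolvent_left [OF assms(2)]) (simp add: blinfun_compose_simps)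
  have X: "resolvent Y o\<^sub>L ((id_blinfun + X) o\<^sub>L resolvent X) = resolvent Y"
    by (simp only: resolvent_right [OF assms(1)]) (simp add: blinfun_compose_simps)
  have "Y - X = (id_blinfun + Y) - (id_blinfun + X)" by simp
  then have "resolvent Y o\<^sub>L ((Y - X) o\<^sub>L resolvent X)
      = (resolvent Y o\<^sub>L ((id_blinfun + Y) o\<^sub>L resolvent X)) - (resolvent Y o\<^sub>L ((id_blinfun + X) o\<^sub>L resolvent X))"
    by (simp only: blinfun_compose_simps(3,4))
  then show ?thesis unfolding X Y by simp
qed

lemma cay_diff:
  assumes "skew X" "skew Y"
  shows "cay Y - cay X = resolvent Y o\<^sub>L ((Y - X) o\<^sub>L resolvent X)"
  using resolvent_diff [OF assms] assms by (simp add: cay_eq) (simp add: algebra_simps)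

lemma norm_cay_le:
  assumes X: "skew X"
  shows "norm (cay X) \<le> 1"
proof (rule norm_blinfun_bound)
  fix x
  let ?y = "blinfun_apply (resolvent X) x"
  have "blinfun_apply ((id_blinfun + X) o\<^sub>L resolvent X) x = x" by (simp add: resolvent_right [OF X])
  then have x: "x = ?y + blinfun_apply X ?y" by (simp add: blinfun.add_left)
  have "(norm (blinfun_apply X ?y))\<^sup>2 \<le> (norm (?y + blinfun_apply X ?y))\<^sup>2"
    unfolding norm_add_skew [OF X] by simp
  then have "(norm (blinfun_apply X ?y))\<^sup>2 \<le> (norm x)\<^sup>2" by (simp only: x [symmetric])
  then have "norm (blinfun_apply X ?y) \<le> norm x" by (rule power2_le_imp_le) simp
  then show "norm (blinfun_apply (cay X) x) \<le> 1 * norm x" by (simp add: cay_def)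
qed simp

lemma compact_map_cay: "compact_map X \<Longrightarrow> compact_map (cay X)"
  unfolding cay_def by (rule compact_map_compose_right)

lemma schatten_sandwich:
  assumes "schatten q C A" "skew X" "skew Y" "q > 0"
  shows "schatten q C (resolvent Y o\<^sub>L (A o\<^sub>L resolvent X))"
proof -
  have "schatten q (1 * (1 * C)) (resolvent Y o\<^sub>L (A o\<^sub>L resolvent X))"
    using assms by (intro schatten_compose_left schatten_compose_right norm_resolvent_le)
  then show ?thesis by simp
qed

text \<open>The span of \<open>e\<close> and \<open>X e\<close> is invariant, and \<open>X\<close>
  acts on it like multiplication by an imaginary number, so the resolvent can be written down
  explicitly.\<close>

lemma cay_scaled_eigenvector:
  assumes X: "skew X" and e: "blinfun_apply X e = w *\<^sub>R g"
    and ee: "blinfun_apply X (blinfun_apply X e) = - (w\<^sup>2 *\<^sub>R e)" and s: "s > 0"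
  shows "blinfun_apply (cay ((1 / s) *\<^sub>R X)) e
    = ((w / s)\<^sup>2 / (1 + (w / s)\<^sup>2)) *\<^sub>R e + ((w / s) / (1 + (w / s)\<^sup>2)) *\<^sub>R g"
proof -
  let ?Y = "(1 / s) *\<^sub>R X"
  let ?k = "1 + (w / s)\<^sup>2"
  have k: "?k \<noteq> 0" by (metis add_nonneg_eq_0_iff zero_le_one zero_le_power2 zero_neq_one)
  have Y: "skew ?Y" by (rule skew_scaleR [OF X])
  have Ye: "blinfun_apply ?Y e = (w / s) *\<^sub>R g" by (simp add: blinfun.scaleR_left e)
  have YYe: "blinfun_apply ?Y (blinfun_apply ?Y e) = - ((w / s)\<^sup>2 *\<^sub>R e)"
    by (simp add: blinfun.scaleR_left blinfun.scaleR_right ee power_divide power2_eq_square)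
  \<comment> \<open>(1 + Y)(1 - Y) = 1 - Y^2, which multiplies \<open>e\<close> by 1 +
    (w/s)^2.\<close>
  have "blinfun_apply (id_blinfun + ?Y) (e - blinfun_apply ?Y e) = ?k *\<^sub>R e"
    by (simp add: blinfun.add_left blinfun.diff_right YYe scaleR_add_left del: scaleR_blinfun.rep_eq)
  then have "blinfun_apply (resolvent ?Y) (?k *\<^sub>R e)
      = blinfun_apply (resolvent ?Y o\<^sub>L (id_blinfun + ?Y)) (e - blinfun_apply ?Y e)"
    by (simp only: blinfun_apply_blinfun_compose)
  then have "?k *\<^sub>R blinfun_apply (resolvent ?Y) e = e - blinfun_apply ?Y e"
    by (simp add: resolvent_left [OF Y] blinfun.scaleR_right del: scaleR_blinfun.rep_eq)
  then have Re: "blinfun_apply (resolvent ?Y) e = (1 / ?k) *\<^sub>R (e - blinfun_apply ?Y e)"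
    using k by (metis (no_types, lifting) divide_inverse mult_1 real_vector.scale_scale
        left_inverse scaleR_one)
  have "blinfun_apply (cay ?Y) e = (1 / ?k) *\<^sub>R (blinfun_apply ?Y e - blinfun_apply ?Y (blinfun_apply ?Y e))"
    unfolding cay_def blinfun_apply_blinfun_compose Re by (simp only: blinfun.scaleR_right blinfun.diff_right)
  then show ?thesis unfolding YYe unfolding Ye by (simp add: scaleR_add_right)
qed

end


section \<open>Dyadic sums\<close>

context real_hilbert
begin

text \<open>\<open>dyadic_bounded q \<alpha> C Z\<close> controls all signed sums of \<open>s\<^sup>\<alpha> Z s\<close> over dyadic sequences of
  \<open>s\<close>. It is preserved under products, by averaging over the signs, and it implies absolute
  convergence of the integral of \<open>s\<^sup>\<alpha> Z s\<close> with respect to \<open>ds/s\<close>.\<close>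

definition dyadic_bounded :: "real \<Rightarrow> real \<Rightarrow> real \<Rightarrow> (real \<Rightarrow> 'b \<Rightarrow>\<^sub>L 'b) \<Rightarrow> bool" where
  "dyadic_bounded q \<alpha> C Z \<longleftrightarrow> (\<forall>s>0. \<forall>J::int set. \<forall>\<sigma>. finite J \<longrightarrow> (\<forall>j. \<bar>\<sigma> j\<bar> = 1) \<longrightarrow>
     schatten q C (\<Sum>j\<in>J. (\<sigma> j * (s * 2 powr j) powr \<alpha>) *\<^sub>R Z (s * 2 powr j)))"

lemma dyadic_boundedI:
  assumes "\<And>s (J :: int set) \<sigma>. s > 0 \<Longrightarrow> finite J \<Longrightarrow> (\<And>j. \<bar>\<sigma> j\<bar> = 1) \<Longrightarrow>
     schatten q C (\<Sum>j\<in>J. (\<sigma> j * (s * 2 powr j) powr \<alpha>) *\<^sub>R Z (s * 2 powr j))"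
  shows "dyadic_bounded q \<alpha> C Z"
  using assms unfolding dyadic_bounded_def by blast

lemma dyadic_boundedD:
  assumes "dyadic_bounded q \<alpha> C Z" "s > 0" "finite J" "\<And>j. \<bar>\<sigma> j\<bar> = 1"
  shows "schatten q C (\<Sum>j\<in>J. (\<sigma> j * (s * 2 powr real_of_int j) powr \<alpha>) *\<^sub>R Z (s * 2 powr real_of_int j))"
  using assms unfolding dyadic_bounded_def by blast

lemma dyadic_bounded_nonneg: "dyadic_bounded q \<alpha> C Z \<Longrightarrow> 0 \<le> C"
  using dyadic_boundedD [of q \<alpha> C Z 1 "{}" "\<lambda>_. 1"] schatten_nonneg by force

lemma dyadic_bounded_mono:
  assumes "dyadic_bounded q \<alpha> C Z" "C \<le> D" "q > 0"
  shows "dyadic_bounded q \<alpha> D Z"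
  by (intro dyadic_boundedI schatten_mono [OF dyadic_boundedD [OF assms(1)] assms(2,3)])

lemma dyadic_bounded_add:
  assumes "dyadic_bounded q \<alpha> C Y" "dyadic_bounded q \<alpha> D Z" "q \<ge> 1"
  shows "dyadic_bounded q \<alpha> (C + D) (\<lambda>s. Y s + Z s)"
proof (rule dyadic_boundedI)
  fix s :: real and J :: "int set" and \<sigma> :: "int \<Rightarrow> real"
  assume a: "s > 0" "finite J" "\<And>j. \<bar>\<sigma> j\<bar> = 1"
  show "schatten q (C + D) (\<Sum>j\<in>J. (\<sigma> j * (s * 2 powr j) powr \<alpha>) *\<^sub>R (Y (s * 2 powr j) + Z (s * 2 powr j)))"
    unfolding scaleR_add_right sum.distrib
    by (intro schatten_add dyadic_boundedD assms a)
qed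

lemma dyadic_bounded_minus:
  assumes "dyadic_bounded q \<alpha> C Z"
  shows "dyadic_bounded q \<alpha> C (\<lambda>s. - Z s)"
proof (rule dyadic_boundedI)
  fix s :: real and J :: "int set" and \<sigma> :: "int \<Rightarrow> real"
  assume a: "s > 0" "finite J" "\<And>j. \<bar>\<sigma> j\<bar> = 1"
  show "schatten q C (\<Sum>j\<in>J. (\<sigma> j * (s * 2 powr j) powr \<alpha>) *\<^sub>R - Z (s * 2 powr j))"
    unfolding scaleR_minus_right sum_negf
    by (intro schatten_minus dyadic_boundedD assms a)
qed

lemma dyadic_bounded_diff:
  assumes "dyadic_bounded q \<alpha> C Y" "dyadic_bounded q \<alpha> D Z" "q \<ge> 1"
  shows "dyadic_bounded q \<alpha> (C + D) (\<lambda>s. Y s - Z s)"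
  using dyadic_bounded_add [OF assms(1) dyadic_bounded_minus [OF assms(2)] assms(3)] by simp

lemma dyadic_bounded_const_left:
  assumes A: "schatten q1 C A" and Z: "dyadic_bounded q2 \<alpha> D Z"
    and q: "q1 > 0" "q2 > 0" "1 / q1 + 1 / q2 = 1 / q" "q \<ge> 1"
  shows "dyadic_bounded q \<alpha> (C * D) (\<lambda>s. A o\<^sub>L Z s)"
proof (rule dyadic_boundedI)
  fix s :: real and J :: "int set" and \<sigma> :: "int \<Rightarrow> real"
  assume a: "s > 0" "finite J" "\<And>j. \<bar>\<sigma> j\<bar> = 1"
  show "schatten q (C * D) (\<Sum>j\<in>J. (\<sigma> j * (s * 2 powr j) powr \<alpha>) *\<^sub>R (A o\<^sub>L Z (s * 2 powr j)))"
    unfolding blinfun_compose_simps(7) [symmetric] blinfun_compose_sum_right [symmetric]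
    by (rule schatten_holder [OF A dyadic_boundedD [OF Z a] q])
qed

lemma dyadic_bounded_const_right:
  assumes Z: "dyadic_bounded q1 \<alpha> C Z" and A: "schatten q2 D A"
    and q: "q1 > 0" "q2 > 0" "1 / q1 + 1 / q2 = 1 / q" "q \<ge> 1"
  shows "dyadic_bounded q \<alpha> (C * D) (\<lambda>s. Z s o\<^sub>L A)"
proof (rule dyadic_boundedI)
  fix s :: real and J :: "int set" and \<sigma> :: "int \<Rightarrow> real"
  assume a: "s > 0" "finite J" "\<And>j. \<bar>\<sigma> j\<bar> = 1"
  show "schatten q (C * D) (\<Sum>j\<in>J. (\<sigma> j * (s * 2 powr j) powr \<alpha>) *\<^sub>R (Z (s * 2 powr j) o\<^sub>L A))"
    unfolding blinfun_compose_simps(8) [symmetric] blinfun_compose_sum_left [symmetric]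
    by (rule schatten_holder [OF dyadic_boundedD [OF Z a] A q])
qed

lemma dyadic_bounded_scaled_left:
  assumes A: "schatten q1 C A" and Z: "dyadic_bounded q2 \<alpha> D Z"
    and q: "q1 > 0" "q2 > 0" "1 / q1 + 1 / q2 = 1 / q" "q \<ge> 1"
  shows "dyadic_bounded q (\<alpha> + 1) (C * D) (\<lambda>s. ((1 / s) *\<^sub>R A) o\<^sub>L Z s)"
proof (rule dyadic_boundedI)
  fix s :: real and J :: "int set" and \<sigma> :: "int \<Rightarrow> real"
  assume a: "s > 0" "finite J" "\<And>j. \<bar>\<sigma> j\<bar> = 1"
  have "(\<sigma> j * (s * 2 powr j) powr (\<alpha> + 1)) *\<^sub>R (((1 / (s * 2 powr j)) *\<^sub>R A) o\<^sub>L Z (s * 2 powr j))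
      = (\<sigma> j * (s * 2 powr j) powr \<alpha>) *\<^sub>R (A o\<^sub>L Z (s * 2 powr j))" for j
    using a(1) by (simp add: blinfun_compose_simps powr_add)
  then show "schatten q (C * D) (\<Sum>j\<in>J. (\<sigma> j * (s * 2 powr j) powr (\<alpha> + 1)) *\<^sub>R
      (((1 / (s * 2 powr j)) *\<^sub>R A) o\<^sub>L Z (s * 2 powr j)))"
    using dyadic_boundedD [OF dyadic_bounded_const_left [OF A Z q] a] by simp
qed

text \<open>Averaging over independent signs removes the mixed products of x i and y j and keeps the
  diagonal ones. The induction averages over one sign at a time; \<open>A\<close> and
  \<open>B\<close> are general because they absorb the terms whose sign has already been
  fixed.\<close>

lemma schatten_sign_average:
  fixes x y :: "'i \<Rightarrow> 'b \<Rightarrow>\<^sub>L 'b"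
  assumes "finite J" "q \<ge> 1"
    and "\<And>\<epsilon>. (\<And>j. \<bar>\<epsilon> j\<bar> = (1::real)) \<Longrightarrow>
      schatten q K ((A + (\<Sum>j\<in>J. \<epsilon> j *\<^sub>R x j)) o\<^sub>L (B + (\<Sum>j\<in>J. \<epsilon> j *\<^sub>R y j)))"
  shows "schatten q K ((A o\<^sub>L B) + (\<Sum>j\<in>J. x j o\<^sub>L y j))"
  using assms(1,3)
proof (induction J arbitrary: A B rule: finite_induct)
  case empty
  from empty(1)[of "\<lambda>_. 1"] show ?case by simp
next
  case (insert i J)
  have step: "schatten q K (((A + c *\<^sub>R x i) o\<^sub>L (B + c *\<^sub>R y i)) + (\<Sum>j\<in>J. x j o\<^sub>L y j))" if c: "\<bar>c\<bar> = 1" for c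
  proof (rule insert.IH)
    fix \<epsilon> :: "'i \<Rightarrow> real" assume \<epsilon>: "\<And>j. \<bar>\<epsilon> j\<bar> = 1"
    have eq: "(\<Sum>j\<in>J. (\<epsilon>(i := c)) j *\<^sub>R z j) = (\<Sum>j\<in>J. \<epsilon> j *\<^sub>R z j)" for z :: "'i \<Rightarrow> 'b \<Rightarrow>\<^sub>L 'b"
      using insert.hyps by (intro sum.cong) auto
    have "schatten q K ((A + (\<Sum>j\<in>insert i J. (\<epsilon>(i := c)) j *\<^sub>R x j)) o\<^sub>L (B + (\<Sum>j\<in>insert i J. (\<epsilon>(i := c)) j *\<^sub>R y j)))"
      by (rule insert.prems) (simp add: \<epsilon> c)
    then show "schatten q K ((A + c *\<^sub>R x i + (\<Sum>j\<in>J. \<epsilon> j *\<^sub>R x j)) o\<^sub>L (B + c *\<^sub>R y i + (\<Sum>j\<in>J. \<epsilon> j *\<^sub>R y j)))"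
      by (simp only: sum.insert [OF insert.hyps] eq fun_upd_same add.assoc)
  qed
  let ?S = "\<Sum>j\<in>J. x j o\<^sub>L y j"
  have "schatten q (\<bar>1/2\<bar> * (K + K)) ((1/2) *\<^sub>R ((((A + 1 *\<^sub>R x i) o\<^sub>L (B + 1 *\<^sub>R y i)) + ?S)
      + (((A + (-1) *\<^sub>R x i) o\<^sub>L (B + (-1) *\<^sub>R y i)) + ?S)))"
    by (intro schatten_scaleR schatten_add step assms) auto
  moreover have "(((A + 1 *\<^sub>R x i) o\<^sub>L (B + 1 *\<^sub>R y i)) + ?S) + (((A + (-1) *\<^sub>R x i) o\<^sub>L (B + (-1) *\<^sub>R y i)) + ?S)
      = 2 *\<^sub>R ((A o\<^sub>L B) + ((x i o\<^sub>L y i) + ?S))"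
    by (simp add: blinfun_compose_simps scaleR_2)
  ultimately show ?case using insert.hyps by simp
qed

text \<open>The given signs \<sigma> are put on the first factor, and random signs \<epsilon> on
  both. Hoelder's inequality bounds the product of the two signed sums for every \<epsilon>, and the
  average over \<epsilon> is the signed sum of the products. The constants simply multiply.\<close>

lemma dyadic_bounded_compose:
  assumes Y: "dyadic_bounded q1 \<alpha> C Y" and Z: "dyadic_bounded q2 \<beta> D Z"
    and q: "q1 > 0" "q2 > 0" "1 / q1 + 1 / q2 = 1 / q" "q \<ge> 1"
  shows "dyadic_bounded q (\<alpha> + \<beta>) (C * D) (\<lambda>s. Y s o\<^sub>L Z s)"
proof (rule dyadic_boundedI)
  fix s :: real and J :: "int set" and \<sigma> :: "int \<Rightarrow> real"
  assume a: "s > 0" "finite J" "\<And>j. \<bar>\<sigma> j\<bar> = 1"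
  let ?y = "\<lambda>j. (\<sigma> j * (s * 2 powr real_of_int j) powr \<alpha>) *\<^sub>R Y (s * 2 powr real_of_int j)"
  let ?z = "\<lambda>j. ((s * 2 powr real_of_int j) powr \<beta>) *\<^sub>R Z (s * 2 powr real_of_int j)"
  have "schatten q (C * D) ((0 o\<^sub>L (0 :: 'b \<Rightarrow>\<^sub>L 'b)) + (\<Sum>j\<in>J. ?y j o\<^sub>L ?z j))"
  proof (rule schatten_sign_average [where x = ?y and y = ?z, OF a(2) q(4)])
    fix \<epsilon> :: "int \<Rightarrow> real" assume \<epsilon>: "\<And>j. \<bar>\<epsilon> j\<bar> = 1"
    have "schatten q1 C (\<Sum>j\<in>J. ((\<epsilon> j * \<sigma> j) * (s * 2 powr real_of_int j) powr \<alpha>) *\<^sub>R Y (s * 2 powr real_of_int j))"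
      by (rule dyadic_boundedD [OF Y a(1,2)]) (simp add: abs_mult \<epsilon> a(3))
    moreover have "schatten q2 D (\<Sum>j\<in>J. (\<epsilon> j * (s * 2 powr real_of_int j) powr \<beta>) *\<^sub>R Z (s * 2 powr real_of_int j))"
      by (rule dyadic_boundedD [OF Z a(1,2) \<epsilon>])
    ultimately have "schatten q (C * D) ((\<Sum>j\<in>J. ((\<epsilon> j * \<sigma> j) * (s * 2 powr real_of_int j) powr \<alpha>) *\<^sub>R Y (s * 2 powr real_of_int j))
        o\<^sub>L (\<Sum>j\<in>J. (\<epsilon> j * (s * 2 powr real_of_int j) powr \<beta>) *\<^sub>R Z (s * 2 powr real_of_int j)))"
      by (rule schatten_holder [OF _ _ q])
    then show "schatten q (C * D) ((0 + (\<Sum>j\<in>J. \<epsilon> j *\<^sub>R ?y j)) o\<^sub>L (0 + (\<Sum>j\<in>J. \<epsilon> j *\<^sub>R ?z j)))"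
      by (simp add: mult.assoc)
  qed
  moreover have "?y j o\<^sub>L ?z j = (\<sigma> j * (s * 2 powr j) powr (\<alpha> + \<beta>)) *\<^sub>R (Y (s * 2 powr j) o\<^sub>L Z (s * 2 powr j))" for j
    by (simp add: blinfun_compose_simps powr_add mult_ac)
  ultimately show "schatten q (C * D) (\<Sum>j\<in>J. (\<sigma> j * (s * 2 powr j) powr (\<alpha> + \<beta>)) *\<^sub>R (Y (s * 2 powr j) o\<^sub>L Z (s * 2 powr j)))"
    by (simp only: blinfun_compose_simps(12) add_0)
qed

section \<open>Dyadic bounds for the Cayley transform and its increments\<close>

lemma dyadic_bounded_single:
  assumes "dyadic_bounded q \<alpha> C Z" "s > 0"
  shows "schatten q (s powr (- \<alpha>) * C) (Z s)"
proof -
  have "schatten q C (s powr \<alpha> *\<^sub>R Z s)"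
    using dyadic_boundedD [OF assms, of "{0}" "\<lambda>_. 1"] by simp
  from schatten_scaleR [OF this, of "s powr (- \<alpha>)"] show ?thesis
    using assms(2) by (simp add: powr_add [symmetric])
qed

text \<open>For families whose norms at the single scales are already summable. For
  \<open>cay\<close> itself they need not be, but for the corrected increment \<open>W\<close> in
  \<open>dyadic_bounded_cay_diff\<close> they are.\<close>

lemma dyadic_bounded_of_pointwise:
  assumes Z: "\<And>s. s > 0 \<Longrightarrow> schatten q (d s) (Z s)" and q: "q \<ge> 1"
    and le: "\<And>s (J :: int set). s > 0 \<Longrightarrow> finite J \<Longrightarrow> (\<Sum>j\<in>J. (s * 2 powr j) powr \<alpha> * d (s * 2 powr j)) \<le> C"
  shows "dyadic_bounded q \<alpha> C Z"
proof (rule dyadic_boundedI)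
  fix s :: real and J :: "int set" and \<sigma> :: "int \<Rightarrow> real"
  assume a: "s > 0" "finite J" "\<And>j. \<bar>\<sigma> j\<bar> = 1"
  have "schatten q (\<Sum>j\<in>J. \<bar>\<sigma> j * (s * 2 powr j) powr \<alpha>\<bar> * d (s * 2 powr j))
      (\<Sum>j\<in>J. (\<sigma> j * (s * 2 powr j) powr \<alpha>) *\<^sub>R Z (s * 2 powr j))"
    using a by (intro schatten_sum schatten_scaleR Z q) auto
  then have "schatten q (\<Sum>j\<in>J. (s * 2 powr j) powr \<alpha> * d (s * 2 powr j))
      (\<Sum>j\<in>J. (\<sigma> j * (s * 2 powr j) powr \<alpha>) *\<^sub>R Z (s * 2 powr j))"
    by (simp add: abs_mult a(3))
  then show "schatten q C (\<Sum>j\<in>J. (\<sigma> j * (s * 2 powr j) powr \<alpha>) *\<^sub>R Z (s * 2 powr j))"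
    by (rule schatten_mono [OF _ le [OF a(1,2)]]) (use q in auto)
qed

text \<open>On a singular vector \<open>e\<close> every signed sum acts through two scalar sums over
  the scales, \<open>u e\<close> along \<open>e\<close> and \<open>v e\<close> along
  \<open>g e\<close>. Each is at most \<open>dyadic_const \<alpha> * w e powr \<alpha>\<close> by
  \<open>dyadic_sum_min\<close>, and the w^\<alpha> have summable powers of exponent p/\<alpha>. The
  factor 2 stems from the two components.\<close>

lemma dyadic_bounded_cay:
  assumes X: "skew X" and C: "schatten p C X" and p: "p \<ge> 1" and \<alpha>: "0 < \<alpha>" "\<alpha> < 1"
  shows "dyadic_bounded (p / \<alpha>) \<alpha> (2 * dyadic_const \<alpha> * C powr \<alpha>) (\<lambda>s. cay ((1 / s) *\<^sub>R X))"
proof (rule dyadic_boundedI)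
  fix s :: real and J :: "int set" and \<sigma> :: "int \<Rightarrow> real"
  assume s: "s > 0" and J: "finite J" and \<sigma>: "\<And>j. \<bar>\<sigma> j\<bar> = 1"
  let ?t = "\<lambda>j. s * 2 powr real_of_int j"
  let ?K = "dyadic_const \<alpha>"
  have t: "?t j > 0" for j using s by simp
  obtain B w g where B: "onb B" and w: "\<And>e. w e \<ge> (0::real)"
    and Xe: "\<And>e. e \<in> B \<Longrightarrow> blinfun_apply X e = w e *\<^sub>R g e"
    and XX: "\<And>e. e \<in> B \<Longrightarrow> blinfun_apply (radj X) (blinfun_apply X e) = (w e)\<^sup>2 *\<^sub>R e"
    and g: "\<And>F. finite F \<Longrightarrow> F \<subseteq> B \<Longrightarrow> bessel_on F g"
    and n: "\<And>e. e \<in> B \<Longrightarrow> w e \<noteq> 0 \<Longrightarrow> norm (g e) = 1"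
    by (rule svd [OF schatten_compact [OF C]]) (rule that)
  define u where "u e = (\<Sum>j\<in>J. \<sigma> j * ?t j powr \<alpha> * ((w e / ?t j)\<^sup>2 / (1 + (w e / ?t j)\<^sup>2)))" for e
  define v where "v e = (\<Sum>j\<in>J. \<sigma> j * ?t j powr \<alpha> * ((w e / ?t j) / (1 + (w e / ?t j)\<^sup>2)))" for e
  let ?Y = "\<Sum>j\<in>J. (\<sigma> j * ?t j powr \<alpha>) *\<^sub>R cay ((1 / ?t j) *\<^sub>R X)"
  have Ye: "blinfun_apply ?Y e = u e *\<^sub>R e + v e *\<^sub>R g e" if e: "e \<in> B" for e
  proof -
    have "blinfun_apply X (blinfun_apply X e) = - ((w e)\<^sup>2 *\<^sub>R e)"
      using XX [OF e] by (simp add: skew_adjoint [OF X] blinfun.minus_left) (metis minus_minus)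
    note * = cay_scaled_eigenvector [OF X Xe [OF e] this t]
    show ?thesis
      unfolding blinfun.sum_left blinfun.scaleR_left * u_def v_def scaleR_sum_left sum.distrib [symmetric]
      by (intro sum.cong) (simp_all add: scaleR_add_right)
  qed
  have bound: "\<bar>\<Sum>j\<in>J. \<sigma> j * ?t j powr \<alpha> * f (w e / ?t j)\<bar> \<le> ?K * w e powr \<alpha>"
    if f: "\<And>x. x \<ge> 0 \<Longrightarrow> 0 \<le> f x \<and> f x \<le> min 1 x" for f e
  proof -
    have "\<bar>\<Sum>j\<in>J. \<sigma> j * ?t j powr \<alpha> * f (w e / ?t j)\<bar> \<le> (\<Sum>j\<in>J. \<bar>\<sigma> j * ?t j powr \<alpha> * f (w e / ?t j)\<bar>)"
      by (rule sum_abs)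
    also have "\<dots> \<le> (\<Sum>j\<in>J. ?t j powr \<alpha> * min 1 (w e / ?t j))"
    proof (rule sum_mono)
      fix j
      have "0 \<le> w e / ?t j" using w t [of j] by (intro divide_nonneg_nonneg) auto
      from f [OF this] show "\<bar>\<sigma> j * ?t j powr \<alpha> * f (w e / ?t j)\<bar> \<le> ?t j powr \<alpha> * min 1 (w e / ?t j)"
        by (simp add: abs_mult \<sigma> mult_left_mono)
    qed
    also have "\<dots> \<le> ?K * w e powr \<alpha>" by (rule dyadic_sum_min [OF J s \<alpha> w])
    finally show ?thesis .
  qed
  have f1: "0 \<le> x\<^sup>2 / (1 + x\<^sup>2) \<and> x\<^sup>2 / (1 + x\<^sup>2) \<le> min 1 x" and f2: "0 \<le> x / (1 + x\<^sup>2) \<and> x / (1 + x\<^sup>2) \<le> min 1 x"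
    if x: "x \<ge> 0" for x :: real
  proof -
    have pos: "1 + x\<^sup>2 > 0" by (simp add: add_pos_nonneg)
    have "2 * x \<le> 1 + x\<^sup>2" using zero_le_power2 [of "x - 1"] by (simp add: power2_eq_square algebra_simps)
    then have le: "x \<le> 1 + x\<^sup>2" using x by simp
    have "x\<^sup>2 \<le> x * (1 + x\<^sup>2)" using mult_left_mono [OF le x] by (simp add: power2_eq_square)
    then show "0 \<le> x\<^sup>2 / (1 + x\<^sup>2) \<and> x\<^sup>2 / (1 + x\<^sup>2) \<le> min 1 x" using pos by (simp add: divide_le_eq)
    have "x \<le> x * (1 + x\<^sup>2)" using x by (simp add: mult_left_le algebra_simps)
    then show "0 \<le> x / (1 + x\<^sup>2) \<and> x / (1 + x\<^sup>2) \<le> min 1 x" using pos le x by (simp add: divide_le_eq)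
  qed
  have u: "\<bar>u e\<bar> \<le> ?K * w e powr \<alpha>" and v: "\<bar>v e\<bar> \<le> ?K * w e powr \<alpha>" for e
    unfolding u_def v_def using bound [of "\<lambda>x. x\<^sup>2 / (1 + x\<^sup>2)" e, OF f1] bound [of "\<lambda>x. x / (1 + x\<^sup>2)" e, OF f2]
    by blast+
  have K: "?K \<ge> 0" using dyadic_const_pos [OF \<alpha>] by simp
  have C0: "C \<ge> 0" by (rule schatten_nonneg [OF C])
  have pow: "(?K * x powr \<alpha>) powr (p / \<alpha>) = ?K powr (p / \<alpha>) * x powr p" for x
    using \<alpha> by (simp add: powr_mult powr_powr)
  have sum: "(\<Sum>e\<in>F. \<bar>h e\<bar> powr (p / \<alpha>)) \<le> (?K * C powr \<alpha>) powr (p / \<alpha>)"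
    if h: "\<And>e. \<bar>h e\<bar> \<le> ?K * w e powr \<alpha>" and F: "finite F" "F \<subseteq> B" for h F
  proof -
    have "(\<Sum>e\<in>F. \<bar>h e\<bar> powr (p / \<alpha>)) \<le> (\<Sum>e\<in>F. (?K * w e powr \<alpha>) powr (p / \<alpha>))"
      using h \<alpha> p by (intro sum_mono powr_mono2) auto
    also have "\<dots> = ?K powr (p / \<alpha>) * (\<Sum>e\<in>F. w e powr p)" by (simp add: pow sum_distrib_left)
    also have "\<dots> \<le> ?K powr (p / \<alpha>) * C powr p"
      by (intro mult_left_mono schatten_singular_values [OF C B w Xe g n F]) auto
    also have "\<dots> = (?K * C powr \<alpha>) powr (p / \<alpha>)" by (simp add: pow)
    finally show ?thesis .
  qed
  have "schatten (p / \<alpha>) (?K * C powr \<alpha> + ?K * C powr \<alpha>) ?Y"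
  proof (rule schatten_of_two_diagonals [OF _ B Ye bessel_on_onb [OF B] g sum [OF u] sum [OF v]])
    show "compact_map ?Y"
      by (intro compact_map_sum compact_map_scaleR compact_map_cay schatten_compact [OF C])
    have "1 * \<alpha> \<le> p" using p \<alpha> by linarith
    then show "1 \<le> p / \<alpha>" using \<alpha> by (subst pos_le_divide_eq) auto
  qed (use K in auto)
  moreover have "?K * C powr \<alpha> + ?K * C powr \<alpha> = 2 * ?K * C powr \<alpha>" by simp
  ultimately show "schatten (p / \<alpha>) (2 * ?K * C powr \<alpha>) ?Y" by (simp only:)
qed

text \<open>Cut off at the finitely many singular vectors that carry all but a small part of the sum
  of the w^p. The projection onto their span is applied on both sides; X - G is then a combination
  of the one-sided tail \<open>T\<close> and its adjoint.\<close>

lemma schatten_finite_rank_approximation: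
  assumes X: "skew X" and C: "schatten p C X" and p: "p \<ge> 1" and \<epsilon>: "\<epsilon> > 0"
  obtains G D where "skew G" "schatten 1 D G" "schatten p \<epsilon> (X - G)"
proof -
  obtain B w g where B: "onb B" and w: "\<And>e. w e \<ge> (0::real)"
    and Xe: "\<And>e. e \<in> B \<Longrightarrow> blinfun_apply X e = w e *\<^sub>R g e"
    and g: "\<And>F. finite F \<Longrightarrow> F \<subseteq> B \<Longrightarrow> bessel_on F g"
    and n: "\<And>e. e \<in> B \<Longrightarrow> w e \<noteq> 0 \<Longrightarrow> norm (g e) = 1"
    by (rule svd [OF schatten_compact [OF C]]) (rule that)
  \<comment> \<open>Two partial sums within \<eta> of the total differ by less than 2\<eta> =
    (\<epsilon>/2)^p, and X - G is made of two tails of norm at most \<epsilon>/2.\<close>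
  define \<eta> where "\<eta> = (\<epsilon> / 2) powr p / 2"
  have \<eta>: "\<eta> > 0" using \<epsilon> by (simp add: \<eta>_def)
  have "(\<lambda>e. w e powr p) summable_on B"
    by (rule nonneg_bdd_above_summable_on)
      (use schatten_singular_values [OF C B w Xe g n] in \<open>auto intro!: bdd_aboveI2\<close>)
  then have "((\<lambda>e. w e powr p) has_sum infsum (\<lambda>e. w e powr p) B) B" by simp
  then obtain F0 where F0: "finite F0" "F0 \<subseteq> B"
    and close: "\<And>F. finite F \<Longrightarrow> F0 \<subseteq> F \<Longrightarrow> F \<subseteq> B \<Longrightarrow> dist (\<Sum>e\<in>F. w e powr p) (infsum (\<lambda>e. w e powr p) B) < \<eta>"
    using \<eta> unfolding has_sum_dist_iff by meson
  have tail: "(\<Sum>e\<in>F. w e powr p) \<le> (\<epsilon> / 2) powr p" if F: "finite F" "F \<subseteq> B - F0" for F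
  proof -
    have "(\<Sum>e\<in>F0 \<union> F. w e powr p) = (\<Sum>e\<in>F0. w e powr p) + (\<Sum>e\<in>F. w e powr p)"
      using F F0 by (intro sum.union_disjoint) auto
    moreover have "F0 \<union> F \<subseteq> B" "finite (F0 \<union> F)" using F F0 by auto
    ultimately have "(\<Sum>e\<in>F. w e powr p) < 2 * \<eta>"
      using close [OF F0(1) order_refl F0(2)] close [of "F0 \<union> F"] unfolding dist_real_def by fastforce
    then show ?thesis by (simp add: \<eta>_def)
  qed
  define P where "P = rank_sum F0 (\<lambda>_. 1) (\<lambda>e. e) (\<lambda>e. e)"
  have bF0: "bessel_on F0 (\<lambda>e. e)" by (rule bessel_on_onb [OF B F0])
  have P1: "norm P \<le> 1" unfolding P_def by (rule norm_rank_sum_le [OF F0(1) bF0 bF0]) simp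
  have Psym: "r (blinfun_apply P x) y = r x (blinfun_apply P y)" for x y
    by (simp add: P_def rank_sum_apply r_sum_left r_sum_right r_simps r_commute mult.commute)
  have Padj: "radj P = P" by (rule adjoint_eqI) (rule Psym)
  have Pe: "blinfun_apply P e = (if e \<in> F0 then e else 0)" if e: "e \<in> B" for e
  proof -
    have "blinfun_apply P e = (\<Sum>f\<in>F0. if f = e then e else 0)"
      unfolding P_def rank_sum_apply
    proof (rule sum.cong)
      fix f assume "f \<in> F0"
      then have "r f e = (if f = e then 1 else 0)"
        using R.orthonormal_ip [OF R.orthonormal_basis_set [OF B], of f e] F0 e by (auto split: if_splits)
      then show "(1 * r f e) *\<^sub>R f = (if f = e then e else 0)" by simp
    qed simp
    then show ?thesis using F0(1) by simp
  qed
  define T where "T = X - (X o\<^sub>L P)"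
  have T: "schatten p (\<epsilon> / 2) T"
  proof (rule schatten_of_diagonal [OF _ B _ g, where w = "\<lambda>e. if e \<in> F0 then 0 else w e"])
    show "compact_map T"
      using compact_map_add [OF schatten_compact [OF C] compact_map_scaleR [of "X o\<^sub>L P" "-1"]]
      by (simp add: T_def compact_map_compose_right schatten_compact [OF C])
    show "blinfun_apply T e = (if e \<in> F0 then 0 else w e) *\<^sub>R g e" if "e \<in> B" for e
      using that by (simp add: T_def blinfun.diff_left Pe Xe blinfun.zero_right)
    show "(\<Sum>e\<in>F. \<bar>if e \<in> F0 then 0 else w e\<bar> powr p) \<le> (\<epsilon> / 2) powr p" if F: "finite F" "F \<subseteq> B" for F
    proof -
      have "(\<Sum>e\<in>F. \<bar>if e \<in> F0 then 0 else w e\<bar> powr p) = (\<Sum>e\<in>F - F0. w e powr p)"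
        using F w by (intro sum.mono_neutral_cong_right) auto
      also have "\<dots> \<le> (\<epsilon> / 2) powr p" using F by (intro tail) auto
      finally show ?thesis .
    qed
  qed (use p \<epsilon> in auto)
  have radj_T: "radj T = (P o\<^sub>L X) - X"
    by (rule adjoint_eqI)
      (simp add: T_def blinfun.diff_left r_simps skew_r [OF X] Psym [symmetric])
  \<comment> \<open>Compression from both sides keeps the operator skew; the one-sided product X P
    is in general not skew.\<close>
  define G where "G = P o\<^sub>L (X o\<^sub>L P)"
  have "X - G = T - (radj T o\<^sub>L P)" 
    unfolding radj_T unfolding G_def T_def by (simp add: blinfun_compose_simps)
  moreover have "schatten p (\<epsilon> / 2 + 1 * (\<epsilon> / 2)) (T - (radj T o\<^sub>L P))"
    using p by (intro schatten_diff schatten_compose_right schatten_adjoint T P1) auto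
  ultimately have 1: "schatten p \<epsilon> (X - G)" by simp
  have 2: "skew G" unfolding skew_def G_def by (simp add: Psym skew_r [OF X])
  have "schatten 1 ((\<Sum>e\<in>F0. \<bar>1\<bar> powr 1) powr (1 / 1)) P"
    unfolding P_def by (rule schatten_rank_sum [OF F0(1) bF0 bF0]) simp
  then have "schatten 1 (norm (X o\<^sub>L P) * (\<Sum>e\<in>F0. \<bar>1\<bar> powr 1) powr (1 / 1)) G"
    unfolding G_def by (rule schatten_compose_right) auto
  with 1 2 that show ?thesis by blast
qed

text \<open>With \<open>X = G + E\<close>, \<open>X' = G + E'\<close>, \<open>G\<close> of finite rank and \<open>E\<close>, \<open>E'\<close> small: the terms
  \<open>cay (X'/s) - cay (E'/s)\<close> are of trace class, which controls small \<open>s\<close>, and for large \<open>s\<close> one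
  compares \<open>X'\<close> with \<open>X\<close> directly.\<close>

theorem dyadic_bounded_cay_diff:
  assumes X: "skew X" and C: "schatten p C X" and p: "p > 1" and \<alpha>: "0 < \<alpha>" "\<alpha> < 1" and \<epsilon>: "\<epsilon> > 0"
  obtains \<delta> where "\<delta> > 0"
    "\<And>X'. skew X' \<Longrightarrow> schatten p \<delta> (X' - X) \<Longrightarrow>
       dyadic_bounded (p / \<alpha>) \<alpha> \<epsilon> (\<lambda>s. cay ((1 / s) *\<^sub>R X') - cay ((1 / s) *\<^sub>R X))"
proof -
  define q where "q = p / \<alpha>"
  have q: "q > 1" "q \<ge> p" "1 / q = \<alpha> / p"
  proof -
    have "1 * \<alpha> < p" using p \<alpha> by linarith
    then show "q > 1" unfolding q_def using \<alpha> by (subst pos_less_divide_eq) auto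
    show "q \<ge> p" unfolding q_def using \<alpha> p by (subst pos_le_divide_eq) auto
  qed (simp add: q_def)
  let ?K = "dyadic_const \<alpha>"
  have K: "?K > 0" by (rule dyadic_const_pos [OF \<alpha>])
  \<comment> \<open>Chosen so that \<open>dyadic_bounded_cay\<close> gives the bound \<epsilon>/4
    for an operator of Schatten norm 2 * \<epsilon>1, which covers both \<open>E\<close> and its
    perturbation \<open>E'\<close>.\<close>
  define \<epsilon>1 where "\<epsilon>1 = (\<epsilon> / (8 * ?K)) powr (1 / \<alpha>) / 2"
  have e1: "\<epsilon>1 > 0" using \<epsilon> K by (simp add: \<epsilon>1_def)
  have "2 * \<epsilon>1 = (\<epsilon> / (8 * ?K)) powr (1 / \<alpha>)" by (simp add: \<epsilon>1_def)
  then have "(2 * \<epsilon>1) powr \<alpha> = \<epsilon> / (8 * ?K)" using \<alpha> \<epsilon> K by (simp add: powr_powr)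
  then have e1K: "2 * ?K * (2 * \<epsilon>1) powr \<alpha> = \<epsilon> / 4" using K by simp
  obtain G D where G: "skew G" "schatten 1 D G" "schatten p \<epsilon>1 (X - G)"
    using p by (auto intro: schatten_finite_rank_approximation [OF X C _ e1])
  have D: "D \<ge> 0" by (rule schatten_nonneg [OF G(2)])
  define E where "E = X - G"
  have E: "skew E" "schatten p (2 * \<epsilon>1) E"
    unfolding E_def by (rule skew_diff [OF X G(1)]) (rule schatten_mono [OF G(3)], use e1 p in auto)
  \<comment> \<open>For small s the terms are of size s^(-1/q), so with the weight s^\<alpha> they
    sum like s^\<beta>. As 1/q = \<alpha>/p, positivity of \<beta> is where p > 1 enters.\<close>
  define \<beta> where "\<beta> = \<alpha> - 1 / q"
  have \<beta>: "\<beta> > 0"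
  proof -
    have "\<alpha> / p < \<alpha> / 1" using \<alpha> p by (intro divide_strict_left_mono) auto
    then show ?thesis by (simp add: \<beta>_def q(3))
  qed
  \<comment> \<open>Two differences of trace class, each interpolated between the trace norm D/s and
    the operator norm 2.\<close>
  define c where "c = 2 * (2 powr (1 - 1 / q) * D powr (1 / q))"
  have c: "c \<ge> 0" by (simp add: c_def)
  define k where "k = 1 - 2 powr (- \<beta>)"
  have k: "k > 0" using \<beta> by (simp add: k_def powr_less_one)
  \<comment> \<open>The scale that separates the two estimates, so low that the scales below it
    contribute at most \<epsilon>/4. It does not depend on \<open>X'\<close>, so \<delta> can be
    chosen after it.\<close>
  define l where "l = (\<epsilon> / 4 * k / (c + 1)) powr (1 / \<beta>)"
  have l: "l > 0" using \<epsilon> k c by (simp add: l_def)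
  have l\<beta>: "c * (l powr \<beta> / k) \<le> \<epsilon> / 4"
  proof -
    have "l powr \<beta> = \<epsilon> / 4 * k / (c + 1)" using \<beta> \<epsilon> k c by (simp add: l_def powr_powr)
    then have "c * (l powr \<beta> / k) = \<epsilon> / 4 * (c / (c + 1))" using k by simp
    also have "\<dots> \<le> \<epsilon> / 4 * 1" using c \<epsilon> by (intro mult_left_mono) auto
    finally show ?thesis by simp
  qed
  define m where "m = l powr (- (1 - \<alpha>)) / (1 - 2 powr (- (1 - \<alpha>)))"
  have m: "m > 0" using \<alpha> l by (auto simp: m_def powr_less_one intro!: divide_pos_pos)
  \<comment> \<open>The first bound keeps \<open>E'\<close> of norm at most 2 * \<epsilon>1; the
    second makes the contribution 2 * \<delta> * m of the scales above \<open>l\<close> at most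
    \<epsilon>/4.\<close>
  define \<delta> where "\<delta> = min \<epsilon>1 (\<epsilon> / (8 * m))"
  have \<delta>: "\<delta> > 0" "\<delta> \<le> \<epsilon>1" using e1 \<epsilon> m by (auto simp: \<delta>_def)
  have \<delta>m: "2 * \<delta> * m \<le> \<epsilon> / 4"
  proof -
    have "2 * \<delta> * m \<le> 2 * (\<epsilon> / (8 * m)) * m" using m by (intro mult_right_mono mult_left_mono) (auto simp: \<delta>_def)
    also have "\<dots> = \<epsilon> / 4" using m by simp
    finally show ?thesis .
  qed
  have "dyadic_bounded q \<alpha> \<epsilon> (\<lambda>s. cay ((1 / s) *\<^sub>R X') - cay ((1 / s) *\<^sub>R X))"
    if X': "skew X'" "schatten p \<delta> (X' - X)" for X'
  proof -
    define E' where "E' = X' - G"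
    have "schatten p (\<epsilon>1 + \<delta>) (E + (X' - X))"
      using p by (intro schatten_add X'(2)) (simp_all add: E_def G(3))
    moreover have "E + (X' - X) = E'" by (simp add: E_def E'_def)
    ultimately have "schatten p (\<epsilon>1 + \<delta>) E'" by simp
    then have E'_p: "schatten p (2 * \<epsilon>1) E'" by (rule schatten_mono) (use \<delta> p in auto)
    have E'_skew: "skew E'" unfolding E'_def by (rule skew_diff [OF X'(1) G(1)])
    note E' = E'_skew E'_p
    have EE: "E' - E = X' - X" by (simp add: E_def E'_def)
    let ?c = "\<lambda>Y s. cay ((1 / s) *\<^sub>R Y)"
    \<comment> \<open>The four terms are grouped in two ways: X' with E' and X with E, which differ
      by the finite-rank \<open>G\<close>, for small s; X' with X and E' with E, which differ by the
      small X' - X, for large s.\<close>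
    define W where "W s = (?c X' s - ?c E' s) - (?c X s - ?c E s)" for s
    have small: "dyadic_bounded q \<alpha> (\<epsilon> / 4 + \<epsilon> / 4) (\<lambda>s. ?c E' s - ?c E s)"
      using dyadic_bounded_cay [OF E'(1,2) _ \<alpha>] dyadic_bounded_cay [OF E(1,2) _ \<alpha>] p q(1)
      unfolding q_def e1K by (intro dyadic_bounded_diff) auto
    have trace_class: "schatten q (2 powr (1 - 1 / q) * (D / s) powr (1 / q)) (?c Y s - ?c F s)"
      if Y: "skew Y" "skew F" "Y - F = G" and s: "s > 0" for Y F s
    proof (rule schatten_interpolate)
      have sk: "skew ((1 / s) *\<^sub>R Y)" "skew ((1 / s) *\<^sub>R F)" using Y by (auto intro: skew_scaleR)
      have "(1 / s) *\<^sub>R Y - (1 / s) *\<^sub>R F = (1 / s) *\<^sub>R G" using Y(3) by (simp add: scaleR_diff_right [symmetric])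
      then have "?c Y s - ?c F s = resolvent ((1 / s) *\<^sub>R Y) o\<^sub>L (((1 / s) *\<^sub>R G) o\<^sub>L resolvent ((1 / s) *\<^sub>R F))"
        using cay_diff [OF sk(2,1)] by simp
      moreover have "schatten 1 (\<bar>1 / s\<bar> * D) \<dots>"
        by (intro schatten_sandwich schatten_scaleR G(2) sk) simp
      ultimately show "schatten 1 (D / s) (?c Y s - ?c F s)" using s by simp
      have "norm (?c Y s - ?c F s) \<le> norm (?c Y s) + norm (?c F s)" by (rule norm_triangle_ineq4)
      also have "\<dots> \<le> 1 + 1" by (intro add_mono norm_cay_le sk)
      finally show "norm (?c Y s - ?c F s) \<le> 2" by simp
    qed (use q in simp)
    have perturb: "schatten q (\<delta> / s) (?c Y' s - ?c Y s)"
      if Y: "skew Y" "skew Y'" "Y' - Y = X' - X" and s: "s > 0" for Y Y' s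
    proof -
      have sk: "skew ((1 / s) *\<^sub>R Y)" "skew ((1 / s) *\<^sub>R Y')" using Y by (auto intro: skew_scaleR)
      have "(1 / s) *\<^sub>R Y' - (1 / s) *\<^sub>R Y = (1 / s) *\<^sub>R (X' - X)" using Y(3) by (simp add: scaleR_diff_right [symmetric])
      then have "?c Y' s - ?c Y s = resolvent ((1 / s) *\<^sub>R Y') o\<^sub>L (((1 / s) *\<^sub>R (X' - X)) o\<^sub>L resolvent ((1 / s) *\<^sub>R Y))"
        using cay_diff [OF sk] by simp
      moreover have "schatten p (\<bar>1 / s\<bar> * \<delta>) \<dots>"
        using p by (intro schatten_sandwich schatten_scaleR X' sk) simp
      ultimately have "schatten p (\<delta> / s) (?c Y' s - ?c Y s)" using s by simp
      then show ?thesis by (rule schatten_exponent_mono) (use p q in auto)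
    qed
    define d where "d s = (if s \<le> l then c * s powr (- (1 / q)) else 2 * \<delta> / s)" for s
    have W: "dyadic_bounded q \<alpha> (\<epsilon> / 4 + \<epsilon> / 4) W"
    proof (rule dyadic_bounded_of_pointwise)
      fix s :: real assume s: "s > 0"
      show "schatten q (d s) (W s)"
      proof (cases "s \<le> l")
        case True
        have eq: "2 powr (1 - 1 / q) * (D / s) powr (1 / q) = c / 2 * s powr (- (1 / q))"
          using s D by (simp add: c_def powr_divide powr_minus_divide)
        have G': "X' - E' = G" "X - E = G" by (simp_all add: E_def E'_def)
        have "schatten q (c / 2 * s powr (- (1 / q)) + c / 2 * s powr (- (1 / q))) (W s)"
          unfolding W_def eq [symmetric]
          by (rule schatten_diff [OF trace_class [OF X'(1) E'(1) G'(1) s] trace_class [OF X E(1) G'(2) s]])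
            (use q in simp)
        then show ?thesis using True by (simp add: d_def)
      next
        case False
        have "W s = (?c X' s - ?c X s) - (?c E' s - ?c E s)" by (simp add: W_def)
        moreover have "schatten q (\<delta> / s + \<delta> / s) ((?c X' s - ?c X s) - (?c E' s - ?c E s))"
          using q(1) by (intro schatten_diff perturb X X'(1) E(1) E'(1) EE s refl) auto
        ultimately show ?thesis using False by (simp add: d_def)
      qed
    next
      fix s :: real and J :: "int set" assume s: "s > 0" and J: "finite J"
      let ?t = "\<lambda>j. s * 2 powr real_of_int j"
      define J1 J2 where "J1 = {j\<in>J. ?t j \<le> l}" and "J2 = {j\<in>J. ?t j > l}"
      have fin: "finite J1" "finite J2" using J by (auto simp: J1_def J2_def)
      have "(\<Sum>j\<in>J. ?t j powr \<alpha> * d (?t j)) = (\<Sum>j\<in>J1. ?t j powr \<alpha> * d (?t j)) + (\<Sum>j\<in>J2. ?t j powr \<alpha> * d (?t j))"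
        using J by (subst sum.union_disjoint [symmetric]) (auto simp: J1_def J2_def intro!: sum.cong)
      also have "(\<Sum>j\<in>J1. ?t j powr \<alpha> * d (?t j)) = c * (\<Sum>j\<in>J1. ?t j powr \<beta>)"
        unfolding sum_distrib_left
        by (intro sum.cong) (auto simp: J1_def d_def \<beta>_def powr_diff powr_minus_divide)
      also have "\<dots> \<le> c * (l powr \<beta> / k)"
        unfolding k_def using c s \<beta> fin by (intro mult_left_mono geometric_sum_le) (auto simp: J1_def)
      also have "\<dots> \<le> \<epsilon> / 4" by (rule l\<beta>)
      also have "(\<Sum>j\<in>J2. ?t j powr \<alpha> * d (?t j)) = 2 * \<delta> * (\<Sum>j\<in>J2. ?t j powr (- (1 - \<alpha>)))"
        unfolding sum_distrib_left
      proof (intro sum.cong)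
        fix j assume j: "j \<in> J2"
        have t: "?t j > 0" using s by simp
        have "?t j powr (- (1 - \<alpha>)) = ?t j powr (\<alpha> - 1)" by simp
        also have "\<dots> = ?t j powr \<alpha> / ?t j" using t by (simp only: powr_diff powr_one)
        finally show "?t j powr \<alpha> * d (?t j) = 2 * \<delta> * ?t j powr (- (1 - \<alpha>))"
          using j by (simp add: J2_def d_def)
      qed simp
      also have "\<dots> \<le> 2 * \<delta> * m"
        unfolding m_def using \<delta> s \<alpha> l fin by (intro mult_left_mono geometric_sum_ge) (auto simp: J2_def)
      also have "\<dots> \<le> \<epsilon> / 4" by (rule \<delta>m)
      finally show "(\<Sum>j\<in>J. ?t j powr \<alpha> * d (?t j)) \<le> \<epsilon> / 4 + \<epsilon> / 4" by simp
    qed (use q in simp)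
    have "dyadic_bounded q \<alpha> ((\<epsilon> / 4 + \<epsilon> / 4) + (\<epsilon> / 4 + \<epsilon> / 4)) (\<lambda>s. W s + (?c E' s - ?c E s))"
      using q by (intro dyadic_bounded_add W small) auto
    then show ?thesis by (simp add: W_def)
  qed
  with \<delta>(1) that show ?thesis unfolding q_def by blast
qed

end


section \<open>Words in resolvents\<close>

context real_hilbert
begin

text \<open>For \<open>w = [(v1, X1), \<dots>, (vn, Xn)]\<close>, \<open>word (k + 1) X0 w\<close> is the product
  \<open>(1 + X0)\<inverse> v1 (1 + X1)\<inverse> \<dots> vn (1 + Xn)\<inverse>\<close> minus its Taylor polynomial of degree \<open>k\<close> in
  \<open>(X0, \<dots>, Xn)\<close>, and \<open>word 0 X0 w\<close> is the product itself.\<close>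

fun word :: "nat \<Rightarrow> ('b \<Rightarrow>\<^sub>L 'b) \<Rightarrow> (('b \<Rightarrow>\<^sub>L 'b) \<times> ('b \<Rightarrow>\<^sub>L 'b)) list \<Rightarrow> ('b \<Rightarrow>\<^sub>L 'b)" where
  "word 0 X [] = resolvent X"
| "word 0 X ((v, Y) # w) = resolvent X o\<^sub>L (v o\<^sub>L word 0 Y w)"
| "word (Suc k) X [] = - (X o\<^sub>L word k X [])"
| "word (Suc k) X ((v, Y) # w) = (v o\<^sub>L word (Suc k) Y w) - (X o\<^sub>L word k X ((v, Y) # w))"

lemma word_linear:
  "word k X (w @ (a *\<^sub>R u + b *\<^sub>R v, Y) # w') = a *\<^sub>R word k X (w @ (u, Y) # w') + b *\<^sub>R word k X (w @ (v, Y) # w')"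
proof (induction w arbitrary: k X)
  case Nil
  show ?case
  proof (induction k)
    case 0
    show ?case by (simp add: blinfun_compose_simps)
  next
    case (Suc k)
    then show ?case by (simp add: blinfun_compose_simps algebra_simps)
  qed
next
  case (Cons x w)
  obtain z Z where x: "x = (z, Z)" by (cases x)
  note IH = Cons.IH
  show ?case
  proof (induction k)
    case 0
    show ?case by (simp add: x IH blinfun_compose_simps)
  next
    case (Suc k)
    then show ?case by (simp add: x IH blinfun_compose_simps algebra_simps)
  qed
qed

lemma word_scaleR: "word k X (w @ (a *\<^sub>R u, Y) # w') = a *\<^sub>R word k X (w @ (u, Y) # w')"
  using word_linear [of k X w a u 0 0 Y w'] by simp

primrec opsprod :: "('b \<Rightarrow>\<^sub>L 'b) list \<Rightarrow> ('b \<Rightarrow>\<^sub>L 'b)" where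
  "opsprod [] = id_blinfun"
| "opsprod (v # vs) = v o\<^sub>L opsprod vs"

text \<open>A Taylor polynomial of degree 0 is the value at the origin, where every resolvent is the
  identity.\<close>

lemma word_one:
  assumes "skew X" "\<And>v Y. (v, Y) \<in> set w \<Longrightarrow> skew Y"
  shows "word (Suc 0) X w = word 0 X w - opsprod (map fst w)"
  using assms
proof (induction w arbitrary: X)
  case Nil
  then show ?case using cay_eq [of X] by (simp add: cay_def)
next
  case (Cons x w)
  obtain v Y where x: "x = (v, Y)" by (cases x)
  have IH: "word (Suc 0) Y w = word 0 Y w - opsprod (map fst w)"
    using Cons.prems x by (intro Cons.IH) auto
  have "word (Suc 0) X (x # w) = (v o\<^sub>L word (Suc 0) Y w) - (cay X o\<^sub>L (v o\<^sub>L word 0 Y w))"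
    by (simp add: x cay_def blinfun_compose_assoc)
  also have "\<dots> = (resolvent X o\<^sub>L (v o\<^sub>L word 0 Y w)) - (v o\<^sub>L opsprod (map fst w))"
    unfolding IH resolvent_eq [OF Cons.prems(1)] by (simp add: blinfun_compose_simps)
  finally show ?case by (simp add: x)
qed

section \<open>Increments of words\<close>

abbreviation const_word :: "('b \<Rightarrow>\<^sub>L 'b) \<Rightarrow> ('b \<Rightarrow>\<^sub>L 'b) list \<Rightarrow> (('b \<Rightarrow>\<^sub>L 'b) \<times> ('b \<Rightarrow>\<^sub>L 'b)) list" where
  "const_word X vs \<equiv> map (\<lambda>v. (v, X)) vs"

text \<open>The terms of a telescoping sum: the points X are replaced by X' from left to right, and
  the one resolvent difference that arises at place i contributes the additional argument
  \<open>h\<close> between X' on its left and X on its right.\<close>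

definition mixed_word :: "nat \<Rightarrow> ('b \<Rightarrow>\<^sub>L 'b) \<Rightarrow> ('b \<Rightarrow>\<^sub>L 'b) \<Rightarrow> ('b \<Rightarrow>\<^sub>L 'b) \<Rightarrow> ('b \<Rightarrow>\<^sub>L 'b) list
    \<Rightarrow> (('b \<Rightarrow>\<^sub>L 'b) \<times> ('b \<Rightarrow>\<^sub>L 'b)) list" where
  "mixed_word i X' X h vs = const_word X' (take i vs) @ (h, X) # const_word X (drop i vs)"

lemma mixed_word_simps:
  "mixed_word 0 X' X h vs = (h, X) # const_word X vs"
  "mixed_word (Suc i) X' X h (v # vs) = (v, X') # mixed_word i X' X h vs"
  by (simp_all add: mixed_word_def)

lemma word_zero_diff:
  assumes "skew X" "skew X'"
  shows "word 0 X' (const_word X' vs) - word 0 X (const_word X vs)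
    = - (\<Sum>i\<le>length vs. word 0 X' (mixed_word i X' X (X' - X) vs))"
proof (induction vs)
  case Nil
  show ?case using resolvent_diff [OF assms] by (simp add: mixed_word_simps)
next
  case (Cons v vs)
  let ?W = "word 0 X (const_word X vs)" and ?W' = "word 0 X' (const_word X' vs)"
  have "word 0 X' (const_word X' (v # vs)) - word 0 X (const_word X (v # vs))
      = ((resolvent X' - resolvent X) o\<^sub>L (v o\<^sub>L ?W)) + (resolvent X' o\<^sub>L (v o\<^sub>L (?W' - ?W)))"
    by (simp add: blinfun_compose_simps)
  then show ?case
    unfolding Cons.IH resolvent_diff [OF assms]
    by (simp add: sum.atMost_Suc_shift mixed_word_simps blinfun_compose_simps blinfun_compose_sum_right
        del: sum.atMost_Suc)
qed

text \<open>The telescoping identity for products of resolvents is inherited by Taylor remainders,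
  with the degree lowered by one and without error term. At the bottom, a remainder of degree 0
  differs from the product of resolvents by a term that does not depend on the point; the recursion
  of \<open>word\<close> then propagates the identity, by induction on the degree and inside it on
  the arguments.\<close>

lemma word_diff:
  assumes "skew X" "skew X'"
  shows "word (Suc k) X' (const_word X' vs) - word (Suc k) X (const_word X vs)
    = - (\<Sum>i\<le>length vs. word k X' (mixed_word i X' X (X' - X) vs))"
proof (induction k arbitrary: vs)
  case 0
  have "word (Suc 0) Y (const_word Y vs) = word 0 Y (const_word Y vs) - opsprod vs" if "skew Y" for Y
    using word_one [OF that, of "const_word Y vs"] that by (auto simp: o_def)
  then show ?case using word_zero_diff [OF assms, of vs] assms by simp
next
  case (Suc k)
  note IHk = Suc.IH
  show ?case
  proof (induction vs)
    case Nil
    have eq: "word (Suc (Suc k)) X' [] - word (Suc (Suc k)) X []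
        = - ((X' o\<^sub>L (word (Suc k) X' [] - word (Suc k) X [])) + ((X' - X) o\<^sub>L word (Suc k) X []))"
      by (simp only: word.simps(3) [of "Suc k"]) (simp add: blinfun_compose_simps del: word.simps)
    have IH0: "word (Suc k) X' [] - word (Suc k) X [] = - word k X' [(X' - X, X)]"
      using IHk [of "[]"] by (simp add: mixed_word_simps del: word.simps)
    show ?case unfolding list.map(1) eq IH0 by (simp add: mixed_word_simps blinfun_compose_simps)
  next
    case (Cons v vs)
    let ?w = "\<lambda>Y. const_word Y (v # vs)"
    have "word (Suc (Suc k)) X' (?w X') - word (Suc (Suc k)) X (?w X)
        = (v o\<^sub>L (word (Suc (Suc k)) X' (const_word X' vs) - word (Suc (Suc k)) X (const_word X vs)))
          - (X' o\<^sub>L (word (Suc k) X' (?w X') - word (Suc k) X (?w X))) - ((X' - X) o\<^sub>L word (Suc k) X (?w X))"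
      by (simp add: blinfun_compose_simps)
    also have "\<dots> = - (\<Sum>i\<le>length (v # vs). word (Suc k) X' (mixed_word i X' X (X' - X) (v # vs)))"
      unfolding IHk Cons.IH
      by (simp add: sum.atMost_Suc_shift mixed_word_simps blinfun_compose_simps blinfun_compose_sum_right
          sum_subtractf del: sum.atMost_Suc)
    finally show ?case .
  qed
qed

section \<open>Scaled words and the exponents they require\<close>

lemma schatten_opsprod:
  assumes "vs \<noteq> []" "\<And>v. v \<in> set vs \<Longrightarrow> schatten p (N v) v" "p > 0" "real (length vs) \<le> p"
  shows "schatten (p / length vs) (prod_list (map N vs)) (opsprod vs)"
  using assms
proof (induction vs)
  case (Cons v vs)
  show ?case
  proof (cases "vs = []")
    case True
    then show ?thesis using Cons.prems by (simp add: blinfun_compose_simps)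
  next
    case False
    have "schatten (p / length vs) (prod_list (map N vs)) (opsprod vs)"
      using False Cons.prems by (intro Cons.IH) auto
    moreover have "schatten p (N v) v" using Cons.prems by simp
    ultimately have "schatten (p / length (v # vs)) (N v * prod_list (map N vs)) (v o\<^sub>L opsprod vs)"
      using False Cons.prems
      by (intro schatten_holder [of p _ _ "p / length vs"]) (auto simp: add_divide_distrib)
    then show ?thesis by simp
  qed
qed simp

text \<open>The exponents \<open>\<theta> / 2\<^sup>i\<close> occur because a product of \<open>i + 1\<close> factors \<open>cay (X/s)\<close> has to share
  the total exponent \<open>\<theta>\<close>.\<close>

definition admissible :: "real \<Rightarrow> real \<Rightarrow> nat \<Rightarrow> real \<Rightarrow> ('b \<Rightarrow>\<^sub>L 'b) \<Rightarrow> bool" where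
  "admissible p \<theta> n M X \<longleftrightarrow> skew X \<and> schatten p M X \<and>
     (\<forall>i\<le>n. dyadic_bounded (p / (\<theta> / 2 ^ i)) (\<theta> / 2 ^ i) M (\<lambda>s. cay ((1 / s) *\<^sub>R X)))"

definition close_to :: "real \<Rightarrow> real \<Rightarrow> nat \<Rightarrow> real \<Rightarrow> ('b \<Rightarrow>\<^sub>L 'b) \<Rightarrow> ('b \<Rightarrow>\<^sub>L 'b) \<Rightarrow> bool" where
  "close_to p \<theta> n \<eta> X Y \<longleftrightarrow> schatten p \<eta> (X - Y) \<and>
     (\<forall>i\<le>n. dyadic_bounded (p / (\<theta> / 2 ^ i)) (\<theta> / 2 ^ i) \<eta> (\<lambda>s. cay ((1 / s) *\<^sub>R X) - cay ((1 / s) *\<^sub>R Y)))"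

text \<open>When a \<open>cay\<close> factor is split off a word, it takes \<theta>/2 and leaves
  \<theta>/2 to the rest. The price is one level of halving, which the number of arguments
  limits.\<close>

lemma admissible_half:
  assumes "admissible p \<theta> (Suc n) M X"
  shows "admissible p (\<theta> / 2) n M X"
  unfolding admissible_def
proof (intro conjI allI impI)
  fix i assume "i \<le> n"
  then have "dyadic_bounded (p / (\<theta> / 2 ^ Suc i)) (\<theta> / 2 ^ Suc i) M (\<lambda>s. cay ((1 / s) *\<^sub>R X))"
    using assms unfolding admissible_def by blast
  then show "dyadic_bounded (p / (\<theta> / 2 / 2 ^ i)) (\<theta> / 2 / 2 ^ i) M (\<lambda>s. cay ((1 / s) *\<^sub>R X))"
    by simp
qed (use assms in \<open>simp_all add: admissible_def\<close>)

lemma admissible_mono_nat: "admissible p \<theta> n M X \<Longrightarrow> n' \<le> n \<Longrightarrow> admissible p \<theta> n' M X"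
  unfolding admissible_def by simp

lemma close_to_half:
  assumes "close_to p \<theta> (Suc n) \<eta> X Y"
  shows "close_to p (\<theta> / 2) n \<eta> X Y"
  unfolding close_to_def
proof (intro conjI allI impI)
  fix i assume "i \<le> n"
  then have "dyadic_bounded (p / (\<theta> / 2 ^ Suc i)) (\<theta> / 2 ^ Suc i) \<eta>
      (\<lambda>s. cay ((1 / s) *\<^sub>R X) - cay ((1 / s) *\<^sub>R Y))"
    using assms unfolding close_to_def by blast
  then show "dyadic_bounded (p / (\<theta> / 2 / 2 ^ i)) (\<theta> / 2 / 2 ^ i) \<eta>
      (\<lambda>s. cay ((1 / s) *\<^sub>R X) - cay ((1 / s) *\<^sub>R Y))"
    by simp
qed (use assms in \<open>simp_all add: close_to_def\<close>)

lemma close_to_mono_nat: "close_to p \<theta> n \<eta> X Y \<Longrightarrow> n' \<le> n \<Longrightarrow> close_to p \<theta> n' \<eta> X Y"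
  unfolding close_to_def by simp

text \<open>The points are divided by s, the arguments are not: in the derivatives an argument is a
  fixed direction, and its factor 1/s is absorbed into the weight of the integral.\<close>

definition scaled_word :: "nat \<Rightarrow> real \<Rightarrow> ('b \<Rightarrow>\<^sub>L 'b) \<Rightarrow> (('b \<Rightarrow>\<^sub>L 'b) \<times> ('b \<Rightarrow>\<^sub>L 'b)) list \<Rightarrow> ('b \<Rightarrow>\<^sub>L 'b)" where
  "scaled_word k s X w = word k ((1 / s) *\<^sub>R X) (map (\<lambda>(v, Y). (v, (1 / s) *\<^sub>R Y)) w)"

lemma scaled_word_Nil: "scaled_word (Suc 0) s X [] = - cay ((1 / s) *\<^sub>R X)"
  by (simp add: scaled_word_def cay_def)

lemma scaled_word_Nil_Suc: "scaled_word (Suc (Suc k)) s X [] = - (((1 / s) *\<^sub>R X) o\<^sub>L scaled_word (Suc k) s X [])"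
  by (simp add: scaled_word_def)

lemma scaled_word_Cons_Suc:
  "scaled_word (Suc (Suc k)) s X ((v, Y) # w)
    = (v o\<^sub>L scaled_word (Suc (Suc k)) s Y w) - (((1 / s) *\<^sub>R X) o\<^sub>L scaled_word (Suc k) s X ((v, Y) # w))"
  by (simp add: scaled_word_def)

text \<open>The full product of resolvents, which does not become small for large s, is eliminated:
  each of the three terms contains a \<open>cay\<close> or a Taylor remainder, and so is accessible
  to dyadic bounds.\<close>

lemma scaled_word_Cons:
  assumes "skew Y" "\<And>u Z. (u, Z) \<in> set w \<Longrightarrow> skew Z"
  shows "scaled_word (Suc 0) s X ((v, Y) # w)
    = (v o\<^sub>L scaled_word (Suc 0) s Y w) - (cay ((1 / s) *\<^sub>R X) o\<^sub>L (v o\<^sub>L scaled_word (Suc 0) s Y w))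
      - (cay ((1 / s) *\<^sub>R X) o\<^sub>L opsprod (v # map fst w))"
proof -
  have "word (Suc 0) ((1 / s) *\<^sub>R Y) (map (\<lambda>(v, Y). (v, (1 / s) *\<^sub>R Y)) w)
      = word 0 ((1 / s) *\<^sub>R Y) (map (\<lambda>(v, Y). (v, (1 / s) *\<^sub>R Y)) w) - opsprod (map fst (map (\<lambda>(v, Y). (v, (1 / s) *\<^sub>R Y)) w))"
    using assms by (intro word_one) (auto intro!: skew_scaleR)
  moreover have "map fst (map (\<lambda>(v, Y). (v, (1 / s) *\<^sub>R Y)) w) = map fst w" by (auto simp: o_def)
  ultimately have "word 0 ((1 / s) *\<^sub>R Y) (map (\<lambda>(v, Y). (v, (1 / s) *\<^sub>R Y)) w)
      = scaled_word (Suc 0) s Y w + opsprod (map fst w)"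
    unfolding scaled_word_def by (metis diff_add_cancel)
  then show ?thesis by (simp add: scaled_word_def cay_def blinfun_compose_simps)
qed

text \<open>The Schatten exponent is recorded through x as p/x, since Hoelder's inequality then
  simply adds the x. \<eta> is the size of the difference relative to \<open>C\<close>. Boundedness
  and continuity are carried through one and the same induction in this way.\<close>

definition pair_bounded :: "real \<Rightarrow> real \<Rightarrow> real \<Rightarrow> real \<Rightarrow> real \<Rightarrow> (real \<Rightarrow> 'b \<Rightarrow>\<^sub>L 'b) \<Rightarrow> (real \<Rightarrow> 'b \<Rightarrow>\<^sub>L 'b) \<Rightarrow> bool" where
  "pair_bounded p x \<alpha> \<eta> C Z Z' \<longleftrightarrow> dyadic_bounded (p / x) \<alpha> C Z \<and> dyadic_bounded (p / x) \<alpha> C Z' \<and>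
     dyadic_bounded (p / x) \<alpha> (\<eta> * C) (\<lambda>s. Z s - Z' s)"

lemma pair_bounded_add:
  assumes "pair_bounded p x \<alpha> \<eta> C Y Y'" "pair_bounded p x \<alpha> \<eta> D Z Z'" "0 < x" "x \<le> p"
  shows "pair_bounded p x \<alpha> \<eta> (C + D) (\<lambda>s. Y s + Z s) (\<lambda>s. Y' s + Z' s)"
proof -
  have q: "1 \<le> p / x" using assms(3,4) by simp
  have "dyadic_bounded (p / x) \<alpha> (\<eta> * C + \<eta> * D) (\<lambda>s. (Y s - Y' s) + (Z s - Z' s))"
    using assms unfolding pair_bounded_def by (intro dyadic_bounded_add q) auto
  then have "dyadic_bounded (p / x) \<alpha> (\<eta> * (C + D)) (\<lambda>s. (Y s + Z s) - (Y' s + Z' s))"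
    by (simp add: distrib_left algebra_simps)
  moreover have "dyadic_bounded (p / x) \<alpha> (C + D) (\<lambda>s. Y s + Z s)"
    "dyadic_bounded (p / x) \<alpha> (C + D) (\<lambda>s. Y' s + Z' s)"
    using assms unfolding pair_bounded_def by (intro dyadic_bounded_add q; simp)+
  ultimately show ?thesis unfolding pair_bounded_def by blast
qed

lemma pair_bounded_minus:
  assumes "pair_bounded p x \<alpha> \<eta> C Z Z'"
  shows "pair_bounded p x \<alpha> \<eta> C (\<lambda>s. - Z s) (\<lambda>s. - Z' s)"
proof -
  have "dyadic_bounded (p / x) \<alpha> (\<eta> * C) (\<lambda>s. - (Z s - Z' s))"
    using assms unfolding pair_bounded_def by (intro dyadic_bounded_minus) auto
  then show ?thesis using assms dyadic_bounded_minus unfolding pair_bounded_def by simp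
qed

lemma pair_bounded_diff:
  assumes "pair_bounded p x \<alpha> \<eta> C Y Y'" "pair_bounded p x \<alpha> \<eta> D Z Z'" "0 < x" "x \<le> p"
  shows "pair_bounded p x \<alpha> \<eta> (C + D) (\<lambda>s. Y s - Z s) (\<lambda>s. Y' s - Z' s)"
  using pair_bounded_add [OF assms(1) pair_bounded_minus [OF assms(2)] assms(3,4)] by simp

section \<open>Products of pairs of dyadically bounded families\<close>

lemma exponent_add: "1 / (p / x) + 1 / (p / y) = 1 / (p / (x + y))" for p x y :: real
  by (simp add: add_divide_distrib)

lemma pair_bounded_compose:
  assumes Y: "pair_bounded p x \<alpha> \<eta> C Y Y'" and Z: "pair_bounded p y \<beta> \<eta> D Z Z'"
    and xy: "0 < x" "0 < y" "x + y \<le> p"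
  shows "pair_bounded p (x + y) (\<alpha> + \<beta>) \<eta> (2 * C * D) (\<lambda>s. Y s o\<^sub>L Z s) (\<lambda>s. Y' s o\<^sub>L Z' s)"
proof -
  have q: "0 < p / x" "0 < p / y" "1 / (p / x) + 1 / (p / y) = 1 / (p / (x + y))" "1 \<le> p / (x + y)"
    using xy exponent_add by (auto intro: divide_pos_pos)
  have CD: "0 \<le> C" "0 \<le> D" using Y Z dyadic_bounded_nonneg unfolding pair_bounded_def by blast+
  have 1: "dyadic_bounded (p / (x + y)) (\<alpha> + \<beta>) (2 * C * D) (\<lambda>s. U s o\<^sub>L V s)"
    if "dyadic_bounded (p / x) \<alpha> C U" "dyadic_bounded (p / y) \<beta> D V" for U V
    by (rule dyadic_bounded_mono [OF dyadic_bounded_compose [OF that q]])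
      (use CD q in \<open>auto simp: mult_right_mono\<close>)
  \<comment> \<open>The product rule Y Z - Y' Z' = (Y - Y') Z + Y' (Z - Z'). Its two terms account
    for the factor 2 in the constant.\<close>
  have "dyadic_bounded (p / (x + y)) (\<alpha> + \<beta>) ((\<eta> * C) * D + C * (\<eta> * D))
      (\<lambda>s. ((Y s - Y' s) o\<^sub>L Z s) + (Y' s o\<^sub>L (Z s - Z' s)))"
    using Y Z unfolding pair_bounded_def by (intro dyadic_bounded_add dyadic_bounded_compose [OF _ _ q] q(4)) auto
  then have "dyadic_bounded (p / (x + y)) (\<alpha> + \<beta>) (\<eta> * (2 * C * D)) (\<lambda>s. (Y s o\<^sub>L Z s) - (Y' s o\<^sub>L Z' s))"
    by (simp add: blinfun_compose_simps algebra_simps)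
  then show ?thesis using 1 Y Z unfolding pair_bounded_def by blast
qed

lemma pair_bounded_const_left:
  assumes A: "schatten (p / x) C A" and Z: "pair_bounded p y \<beta> \<eta> D Z Z'"
    and xy: "0 < x" "0 < y" "x + y \<le> p"
  shows "pair_bounded p (x + y) \<beta> \<eta> (C * D) (\<lambda>s. A o\<^sub>L Z s) (\<lambda>s. A o\<^sub>L Z' s)"
proof -
  have q: "0 < p / x" "0 < p / y" "1 / (p / x) + 1 / (p / y) = 1 / (p / (x + y))" "1 \<le> p / (x + y)"
    using xy exponent_add by (auto intro: divide_pos_pos)
  have "dyadic_bounded (p / (x + y)) \<beta> (C * (\<eta> * D)) (\<lambda>s. A o\<^sub>L (Z s - Z' s))"
    using Z unfolding pair_bounded_def by (intro dyadic_bounded_const_left [OF A _ q]) auto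
  then have "dyadic_bounded (p / (x + y)) \<beta> (\<eta> * (C * D)) (\<lambda>s. (A o\<^sub>L Z s) - (A o\<^sub>L Z' s))"
    by (simp add: blinfun_compose_simps mult_ac)
  then show ?thesis using dyadic_bounded_const_left [OF A _ q] Z unfolding pair_bounded_def by blast
qed

lemma pair_bounded_const_right:
  assumes Z: "pair_bounded p x \<alpha> \<eta> C Z Z'" and A: "schatten (p / y) D A"
    and xy: "0 < x" "0 < y" "x + y \<le> p"
  shows "pair_bounded p (x + y) \<alpha> \<eta> (C * D) (\<lambda>s. Z s o\<^sub>L A) (\<lambda>s. Z' s o\<^sub>L A)"
proof -
  have q: "0 < p / x" "0 < p / y" "1 / (p / x) + 1 / (p / y) = 1 / (p / (x + y))" "1 \<le> p / (x + y)"
    using xy exponent_add by (auto intro: divide_pos_pos)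
  have "dyadic_bounded (p / (x + y)) \<alpha> ((\<eta> * C) * D) (\<lambda>s. (Z s - Z' s) o\<^sub>L A)"
    using Z unfolding pair_bounded_def by (intro dyadic_bounded_const_right [OF _ A q]) auto
  then have "dyadic_bounded (p / (x + y)) \<alpha> (\<eta> * (C * D)) (\<lambda>s. (Z s o\<^sub>L A) - (Z' s o\<^sub>L A))"
    by (simp add: blinfun_compose_simps mult_ac)
  then show ?thesis using dyadic_bounded_const_right [OF _ A q] Z unfolding pair_bounded_def by blast
qed

lemma pair_bounded_scaled_left:
  assumes X: "schatten (p / x) C X" "schatten (p / x) C X'" "schatten (p / x) (\<eta> * C) (X - X')"
    and Z: "pair_bounded p y \<beta> \<eta> D Z Z'" and xy: "0 < x" "0 < y" "x + y \<le> p"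
  shows "pair_bounded p (x + y) (\<beta> + 1) \<eta> (2 * C * D) (\<lambda>s. ((1 / s) *\<^sub>R X) o\<^sub>L Z s) (\<lambda>s. ((1 / s) *\<^sub>R X') o\<^sub>L Z' s)"
proof -
  have q: "0 < p / x" "0 < p / y" "1 / (p / x) + 1 / (p / y) = 1 / (p / (x + y))" "1 \<le> p / (x + y)"
    using xy exponent_add by (auto intro: divide_pos_pos)
  have CD: "0 \<le> C" "0 \<le> D" using schatten_nonneg [OF X(1)] Z dyadic_bounded_nonneg unfolding pair_bounded_def by blast+
  have 1: "dyadic_bounded (p / (x + y)) (\<beta> + 1) (2 * C * D) (\<lambda>s. ((1 / s) *\<^sub>R U) o\<^sub>L V s)"
    if "schatten (p / x) C U" "dyadic_bounded (p / y) \<beta> D V" for U V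
    by (rule dyadic_bounded_mono [OF dyadic_bounded_scaled_left [OF that q]])
      (use CD q in \<open>auto simp: mult_right_mono\<close>)
  have "dyadic_bounded (p / (x + y)) (\<beta> + 1) ((\<eta> * C) * D + C * (\<eta> * D))
      (\<lambda>s. (((1 / s) *\<^sub>R (X - X')) o\<^sub>L Z s) + (((1 / s) *\<^sub>R X') o\<^sub>L (Z s - Z' s)))"
    using X Z unfolding pair_bounded_def by (intro dyadic_bounded_add dyadic_bounded_scaled_left [OF _ _ q] q(4)) auto
  then have "dyadic_bounded (p / (x + y)) (\<beta> + 1) (\<eta> * (2 * C * D))
      (\<lambda>s. (((1 / s) *\<^sub>R X) o\<^sub>L Z s) - (((1 / s) *\<^sub>R X') o\<^sub>L Z' s))"
    by (simp add: blinfun_compose_simps algebra_simps scaleR_diff_right)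
  then show ?thesis using 1 X Z unfolding pair_bounded_def by blast
qed

definition close_pair :: "real \<Rightarrow> real \<Rightarrow> nat \<Rightarrow> real \<Rightarrow> real \<Rightarrow> ('b \<Rightarrow>\<^sub>L 'b) \<Rightarrow> ('b \<Rightarrow>\<^sub>L 'b) \<Rightarrow> bool" where
  "close_pair p \<theta> n M \<eta> X X' \<longleftrightarrow> admissible p \<theta> n M X \<and> admissible p \<theta> n M X' \<and> close_to p \<theta> n \<eta> X X'"

lemma close_pair_half: "close_pair p \<theta> (Suc n) M \<eta> X X' \<Longrightarrow> close_pair p (\<theta> / 2) n M \<eta> X X'"
  unfolding close_pair_def by (blast intro: admissible_half close_to_half)

lemma close_pair_mono_nat: "close_pair p \<theta> n M \<eta> X X' \<Longrightarrow> n' \<le> n \<Longrightarrow> close_pair p \<theta> n' M \<eta> X X'"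
  unfolding close_pair_def by (blast intro: admissible_mono_nat close_to_mono_nat)

lemma close_pair_schatten:
  assumes "close_pair p \<theta> n M \<eta> X X'" "1 \<le> M" "0 \<le> \<eta>" "1 < p"
  shows "schatten p M X" "schatten p M X'" "schatten p (\<eta> * M) (X - X')" "skew X" "skew X'"
proof -
  show "schatten p M X" "schatten p M X'" "skew X" "skew X'"
    using assms(1) by (auto simp: close_pair_def admissible_def)
  have "schatten p \<eta> (X - X')" using assms(1) by (simp add: close_pair_def close_to_def)
  then show "schatten p (\<eta> * M) (X - X')"
    by (rule schatten_mono) (use assms mult_left_mono [of 1 M \<eta>] in auto)
qed

lemma close_pair_cay:
  assumes "close_pair p \<theta> n M \<eta> X X'" "1 \<le> M" "0 \<le> \<eta>" "1 < p" "0 < \<theta>" "i \<le> n"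
  shows "pair_bounded p (\<theta> / 2 ^ i) (\<theta> / 2 ^ i) \<eta> M (\<lambda>s. cay ((1 / s) *\<^sub>R X)) (\<lambda>s. cay ((1 / s) *\<^sub>R X'))"
proof -
  have "dyadic_bounded (p / (\<theta> / 2 ^ i)) (\<theta> / 2 ^ i) \<eta> (\<lambda>s. cay ((1 / s) *\<^sub>R X) - cay ((1 / s) *\<^sub>R X'))"
    using assms(1,6) by (simp add: close_pair_def close_to_def)
  then have "dyadic_bounded (p / (\<theta> / 2 ^ i)) (\<theta> / 2 ^ i) (\<eta> * M) (\<lambda>s. cay ((1 / s) *\<^sub>R X) - cay ((1 / s) *\<^sub>R X'))"
    by (rule dyadic_bounded_mono) (use assms mult_left_mono [of 1 M \<eta>] in auto)
  then show ?thesis using assms(1,6) by (simp add: pair_bounded_def close_pair_def admissible_def)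
qed

section \<open>Bounds for words by induction on length and degree\<close>

definition left_word :: "(('b \<Rightarrow>\<^sub>L 'b) \<times> ('b \<Rightarrow>\<^sub>L 'b) \<times> ('b \<Rightarrow>\<^sub>L 'b)) list \<Rightarrow> (('b \<Rightarrow>\<^sub>L 'b) \<times> ('b \<Rightarrow>\<^sub>L 'b)) list" where
  "left_word t = map (\<lambda>(v, Y, Y'). (v, Y)) t"

definition right_word :: "(('b \<Rightarrow>\<^sub>L 'b) \<times> ('b \<Rightarrow>\<^sub>L 'b) \<times> ('b \<Rightarrow>\<^sub>L 'b)) list \<Rightarrow> (('b \<Rightarrow>\<^sub>L 'b) \<times> ('b \<Rightarrow>\<^sub>L 'b)) list" where
  "right_word t = map (\<lambda>(v, Y, Y'). (v, Y')) t"

text \<open>The triples in \<open>t\<close> carry one argument and the two points to be compared.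
  \<open>N\<close> is any function bounding the norms of the arguments, and it is quantified inside,
  together with the points and \<eta>: \<open>K\<close> depends on none of them, so the bound is
  that of a multilinear form, uniformly over admissible points.\<close>

definition word_bound :: "real \<Rightarrow> real \<Rightarrow> nat \<Rightarrow> nat \<Rightarrow> real \<Rightarrow> real \<Rightarrow> bool" where
  "word_bound p M n k \<theta> K \<longleftrightarrow> (\<forall>\<eta> N X X' t. 0 \<le> \<eta> \<longrightarrow> length t = n \<longrightarrow> real k + \<theta> + real n \<le> p \<longrightarrow>
     close_pair p \<theta> n M \<eta> X X' \<longrightarrow>
     (\<forall>(v, Y, Y')\<in>set t. schatten p (N v) v \<and> close_pair p \<theta> n M \<eta> Y Y') \<longrightarrow>
     pair_bounded p (real k + \<theta> + real n) (real k + \<theta>) \<eta> (K * prod_list (map (\<lambda>x. N (fst x)) t))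
       (\<lambda>s. scaled_word (Suc k) s X (left_word t)) (\<lambda>s. scaled_word (Suc k) s X' (right_word t)))"

lemma word_boundI:
  assumes "\<And>\<eta> N X X' t. 0 \<le> \<eta> \<Longrightarrow> length t = n \<Longrightarrow> real k + \<theta> + real n \<le> p \<Longrightarrow>
     close_pair p \<theta> n M \<eta> X X' \<Longrightarrow>
     (\<And>v Y Y'. (v, Y, Y') \<in> set t \<Longrightarrow> schatten p (N v) v \<and> close_pair p \<theta> n M \<eta> Y Y') \<Longrightarrow>
     pair_bounded p (real k + \<theta> + real n) (real k + \<theta>) \<eta> (K * prod_list (map (\<lambda>x. N (fst x)) t))
       (\<lambda>s. scaled_word (Suc k) s X (left_word t)) (\<lambda>s. scaled_word (Suc k) s X' (right_word t))"
  shows "word_bound p M n k \<theta> K"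
  unfolding word_bound_def using assms by (metis (mono_tags, lifting) case_prodD)

lemma word_boundD:
  assumes "word_bound p M n k \<theta> K" "0 \<le> \<eta>" "length t = n" "real k + \<theta> + real n \<le> p"
    "close_pair p \<theta> n M \<eta> X X'"
    "\<And>v Y Y'. (v, Y, Y') \<in> set t \<Longrightarrow> schatten p (N v) v \<and> close_pair p \<theta> n M \<eta> Y Y'"
  shows "pair_bounded p (real k + \<theta> + real n) (real k + \<theta>) \<eta> (K * prod_list (map (\<lambda>x. N (fst x)) t))
       (\<lambda>s. scaled_word (Suc k) s X (left_word t)) (\<lambda>s. scaled_word (Suc k) s X' (right_word t))"
proof -
  have "\<forall>(v, Y, Y')\<in>set t. schatten p (N v) v \<and> close_pair p \<theta> n M \<eta> Y Y'" using assms(6) by blast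
  then show ?thesis using assms(1-5) unfolding word_bound_def by blast
qed

lemma word_bound_0_0:
  assumes "1 < p" "1 \<le> M" "0 < \<theta>"
  shows "word_bound p M 0 0 \<theta> M"
proof (rule word_boundI)
  fix \<eta> N X X' and t :: "(('b \<Rightarrow>\<^sub>L 'b) \<times> ('b \<Rightarrow>\<^sub>L 'b) \<times> ('b \<Rightarrow>\<^sub>L 'b)) list"
  assume a: "0 \<le> \<eta>" "length t = 0" "close_pair p \<theta> 0 M \<eta> X X'"
  from close_pair_cay [OF a(3) assms(2) a(1) assms(1,3), of 0]
  have "pair_bounded p \<theta> \<theta> \<eta> M (\<lambda>s. - cay ((1 / s) *\<^sub>R X)) (\<lambda>s. - cay ((1 / s) *\<^sub>R X'))"
    by (intro pair_bounded_minus) simp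
  then show "pair_bounded p (real 0 + \<theta> + real 0) (real 0 + \<theta>) \<eta> (M * prod_list (map (\<lambda>x. N (fst x)) t))
       (\<lambda>s. scaled_word (Suc 0) s X (left_word t)) (\<lambda>s. scaled_word (Suc 0) s X' (right_word t))"
    using a(2) by (simp add: left_word_def right_word_def scaled_word_Nil)
qed

lemma word_bound_0_Suc:
  assumes "1 < p" "1 \<le> M" "0 < \<theta>" and K: "word_bound p M 0 k \<theta> K"
  shows "word_bound p M 0 (Suc k) \<theta> (2 * M * K)"
proof (rule word_boundI)
  fix \<eta> N X X' and t :: "(('b \<Rightarrow>\<^sub>L 'b) \<times> ('b \<Rightarrow>\<^sub>L 'b) \<times> ('b \<Rightarrow>\<^sub>L 'b)) list"
  assume a: "0 \<le> \<eta>" "length t = 0" "real (Suc k) + \<theta> + real 0 \<le> p" "close_pair p \<theta> 0 M \<eta> X X'"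
  have "pair_bounded p (real k + \<theta> + real 0) (real k + \<theta>) \<eta> (K * prod_list (map (\<lambda>x. N (fst x)) t))
       (\<lambda>s. scaled_word (Suc k) s X (left_word t)) (\<lambda>s. scaled_word (Suc k) s X' (right_word t))"
    using a by (intro word_boundD [OF K]) auto
  from pair_bounded_scaled_left [OF _ _ _ this, of 1 M X X']
  have "pair_bounded p (1 + (real k + \<theta> + real 0)) (real k + \<theta> + 1) \<eta> (2 * M * (K * prod_list (map (\<lambda>x. N (fst x)) t)))
       (\<lambda>s. - (((1 / s) *\<^sub>R X) o\<^sub>L scaled_word (Suc k) s X (left_word t)))
       (\<lambda>s. - (((1 / s) *\<^sub>R X') o\<^sub>L scaled_word (Suc k) s X' (right_word t)))"
    using close_pair_schatten [OF a(4) assms(2) a(1) assms(1)] a(3) assms(3) by (intro pair_bounded_minus) auto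
  then show "pair_bounded p (real (Suc k) + \<theta> + real 0) (real (Suc k) + \<theta>) \<eta> (2 * M * K * prod_list (map (\<lambda>x. N (fst x)) t))
       (\<lambda>s. scaled_word (Suc (Suc k)) s X (left_word t)) (\<lambda>s. scaled_word (Suc (Suc k)) s X' (right_word t))"
    using a(2) by (simp add: left_word_def right_word_def scaled_word_Nil_Suc add_ac)
qed

text \<open>Of the three terms of \<open>scaled_word_Cons\<close>, the middle one is a product of
  \<open>cay\<close> and a shorter word which share the weight s^\<theta>. This is why the shorter
  word must be bounded for \<theta>/2 as well as for \<theta>.\<close>

lemma word_bound_Suc_0:
  assumes "1 < p" "1 \<le> M" "0 < \<theta>" and K: "word_bound p M n 0 \<theta> K1" "word_bound p M n 0 (\<theta> / 2) K2"
  shows "word_bound p M (Suc n) 0 \<theta> (K1 + 2 * M * K2 + M)"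
proof (rule word_boundI)
  fix \<eta> N X X' and t0 :: "(('b \<Rightarrow>\<^sub>L 'b) \<times> ('b \<Rightarrow>\<^sub>L 'b) \<times> ('b \<Rightarrow>\<^sub>L 'b)) list"
  assume a: "0 \<le> \<eta>" "length t0 = Suc n" "real 0 + \<theta> + real (Suc n) \<le> p" "close_pair p \<theta> (Suc n) M \<eta> X X'"
    and t0: "\<And>v Y Y'. (v, Y, Y') \<in> set t0 \<Longrightarrow> schatten p (N v) v \<and> close_pair p \<theta> (Suc n) M \<eta> Y Y'"
  obtain v Y Y' t where t: "t0 = (v, Y, Y') # t" "length t = n"
    using a(2) by (metis length_Suc_conv prod_cases3)
  have v: "schatten (p / 1) (N v) v" and Y: "close_pair p \<theta> (Suc n) M \<eta> Y Y'" using t0 t by auto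
  have tl: "\<And>v Y Y'. (v, Y, Y') \<in> set t \<Longrightarrow> schatten p (N v) v \<and> close_pair p \<theta> (Suc n) M \<eta> Y Y'"
    using t0 t by auto
  have tl': "schatten p (N u) u \<and> close_pair p \<theta> n M \<eta> Z Z'" if "(u, Z, Z') \<in> set t" for u Z Z'
    using tl [OF that] close_pair_mono_nat [of p \<theta> "Suc n" M \<eta> Z Z' n] by simp
  let ?P = "prod_list (map (\<lambda>x. N (fst x)) t)"
  let ?W = "\<lambda>s. scaled_word (Suc 0) s Y (left_word t)" and ?W' = "\<lambda>s. scaled_word (Suc 0) s Y' (right_word t)"
  let ?c = "\<lambda>s. cay ((1 / s) *\<^sub>R X)" and ?c' = "\<lambda>s. cay ((1 / s) *\<^sub>R X')"
  have 1: "pair_bounded p (1 + (real 0 + \<theta> + real n)) (real 0 + \<theta>) \<eta> (N v * (K1 * ?P)) (\<lambda>s. v o\<^sub>L ?W s) (\<lambda>s. v o\<^sub>L ?W' s)"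
  proof (rule pair_bounded_const_left [OF v])
    show "pair_bounded p (real 0 + \<theta> + real n) (real 0 + \<theta>) \<eta> (K1 * ?P) ?W ?W'"
      using tl' by (intro word_boundD [OF K(1) a(1) t(2)] close_pair_mono_nat [OF Y]) (use a in auto)
  qed (use a assms in auto)
  have 2: "pair_bounded p (1 + (real 0 + \<theta> / 2 + real n)) (real 0 + \<theta> / 2) \<eta> (N v * (K2 * ?P)) (\<lambda>s. v o\<^sub>L ?W s) (\<lambda>s. v o\<^sub>L ?W' s)"
  proof (rule pair_bounded_const_left [OF v])
    show "pair_bounded p (real 0 + \<theta> / 2 + real n) (real 0 + \<theta> / 2) \<eta> (K2 * ?P) ?W ?W'"
      using tl by (intro word_boundD [OF K(2) a(1) t(2)] close_pair_half [OF Y]) (use a assms in \<open>auto intro: close_pair_half\<close>)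
  qed (use a assms in auto)
  have "pair_bounded p (\<theta> / 2 ^ 1 + (1 + (real 0 + \<theta> / 2 + real n))) (\<theta> / 2 ^ 1 + (real 0 + \<theta> / 2)) \<eta>
      (2 * M * (N v * (K2 * ?P))) (\<lambda>s. ?c s o\<^sub>L (v o\<^sub>L ?W s)) (\<lambda>s. ?c' s o\<^sub>L (v o\<^sub>L ?W' s))"
    by (rule pair_bounded_compose [OF close_pair_cay [OF a(4) assms(2) a(1) assms(1,3)] 2]) (use a assms in auto)
  moreover have e2: "\<theta> / 2 ^ 1 + (1 + (real 0 + \<theta> / 2 + real n)) = 1 + (real 0 + \<theta> + real n)"
    "\<theta> / 2 ^ 1 + (real 0 + \<theta> / 2) = real 0 + \<theta>" by simp_all
  ultimately have 3: "pair_bounded p (1 + (real 0 + \<theta> + real n)) (real 0 + \<theta>) \<eta>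
      (2 * M * (N v * (K2 * ?P))) (\<lambda>s. ?c s o\<^sub>L (v o\<^sub>L ?W s)) (\<lambda>s. ?c' s o\<^sub>L (v o\<^sub>L ?W' s))"
    by (simp only: e2)
  have fst: "map fst (left_word t) = map fst t" "map fst (right_word t) = map fst t"
    by (auto simp: left_word_def right_word_def)
  have "schatten (p / length (v # map fst t)) (prod_list (map N (v # map fst t))) (opsprod (v # map fst t))"
  proof (rule schatten_opsprod)
    fix u assume "u \<in> set (v # map fst t)"
    then show "schatten p (N u) u" using v tl' by auto
  qed (use t a assms in auto)
  then have ops: "schatten (p / (1 + real n)) (N v * ?P) (opsprod (v # map fst t))"
    using t by (simp add: o_def)
  have "pair_bounded p (\<theta> / 2 ^ 0 + (1 + real n)) (\<theta> / 2 ^ 0) \<eta> (M * (N v * ?P))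
      (\<lambda>s. ?c s o\<^sub>L opsprod (v # map fst t)) (\<lambda>s. ?c' s o\<^sub>L opsprod (v # map fst t))"
    by (rule pair_bounded_const_right [OF close_pair_cay [OF a(4) assms(2) a(1) assms(1,3)] ops]) (use a assms in auto)
  moreover have e0: "\<theta> / 2 ^ 0 + (1 + real n) = 1 + (real 0 + \<theta> + real n)" "\<theta> / 2 ^ 0 = real 0 + \<theta>" by simp_all
  ultimately have 4: "pair_bounded p (1 + (real 0 + \<theta> + real n)) (real 0 + \<theta>) \<eta> (M * (N v * ?P))
      (\<lambda>s. ?c s o\<^sub>L opsprod (v # map fst t)) (\<lambda>s. ?c' s o\<^sub>L opsprod (v # map fst t))"
    by (simp only: e0)
  have "pair_bounded p (1 + (real 0 + \<theta> + real n)) (real 0 + \<theta>) \<eta>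
      (N v * (K1 * ?P) + 2 * M * (N v * (K2 * ?P)) + M * (N v * ?P))
      (\<lambda>s. (v o\<^sub>L ?W s) - (?c s o\<^sub>L (v o\<^sub>L ?W s)) - (?c s o\<^sub>L opsprod (v # map fst t)))
      (\<lambda>s. (v o\<^sub>L ?W' s) - (?c' s o\<^sub>L (v o\<^sub>L ?W' s)) - (?c' s o\<^sub>L opsprod (v # map fst t)))"
    by (intro pair_bounded_diff 1 3 4) (use a assms in auto)
  moreover have "scaled_word (Suc 0) s X (left_word t0)
      = (v o\<^sub>L ?W s) - (?c s o\<^sub>L (v o\<^sub>L ?W s)) - (?c s o\<^sub>L opsprod (v # map fst t))" for s
  proof -
    have "left_word t0 = (v, Y) # left_word t" by (simp add: t left_word_def)
    moreover have "skew Y" "\<And>u Z. (u, Z) \<in> set (left_word t) \<Longrightarrow> skew Z"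
      using Y tl by (auto simp: left_word_def close_pair_def admissible_def)
    ultimately show ?thesis by (simp only: scaled_word_Cons fst)
  qed
  moreover have "scaled_word (Suc 0) s X' (right_word t0)
      = (v o\<^sub>L ?W' s) - (?c' s o\<^sub>L (v o\<^sub>L ?W' s)) - (?c' s o\<^sub>L opsprod (v # map fst t))" for s
  proof -
    have "right_word t0 = (v, Y') # right_word t" by (simp add: t right_word_def)
    moreover have "skew Y'" "\<And>u Z. (u, Z) \<in> set (right_word t) \<Longrightarrow> skew Z"
      using Y tl by (auto simp: right_word_def close_pair_def admissible_def)
    ultimately show ?thesis by (simp only: scaled_word_Cons fst)
  qed
  moreover have "N v * (K1 * ?P) + 2 * M * (N v * (K2 * ?P)) + M * (N v * ?P)
      = (K1 + 2 * M * K2 + M) * prod_list (map (\<lambda>x. N (fst x)) t0)"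
    by (simp add: t algebra_simps)
  moreover have "1 + (real 0 + \<theta> + real n) = real 0 + \<theta> + real (Suc n)" by simp
  ultimately show "pair_bounded p (real 0 + \<theta> + real (Suc n)) (real 0 + \<theta>) \<eta>
      ((K1 + 2 * M * K2 + M) * prod_list (map (\<lambda>x. N (fst x)) t0))
      (\<lambda>s. scaled_word (Suc 0) s X (left_word t0)) (\<lambda>s. scaled_word (Suc 0) s X' (right_word t0))"
    by (simp only:)
qed

lemma word_bound_Suc_Suc:
  assumes "1 < p" "1 \<le> M" "0 < \<theta>" and K: "word_bound p M n (Suc k) \<theta> K1" "word_bound p M (Suc n) k \<theta> K2"
  shows "word_bound p M (Suc n) (Suc k) \<theta> (K1 + 2 * M * K2)"
proof (rule word_boundI)
  fix \<eta> N X X' and t0 :: "(('b \<Rightarrow>\<^sub>L 'b) \<times> ('b \<Rightarrow>\<^sub>L 'b) \<times> ('b \<Rightarrow>\<^sub>L 'b)) list"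
  assume a: "0 \<le> \<eta>" "length t0 = Suc n" "real (Suc k) + \<theta> + real (Suc n) \<le> p" "close_pair p \<theta> (Suc n) M \<eta> X X'"
    and t0: "\<And>v Y Y'. (v, Y, Y') \<in> set t0 \<Longrightarrow> schatten p (N v) v \<and> close_pair p \<theta> (Suc n) M \<eta> Y Y'"
  obtain v Y Y' t where t: "t0 = (v, Y, Y') # t" "length t = n"
    using a(2) by (metis length_Suc_conv prod_cases3)
  have v: "schatten (p / 1) (N v) v" and Y: "close_pair p \<theta> (Suc n) M \<eta> Y Y'" using t0 t by auto
  have tl: "\<And>v Y Y'. (v, Y, Y') \<in> set t \<Longrightarrow> schatten p (N v) v \<and> close_pair p \<theta> (Suc n) M \<eta> Y Y'"
    using t0 t by auto
  have tl': "schatten p (N u) u \<and> close_pair p \<theta> n M \<eta> Z Z'" if "(u, Z, Z') \<in> set t" for u Z Z'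
    using tl [OF that] close_pair_mono_nat [of p \<theta> "Suc n" M \<eta> Z Z' n] by simp
  let ?P = "prod_list (map (\<lambda>x. N (fst x)) t)"
  let ?W = "\<lambda>s. scaled_word (Suc (Suc k)) s Y (left_word t)" and ?W' = "\<lambda>s. scaled_word (Suc (Suc k)) s Y' (right_word t)"
  let ?V = "\<lambda>s. scaled_word (Suc k) s X (left_word t0)" and ?V' = "\<lambda>s. scaled_word (Suc k) s X' (right_word t0)"
  let ?x = "real (Suc k) + \<theta> + real (Suc n)" and ?y = "real (Suc k) + \<theta>"
  have "pair_bounded p (1 + (real (Suc k) + \<theta> + real n)) ?y \<eta> (N v * (K1 * ?P)) (\<lambda>s. v o\<^sub>L ?W s) (\<lambda>s. v o\<^sub>L ?W' s)"
  proof (rule pair_bounded_const_left [OF v])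
    show "pair_bounded p (real (Suc k) + \<theta> + real n) (real (Suc k) + \<theta>) \<eta> (K1 * ?P) ?W ?W'"
      using tl' by (intro word_boundD [OF K(1) a(1) t(2)] close_pair_mono_nat [OF Y]) (use a in auto)
  qed (use a assms in auto)
  moreover have e1: "1 + (real (Suc k) + \<theta> + real n) = ?x" by simp
  ultimately have 1: "pair_bounded p ?x ?y \<eta> (N v * (K1 * ?P)) (\<lambda>s. v o\<^sub>L ?W s) (\<lambda>s. v o\<^sub>L ?W' s)"
    by (simp only: e1)
  have "pair_bounded p (1 + (real k + \<theta> + real (Suc n))) (real k + \<theta> + 1) \<eta>
      (2 * M * (K2 * prod_list (map (\<lambda>x. N (fst x)) t0)))
      (\<lambda>s. ((1 / s) *\<^sub>R X) o\<^sub>L ?V s) (\<lambda>s. ((1 / s) *\<^sub>R X') o\<^sub>L ?V' s)"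
  proof (rule pair_bounded_scaled_left)
    show "pair_bounded p (real k + \<theta> + real (Suc n)) (real k + \<theta>) \<eta> (K2 * prod_list (map (\<lambda>x. N (fst x)) t0)) ?V ?V'"
      by (rule word_boundD [OF K(2) a(1,2) _ a(4) t0]) (use a in auto)
  qed (use a assms close_pair_schatten [OF a(4) assms(2) a(1) assms(1)] in auto)
  moreover have e2: "1 + (real k + \<theta> + real (Suc n)) = ?x" "real k + \<theta> + 1 = ?y" by simp_all
  ultimately have 2: "pair_bounded p ?x ?y \<eta> (2 * M * (K2 * prod_list (map (\<lambda>x. N (fst x)) t0)))
      (\<lambda>s. ((1 / s) *\<^sub>R X) o\<^sub>L ?V s) (\<lambda>s. ((1 / s) *\<^sub>R X') o\<^sub>L ?V' s)"
    by (simp only: e2)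
  have "pair_bounded p ?x ?y \<eta> (N v * (K1 * ?P) + 2 * M * (K2 * prod_list (map (\<lambda>x. N (fst x)) t0)))
      (\<lambda>s. (v o\<^sub>L ?W s) - (((1 / s) *\<^sub>R X) o\<^sub>L ?V s)) (\<lambda>s. (v o\<^sub>L ?W' s) - (((1 / s) *\<^sub>R X') o\<^sub>L ?V' s))"
    by (rule pair_bounded_diff [OF 1 2]) (use a assms in auto)
  moreover have "left_word t0 = (v, Y) # left_word t" "right_word t0 = (v, Y') # right_word t"
    by (simp_all add: t left_word_def right_word_def)
  then have "scaled_word (Suc (Suc k)) s X (left_word t0) = (v o\<^sub>L ?W s) - (((1 / s) *\<^sub>R X) o\<^sub>L ?V s)"
    "scaled_word (Suc (Suc k)) s X' (right_word t0) = (v o\<^sub>L ?W' s) - (((1 / s) *\<^sub>R X') o\<^sub>L ?V' s)" for s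
    by (simp_all only: scaled_word_Cons_Suc)
  moreover have "N v * (K1 * ?P) + 2 * M * (K2 * prod_list (map (\<lambda>x. N (fst x)) t0))
      = (K1 + 2 * M * K2) * prod_list (map (\<lambda>x. N (fst x)) t0)"
    by (simp add: t algebra_simps)
  ultimately show "pair_bounded p ?x ?y \<eta> ((K1 + 2 * M * K2) * prod_list (map (\<lambda>x. N (fst x)) t0))
      (\<lambda>s. scaled_word (Suc (Suc k)) s X (left_word t0)) (\<lambda>s. scaled_word (Suc (Suc k)) s X' (right_word t0))"
    by (simp only:)
qed

text \<open>Splitting off the first argument shortens the word, splitting off a factor X/s lowers
  the degree, so the induction on the degree sits inside that on the length. \<theta> is generalized
  because of the halving.\<close>

theorem word_bound_exists:
  assumes "1 < p" "1 \<le> M" "0 < \<theta>"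
  shows "\<exists>K\<ge>0. word_bound p M n k \<theta> K"
  using assms(3)
proof (induction n arbitrary: k \<theta>)
  case 0
  show ?case
  proof (induction k)
    case 0
    show ?case using word_bound_0_0 [OF assms(1,2) \<open>0 < \<theta>\<close>] assms(2) by (intro exI [of _ M]) simp
  next
    case (Suc k)
    then obtain K where K: "K \<ge> 0" "word_bound p M 0 k \<theta> K" by blast
    have "word_bound p M 0 (Suc k) \<theta> (2 * M * K)"
      by (rule word_bound_0_Suc [OF assms(1,2) \<open>0 < \<theta>\<close> K(2)])
    then show ?case using K(1) assms(2) by (intro exI [of _ "2 * M * K"]) simp
  qed
next
  case (Suc n)
  show ?case
  proof (induction k)
    case 0
    obtain K1 where K1: "K1 \<ge> 0" "word_bound p M n 0 \<theta> K1" using Suc.IH Suc.prems by blast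
    obtain K2 where K2: "K2 \<ge> 0" "word_bound p M n 0 (\<theta> / 2) K2" using Suc.IH [of "\<theta> / 2" 0] Suc.prems by auto
    have "word_bound p M (Suc n) 0 \<theta> (K1 + 2 * M * K2 + M)"
      by (rule word_bound_Suc_0 [OF assms(1,2) Suc.prems K1(2) K2(2)])
    then show ?case using K1(1) K2(1) assms(2) by (intro exI [of _ "K1 + 2 * M * K2 + M"]) simp
  next
    case (Suc k)
    obtain K1 where K1: "K1 \<ge> 0" "word_bound p M n (Suc k) \<theta> K1" using Suc.prems \<open>0 < \<theta>\<close> Suc.IH
      \<open>\<And>\<theta> k. 0 < \<theta> \<Longrightarrow> \<exists>K\<ge>0. word_bound p M n k \<theta> K\<close> by blast
    obtain K2 where K2: "K2 \<ge> 0" "word_bound p M (Suc n) k \<theta> K2" using Suc.IH by blast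
    have "word_bound p M (Suc n) (Suc k) \<theta> (K1 + 2 * M * K2)"
      by (rule word_bound_Suc_Suc [OF assms(1,2) \<open>0 < \<theta>\<close> K1(2) K2(2)])
    then show ?case using K1(1) K2(1) assms(2) by (intro exI [of _ "K1 + 2 * M * K2"]) simp
  qed
qed

end


section \<open>Trace integrals\<close>

text \<open>Mapping each dyadic interval onto [1, 2) turns the integral into one over [1, 2), of
  length 1, whose integrand is a dyadic sum and at most \<open>C\<close>.\<close>

lemma nn_integral_dyadic_le:
  fixes F :: "real \<Rightarrow> real"
  assumes F [measurable]: "F \<in> borel_measurable borel" and F0: "\<And>x. x \<le> 0 \<Longrightarrow> F x = 0"
    and le: "\<And>s (J :: int set). s > 0 \<Longrightarrow> finite J \<Longrightarrow>
      (\<Sum>j\<in>J. (s * 2 powr j) * \<bar>F (s * 2 powr j)\<bar>) \<le> C"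
  shows "(\<integral>\<^sup>+ x. ennreal \<bar>F x\<bar> \<partial>lborel) \<le> ennreal C"
proof -
  have C: "C \<ge> 0" using le [of 1 "{}"] by simp
  \<comment> \<open>The hypothesis speaks of finite sets of scales; monotone convergence removes
    this cut-off at the end.\<close>
  define U where "U N = {2 powr (- real N) ..< 2 powr real N}" for N :: nat
  define G where "G N x = ennreal \<bar>F x\<bar> * indicator (U N) x" for N x
  have UN: "U N \<subseteq> U M" if "N \<le> M" for N M
  proof
    fix x assume "x \<in> U N"
    moreover have "2 powr (- real M) \<le> (2 powr (- real N) :: real)" "2 powr real N \<le> (2 powr real M :: real)"
      using that by (auto intro!: powr_mono)
    ultimately show "x \<in> U M"
      unfolding U_def atLeastLessThan_iff by (meson order_trans less_le_trans)
  qed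
  have inc: "incseq G"
    using UN by (auto simp: incseq_def le_fun_def G_def intro!: mult_left_mono split: split_indicator)
  have [measurable]: "G N \<in> borel_measurable lborel" for N
    unfolding G_def U_def by measurable
  have sup: "(SUP N. G N x) = ennreal \<bar>F x\<bar>" for x
  proof (rule antisym)
    show "(SUP N. G N x) \<le> ennreal \<bar>F x\<bar>"
      by (rule SUP_least) (auto simp: G_def split: split_indicator)
    show "ennreal \<bar>F x\<bar> \<le> (SUP N. G N x)"
    proof (cases "x \<le> 0")
      case False
      then have x: "x > 0" by simp
      obtain N :: nat where N: "\<bar>log 2 x\<bar> < real N" using reals_Archimedean2 by blast
      have "2 powr (- real N) \<le> 2 powr (log 2 x)" "2 powr (log 2 x) < (2 powr real N :: real)"
        using N by (auto intro!: powr_mono powr_less_mono)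
      then have "x \<in> U N" using x by (simp add: U_def)
      then have "ennreal \<bar>F x\<bar> = G N x" by (simp add: G_def)
      then show ?thesis using SUP_upper [of N UNIV "\<lambda>N. G N x"] by simp
    qed (simp add: F0)
  qed
  have GN: "(\<integral>\<^sup>+ x. G N x \<partial>lborel) \<le> ennreal C" for N
  proof -
    let ?J = "{- int N ..< int N}"
    let ?I = "\<lambda>j::int. {2 powr real_of_int j ..< 2 powr (real_of_int j + 1)}"
    have cover: "G N x \<le> (\<Sum>j\<in>?J. ennreal \<bar>F x\<bar> * indicator (?I j) x)" for x
    proof (cases "x \<in> U N")
      case True
      then have x: "x > 0" "2 powr (- real N) \<le> x" "x < 2 powr real N"
        by (auto simp: U_def intro: less_le_trans [of 0 "2 powr (- real N)"])
      define j where "j = \<lfloor>log 2 x\<rfloor>"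
      have "- real N \<le> log 2 x" "log 2 x < real N"
        using x by (auto simp: le_log_iff log_less_iff)
      then have jJ: "j \<in> ?J" unfolding j_def by (auto simp: le_floor_iff floor_less_iff)
      have "real_of_int j \<le> log 2 x" "log 2 x < real_of_int j + 1" by (auto simp: j_def)
      then have "x \<in> ?I j" using x(1) by (auto simp: le_log_iff log_less_iff)
      then have "G N x = ennreal \<bar>F x\<bar> * indicator (?I j) x" using True by (simp add: G_def)
      also have "\<dots> \<le> (\<Sum>j\<in>?J. ennreal \<bar>F x\<bar> * indicator (?I j) x)"
        by (rule member_le_sum [OF jJ]) auto
      finally show ?thesis .
    qed (simp add: G_def)
    have "(\<integral>\<^sup>+ x. G N x \<partial>lborel) \<le> (\<integral>\<^sup>+ x. (\<Sum>j\<in>?J. ennreal \<bar>F x\<bar> * indicator (?I j) x) \<partial>lborel)"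
      by (rule nn_integral_mono) (rule cover)
    also have "\<dots> = (\<Sum>j\<in>?J. \<integral>\<^sup>+ x. ennreal \<bar>F x\<bar> * indicator (?I j) x \<partial>lborel)"
      by (rule nn_integral_sum) measurable
    also have "\<dots> = (\<Sum>j\<in>?J. \<integral>\<^sup>+ x. ennreal (2 powr real_of_int j) * (ennreal \<bar>F (2 powr real_of_int j * x)\<bar> * indicator {1..<2} x) \<partial>lborel)"
    proof (rule sum.cong)
      fix j :: int
      have ind: "indicator (?I j) (2 powr real_of_int j * x) = (indicator {1..<2} x :: ennreal)" for x
        by (auto simp: powr_add split: split_indicator)
      have "(\<integral>\<^sup>+ x. ennreal \<bar>F x\<bar> * indicator (?I j) x \<partial>lborel)
          = ennreal \<bar>2 powr real_of_int j\<bar> * (\<integral>\<^sup>+ x. ennreal \<bar>F (0 + 2 powr real_of_int j * x)\<bar> * indicator (?I j) (0 + 2 powr real_of_int j * x) \<partial>lborel)"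
      proof (rule nn_integral_real_affine)
        have [measurable]: "?I j \<in> sets borel" by simp
        show "(\<lambda>x. ennreal \<bar>F x\<bar> * indicator (?I j) x) \<in> borel_measurable borel" by measurable
      qed simp
      also have "\<dots> = (\<integral>\<^sup>+ x. ennreal (2 powr real_of_int j) * (ennreal \<bar>F (2 powr real_of_int j * x)\<bar> * indicator {1..<2} x) \<partial>lborel)"
        by (subst nn_integral_cmult [symmetric]) (simp_all add: ind)
      finally show "(\<integral>\<^sup>+ x. ennreal \<bar>F x\<bar> * indicator (?I j) x \<partial>lborel)
          = (\<integral>\<^sup>+ x. ennreal (2 powr real_of_int j) * (ennreal \<bar>F (2 powr real_of_int j * x)\<bar> * indicator {1..<2} x) \<partial>lborel)" .
    qed simp
    also have "\<dots> = (\<integral>\<^sup>+ x. (\<Sum>j\<in>?J. ennreal (2 powr real_of_int j) * (ennreal \<bar>F (2 powr real_of_int j * x)\<bar> * indicator {1..<2} x)) \<partial>lborel)"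
      by (rule nn_integral_sum [symmetric]) measurable
    also have "\<dots> \<le> (\<integral>\<^sup>+ x. ennreal C * indicator {1..<2::real} x \<partial>lborel)"
    proof (rule nn_integral_mono)
      fix x :: real
      show "(\<Sum>j\<in>?J. ennreal (2 powr real_of_int j) * (ennreal \<bar>F (2 powr real_of_int j * x)\<bar> * indicator {1..<2} x))
          \<le> ennreal C * indicator {1..<2} x"
      proof (cases "x \<in> {1..<2}")
        case True
        then have x: "x \<ge> 1" by simp
        \<comment> \<open>The substitution yields only the factor 2^j, the hypothesis has x 2^j.
          Since x is at least 1, the replacement increases the sum.\<close>
        have "(\<Sum>j\<in>?J. 2 powr real_of_int j * \<bar>F (2 powr real_of_int j * x)\<bar>)
            \<le> (\<Sum>j\<in>?J. (x * 2 powr real_of_int j) * \<bar>F (x * 2 powr real_of_int j)\<bar>)"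
        proof (rule sum_mono)
          fix j :: int
          have "1 * (2 powr real_of_int j * \<bar>F (2 powr real_of_int j * x)\<bar>)
              \<le> x * (2 powr real_of_int j * \<bar>F (2 powr real_of_int j * x)\<bar>)"
            using x by (intro mult_right_mono) auto
          then show "2 powr real_of_int j * \<bar>F (2 powr real_of_int j * x)\<bar>
              \<le> (x * 2 powr real_of_int j) * \<bar>F (x * 2 powr real_of_int j)\<bar>"
            by (simp add: mult_ac)
        qed
        also have "\<dots> \<le> C" using x by (intro le) auto
        finally have "ennreal (\<Sum>j\<in>?J. 2 powr real_of_int j * \<bar>F (2 powr real_of_int j * x)\<bar>) \<le> ennreal C"
          by (rule ennreal_leI)
        moreover have "(\<Sum>j\<in>?J. ennreal (2 powr real_of_int j) * (ennreal \<bar>F (2 powr real_of_int j * x)\<bar> * indicator {1..<2} x))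
            = ennreal (\<Sum>j\<in>?J. 2 powr real_of_int j * \<bar>F (2 powr real_of_int j * x)\<bar>)"
          using True by (simp add: ennreal_mult sum_ennreal [symmetric])
        ultimately show ?thesis using True by simp
      qed auto
    qed
    also have "\<dots> = ennreal C" by (simp add: nn_integral_cmult_indicator)
    finally show ?thesis .
  qed
  have "(\<integral>\<^sup>+ x. ennreal \<bar>F x\<bar> \<partial>lborel) = (\<integral>\<^sup>+ x. (SUP N. G N x) \<partial>lborel)" by (simp add: sup)
  also have "\<dots> = (SUP N. \<integral>\<^sup>+ x. G N x \<partial>lborel)"
    by (rule nn_integral_monotone_convergence_SUP [OF inc]) measurable
  also have "\<dots> \<le> ennreal C" by (rule SUP_least) (rule GN)
  finally show ?thesis .
qed

lemma dyadic_set_integrable: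
  fixes f :: "real \<Rightarrow> real"
  assumes f: "continuous_on {0<..} f"
    and le: "\<And>s (J :: int set). s > 0 \<Longrightarrow> finite J \<Longrightarrow>
      (\<Sum>j\<in>J. (s * 2 powr j) * \<bar>f (s * 2 powr j)\<bar>) \<le> C"
  shows "set_integrable lborel {0<..} f" "\<bar>set_lebesgue_integral lborel {0<..} f\<bar> \<le> C"
proof -
  define F where "F x = indicator {0<..} x *\<^sub>R f x" for x
  have C: "C \<ge> 0" using le [of 1 "{}"] by simp
  have F [measurable]: "F \<in> borel_measurable borel"
    unfolding F_def by (rule borel_measurable_continuous_on_indicator [OF _ f]) simp
  have nn: "(\<integral>\<^sup>+ x. ennreal \<bar>F x\<bar> \<partial>lborel) \<le> ennreal C"
  proof (rule nn_integral_dyadic_le [OF F])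
    fix s :: real and J :: "int set" assume s: "s > 0" "finite J"
    have "(\<Sum>j\<in>J. (s * 2 powr j) * \<bar>F (s * 2 powr j)\<bar>) = (\<Sum>j\<in>J. (s * 2 powr j) * \<bar>f (s * 2 powr j)\<bar>)"
      using s by (simp add: F_def)
    with le [OF s] show "(\<Sum>j\<in>J. (s * 2 powr j) * \<bar>F (s * 2 powr j)\<bar>) \<le> C" by simp
  qed (simp add: F_def)
  have int: "integrable lborel F"
    by (rule integrableI_bounded) (use nn in \<open>auto intro: le_less_trans\<close>)
  then show "set_integrable lborel {0<..} f" by (simp add: set_integrable_def F_def [abs_def])
  have "ennreal \<bar>integral\<^sup>L lborel F\<bar> \<le> ennreal C"
    by (rule order_trans [OF integral_norm_bound_ennreal [OF int, unfolded real_norm_def] nn])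
  then show "\<bar>set_lebesgue_integral lborel {0<..} f\<bar> \<le> C"
    using C by (simp add: set_lebesgue_integral_def F_def [abs_def])
qed

context real_hilbert
begin

section \<open>Traces of dyadically bounded families\<close>

lemma optrace_zero: "optrace 0 = 0"
  using optrace_scaleR [OF schatten_zero, of 0] by simp

lemma optrace_sum:
  assumes "finite I" "\<And>i. i \<in> I \<Longrightarrow> schatten 1 (C i) (Z i)"
  shows "optrace (\<Sum>i\<in>I. Z i) = (\<Sum>i\<in>I. optrace (Z i))"
  using assms
proof (induction I rule: finite_induct)
  case (insert i I)
  then have "optrace (Z i + sum Z I) = optrace (Z i) + optrace (sum Z I)"
    by (intro optrace_add [OF _ schatten_sum [of I 1 C Z]]) auto
  then show ?case using insert by simp
qed (simp add: optrace_zero)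

text \<open>With \<sigma> taken as the signs of the traces, the bound for a signed sum becomes one
  for the sum of absolute values.\<close>

lemma dyadic_trace_sum:
  assumes Z: "dyadic_bounded 1 \<alpha> C Z" and s: "s > 0" and J: "finite (J :: int set)"
  shows "(\<Sum>j\<in>J. (s * 2 powr j) powr \<alpha> * \<bar>optrace (Z (s * 2 powr j))\<bar>) \<le> C"
proof -
  define \<sigma> :: "int \<Rightarrow> real" where "\<sigma> j = (if optrace (Z (s * 2 powr j)) < 0 then - 1 else 1)" for j
  have "schatten 1 C (\<Sum>j\<in>J. (\<sigma> j * (s * 2 powr j) powr \<alpha>) *\<^sub>R Z (s * 2 powr j))"
    by (rule dyadic_boundedD [OF Z s J]) (simp add: \<sigma>_def)
  then have "\<bar>optrace (\<Sum>j\<in>J. (\<sigma> j * (s * 2 powr j) powr \<alpha>) *\<^sub>R Z (s * 2 powr j))\<bar> \<le> C"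
    by (rule optrace_abs_le)
  moreover have "optrace (\<Sum>j\<in>J. (\<sigma> j * (s * 2 powr j) powr \<alpha>) *\<^sub>R Z (s * 2 powr j))
      = (\<Sum>j\<in>J. (s * 2 powr j) powr \<alpha> * \<bar>optrace (Z (s * 2 powr j))\<bar>)"
  proof -
    have Zj: "schatten 1 ((s * 2 powr real_of_int j) powr (- \<alpha>) * C) (Z (s * 2 powr real_of_int j))" for j
      using s by (intro dyadic_bounded_single [OF Z]) simp
    have "optrace (\<Sum>j\<in>J. (\<sigma> j * (s * 2 powr j) powr \<alpha>) *\<^sub>R Z (s * 2 powr j))
        = (\<Sum>j\<in>J. optrace ((\<sigma> j * (s * 2 powr j) powr \<alpha>) *\<^sub>R Z (s * 2 powr j)))"
      by (rule optrace_sum [OF J schatten_scaleR [OF Zj]])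
    also have "\<dots> = (\<Sum>j\<in>J. (s * 2 powr j) powr \<alpha> * \<bar>optrace (Z (s * 2 powr j))\<bar>)"
      by (intro sum.cong) (auto simp: optrace_scaleR [OF Zj] \<sigma>_def)
    finally show ?thesis .
  qed
  ultimately show ?thesis by simp
qed

lemma dyadic_bounded_zero: "dyadic_bounded q \<alpha> 0 (\<lambda>s. 0)"
  by (rule dyadic_boundedI) (simp add: schatten_zero)

lemma half_powers: "0 < \<theta> \<Longrightarrow> \<theta> < 1 \<Longrightarrow> 0 < \<theta> / 2 ^ i \<and> \<theta> / 2 ^ i < (1::real)"
proof -
  assume \<theta>: "0 < \<theta>" "\<theta> < 1"
  have "1 \<le> (2::real) ^ i" by simp
  then have "\<theta> < 2 ^ i" using \<theta>(2) by linarith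
  then show ?thesis using \<theta> by (simp add: divide_less_eq)
qed

text \<open>One \<open>M\<close> has to serve the whole Schatten ball and all levels of halving, for
  then the constants of \<open>word_bound\<close> are uniform in the points. A sum over the levels
  is used in place of their maximum.\<close>

lemma admissible_ball:
  assumes p: "1 < p" and \<theta>: "0 < \<theta>" "\<theta> < 1" and C: "0 \<le> C"
  obtains M where "1 \<le> M" "\<And>X. skew X \<Longrightarrow> schatten p C X \<Longrightarrow> admissible p \<theta> n M X"
proof -
  define c where "c i = 2 * dyadic_const (\<theta> / 2 ^ i) * C powr (\<theta> / 2 ^ i)" for i
  have c: "c i \<ge> 0" for i
    using dyadic_const_pos half_powers [OF \<theta>, of i] by (simp add: c_def less_imp_le)
  define M where "M = 1 + C + (\<Sum>i\<le>n. c i)"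
  have sum: "(\<Sum>i\<le>n. c i) \<ge> 0" by (intro sum_nonneg c)
  have ci: "c i \<le> M" if "i \<le> n" for i
  proof -
    have "c i \<le> (\<Sum>i\<le>n. c i)" using that c by (intro member_le_sum) auto
    then show ?thesis using C by (simp add: M_def)
  qed
  have "admissible p \<theta> n M X" if X: "skew X" "schatten p C X" for X
    unfolding admissible_def
  proof (intro conjI allI impI)
    show "schatten p M X" by (rule schatten_mono [OF X(2)]) (use sum p in \<open>auto simp: M_def\<close>)
    fix i assume i: "i \<le> n"
    have h: "0 < \<theta> / 2 ^ i" "\<theta> / 2 ^ i < 1" using half_powers [OF \<theta>, of i] by auto
    have "dyadic_bounded (p / (\<theta> / 2 ^ i)) (\<theta> / 2 ^ i) (c i) (\<lambda>s. cay ((1 / s) *\<^sub>R X))"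
      unfolding c_def by (rule dyadic_bounded_cay [OF X _ h]) (use p in simp)
    then show "dyadic_bounded (p / (\<theta> / 2 ^ i)) (\<theta> / 2 ^ i) M (\<lambda>s. cay ((1 / s) *\<^sub>R X))"
      by (rule dyadic_bounded_mono [OF _ ci [OF i]]) (use p \<theta> in simp)
  qed (rule X(1))
  moreover have "1 \<le> M" using C sum by (simp add: M_def)
  ultimately show ?thesis using that by blast
qed

text \<open>There are finitely many levels of halving up to \<open>n\<close>, so the smallest of
  their \<delta> serves for all of them.\<close>

lemma close_to_near:
  assumes p: "1 < p" and \<theta>: "0 < \<theta>" "\<theta> < 1" and X: "skew X" "schatten p C X" and \<epsilon>: "\<epsilon> > 0"
  obtains \<delta> where "\<delta> > 0" "\<And>X'. skew X' \<Longrightarrow> schatten p \<delta> (X' - X) \<Longrightarrow> close_to p \<theta> n \<epsilon> X' X"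
proof -
  have "\<exists>\<delta>>0. \<forall>X'. skew X' \<longrightarrow> schatten p \<delta> (X' - X) \<longrightarrow>
      dyadic_bounded (p / (\<theta> / 2 ^ i)) (\<theta> / 2 ^ i) \<epsilon> (\<lambda>s. cay ((1 / s) *\<^sub>R X') - cay ((1 / s) *\<^sub>R X))" for i
  proof -
    have h: "0 < \<theta> / 2 ^ i" "\<theta> / 2 ^ i < 1" using half_powers [OF \<theta>, of i] by auto
    show ?thesis by (rule dyadic_bounded_cay_diff [OF X p h \<epsilon>]) blast
  qed
  then have "\<exists>d. \<forall>i. 0 < d i \<and> (\<forall>X'. skew X' \<longrightarrow> schatten p (d i) (X' - X) \<longrightarrow>
      dyadic_bounded (p / (\<theta> / 2 ^ i)) (\<theta> / 2 ^ i) \<epsilon> (\<lambda>s. cay ((1 / s) *\<^sub>R X') - cay ((1 / s) *\<^sub>R X)))"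
    by (rule choice [OF allI])
  then obtain d where dd: "\<forall>i. 0 < d i \<and> (\<forall>X'. skew X' \<longrightarrow> schatten p (d i) (X' - X) \<longrightarrow>
      dyadic_bounded (p / (\<theta> / 2 ^ i)) (\<theta> / 2 ^ i) \<epsilon> (\<lambda>s. cay ((1 / s) *\<^sub>R X') - cay ((1 / s) *\<^sub>R X)))" ..
  have d: "d i > 0" "skew X' \<Longrightarrow> schatten p (d i) (X' - X) \<Longrightarrow>
      dyadic_bounded (p / (\<theta> / 2 ^ i)) (\<theta> / 2 ^ i) \<epsilon> (\<lambda>s. cay ((1 / s) *\<^sub>R X') - cay ((1 / s) *\<^sub>R X))" for i X'
    using dd by simp_all
  define \<delta> where "\<delta> = min \<epsilon> (Min (d ` {..n}))"
  have le: "\<delta> \<le> \<epsilon>" "\<And>i. i \<le> n \<Longrightarrow> \<delta> \<le> d i" by (auto simp: \<delta>_def intro: min.coboundedI2)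
  have "\<delta> > 0" using d(1) \<epsilon> by (simp add: \<delta>_def)
  moreover have "close_to p \<theta> n \<epsilon> X' X" if X': "skew X'" "schatten p \<delta> (X' - X)" for X'
    unfolding close_to_def
  proof (intro conjI allI impI)
    show "schatten p \<epsilon> (X' - X)" by (rule schatten_mono [OF X'(2) le(1)]) (use p in simp)
    fix i assume i: "i \<le> n"
    show "dyadic_bounded (p / (\<theta> / 2 ^ i)) (\<theta> / 2 ^ i) \<epsilon> (\<lambda>s. cay ((1 / s) *\<^sub>R X') - cay ((1 / s) *\<^sub>R X))"
      by (rule d(2) [OF X'(1) schatten_mono [OF X'(2) le(2) [OF i]]]) (use p in simp)
  qed
  ultimately show ?thesis using that by blast
qed

section \<open>Words of trace class: uniform bounds and continuity in s\<close>

definition tame_word :: "real \<Rightarrow> real \<Rightarrow> (('b \<Rightarrow>\<^sub>L 'b) \<Rightarrow> real) \<Rightarrow> (('b \<Rightarrow>\<^sub>L 'b) \<times> ('b \<Rightarrow>\<^sub>L 'b)) list \<Rightarrow> bool" where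
  "tame_word p C N w \<longleftrightarrow> (\<forall>(v, Y)\<in>set w. schatten p (N v) v \<and> skew Y \<and> schatten p C Y)"

lemma tame_wordD: "tame_word p C N w \<Longrightarrow> (v, Y) \<in> set w \<Longrightarrow> schatten p (N v) v \<and> skew Y \<and> schatten p C Y"
  unfolding tame_word_def by blast

definition uniform_word_bound :: "real \<Rightarrow> real \<Rightarrow> nat \<Rightarrow> nat \<Rightarrow> real \<Rightarrow> real \<Rightarrow> bool" where
  "uniform_word_bound p \<theta> k n C K \<longleftrightarrow> (\<forall>\<eta> N X X' t. 0 \<le> \<eta> \<longrightarrow> length t = n \<longrightarrow>
     skew X \<longrightarrow> skew X' \<longrightarrow> schatten p C X \<longrightarrow> schatten p C X' \<longrightarrow> close_to p \<theta> n \<eta> X X' \<longrightarrow>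
     tame_word p C N (left_word t) \<longrightarrow> tame_word p C N (right_word t) \<longrightarrow>
     (\<forall>(v, Y, Y')\<in>set t. close_to p \<theta> n \<eta> Y Y') \<longrightarrow>
     dyadic_bounded 1 (real k + \<theta>) (K * prod_list (map (\<lambda>x. N (fst x)) t)) (\<lambda>s. scaled_word (Suc k) s X (left_word t)) \<and>
     dyadic_bounded 1 (real k + \<theta>) (K * \<eta> * prod_list (map (\<lambda>x. N (fst x)) t))
       (\<lambda>s. scaled_word (Suc k) s X (left_word t) - scaled_word (Suc k) s X' (right_word t)))"

lemma uniform_word_boundD:
  assumes "uniform_word_bound p \<theta> k n C K" "0 \<le> \<eta>" "length t = n" "skew X" "skew X'"
    "schatten p C X" "schatten p C X'" "close_to p \<theta> n \<eta> X X'"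
    "tame_word p C N (left_word t)" "tame_word p C N (right_word t)"
    "\<And>v Y Y'. (v, Y, Y') \<in> set t \<Longrightarrow> close_to p \<theta> n \<eta> Y Y'"
  shows "dyadic_bounded 1 (real k + \<theta>) (K * prod_list (map (\<lambda>x. N (fst x)) t)) (\<lambda>s. scaled_word (Suc k) s X (left_word t))"
    "dyadic_bounded 1 (real k + \<theta>) (K * \<eta> * prod_list (map (\<lambda>x. N (fst x)) t))
       (\<lambda>s. scaled_word (Suc k) s X (left_word t) - scaled_word (Suc k) s X' (right_word t))"
proof -
  have "\<forall>(v, Y, Y')\<in>set t. close_to p \<theta> n \<eta> Y Y'" using assms(11) by blast
  then show "dyadic_bounded 1 (real k + \<theta>) (K * prod_list (map (\<lambda>x. N (fst x)) t)) (\<lambda>s. scaled_word (Suc k) s X (left_word t))"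
    "dyadic_bounded 1 (real k + \<theta>) (K * \<eta> * prod_list (map (\<lambda>x. N (fst x)) t))
       (\<lambda>s. scaled_word (Suc k) s X (left_word t) - scaled_word (Suc k) s X' (right_word t))"
    using assms(1-10) unfolding uniform_word_bound_def by blast+
qed

text \<open>At the total k + \<theta> + n = p the Schatten exponent p / (k + \<theta> + n) has come
  down to 1, so the words have traces. The abstract \<open>M\<close> is traded for the radius
  \<open>C\<close> of a Schatten ball.\<close>

lemma uniform_word_bound_exists:
  assumes p: "1 < p" and \<theta>: "0 < \<theta>" "\<theta> < 1" and C: "0 \<le> C" and n: "real k + \<theta> + real n = p"
  obtains K where "K \<ge> 0" "uniform_word_bound p \<theta> k n C K"
proof -
  obtain M where M: "1 \<le> M" "\<And>X. skew X \<Longrightarrow> schatten p C X \<Longrightarrow> admissible p \<theta> n M X"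
    using admissible_ball [OF p \<theta> C] by blast
  obtain K where K: "K \<ge> 0" "word_bound p M n k \<theta> K" using word_bound_exists [OF p M(1) \<theta>(1)] by blast
  have "dyadic_bounded 1 (real k + \<theta>) (K * prod_list (map (\<lambda>x. N (fst x)) t)) (\<lambda>s. scaled_word (Suc k) s X (left_word t)) \<and>
      dyadic_bounded 1 (real k + \<theta>) (K * \<eta> * prod_list (map (\<lambda>x. N (fst x)) t))
        (\<lambda>s. scaled_word (Suc k) s X (left_word t) - scaled_word (Suc k) s X' (right_word t))"
    if a: "0 \<le> \<eta>" "length t = n" "skew X" "skew X'" "schatten p C X" "schatten p C X'" "close_to p \<theta> n \<eta> X X'"
      and w: "tame_word p C N (left_word t)" "tame_word p C N (right_word t)"
      and cl: "\<And>v Y Y'. (v, Y, Y') \<in> set t \<Longrightarrow> close_to p \<theta> n \<eta> Y Y'" for \<eta> N X X' t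
  proof -
    have "schatten p (N v) v \<and> close_pair p \<theta> n M \<eta> Y Y'" if vY: "(v, Y, Y') \<in> set t" for v Y Y'
    proof -
      have "(v, Y) \<in> set (left_word t)" "(v, Y') \<in> set (right_word t)"
        using vY by (force simp: left_word_def right_word_def)+
      then have "schatten p (N v) v" "skew Y" "schatten p C Y" "skew Y'" "schatten p C Y'"
        using tame_wordD [OF w(1)] tame_wordD [OF w(2)] by blast+
      then show ?thesis using M(2) cl [OF vY] by (simp add: close_pair_def)
    qed
    moreover have "close_pair p \<theta> n M \<eta> X X'" using a M(2) by (simp add: close_pair_def)
    ultimately have "pair_bounded p (real k + \<theta> + real n) (real k + \<theta>) \<eta> (K * prod_list (map (\<lambda>x. N (fst x)) t))
       (\<lambda>s. scaled_word (Suc k) s X (left_word t)) (\<lambda>s. scaled_word (Suc k) s X' (right_word t))"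
      using a n by (intro word_boundD [OF K(2)]) auto
    then show ?thesis using n p by (simp add: pair_bounded_def mult_ac)
  qed
  then have "uniform_word_bound p \<theta> k n C K" unfolding uniform_word_bound_def by blast
  with K(1) that show ?thesis by blast
qed

lemma scaled_word_rescale:
  "scaled_word k s X w = scaled_word k 1 ((1 / s) *\<^sub>R X) (map (\<lambda>(v, Y). (v, (1 / s) *\<^sub>R Y)) w)"
  by (simp add: scaled_word_def o_def case_prod_beta')

lemma close_to_refl:
  assumes "0 < p" "0 < \<theta>" "0 \<le> \<epsilon>"
  shows "close_to p \<theta> n \<epsilon> X X"
  unfolding close_to_def
proof (intro conjI allI impI)
  show "schatten p \<epsilon> (X - X)" using schatten_mono [OF schatten_zero assms(3,1)] by simp
  fix i
  have "0 < p / (\<theta> / 2 ^ i)" using assms by (intro divide_pos_pos) auto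
  then show "dyadic_bounded (p / (\<theta> / 2 ^ i)) (\<theta> / 2 ^ i) \<epsilon> (\<lambda>s. cay ((1 / s) *\<^sub>R X) - cay ((1 / s) *\<^sub>R X))"
    using dyadic_bounded_mono [OF dyadic_bounded_zero assms(3)] by simp
qed

lemma close_to_rescaled:
  assumes p: "1 < p" and \<theta>: "0 < \<theta>" "\<theta> < 1" and Z: "skew Z" "schatten p C Z" and s0: "s0 > 0" and \<epsilon>: "\<epsilon> > 0"
  shows "\<forall>\<^sub>F s in at s0. close_to p \<theta> n \<epsilon> ((1 / s) *\<^sub>R Z) ((1 / s0) *\<^sub>R Z)"
proof -
  have Z0: "skew ((1 / s0) *\<^sub>R Z)" "schatten p (\<bar>1 / s0\<bar> * C) ((1 / s0) *\<^sub>R Z)"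
    by (rule skew_scaleR [OF Z(1)], rule schatten_scaleR [OF Z(2)])
  obtain \<delta> where \<delta>: "\<delta> > 0"
    "\<And>X'. skew X' \<Longrightarrow> schatten p \<delta> (X' - (1 / s0) *\<^sub>R Z) \<Longrightarrow> close_to p \<theta> n \<epsilon> X' ((1 / s0) *\<^sub>R Z)"
    using close_to_near [OF p \<theta> Z0 \<epsilon>] by blast
  have "((\<lambda>s. \<bar>1 / s - 1 / s0\<bar> * C) \<longlongrightarrow> \<bar>1 / s0 - 1 / s0\<bar> * C) (at s0)"
    using s0 by (intro tendsto_intros) auto
  then have "\<forall>\<^sub>F s in at s0. \<bar>1 / s - 1 / s0\<bar> * C < \<delta>" using \<delta>(1) by (intro order_tendstoD(2)) auto
  then show ?thesis
  proof eventually_elim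
    case (elim s)
    have "schatten p (\<bar>1 / s - 1 / s0\<bar> * C) ((1 / s - 1 / s0) *\<^sub>R Z)" by (rule schatten_scaleR [OF Z(2)])
    then have "schatten p \<delta> ((1 / s) *\<^sub>R Z - (1 / s0) *\<^sub>R Z)"
      unfolding scaleR_diff_left by (rule schatten_mono) (use elim p in auto)
    then show ?case by (rule \<delta>(2) [OF skew_scaleR [OF Z(1)]])
  qed
qed

lemma tame_word_scaleR:
  assumes "tame_word p C N w" "\<bar>a\<bar> * C \<le> D" "0 < p"
  shows "tame_word p D N (map (\<lambda>(v, Y). (v, a *\<^sub>R Y)) w)"
  unfolding tame_word_def
proof (clarsimp)
  fix v Y assume "(v, Y) \<in> set w"
  then have *: "schatten p (N v) v" "skew Y" "schatten p C Y" using tame_wordD [OF assms(1)] by auto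
  have "schatten p D (a *\<^sub>R Y)"
    by (rule schatten_mono [OF schatten_scaleR [OF *(3)] assms(2,3)])
  then show "schatten p (N v) v \<and> skew (a *\<^sub>R Y) \<and> schatten p D (a *\<^sub>R Y)"
    using * skew_scaleR by blast
qed

lemma scaled_word_schatten:
  assumes p: "1 < p" and \<theta>: "0 < \<theta>" "\<theta> < 1" and C: "0 \<le> C" and n: "real k + \<theta> + real n = p"
  obtains K where "K \<ge> 0" "\<And>N X w. length w = n \<Longrightarrow> skew X \<Longrightarrow> schatten p C X \<Longrightarrow> tame_word p C N w \<Longrightarrow>
      dyadic_bounded 1 (real k + \<theta>) (K * prod_list (map (\<lambda>x. N (fst x)) w)) (\<lambda>s. scaled_word (Suc k) s X w)"
proof -
  obtain K where K: "K \<ge> 0" "uniform_word_bound p \<theta> k n C K"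
    using uniform_word_bound_exists [OF p \<theta> C n] by blast
  have "dyadic_bounded 1 (real k + \<theta>) (K * prod_list (map (\<lambda>x. N (fst x)) w)) (\<lambda>s. scaled_word (Suc k) s X w)"
    if a: "length w = n" "skew X" "schatten p C X" "tame_word p C N w" for N X w
  proof -
    define t where "t = map (\<lambda>(v, Y). (v, Y, Y)) w"
    have lw: "left_word t = w" "right_word t = w"
      by (auto simp: t_def left_word_def right_word_def o_def case_prod_beta')
    have "dyadic_bounded 1 (real k + \<theta>) (K * prod_list (map (\<lambda>x. N (fst x)) t)) (\<lambda>s. scaled_word (Suc k) s X (left_word t))"
      by (rule uniform_word_boundD(1) [OF K(2), of 0 t X X]) (use a p lw \<theta> in \<open>auto simp: t_def intro: close_to_refl\<close>)
    moreover have "map (\<lambda>x. N (fst x)) t = map (\<lambda>x. N (fst x)) w" by (auto simp: t_def)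
    ultimately show ?thesis by (simp only: lw)
  qed
  with K(1) that show ?thesis by blast
qed

text \<open>A change of s amounts to rescaling all points at s = 1, by
  \<open>scaled_word_rescale\<close>, so continuity in s is an instance of continuity in the points.
  It provides the measurability of the integrands.\<close>

lemma continuous_on_trace_word:
  assumes p: "1 < p" and \<theta>: "0 < \<theta>" "\<theta> < 1" and n: "real k + \<theta> + real n = p"
    and X: "skew X" "schatten p C X" and w: "tame_word p C N w" "length w = n"
  shows "continuous_on {0<..} (\<lambda>s. optrace (scaled_word (Suc k) s X w))"
proof -
  have C0: "C \<ge> 0" by (rule schatten_nonneg [OF X(2)])
  have "((\<lambda>s. optrace (scaled_word (Suc k) s X w)) \<longlongrightarrow> optrace (scaled_word (Suc k) s0 X w)) (at s0)" if s0: "s0 > 0" for s0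
  proof (rule tendstoI)
    fix e :: real assume e: "e > 0"
    \<comment> \<open>A common bound for the points divided by s, valid for s > s0/2.\<close>
    define D where "D = 2 * C / s0"
    have D: "D \<ge> 0" using C0 s0 by (simp add: D_def)
    obtain K where K: "K \<ge> 0" "uniform_word_bound p \<theta> k n D K"
    using uniform_word_bound_exists [OF p \<theta> D n] by blast
    obtain K' where K': "K' \<ge> 0" "\<And>N X w. length w = n \<Longrightarrow> skew X \<Longrightarrow> schatten p C X \<Longrightarrow> tame_word p C N w \<Longrightarrow>
      dyadic_bounded 1 (real k + \<theta>) (K' * prod_list (map (\<lambda>x. N (fst x)) w)) (\<lambda>s. scaled_word (Suc k) s X w)"
      by (rule scaled_word_schatten [OF p \<theta> C0 n]) (rule that)
    let ?P = "prod_list (map (\<lambda>x. N (fst x)) w)"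
    define \<epsilon> where "\<epsilon> = e / (\<bar>K * ?P\<bar> + 1)"
    have \<epsilon>: "\<epsilon> > 0" using e by (simp add: \<epsilon>_def add_nonneg_pos)
    have small: "K * \<epsilon> * ?P < e"
    proof -
      have "K * \<epsilon> * ?P \<le> \<epsilon> * \<bar>K * ?P\<bar>" using \<epsilon> by (simp add: mult.commute mult.left_commute)
      also have "\<dots> = e * (\<bar>K * ?P\<bar> / (\<bar>K * ?P\<bar> + 1))" by (simp add: \<epsilon>_def)
      also have "\<dots> < e * 1" using e by (intro mult_strict_left_mono) auto
      finally show ?thesis by simp
    qed
    have "\<forall>\<^sub>F s in at s0. \<forall>Z\<in>insert X (snd ` set w). close_to p \<theta> n \<epsilon> ((1 / s) *\<^sub>R Z) ((1 / s0) *\<^sub>R Z)"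
    proof (rule eventually_ball_finite)
      show "\<forall>Z\<in>insert X (snd ` set w). \<forall>\<^sub>F s in at s0. close_to p \<theta> n \<epsilon> ((1 / s) *\<^sub>R Z) ((1 / s0) *\<^sub>R Z)"
      proof
        fix Z assume "Z \<in> insert X (snd ` set w)"
        then have "skew Z" "schatten p C Z" using X tame_wordD [OF w(1)] by auto
        then show "\<forall>\<^sub>F s in at s0. close_to p \<theta> n \<epsilon> ((1 / s) *\<^sub>R Z) ((1 / s0) *\<^sub>R Z)"
          by (rule close_to_rescaled [OF p \<theta> _ _ s0 \<epsilon>])
      qed
    qed simp
    moreover have "\<forall>\<^sub>F s in at s0. s0 / 2 < s"
      using order_tendstoD(1) [OF tendsto_ident_at, of "s0 / 2" s0 UNIV] s0 by simp
    ultimately show "\<forall>\<^sub>F s in at s0. dist (optrace (scaled_word (Suc k) s X w)) (optrace (scaled_word (Suc k) s0 X w)) < e"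
    proof eventually_elim
      case (elim s)
      have s: "s > 0" using elim s0 by simp
      have CD: "\<bar>1 / s\<bar> * C \<le> D" "\<bar>1 / s0\<bar> * C \<le> D"
      proof -
        have "C * (1 / s) \<le> C * (2 / s0)"
          using elim(2) s s0 C0 by (intro mult_left_mono) (simp_all add: field_simps)
        then show "\<bar>1 / s\<bar> * C \<le> D" using s by (simp add: D_def mult.commute)
        show "\<bar>1 / s0\<bar> * C \<le> D" using s0 C0 by (simp add: D_def divide_right_mono)
      qed
      define t where "t = map (\<lambda>(v, Y). (v, (1 / s) *\<^sub>R Y, (1 / s0) *\<^sub>R Y)) w"
      have lw: "left_word t = map (\<lambda>(v, Y). (v, (1 / s) *\<^sub>R Y)) w" "right_word t = map (\<lambda>(v, Y). (v, (1 / s0) *\<^sub>R Y)) w"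
        by (auto simp: t_def left_word_def right_word_def)
      have P: "map (\<lambda>x. N (fst x)) t = map (\<lambda>x. N (fst x)) w" by (auto simp: t_def)
      have "dyadic_bounded 1 (real k + \<theta>) (K * \<epsilon> * prod_list (map (\<lambda>x. N (fst x)) t))
          (\<lambda>u. scaled_word (Suc k) u ((1 / s) *\<^sub>R X) (left_word t) - scaled_word (Suc k) u ((1 / s0) *\<^sub>R X) (right_word t))"
      proof (rule uniform_word_boundD(2) [OF K(2)])
        show "length t = n" using w(2) by (simp add: t_def)
        show "schatten p D ((1 / s) *\<^sub>R X)" "schatten p D ((1 / s0) *\<^sub>R X)"
          using p CD by (auto intro: schatten_mono [OF schatten_scaleR [OF X(2)]])
        show "tame_word p D N (left_word t)" "tame_word p D N (right_word t)"
          unfolding lw using tame_word_scaleR [OF w(1)] CD p by auto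
        show "close_to p \<theta> n \<epsilon> ((1 / s) *\<^sub>R X) ((1 / s0) *\<^sub>R X)" using elim(1) by simp
        show "close_to p \<theta> n \<epsilon> Y Y'" if "(v, Y, Y') \<in> set t" for v Y Y'
          using that elim(1) by (auto simp: t_def)
      qed (use \<epsilon> X in \<open>auto intro: skew_scaleR\<close>)
      from dyadic_bounded_single [OF this, of 1]
      have "schatten 1 (K * \<epsilon> * ?P) (scaled_word (Suc k) s X w - scaled_word (Suc k) s0 X w)"
        by (simp add: lw P scaled_word_rescale [symmetric])
      from optrace_abs_le [OF this]
      have "\<bar>optrace (scaled_word (Suc k) s X w - scaled_word (Suc k) s0 X w)\<bar> < e" using small by simp
      then show ?case
        by (simp add: dist_real_def optrace_diff [OF dyadic_bounded_single [OF K'(2) [OF w(2) X w(1)] s]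
              dyadic_bounded_single [OF K'(2) [OF w(2) X w(1)] s0]])
    qed
  qed
  then show ?thesis by (simp add: continuous_on_eq_continuous_at isCont_def)
qed

text \<open>The weight is s^\<alpha> with respect to ds/s. With n arguments \<alpha> is k + \<theta>
  = p - n, each argument having consumed one factor 1/s.\<close>

definition word_integral :: "real \<Rightarrow> nat \<Rightarrow> ('b \<Rightarrow>\<^sub>L 'b) \<Rightarrow> (('b \<Rightarrow>\<^sub>L 'b) \<times> ('b \<Rightarrow>\<^sub>L 'b)) list \<Rightarrow> real" where
  "word_integral \<alpha> k X w = set_lebesgue_integral lborel {0<..} (\<lambda>s. s powr (\<alpha> - 1) * optrace (scaled_word (Suc k) s X w))"

lemma trace_integral_bound:
  assumes Z: "dyadic_bounded 1 \<alpha> C Z" and cont: "continuous_on {0<..} (\<lambda>s. optrace (Z s))"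
  shows "set_integrable lborel {0<..} (\<lambda>s. s powr (\<alpha> - 1) * optrace (Z s))"
    "\<bar>set_lebesgue_integral lborel {0<..} (\<lambda>s. s powr (\<alpha> - 1) * optrace (Z s))\<bar> \<le> C"
proof -
  have 1: "continuous_on {0<..} (\<lambda>s. s powr (\<alpha> - 1) * optrace (Z s))"
    by (intro continuous_on_mult cont continuous_on_powr continuous_intros) auto
  have 2: "(\<Sum>j\<in>J. (s * 2 powr j) * \<bar>(s * 2 powr j) powr (\<alpha> - 1) * optrace (Z (s * 2 powr j))\<bar>) \<le> C"
    if s: "s > 0" and J: "finite J" for s :: real and J :: "int set"
  proof -
    have "(s * 2 powr j) * \<bar>(s * 2 powr j) powr (\<alpha> - 1) * optrace (Z (s * 2 powr j))\<bar>
        = (s * 2 powr j) powr \<alpha> * \<bar>optrace (Z (s * 2 powr j))\<bar>" for j :: int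
    proof -
      have t: "s * 2 powr j > 0" using s by simp
      then have "(s * 2 powr j) * (s * 2 powr j) powr (\<alpha> - 1) = (s * 2 powr j) powr 1 * (s * 2 powr j) powr (\<alpha> - 1)"
        by simp
      also have "\<dots> = (s * 2 powr j) powr \<alpha>" by (simp only: powr_add [symmetric]) simp
      finally show ?thesis using t by (simp add: abs_mult)
    qed
    then show ?thesis using dyadic_trace_sum [OF Z s J] by simp
  qed
  show "set_integrable lborel {0<..} (\<lambda>s. s powr (\<alpha> - 1) * optrace (Z s))"
    "\<bar>set_lebesgue_integral lborel {0<..} (\<lambda>s. s powr (\<alpha> - 1) * optrace (Z s))\<bar> \<le> C"
    by (rule dyadic_set_integrable [OF 1 2]; assumption)+
qed

end

text \<open>The exponents of the \<open>n\<close>-th derivative: \<open>p = k + \<theta> + n\<close> with \<open>k = m - n\<close>.\<close>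

locale schatten_exponents = real_hilbert r for r :: "'b::banach \<Rightarrow> 'b \<Rightarrow> real" +
  fixes p \<theta> :: real
  assumes p: "1 < p" and \<theta>: "0 < \<theta>" "\<theta> < 1"
begin

section \<open>Bounds and continuity of word integrals\<close>

lemma word_integral_integrable:
  assumes n: "real k + \<theta> + real (length w) = p" and X: "skew X" "schatten p C X" and w: "tame_word p C N w"
  shows "set_integrable lborel {0<..} (\<lambda>s. s powr (real k + \<theta> - 1) * optrace (scaled_word (Suc k) s X w))"
proof -
  obtain K where K: "K \<ge> 0" "\<And>N X w'. length w' = length w \<Longrightarrow> skew X \<Longrightarrow> schatten p C X \<Longrightarrow> tame_word p C N w' \<Longrightarrow>
      dyadic_bounded 1 (real k + \<theta>) (K * prod_list (map (\<lambda>x. N (fst x)) w')) (\<lambda>s. scaled_word (Suc k) s X w')"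
    by (rule scaled_word_schatten [OF p \<theta> schatten_nonneg [OF X(2)] n]) (rule that)
  show ?thesis
    by (rule trace_integral_bound(1) [OF K(2) [OF refl X w] continuous_on_trace_word [OF p \<theta> n X w refl]])
qed

lemma scaled_word_trace_class:
  assumes n: "real k + \<theta> + real (length w) = p" and X: "skew X" "schatten p C X" and w: "tame_word p C N w"
    and s: "s > 0"
  shows "\<exists>C'. schatten 1 C' (scaled_word (Suc k) s X w)"
proof -
  obtain K where K: "K \<ge> 0" "\<And>N X w'. length w' = length w \<Longrightarrow> skew X \<Longrightarrow> schatten p C X \<Longrightarrow> tame_word p C N w' \<Longrightarrow>
      dyadic_bounded 1 (real k + \<theta>) (K * prod_list (map (\<lambda>x. N (fst x)) w')) (\<lambda>s. scaled_word (Suc k) s X w')"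
    by (rule scaled_word_schatten [OF p \<theta> schatten_nonneg [OF X(2)] n]) (rule that)
  show ?thesis using dyadic_bounded_single [OF K(2) [OF refl X w] s] by blast
qed

lemma word_integral_bound:
  assumes C: "0 \<le> C" and n: "real k + \<theta> + real n = p"
  obtains K where "K \<ge> 0" "\<And>N X w. length w = n \<Longrightarrow> skew X \<Longrightarrow> schatten p C X \<Longrightarrow> tame_word p C N w \<Longrightarrow>
      \<bar>word_integral (real k + \<theta>) k X w\<bar> \<le> K * prod_list (map (\<lambda>x. N (fst x)) w)"
proof -
  obtain K where K: "K \<ge> 0" "\<And>N X w. length w = n \<Longrightarrow> skew X \<Longrightarrow> schatten p C X \<Longrightarrow> tame_word p C N w \<Longrightarrow>
      dyadic_bounded 1 (real k + \<theta>) (K * prod_list (map (\<lambda>x. N (fst x)) w)) (\<lambda>s. scaled_word (Suc k) s X w)"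
    by (rule scaled_word_schatten [OF p \<theta> C n]) (rule that)
  have "\<bar>word_integral (real k + \<theta>) k X w\<bar> \<le> K * prod_list (map (\<lambda>x. N (fst x)) w)"
    if a: "length w = n" "skew X" "schatten p C X" "tame_word p C N w" for N X w
    unfolding word_integral_def
    by (rule trace_integral_bound(2) [OF K(2) [OF a] continuous_on_trace_word [OF p \<theta> n a(2-4,1)]])
  with K(1) that show ?thesis by blast
qed

text \<open>Each point of \<open>w\<close> may be X or X' independently of the others, as it happens
  in the words produced by \<open>mixed_word\<close>. \<open>K\<close> is fixed before \<epsilon>,
  and the estimate keeps the product of the bounds of all arguments; for a derivative one of these
  is the increment itself.\<close>

lemma word_integral_continuous:
  assumes X: "skew X" "schatten p C X" and n: "real k + \<theta> + real n = p"
  obtains K where "K \<ge> 0"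
    "\<And>\<epsilon>. \<epsilon> > 0 \<Longrightarrow> \<exists>\<delta>>0. \<forall>N X' w. length w = n \<longrightarrow> skew X' \<longrightarrow> schatten p \<delta> (X' - X) \<longrightarrow>
      (\<forall>(v, Y)\<in>set w. schatten p (N v) v \<and> (Y = X \<or> Y = X')) \<longrightarrow>
      \<bar>word_integral (real k + \<theta>) k X' w - word_integral (real k + \<theta>) k X (const_word X (map fst w))\<bar>
        \<le> K * \<epsilon> * prod_list (map (\<lambda>x. N (fst x)) w)"
proof -
  define D where "D = C + 1"
  have D: "D \<ge> 0" using schatten_nonneg [OF X(2)] by (simp add: D_def)
  have XD: "schatten p D X" by (rule schatten_mono [OF X(2)]) (use p in \<open>auto simp: D_def\<close>)
  obtain K where K: "K \<ge> 0" "uniform_word_bound p \<theta> k n D K"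
    using uniform_word_bound_exists [OF p \<theta> D n] by blast
  have "\<exists>\<delta>>0. \<forall>N X' w. length w = n \<longrightarrow> skew X' \<longrightarrow> schatten p \<delta> (X' - X) \<longrightarrow>
      (\<forall>(v, Y)\<in>set w. schatten p (N v) v \<and> (Y = X \<or> Y = X')) \<longrightarrow>
      \<bar>word_integral (real k + \<theta>) k X' w - word_integral (real k + \<theta>) k X (const_word X (map fst w))\<bar>
        \<le> K * \<epsilon> * prod_list (map (\<lambda>x. N (fst x)) w)" if \<epsilon>: "\<epsilon> > 0" for \<epsilon>
  proof -
    obtain \<delta>0 where \<delta>0: "\<delta>0 > 0" "\<And>X'. skew X' \<Longrightarrow> schatten p \<delta>0 (X' - X) \<Longrightarrow> close_to p \<theta> n \<epsilon> X' X"
      using close_to_near [OF p \<theta> X \<epsilon>] by blast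
    define \<delta> where "\<delta> = min 1 \<delta>0"
    have \<delta>: "\<delta> > 0" "\<delta> \<le> 1" "\<delta> \<le> \<delta>0" using \<delta>0(1) by (auto simp: \<delta>_def)
    have "\<bar>word_integral (real k + \<theta>) k X' w - word_integral (real k + \<theta>) k X (const_word X (map fst w))\<bar>
        \<le> K * \<epsilon> * prod_list (map (\<lambda>x. N (fst x)) w)"
      if w: "length w = n" and X': "skew X'" "schatten p \<delta> (X' - X)"
        and pts: "\<forall>(v, Y)\<in>set w. schatten p (N v) v \<and> (Y = X \<or> Y = X')" for N X' w
    proof -
      have "schatten p (\<delta> + C) ((X' - X) + X)" by (rule schatten_add [OF X'(2) X(2)]) (use p in simp)
      then have "schatten p (\<delta> + C) X'" by simp
      then have X'D: "schatten p D X'" by (rule schatten_mono) (use \<delta> p in \<open>auto simp: D_def\<close>)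
      have cl: "close_to p \<theta> n \<epsilon> X' X"
        by (rule \<delta>0(2) [OF X'(1) schatten_mono [OF X'(2) \<delta>(3)]]) (use p in simp)
      have cl0: "close_to p \<theta> n \<epsilon> X X" using p \<theta> \<epsilon> by (intro close_to_refl) auto
      \<comment> \<open>Every point, be it X or X', is compared with X; the former case is covered
        by \<open>close_to_refl\<close>.\<close>
      define t where "t = map (\<lambda>(v, Y). (v, Y, X)) w"
      have lw: "left_word t = w" "right_word t = const_word X (map fst w)"
        by (auto simp: t_def left_word_def right_word_def o_def case_prod_beta')
      have P: "map (\<lambda>x. N (fst x)) t = map (\<lambda>x. N (fst x)) w" by (auto simp: t_def)
      have tame: "tame_word p D N w" "tame_word p D N (const_word X (map fst w))"
        using pts X X' XD X'D by (auto simp: tame_word_def)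
      have b: "dyadic_bounded 1 (real k + \<theta>) (K * \<epsilon> * prod_list (map (\<lambda>x. N (fst x)) w))
          (\<lambda>s. scaled_word (Suc k) s X' w - scaled_word (Suc k) s X (const_word X (map fst w)))"
      proof -
        have "dyadic_bounded 1 (real k + \<theta>) (K * \<epsilon> * prod_list (map (\<lambda>x. N (fst x)) t))
            (\<lambda>s. scaled_word (Suc k) s X' (left_word t) - scaled_word (Suc k) s X (right_word t))"
        proof (rule uniform_word_boundD(2) [OF K(2)])
          show "length t = n" using w by (simp add: t_def)
          show "close_to p \<theta> n \<epsilon> Y Y'" if "(v, Y, Y') \<in> set t" for v Y Y'
            using that pts cl cl0 by (auto simp: t_def)
        qed (use \<epsilon> X X' XD X'D cl tame lw in auto)
        then show ?thesis by (simp only: lw P)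
      qed
      have len: "length (const_word X (map fst w)) = n" using w by simp
      have c1: "continuous_on {0<..} (\<lambda>s. optrace (scaled_word (Suc k) s X' w))"
        by (rule continuous_on_trace_word [OF p \<theta> n X'(1) X'D tame(1) w])
      have c2: "continuous_on {0<..} (\<lambda>s. optrace (scaled_word (Suc k) s X (const_word X (map fst w))))"
        by (rule continuous_on_trace_word [OF p \<theta> n X(1) XD tame(2) len])
      have tr: "optrace (scaled_word (Suc k) s X' w - scaled_word (Suc k) s X (const_word X (map fst w)))
          = optrace (scaled_word (Suc k) s X' w) - optrace (scaled_word (Suc k) s X (const_word X (map fst w)))"
        if s: "s \<in> {0<..}" for s
      proof -
        obtain c where "schatten 1 c (scaled_word (Suc k) s X' w)"
          using scaled_word_trace_class [of k w X' D N s] n w X'(1) X'D tame(1) s by auto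
        moreover obtain c' where "schatten 1 c' (scaled_word (Suc k) s X (const_word X (map fst w)))"
          using scaled_word_trace_class [of k "const_word X (map fst w)" X D N s] n len X(1) XD tame(2) s by auto
        ultimately show ?thesis by (rule optrace_diff)
      qed
      have c: "continuous_on {0<..} (\<lambda>s. optrace (scaled_word (Suc k) s X' w - scaled_word (Suc k) s X (const_word X (map fst w))))"
        using continuous_on_diff [OF c1 c2] by (subst continuous_on_cong [OF refl tr]) auto
      have "word_integral (real k + \<theta>) k X' w - word_integral (real k + \<theta>) k X (const_word X (map fst w))
          = set_lebesgue_integral lborel {0<..} (\<lambda>s. s powr (real k + \<theta> - 1) *
              optrace (scaled_word (Suc k) s X' w - scaled_word (Suc k) s X (const_word X (map fst w))))"
      proof -
        have "word_integral (real k + \<theta>) k X' w - word_integral (real k + \<theta>) k X (const_word X (map fst w))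
          = set_lebesgue_integral lborel {0<..} (\<lambda>s. s powr (real k + \<theta> - 1) * optrace (scaled_word (Suc k) s X' w)
              - s powr (real k + \<theta> - 1) * optrace (scaled_word (Suc k) s X (const_word X (map fst w))))"
          unfolding word_integral_def
          by (rule set_integral_diff(2) [symmetric];
              rule word_integral_integrable [where C = D and N = N]) (use n w len X(1) XD X'(1) X'D tame in auto)
        also have "\<dots> = set_lebesgue_integral lborel {0<..} (\<lambda>s. s powr (real k + \<theta> - 1) *
              optrace (scaled_word (Suc k) s X' w - scaled_word (Suc k) s X (const_word X (map fst w))))"
          by (rule set_lebesgue_integral_cong, simp, intro allI impI, simp only: tr right_diff_distrib)
        finally show ?thesis .
      qed
      then show ?thesis using trace_integral_bound(2) [OF b c] by simp
    qed
    then show ?thesis using \<delta>(1) by blast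
  qed
  with K(1) that show ?thesis by blast
qed

end


section \<open>Derivatives\<close>

text \<open>\<open>psum T vs\<close> is the sum of \<open>T\<close> over all orderings of \<open>vs\<close>.\<close>

fun psum :: "('v list \<Rightarrow> real) \<Rightarrow> 'v list \<Rightarrow> real" where
  "psum T [] = T []"
| "psum T (h # vs) = psum (\<lambda>ws. \<Sum>i\<le>length ws. T (take i ws @ h # drop i ws)) vs"

lemma psum_lincomb: "psum (\<lambda>ws. a * S ws + b * T ws) vs = a * psum S vs + b * psum T vs"
  by (induction vs arbitrary: S T) (simp_all add: sum.distrib sum_distrib_left [symmetric])

lemma psum_cong:
  assumes "set vs \<subseteq> V" "\<And>ws. set ws \<subseteq> V \<Longrightarrow> length ws = length vs \<Longrightarrow> S ws = T ws"
  shows "psum S vs = psum T vs"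
  using assms
proof (induction vs arbitrary: S T)
  case (Cons h vs)
  have "S (take i ws @ h # drop i ws) = T (take i ws @ h # drop i ws)"
    if "set ws \<subseteq> V" "length ws = length vs" for ws i
    using that Cons.prems(1) set_take_subset [of i ws] set_drop_subset [of i ws]
    by (intro Cons.prems(2)) auto
  then show ?case using Cons.prems(1) by (auto intro!: Cons.IH sum.cong)
qed simp

text \<open>The factorial counts the orderings; the product of the values of \<open>N\<close> is the
  same for all of them.\<close>

lemma psum_abs_le:
  fixes N :: "'v \<Rightarrow> real"
  assumes "set vs \<subseteq> V"
    "\<And>ws. set ws \<subseteq> V \<Longrightarrow> length ws = length vs \<Longrightarrow> \<bar>T ws\<bar> \<le> C * prod_list (map N ws)"
  shows "\<bar>psum T vs\<bar> \<le> fact (length vs) * C * prod_list (map N vs)"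
  using assms
proof (induction vs arbitrary: T C)
  case (Cons h vs)
  let ?n = "length vs"
  have "\<bar>\<Sum>i\<le>length ws. T (take i ws @ h # drop i ws)\<bar> \<le> (real (Suc ?n) * C * N h) * prod_list (map N ws)"
    if ws: "set ws \<subseteq> V" "length ws = ?n" for ws
  proof -
    have "\<bar>T (take i ws @ h # drop i ws)\<bar> \<le> C * N h * prod_list (map N ws)" if "i \<le> length ws" for i
    proof -
      have "\<bar>T (take i ws @ h # drop i ws)\<bar> \<le> C * prod_list (map N (take i ws @ h # drop i ws))"
        using ws Cons.prems(1) set_take_subset [of i ws] set_drop_subset [of i ws] that
        by (intro Cons.prems(2)) auto
      also have "prod_list (map N (take i ws @ h # drop i ws)) = N h * prod_list (map N (take i ws @ drop i ws))"
        by (simp del: append_take_drop_id)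
      finally show ?thesis by (simp add: mult.assoc)
    qed
    then have "\<bar>\<Sum>i\<le>length ws. T (take i ws @ h # drop i ws)\<bar> \<le> (\<Sum>i\<le>length ws. C * N h * prod_list (map N ws))"
      by (intro order_trans [OF sum_abs] sum_mono) auto
    then show ?thesis using ws(2) by simp
  qed
  then have "\<bar>psum T (h # vs)\<bar> \<le> fact ?n * (real (Suc ?n) * C * N h) * prod_list (map N vs)"
    using Cons.prems(1) unfolding psum.simps by (intro Cons.IH) auto
  then show ?case by (simp add: mult_ac)
qed simp

definition multilinear_on :: "'v::real_vector set \<Rightarrow> nat \<Rightarrow> ('v list \<Rightarrow> real) \<Rightarrow> bool" where
  "multilinear_on V n T \<longleftrightarrow> (\<forall>xs ys u v a b. set xs \<subseteq> V \<longrightarrow> set ys \<subseteq> V \<longrightarrow> u \<in> V \<longrightarrow> v \<in> V \<longrightarrow>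
     length xs + length ys + 1 = n \<longrightarrow>
     T (xs @ (a *\<^sub>R u + b *\<^sub>R v) # ys) = a * T (xs @ u # ys) + b * T (xs @ v # ys))"

lemma multilinear_onD:
  assumes "multilinear_on V n T" "set xs \<subseteq> V" "set ys \<subseteq> V" "u \<in> V" "v \<in> V" "length xs + length ys + 1 = n"
  shows "T (xs @ (a *\<^sub>R u + b *\<^sub>R v) # ys) = a * T (xs @ u # ys) + b * T (xs @ v # ys)"
  using assms unfolding multilinear_on_def by blast

lemma multilinear_on_insert:
  assumes T: "multilinear_on V (Suc n) T" and h: "h \<in> V"
  shows "multilinear_on V n (\<lambda>ws. \<Sum>i\<le>length ws. T (take i ws @ h # drop i ws))"
  unfolding multilinear_on_def
proof (intro allI impI)
  fix xs ys u v a b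
  assume a: "set xs \<subseteq> V" "set ys \<subseteq> V" "u \<in> V" "v \<in> V" "length xs + length ys + 1 = n"
  have "T (take i (xs @ (a *\<^sub>R u + b *\<^sub>R v) # ys) @ h # drop i (xs @ (a *\<^sub>R u + b *\<^sub>R v) # ys))
      = a * T (take i (xs @ u # ys) @ h # drop i (xs @ u # ys)) + b * T (take i (xs @ v # ys) @ h # drop i (xs @ v # ys))"
    for i
  \<comment> \<open>\<open>h\<close> is inserted either to the left of the varying slot or to the
    right of it.\<close>
  proof (cases "i \<le> length xs")
    case True
    have sub: "set (take i xs @ h # drop i xs) \<subseteq> V"
      using a(1) h set_take_subset [of i xs] set_drop_subset [of i xs] by auto
    have len: "length (take i xs @ h # drop i xs) + length ys + 1 = Suc n" using a(5) True by simp
    from multilinear_onD [OF T sub a(2-4) len, of a b] True show ?thesis by simp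
  next
    case False
    then obtain j where j: "i - length xs = Suc j" by (metis Suc_diff_Suc not_le)
    have sub: "set (take j ys @ h # drop j ys) \<subseteq> V"
      using a(2) h set_take_subset [of j ys] set_drop_subset [of j ys] by auto
    have len: "length xs + length (take j ys @ h # drop j ys) + 1 = Suc n" using a(5) by simp
    from multilinear_onD [OF T a(1) sub a(3,4) len, of a b] False j show ?thesis by simp
  qed
  then show "(\<Sum>i\<le>length (xs @ (a *\<^sub>R u + b *\<^sub>R v) # ys).
        T (take i (xs @ (a *\<^sub>R u + b *\<^sub>R v) # ys) @ h # drop i (xs @ (a *\<^sub>R u + b *\<^sub>R v) # ys)))
      = a * (\<Sum>i\<le>length (xs @ u # ys). T (take i (xs @ u # ys) @ h # drop i (xs @ u # ys)))
      + b * (\<Sum>i\<le>length (xs @ v # ys). T (take i (xs @ v # ys) @ h # drop i (xs @ v # ys)))"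
    by (simp add: sum.distrib sum_distrib_left del: sum.atMost_Suc)
qed

lemma multilinear_on_psum:
  assumes "multilinear_on V n T"
  shows "multilinear_on V n (psum T)"
  unfolding multilinear_on_def
proof (intro allI impI)
  fix xs ys u v a b
  assume "set xs \<subseteq> V" "set ys \<subseteq> V" "u \<in> V" "v \<in> V" "length xs + length ys + 1 = n"
  then show "psum T (xs @ (a *\<^sub>R u + b *\<^sub>R v) # ys) = a * psum T (xs @ u # ys) + b * psum T (xs @ v # ys)"
    using assms
  proof (induction xs arbitrary: n T)
    case Nil
    have "psum T ((a *\<^sub>R u + b *\<^sub>R v) # ys)
        = psum (\<lambda>ws. a * (\<Sum>i\<le>length ws. T (take i ws @ u # drop i ws)) + b * (\<Sum>i\<le>length ws. T (take i ws @ v # drop i ws))) ys"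
      unfolding psum.simps
    proof (rule psum_cong [OF Nil.prems(2)])
      fix ws assume ws: "set ws \<subseteq> V" "length ws = length ys"
      have "T (take i ws @ (a *\<^sub>R u + b *\<^sub>R v) # drop i ws) = a * T (take i ws @ u # drop i ws) + b * T (take i ws @ v # drop i ws)"
        if "i \<le> length ws" for i
        using Nil.prems ws that set_take_subset [of i ws] set_drop_subset [of i ws]
        by (intro multilinear_onD [OF Nil.prems(6)]) auto
      then show "(\<Sum>i\<le>length ws. T (take i ws @ (a *\<^sub>R u + b *\<^sub>R v) # drop i ws))
          = a * (\<Sum>i\<le>length ws. T (take i ws @ u # drop i ws)) + b * (\<Sum>i\<le>length ws. T (take i ws @ v # drop i ws))"
        by (simp add: sum.distrib sum_distrib_left)
    qed
    then show ?case by (simp add: psum_lincomb)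
  next
    case (Cons x xs)
    obtain n' where n': "n = Suc n'" using Cons.prems(5) by (cases n) auto
    have "multilinear_on V n' (\<lambda>ws. \<Sum>i\<le>length ws. T (take i ws @ x # drop i ws))"
      using Cons.prems n' by (intro multilinear_on_insert) auto
    from Cons.IH [OF _ Cons.prems(2-4) _ this] show ?case using Cons.prems n' by simp
  qed
qed

context real_hilbert
begin

section \<open>Increments of scaled words and of their integrals\<close>

lemma scaled_word_linear:
  "scaled_word k s X (w @ (a *\<^sub>R u + b *\<^sub>R v, Y) # w')
    = a *\<^sub>R scaled_word k s X (w @ (u, Y) # w') + b *\<^sub>R scaled_word k s X (w @ (v, Y) # w')"
  by (simp add: scaled_word_def word_linear)

text \<open>The new argument arrives as (X' - X)/s, because the points are divided by s. Pulled out
  by linearity, the factor 1/s lowers the exponent of the weight by one, in step with the degree of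
  the remainder.\<close>

lemma scaled_word_diff:
  assumes "skew X" "skew X'"
  shows "scaled_word (Suc k) s X' (const_word X' vs) - scaled_word (Suc k) s X (const_word X vs)
    = - ((1 / s) *\<^sub>R (\<Sum>i\<le>length vs. scaled_word k s X' (mixed_word i X' X (X' - X) vs)))"
proof -
  let ?S = "\<lambda>w. map (\<lambda>(v, Y). (v, (1 / s) *\<^sub>R Y)) w :: (('b \<Rightarrow>\<^sub>L 'b) \<times> ('b \<Rightarrow>\<^sub>L 'b)) list"
  have const: "?S (const_word Y us) = const_word ((1 / s) *\<^sub>R Y) us" for Y us by simp
  have mixed: "?S (mixed_word i X' X h vs) = mixed_word i ((1 / s) *\<^sub>R X') ((1 / s) *\<^sub>R X) h vs" for i h
    by (simp add: mixed_word_def const)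
  have "word k ((1 / s) *\<^sub>R X') (mixed_word i ((1 / s) *\<^sub>R X') ((1 / s) *\<^sub>R X) ((1 / s) *\<^sub>R X' - (1 / s) *\<^sub>R X) vs)
      = (1 / s) *\<^sub>R scaled_word k s X' (mixed_word i X' X (X' - X) vs)" for i
    unfolding scaled_word_def mixed unfolding mixed_word_def scaleR_diff_right [symmetric] by (rule word_scaleR)
  then show ?thesis
    using word_diff [OF skew_scaleR [OF assms(1)] skew_scaleR [OF assms(2)], of k "1 / s" vs "1 / s"]
    unfolding scaled_word_def const by (simp add: scaleR_sum_right scaled_word_def)
qed

end

context schatten_exponents
begin

lemma word_integral_linear:
  assumes n: "real k + \<theta> + real (length w + length w' + 1) = p" and X: "skew X" "schatten p C X"
    and w: "tame_word p C N (w @ (u, Y) # w')" "tame_word p C N (w @ (v, Y) # w')"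
  shows "word_integral (real k + \<theta>) k X (w @ (a *\<^sub>R u + b *\<^sub>R v, Y) # w')
    = a * word_integral (real k + \<theta>) k X (w @ (u, Y) # w') + b * word_integral (real k + \<theta>) k X (w @ (v, Y) # w')"
proof -
  let ?u = "w @ (u, Y) # w'" and ?v = "w @ (v, Y) # w'" and ?uv = "w @ (a *\<^sub>R u + b *\<^sub>R v, Y) # w'"
  let ?f = "\<lambda>w s. s powr (real k + \<theta> - 1) * optrace (scaled_word (Suc k) s X w)"
  have len: "real k + \<theta> + real (length ?u) = p" "real k + \<theta> + real (length ?v) = p" using n by auto
  have int: "set_integrable lborel {0<..} (?f ?u)" "set_integrable lborel {0<..} (?f ?v)"
    using word_integral_integrable [OF len(1) X w(1)] word_integral_integrable [OF len(2) X w(2)] by auto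
  have "?f ?uv s = a * ?f ?u s + b * ?f ?v s" if s: "s \<in> {0<..}" for s
  proof -
    obtain c where c: "schatten 1 c (scaled_word (Suc k) s X ?u)"
      using scaled_word_trace_class [OF len(1) X w(1)] s by auto
    obtain d where d: "schatten 1 d (scaled_word (Suc k) s X ?v)"
      using scaled_word_trace_class [OF len(2) X w(2)] s by auto
    have "optrace (scaled_word (Suc k) s X ?uv)
        = a * optrace (scaled_word (Suc k) s X ?u) + b * optrace (scaled_word (Suc k) s X ?v)"
      unfolding scaled_word_linear
      using optrace_add [OF schatten_scaleR [OF c] schatten_scaleR [OF d], of a b]
        optrace_scaleR [OF c, of a] optrace_scaleR [OF d, of b] by simp
    then show ?thesis by (simp only:) (simp add: algebra_simps)
  qed
  then have "word_integral (real k + \<theta>) k X ?uv = set_lebesgue_integral lborel {0<..} (\<lambda>s. a * ?f ?u s + b * ?f ?v s)"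
    unfolding word_integral_def by (intro set_lebesgue_integral_cong) auto
  also have "\<dots> = a * word_integral (real k + \<theta>) k X ?u + b * word_integral (real k + \<theta>) k X ?v"
    using int unfolding word_integral_def
    by (subst set_integral_add) (auto intro: set_integrable_mult_right)
  finally show ?thesis .
qed

lemma tame_const_word: "skew X \<Longrightarrow> schatten p C X \<Longrightarrow> (\<And>v. v \<in> set vs \<Longrightarrow> schatten p (N v) v) \<Longrightarrow> tame_word p C N (const_word X vs)"
  by (auto simp: tame_word_def)

lemma tame_mixed_word:
  assumes "skew X" "schatten p C X" "skew X'" "schatten p C X'" "schatten p (N h) h"
    "\<And>v. v \<in> set vs \<Longrightarrow> schatten p (N v) v"
  shows "tame_word p C N (mixed_word i X' X h vs)"
  using assms set_take_subset [of i vs] set_drop_subset [of i vs]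
  by (auto simp: tame_word_def mixed_word_def)

lemma word_integral_diff:
  assumes n: "real (Suc k) + \<theta> + real (length vs) = p"
    and X: "skew X" "schatten p C X" and X': "skew X'" "schatten p C X'" and N: "schatten p (N (X' - X)) (X' - X)"
    and vs: "\<And>v. v \<in> set vs \<Longrightarrow> schatten p (N v) v"
  shows "word_integral (real (Suc k) + \<theta>) (Suc k) X' (const_word X' vs)
      - word_integral (real (Suc k) + \<theta>) (Suc k) X (const_word X vs)
    = - (\<Sum>i\<le>length vs. word_integral (real k + \<theta>) k X' (mixed_word i X' X (X' - X) vs))"
proof -
  let ?m = "\<lambda>i. mixed_word i X' X (X' - X) vs"
  let ?f = "\<lambda>i s. s powr (real k + \<theta> - 1) * optrace (scaled_word (Suc k) s X' (?m i))"
  let ?g = "\<lambda>Y s. s powr (real (Suc k) + \<theta> - 1) * optrace (scaled_word (Suc (Suc k)) s Y (const_word Y vs))"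
  have tame: "tame_word p C N (const_word X vs)" "tame_word p C N (const_word X' vs)" "tame_word p C N (?m i)" for i
    using X X' N vs by (auto intro!: tame_const_word tame_mixed_word)
  have len: "real (Suc k) + \<theta> + real (length (const_word Y vs)) = p" for Y using n by simp
  have lenm: "real k + \<theta> + real (length (?m i)) = p" if "i \<le> length vs" for i
    using n that by (simp add: mixed_word_def)
  have intf: "set_integrable lborel {0<..} (?f i)" if "i \<le> length vs" for i
    by (rule word_integral_integrable [OF lenm [OF that] X' tame(3)])
  have intg: "set_integrable lborel {0<..} (?g X)" "set_integrable lborel {0<..} (?g X')"
    using word_integral_integrable [OF len X tame(1)] word_integral_integrable [OF len X' tame(2)] by auto
  have eq: "?g X' s - ?g X s = - (\<Sum>i\<le>length vs. ?f i s)" if s: "s \<in> {0<..}" for s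
  proof -
    have s0: "s > 0" using s by simp
    obtain c where c: "schatten 1 c (scaled_word (Suc (Suc k)) s X (const_word X vs))"
      using scaled_word_trace_class [OF len X tame(1) s0] by blast
    obtain d where d: "schatten 1 d (scaled_word (Suc (Suc k)) s X' (const_word X' vs))"
      using scaled_word_trace_class [OF len X' tame(2) s0] by blast
    have "\<exists>b. schatten 1 b (scaled_word (Suc k) s X' (?m i))" if "i \<in> {..length vs}" for i
      using scaled_word_trace_class [OF lenm X' tame(3) s0] that by simp
    then obtain b where b: "\<And>i. i \<in> {..length vs} \<Longrightarrow> schatten 1 (b i) (scaled_word (Suc k) s X' (?m i))"
      using bchoice [of "{..length vs}" "\<lambda>i b. schatten 1 b (scaled_word (Suc k) s X' (?m i))"] by auto
    have sb: "schatten 1 (\<Sum>i\<le>length vs. b i) (\<Sum>i\<le>length vs. scaled_word (Suc k) s X' (?m i))"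
      by (rule schatten_sum) (use b in auto)
    have "optrace (scaled_word (Suc (Suc k)) s X' (const_word X' vs)) - optrace (scaled_word (Suc (Suc k)) s X (const_word X vs))
        = optrace ((- (1 / s)) *\<^sub>R (\<Sum>i\<le>length vs. scaled_word (Suc k) s X' (?m i)))"
      unfolding optrace_diff [OF d c, symmetric] scaled_word_diff [OF X(1) X'(1)] by simp
    also have "\<dots> = - (1 / s) * (\<Sum>i\<le>length vs. optrace (scaled_word (Suc k) s X' (?m i)))"
      unfolding optrace_scaleR [OF sb] by (subst optrace_sum [OF _ b]) auto
    finally have tr: "optrace (scaled_word (Suc (Suc k)) s X' (const_word X' vs)) - optrace (scaled_word (Suc (Suc k)) s X (const_word X vs))
        = - (1 / s) * (\<Sum>i\<le>length vs. optrace (scaled_word (Suc k) s X' (?m i)))" .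
    have pw: "s powr (real (Suc k) + \<theta> - 1) * (1 / s) = s powr (real k + \<theta> - 1)"
    proof -
      have "s powr (real (Suc k) + \<theta> - 1) * (1 / s) = s powr (real (Suc k) + \<theta> - 1) / s powr 1" using s0 by simp
      also have "\<dots> = s powr (real k + \<theta> - 1)" by (simp only: powr_diff [symmetric]) simp
      finally show ?thesis .
    qed
    have "?g X' s - ?g X s = - (s powr (real (Suc k) + \<theta> - 1) * (1 / s)) * (\<Sum>i\<le>length vs. optrace (scaled_word (Suc k) s X' (?m i)))"
      unfolding right_diff_distrib [symmetric] tr by simp
    then show ?thesis unfolding pw by (simp add: sum_distrib_left sum_negf)
  qed
  have "word_integral (real (Suc k) + \<theta>) (Suc k) X' (const_word X' vs)
      - word_integral (real (Suc k) + \<theta>) (Suc k) X (const_word X vs)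
      = set_lebesgue_integral lborel {0<..} (\<lambda>s. ?g X' s - ?g X s)"
    unfolding word_integral_def by (rule set_integral_diff(2) [OF intg(2,1), symmetric])
  also have "\<dots> = set_lebesgue_integral lborel {0<..} (\<lambda>s. - (\<Sum>i\<le>length vs. ?f i s))"
    by (rule set_lebesgue_integral_cong, simp, intro allI impI, rule eq)
  also have "\<dots> = - (\<Sum>i\<le>length vs. set_lebesgue_integral lborel {0<..} (?f i))"
  proof -
    have "set_lebesgue_integral lborel {0<..} (\<lambda>s. - (\<Sum>i\<le>length vs. ?f i s))
        = - (\<integral>s. (\<Sum>i\<le>length vs. indicator {0<..} s *\<^sub>R ?f i s) \<partial>lborel)"
      unfolding set_lebesgue_integral_def by (simp add: scaleR_sum_right sum_distrib_left)
    also have "(\<integral>s. (\<Sum>i\<le>length vs. indicator {0<..} s *\<^sub>R ?f i s) \<partial>lborel)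
        = (\<Sum>i\<le>length vs. \<integral>s. indicator {0<..} s *\<^sub>R ?f i s \<partial>lborel)"
      using intf unfolding set_integrable_def by (intro Bochner_Integration.integral_sum) auto
    finally show ?thesis by (simp only: set_lebesgue_integral_def)
  qed
  finally show ?thesis by (simp only: word_integral_def)
qed

text \<open>The normed space enters through a real-linear injection \<iota> into skew operators
  whose Schatten bound is controlled by \<open>N\<close>. In the application \<iota> is the
  dilation, and \<open>c\<close> accounts for the repetition of singular values.\<close>

context
  fixes V :: "'v::real_vector set" and N :: "'v \<Rightarrow> real" and \<iota> :: "'v \<Rightarrow> ('b \<Rightarrow>\<^sub>L 'b)" and c :: real and m :: nat
  assumes c: "c > 0" and skew_\<iota>: "\<And>u. u \<in> V \<Longrightarrow> skew (\<iota> u)" and schatten_\<iota>: "\<And>u. u \<in> V \<Longrightarrow> schatten p (c * N u) (\<iota> u)"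
    and inj_\<iota>: "inj_on \<iota> V"
    and lin_\<iota>: "\<And>u v a b. u \<in> V \<Longrightarrow> v \<in> V \<Longrightarrow> \<iota> (a *\<^sub>R u + b *\<^sub>R v) = a *\<^sub>R \<iota> u + b *\<^sub>R \<iota> v"
    and m: "real m + \<theta> = p"
begin

text \<open>The bounds for words take the norm of an argument as a function of the operator;
  \<open>N\<close> is therefore transported along the injection \<iota>.\<close>

definition op_bound :: "('b \<Rightarrow>\<^sub>L 'b) \<Rightarrow> real" where
  "op_bound A = c * N (inv_into V \<iota> A)"

lemma op_bound_eq: "u \<in> V \<Longrightarrow> op_bound (\<iota> u) = c * N u"
  by (simp add: op_bound_def inv_into_f_f [OF inj_\<iota>])

lemma schatten_op_bound: "u \<in> V \<Longrightarrow> schatten p (op_bound (\<iota> u)) (\<iota> u)"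
  by (simp add: op_bound_eq schatten_\<iota>)

lemma N_nonneg: "u \<in> V \<Longrightarrow> 0 \<le> N u"
  using schatten_nonneg [OF schatten_\<iota>, of u] c by (simp add: zero_le_mult_iff)

lemma prod_op_bound:
  "set vs \<subseteq> V \<Longrightarrow> prod_list (map (\<lambda>v. op_bound (\<iota> v)) vs) = c ^ length vs * prod_list (map N vs)"
  by (induction vs) (auto simp: op_bound_eq mult_ac)

lemma prod_N_nonneg: "set vs \<subseteq> V \<Longrightarrow> 0 \<le> prod_list (map N vs)"
  by (induction vs) (auto simp: N_nonneg)

text \<open>The n-th derivative at \<open>H\<close> before symmetrization, up to sign and a
  constant: all points are \<iota> H and the arguments stand in a fixed order.\<close>

definition form :: "nat \<Rightarrow> 'v \<Rightarrow> 'v list \<Rightarrow> real" where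
  "form n H ws = word_integral (real (m - n) + \<theta>) (m - n) (\<iota> H) (const_word (\<iota> H) (map \<iota> ws))"

lemma exponent: "n \<le> m \<Longrightarrow> real (m - n) + \<theta> + real n = p"
  using m by simp

lemma tame_map: "H \<in> V \<Longrightarrow> set ws \<subseteq> V \<Longrightarrow> tame_word p (c * N H) op_bound (const_word (\<iota> H) (map \<iota> ws))"
  by (rule tame_const_word [OF skew_\<iota> schatten_\<iota>]) (auto intro: schatten_op_bound)

section \<open>Multilinearity, bounds and first-order remainders of the forms\<close>

lemma form_multilinear:
  assumes "n \<le> m" and H: "H \<in> V"
  shows "multilinear_on V n (form n H)"
  unfolding multilinear_on_def
proof (intro allI impI)
  fix xs ys u v a b
  assume a: "set xs \<subseteq> V" "set ys \<subseteq> V" "u \<in> V" "v \<in> V" "length xs + length ys + 1 = n"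
  let ?w = "\<lambda>zs. const_word (\<iota> H) (map \<iota> zs)"
  have "word_integral (real (m - n) + \<theta>) (m - n) (\<iota> H) (?w xs @ (a *\<^sub>R \<iota> u + b *\<^sub>R \<iota> v, \<iota> H) # ?w ys)
      = a * word_integral (real (m - n) + \<theta>) (m - n) (\<iota> H) (?w xs @ (\<iota> u, \<iota> H) # ?w ys)
        + b * word_integral (real (m - n) + \<theta>) (m - n) (\<iota> H) (?w xs @ (\<iota> v, \<iota> H) # ?w ys)"
  proof (rule word_integral_linear [OF _ skew_\<iota> [OF H] schatten_\<iota> [OF H]])
    show "real (m - n) + \<theta> + real (length (?w xs) + length (?w ys) + 1) = p"
      using exponent [OF assms(1)] a(5) by simp
    show "tame_word p (c * N H) op_bound (?w xs @ (\<iota> u, \<iota> H) # ?w ys)"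
      using tame_map [OF H, of "xs @ u # ys"] a by simp
    show "tame_word p (c * N H) op_bound (?w xs @ (\<iota> v, \<iota> H) # ?w ys)"
      using tame_map [OF H, of "xs @ v # ys"] a by simp
  qed
  then show "form n H (xs @ (a *\<^sub>R u + b *\<^sub>R v) # ys) = a * form n H (xs @ u # ys) + b * form n H (xs @ v # ys)"
    using a by (simp add: form_def lin_\<iota>)
qed

lemma form_bound:
  assumes "n \<le> m" and H: "H \<in> V"
  obtains K where "K \<ge> 0" "\<And>ws. set ws \<subseteq> V \<Longrightarrow> length ws = n \<Longrightarrow> \<bar>form n H ws\<bar> \<le> K * prod_list (map N ws)"
proof -
  have C: "0 \<le> c * N H" by (rule schatten_nonneg [OF schatten_\<iota> [OF H]])
  obtain K where K: "K \<ge> 0" "\<And>M X w. length w = n \<Longrightarrow> skew X \<Longrightarrow> schatten p (c * N H) X \<Longrightarrow> tame_word p (c * N H) M w \<Longrightarrow>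
      \<bar>word_integral (real (m - n) + \<theta>) (m - n) X w\<bar> \<le> K * prod_list (map (\<lambda>x. M (fst x)) w)"
    using word_integral_bound [OF C exponent [OF assms(1)]] by blast
  have "\<bar>form n H ws\<bar> \<le> (K * c ^ n) * prod_list (map N ws)" if ws: "set ws \<subseteq> V" "length ws = n" for ws
  proof -
    have "\<bar>form n H ws\<bar> \<le> K * prod_list (map (\<lambda>x. op_bound (fst x)) (const_word (\<iota> H) (map \<iota> ws)))"
      unfolding form_def by (rule K(2) [OF _ skew_\<iota> [OF H] schatten_\<iota> [OF H] tame_map [OF H ws(1)]]) (simp add: ws)
    also have "map (\<lambda>x. op_bound (fst x)) (const_word (\<iota> H) (map \<iota> ws)) = map (\<lambda>v. op_bound (\<iota> v)) ws" by simp
    finally show ?thesis using prod_op_bound [OF ws(1)] ws(2) by simp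
  qed
  moreover have "K * c ^ n \<ge> 0" using K(1) c by simp
  ultimately show ?thesis using that by blast
qed

text \<open>By \<open>word_integral_diff\<close> the increment is exactly minus a sum of mixed
  words, which have \<open>h\<close> as an argument. The remainder therefore consists of differences
  between mixed words and words at the single point \<iota> H; they are small by continuity, and
  proportional to \<open>N h\<close> by multilinearity, so no second-order expansion occurs.\<close>

lemma form_remainder:
  assumes "n < m" and H: "H \<in> V" and \<epsilon>: "\<epsilon> > 0"
  shows "\<exists>\<delta>>0. \<forall>h ws. h \<in> V \<longrightarrow> H + h \<in> V \<longrightarrow> N h < \<delta> \<longrightarrow> set ws \<subseteq> V \<longrightarrow> length ws = n \<longrightarrow>
    \<bar>form n (H + h) ws - form n H ws + (\<Sum>i\<le>length ws. form (Suc n) H (take i ws @ h # drop i ws))\<bar>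
      \<le> \<epsilon> * N h * prod_list (map N ws)"
proof -
  define k where "k = m - Suc n"
  have mk: "m - n = Suc k" "m - Suc n = k" using assms(1) by (auto simp: k_def)
  have e1: "real k + \<theta> + real (Suc n) = p" using exponent [of "Suc n"] assms(1) mk by simp
  obtain K where K: "K \<ge> 0"
    "\<And>\<epsilon>. \<epsilon> > 0 \<Longrightarrow> \<exists>\<delta>>0. \<forall>M X' w. length w = Suc n \<longrightarrow> skew X' \<longrightarrow> schatten p \<delta> (X' - \<iota> H) \<longrightarrow>
      (\<forall>(v, Y)\<in>set w. schatten p (M v) v \<and> (Y = \<iota> H \<or> Y = X')) \<longrightarrow>
      \<bar>word_integral (real k + \<theta>) k X' w - word_integral (real k + \<theta>) k (\<iota> H) (const_word (\<iota> H) (map fst w))\<bar>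
        \<le> K * \<epsilon> * prod_list (map (\<lambda>x. M (fst x)) w)"
    using word_integral_continuous [OF skew_\<iota> [OF H] schatten_\<iota> [OF H] e1] by blast
  \<comment> \<open>There are n + 1 places for \<open>h\<close>, and each of the n + 1 arguments
    contributes a factor \<open>c\<close>. The summand 1 keeps the denominator positive.\<close>
  define \<epsilon>' where "\<epsilon>' = \<epsilon> / (real (Suc n) * K * c ^ Suc n + 1)"
  have pos: "0 \<le> real (Suc n) * K * c ^ Suc n" using K(1) c by simp
  have \<epsilon>': "\<epsilon>' > 0" using \<epsilon> pos unfolding \<epsilon>'_def by (intro divide_pos_pos) auto
  have small: "real (Suc n) * (K * \<epsilon>' * c ^ Suc n) \<le> \<epsilon>"
  proof -
    have "real (Suc n) * (K * \<epsilon>' * c ^ Suc n) = \<epsilon> * ((real (Suc n) * K * c ^ Suc n) / (real (Suc n) * K * c ^ Suc n + 1))"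
      by (simp add: \<epsilon>'_def)
    also have "\<dots> \<le> \<epsilon> * 1" using \<epsilon> pos by (intro mult_left_mono) auto
    finally show ?thesis by simp
  qed
  obtain \<delta> where \<delta>: "\<delta> > 0" "\<forall>M X' w. length w = Suc n \<longrightarrow> skew X' \<longrightarrow> schatten p \<delta> (X' - \<iota> H) \<longrightarrow>
      (\<forall>(v, Y)\<in>set w. schatten p (M v) v \<and> (Y = \<iota> H \<or> Y = X')) \<longrightarrow>
      \<bar>word_integral (real k + \<theta>) k X' w - word_integral (real k + \<theta>) k (\<iota> H) (const_word (\<iota> H) (map fst w))\<bar>
        \<le> K * \<epsilon>' * prod_list (map (\<lambda>x. M (fst x)) w)"
    using K(2) [OF \<epsilon>'] by blast
  have "\<bar>form n (H + h) ws - form n H ws + (\<Sum>i\<le>length ws. form (Suc n) H (take i ws @ h # drop i ws))\<bar>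
      \<le> \<epsilon> * N h * prod_list (map N ws)"
    if h: "h \<in> V" "H + h \<in> V" "N h < \<delta> / c" and ws: "set ws \<subseteq> V" "length ws = n" for h ws
  proof -
    let ?X = "\<iota> H" and ?X' = "\<iota> (H + h)" and ?vs = "map \<iota> ws"
    let ?m = "\<lambda>i. mixed_word i ?X' ?X (?X' - ?X) ?vs"
    have X'X: "?X' - ?X = \<iota> h" using lin_\<iota> [OF H h(1), of 1 1] by simp
    define C where "C = max (c * N H) (c * N (H + h))"
    have X: "skew ?X" "schatten p C ?X" and X': "skew ?X'" "schatten p C ?X'"
      using skew_\<iota> [OF H] skew_\<iota> [OF h(2)] schatten_mono [OF schatten_\<iota> [OF H]] schatten_mono [OF schatten_\<iota> [OF h(2)]] p
      by (auto simp: C_def)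
    have vs: "schatten p (op_bound v) v" if "v \<in> set ?vs" for v
      using that ws schatten_op_bound by auto
    have N: "schatten p (op_bound (?X' - ?X)) (?X' - ?X)" unfolding X'X by (rule schatten_op_bound [OF h(1)])
    have "word_integral (real (Suc k) + \<theta>) (Suc k) ?X' (const_word ?X' ?vs) - word_integral (real (Suc k) + \<theta>) (Suc k) ?X (const_word ?X ?vs)
        = - (\<Sum>i\<le>length ?vs. word_integral (real k + \<theta>) k ?X' (?m i))"
      by (rule word_integral_diff [OF _ X X' N vs]) (use e1 ws in auto)
    then have "form n (H + h) ws - form n H ws = - (\<Sum>i\<le>length ws. word_integral (real k + \<theta>) k ?X' (?m i))"
      unfolding form_def mk by simp
    then have eq: "form n (H + h) ws - form n H ws + (\<Sum>i\<le>length ws. form (Suc n) H (take i ws @ h # drop i ws))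
        = (\<Sum>i\<le>length ws. form (Suc n) H (take i ws @ h # drop i ws) - word_integral (real k + \<theta>) k ?X' (?m i))"
      by (simp add: sum_subtractf)
    have "\<bar>form (Suc n) H (take i ws @ h # drop i ws) - word_integral (real k + \<theta>) k ?X' (?m i)\<bar>
        \<le> K * \<epsilon>' * c ^ Suc n * (N h * prod_list (map N ws))" if i: "i \<le> length ws" for i
    proof -
      let ?l = "take i ws @ h # drop i ws"
      have l: "set ?l \<subseteq> V" using ws h set_take_subset [of i ws] set_drop_subset [of i ws] by auto
      have fst: "map fst (?m i) = map \<iota> ?l" by (simp add: mixed_word_def X'X take_map drop_map o_def)
      have len: "length (?m i) = Suc n" using i ws by (simp add: mixed_word_def)
      have sd: "schatten p \<delta> (?X' - ?X)" unfolding X'X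
      proof (rule schatten_mono [OF schatten_\<iota> [OF h(1)]])
        show "c * N h \<le> \<delta>" using h(3) c by (simp add: pos_less_divide_eq mult.commute)
      qed (use p in simp)
      have pts: "\<forall>(v, Y)\<in>set (?m i). schatten p (op_bound v) v \<and> (Y = ?X \<or> Y = ?X')"
        using vs N set_take_subset [of i ?vs] set_drop_subset [of i ?vs] by (auto simp: mixed_word_def)
      have "\<bar>word_integral (real k + \<theta>) k ?X' (?m i) - word_integral (real k + \<theta>) k ?X (const_word ?X (map fst (?m i)))\<bar>
          \<le> K * \<epsilon>' * prod_list (map (\<lambda>x. op_bound (fst x)) (?m i))"
        using \<delta>(2) len X'(1) sd pts by blast
      moreover have "map (\<lambda>x. op_bound (fst x)) (?m i) = map (\<lambda>v. op_bound (\<iota> v)) ?l"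
      proof -
        have "map (\<lambda>x. op_bound (fst x)) (?m i) = map op_bound (map fst (?m i))" by simp
        then show ?thesis unfolding fst by simp
      qed
      moreover have "prod_list (map (\<lambda>v. op_bound (\<iota> v)) ?l) = c ^ Suc n * (N h * prod_list (map N ws))"
      proof -
        have "prod_list (map N ?l) = N h * prod_list (map N (take i ws @ drop i ws))"
          by (simp del: append_take_drop_id)
        moreover have "length ?l = Suc n" using i ws by simp
        ultimately show ?thesis using prod_op_bound [OF l] by simp
      qed
      ultimately show ?thesis
        unfolding form_def mk fst by (simp add: abs_minus_commute mult.assoc)
    qed
    then have "\<bar>\<Sum>i\<le>length ws. form (Suc n) H (take i ws @ h # drop i ws) - word_integral (real k + \<theta>) k ?X' (?m i)\<bar>
        \<le> (\<Sum>i\<le>length ws. K * \<epsilon>' * c ^ Suc n * (N h * prod_list (map N ws)))"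
      by (intro order_trans [OF sum_abs] sum_mono) auto
    also have "\<dots> = (real (Suc n) * (K * \<epsilon>' * c ^ Suc n)) * (N h * prod_list (map N ws))"
      using ws(2) by simp
    also have "\<dots> \<le> \<epsilon> * (N h * prod_list (map N ws))"
      by (intro mult_right_mono small mult_nonneg_nonneg N_nonneg h prod_N_nonneg ws)
    finally show ?thesis unfolding eq by (simp add: mult.assoc)
  qed
  moreover have "\<delta> / c > 0" using \<delta>(1) c by simp
  ultimately show ?thesis by blast
qed

text \<open>Differentiating inserts the new direction at every place of every ordering, which is the
  recursion of \<open>psum\<close> for a list headed by that direction. Each differentiation brings
  one sign from the resolvent identity.\<close>

theorem times_frechet_differentiable_form:
  assumes U: "U \<subseteq> V" and f: "\<And>H. H \<in> U \<Longrightarrow> f H = \<gamma> * word_integral p m (\<iota> H) []"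
  shows "times_frechet_differentiable_on m V N U f"
proof -
  define D where "D n H vs = \<gamma> * (-1) ^ n * psum (form n H) vs" for n H vs
  have D0: "D 0 H [] = f H" if "H \<in> U" for H
    using that m by (simp add: D_def form_def f)
  have "has_frechet_derivative_on V N U n (D n) (D (Suc n) H) H" if n: "n < m" and HU: "H \<in> U" for n H
    unfolding has_frechet_derivative_on_def
  proof (intro conjI allI impI)
    have H: "H \<in> V" using HU U by blast
    have Suc: "Suc n \<le> m" using n by simp
    show "bounded_multilinear_on V N (Suc n) (D (Suc n) H)"
      unfolding bounded_multilinear_on_def
    proof (intro conjI allI ballI impI)
      fix xs ys u v a b
      assume a: "u \<in> V" "v \<in> V" "set xs \<subseteq> V \<and> set ys \<subseteq> V \<and> length xs + length ys + 1 = Suc n"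
      have "psum (form (Suc n) H) (xs @ (a *\<^sub>R u + b *\<^sub>R v) # ys)
          = a * psum (form (Suc n) H) (xs @ u # ys) + b * psum (form (Suc n) H) (xs @ v # ys)"
        by (rule multilinear_onD [OF multilinear_on_psum [OF form_multilinear [OF Suc H]]]) (use a in auto)
      then show "D (Suc n) H (xs @ (a *\<^sub>R u + b *\<^sub>R v) # ys) = a *\<^sub>R D (Suc n) H (xs @ u # ys) + b *\<^sub>R D (Suc n) H (xs @ v # ys)"
        unfolding D_def by (simp add: algebra_simps)
    next
      obtain K where K: "K \<ge> 0" "\<And>ws. set ws \<subseteq> V \<Longrightarrow> length ws = Suc n \<Longrightarrow> \<bar>form (Suc n) H ws\<bar> \<le> K * prod_list (map N ws)"
        using form_bound [OF Suc H] by blast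
      have "norm (D (Suc n) H vs) \<le> \<bar>\<gamma>\<bar> * (fact (Suc n) * K) * prod_list (map N vs)"
        if vs: "set vs \<subseteq> V" "length vs = Suc n" for vs
      proof -
        have "\<bar>psum (form (Suc n) H) vs\<bar> \<le> fact (length vs) * K * prod_list (map N vs)"
          by (rule psum_abs_le [OF vs(1) K(2)]) (use vs in auto)
        then have "\<bar>\<gamma>\<bar> * \<bar>psum (form (Suc n) H) vs\<bar> \<le> \<bar>\<gamma>\<bar> * (fact (length vs) * K * prod_list (map N vs))"
          by (rule mult_left_mono) simp
        then show ?thesis unfolding D_def vs(2) real_norm_def abs_mult power_abs by (simp add: mult.assoc)
      qed
      then show "\<exists>C. \<forall>vs. set vs \<subseteq> V \<and> length vs = Suc n \<longrightarrow> norm (D (Suc n) H vs) \<le> C * prod_list (map N vs)"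
        by blast
    qed
    fix \<epsilon> :: real assume \<epsilon>: "\<epsilon> > 0"
    define \<epsilon>' where "\<epsilon>' = \<epsilon> / (\<bar>\<gamma>\<bar> * fact n + 1)"
    have pos: "0 \<le> \<bar>\<gamma>\<bar> * fact n" by simp
    have \<epsilon>': "\<epsilon>' > 0" using \<epsilon> pos unfolding \<epsilon>'_def by (intro divide_pos_pos add_nonneg_pos) auto
    have small: "\<bar>\<gamma>\<bar> * fact n * \<epsilon>' \<le> \<epsilon>"
    proof -
      have le1: "x / (x + 1) \<le> 1" if "0 \<le> x" for x :: real using that by simp
      have "\<bar>\<gamma>\<bar> * fact n * \<epsilon>' = \<epsilon> * ((\<bar>\<gamma>\<bar> * fact n) / (\<bar>\<gamma>\<bar> * fact n + 1))" by (simp add: \<epsilon>'_def)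
      also have "\<dots> \<le> \<epsilon> * 1" using \<epsilon> by (intro mult_left_mono le1 pos) auto
      finally show ?thesis by simp
    qed
    obtain \<delta> where \<delta>: "\<delta> > 0" "\<forall>h ws. h \<in> V \<longrightarrow> H + h \<in> V \<longrightarrow> N h < \<delta> \<longrightarrow> set ws \<subseteq> V \<longrightarrow> length ws = n \<longrightarrow>
        \<bar>form n (H + h) ws - form n H ws + (\<Sum>i\<le>length ws. form (Suc n) H (take i ws @ h # drop i ws))\<bar>
          \<le> \<epsilon>' * N h * prod_list (map N ws)"
      using form_remainder [OF n H \<epsilon>'] by blast
    show "\<exists>\<delta>>0. \<forall>h\<in>V. H + h \<in> U \<and> N h < \<delta> \<longrightarrow> (\<forall>vs. set vs \<subseteq> V \<and> length vs = n \<longrightarrow>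
        norm (D n (H + h) vs - D n H vs - D (Suc n) H (h # vs)) \<le> \<epsilon> * N h * prod_list (map N vs))"
    proof (intro exI [of _ \<delta>] conjI ballI allI impI)
      fix h vs assume h: "h \<in> V" "H + h \<in> U \<and> N h < \<delta>" and vs: "set vs \<subseteq> V \<and> length vs = n"
      have HhV: "H + h \<in> V" using h U by blast
      \<comment> \<open>\<open>psum\<close> is linear, so the remainder of the symmetrized forms is
        the symmetrized remainder, at the cost of a factor n!.\<close>
      let ?R = "\<lambda>ws. form n (H + h) ws - form n H ws + (\<Sum>i\<le>length ws. form (Suc n) H (take i ws @ h # drop i ws))"
      have R: "psum ?R vs = psum (form n (H + h)) vs - psum (form n H) vs + psum (form (Suc n) H) (h # vs)"
        using psum_lincomb [of 1 "\<lambda>ws. 1 * form n (H + h) ws + (-1) * form n H ws" 1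
            "\<lambda>ws. \<Sum>i\<le>length ws. form (Suc n) H (take i ws @ h # drop i ws)" vs]
          psum_lincomb [of 1 "form n (H + h)" "-1" "form n H" vs] by simp
      have "D n (H + h) vs - D n H vs - D (Suc n) H (h # vs) = \<gamma> * (-1) ^ n * psum ?R vs"
        unfolding R D_def by (simp add: algebra_simps)
      moreover have "\<bar>psum ?R vs\<bar> \<le> fact (length vs) * (\<epsilon>' * N h) * prod_list (map N vs)"
        by (rule psum_abs_le [where V = V]) (use \<delta>(2) h HhV vs in auto)
      ultimately have "norm (D n (H + h) vs - D n H vs - D (Suc n) H (h # vs))
          \<le> \<bar>\<gamma>\<bar> * (fact n * (\<epsilon>' * N h) * prod_list (map N vs))"
        using vs by (simp add: abs_mult power_abs mult_left_mono)
      also have "\<dots> = (\<bar>\<gamma>\<bar> * fact n * \<epsilon>') * (N h * prod_list (map N vs))" by (simp add: mult_ac)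
      also have "\<dots> \<le> \<epsilon> * (N h * prod_list (map N vs))"
        by (intro mult_right_mono small mult_nonneg_nonneg N_nonneg h prod_N_nonneg vs [THEN conjunct1])
      finally show "norm (D n (H + h) vs - D n H vs - D (Suc n) H (h # vs)) \<le> \<epsilon> * N h * prod_list (map N vs)"
        by (simp add: mult.assoc)
    qed (use \<delta>(1) in simp)
  qed
  then show ?thesis unfolding times_frechet_differentiable_on_def using D0 by blast
qed

end

end


section \<open>The Schatten norm as a trace integral\<close>

lemma nn_integral_count_space_has_sum:
  fixes f :: "'i \<Rightarrow> real"
  assumes "(f has_sum S) A" "\<And>x. x \<in> A \<Longrightarrow> 0 \<le> f x"
  shows "(\<integral>\<^sup>+x. ennreal (f x) \<partial>count_space A) = ennreal S"
proof -
  have "(\<lambda>x. norm (f x)) summable_on A"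
    using has_sum_imp_summable [OF assms(1)] assms(2) by (simp cong: summable_on_cong)
  then have *: "Infinite_Set_Sum.abs_summable_on f A" using abs_summable_equivalent by blast
  show ?thesis
    using nn_integral_conv_infsetsum [OF *] assms(2) infsetsum_infsum [OF *] infsumI [OF assms(1)] by simp
qed

lemma has_sum_restrict:
  assumes "(f has_sum S) A" "B \<subseteq> A" "\<And>x. x \<in> A - B \<Longrightarrow> f x = 0"
  shows "(f has_sum S) B"
  using assms has_sum_cong_neutral [of B A f f S] by blast

text \<open>Up to sign, the even part in t of (-x)^(m+1) / (1 + x) at x = it, when l = (m + 2) div
  2: then 2l is the even one of m + 1 and m + 2. Only this part is seen by the trace, since the
  quadratic form of an odd power of a skew operator vanishes.\<close>

definition profile :: "nat \<Rightarrow> real \<Rightarrow> real" where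
  "profile l t = t ^ (2 * l) / (1 + t\<^sup>2)"

lemma profile_nonneg: "0 \<le> profile l t"
  by (simp add: profile_def add_nonneg_pos)

lemma borel_measurable_profile [measurable]: "profile l \<in> borel_measurable borel"
  unfolding profile_def [abs_def] by measurable

text \<open>For 0 < p - 2l + 2 < 2 this is the integral of s^(p-2l+1) / (1 + s^2), with value \<pi>
  / (2 sin (\<pi> (p - 2l + 2) / 2)). As an extended real it is meaningful before its finiteness is
  known.\<close>

definition profile_moment :: "real \<Rightarrow> nat \<Rightarrow> ennreal" where
  "profile_moment p l = (\<integral>\<^sup>+s. ennreal (s powr (p - 1) * profile l (1 / s)) * indicator {0<..} s \<partial>lborel)"

lemma profile_moment_scale:
  assumes w: "w > 0"
  shows "(\<integral>\<^sup>+s. ennreal (s powr (p - 1) * profile l (w / s)) * indicator {0<..} s \<partial>lborel)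
    = ennreal (w powr p) * profile_moment p l"
proof -
  have "(\<integral>\<^sup>+s. ennreal (s powr (p - 1) * profile l (w / s)) * indicator {0<..} s \<partial>lborel)
      = ennreal w * (\<integral>\<^sup>+s. ennreal ((w * s) powr (p - 1) * profile l (w / (w * s))) * indicator {0<..} (w * s) \<partial>lborel)"
    using nn_integral_real_affine [of "\<lambda>s. ennreal (s powr (p - 1) * profile l (w / s)) * indicator {0<..} s" w 0] w
    by simp
  also have "\<dots> = ennreal w * (\<integral>\<^sup>+s. ennreal (w powr (p - 1)) * (ennreal (s powr (p - 1) * profile l (1 / s)) * indicator {0<..} s) \<partial>lborel)"
    using w by (intro arg_cong [where f = "(*) (ennreal w)"] nn_integral_cong)
      (simp add: powr_mult profile_nonneg mult.assoc zero_less_mult_iff indicator_def flip: ennreal_mult)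
  also have "\<dots> = ennreal w * ennreal (w powr (p - 1)) * profile_moment p l"
    unfolding profile_moment_def by (subst nn_integral_cmult) (simp_all add: mult.assoc)
  also have "ennreal w * ennreal (w powr (p - 1)) = ennreal (w powr p)"
    using w by (simp add: ennreal_mult [symmetric] powr_mult_base)
  finally show ?thesis .
qed

lemma profile_moment_pos: "profile_moment p l \<noteq> 0"
proof
  assume "profile_moment p l = 0"
  then have "AE s in lborel. ennreal (s powr (p - 1) * profile l (1 / s)) * indicator {0<..} s = 0"
    unfolding profile_moment_def by (subst (asm) nn_integral_0_iff_AE) simp_all
  then have "AE s in lborel. s \<notin> {0<..<1::real}"
  proof eventually_elim
    case (elim s)
    show ?case
    proof
      assume "s \<in> {0<..<1}"
      then have s: "s > 0" by simp
      then have "0 < s powr (p - 1) * profile l (1 / s)" by (simp add: profile_def add_pos_nonneg)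
      moreover have "s powr (p - 1) * profile l (1 / s) \<le> 0" using elim s by (simp add: ennreal_eq_0_iff)
      ultimately show False by simp
    qed
  qed
  then have "{0<..<1::real} \<in> null_sets lborel" by (subst (asm) AE_iff_null_sets [symmetric]) simp_all
  then have "emeasure lborel {0<..<1::real} = 0" by blast
  then show False by simp
qed

context real_hilbert
begin

text \<open>Raising the degree by two multiplies the entry by -t^2, where t = w/s, because Y^2 has
  \<open>e\<close> as an eigenvector. Hence two base cases suffice; they agree, as the odd
  contribution vanishes with the inner product of Y e and \<open>e\<close>.\<close>

lemma scaled_word_diagonal:
  assumes X: "skew X" and e: "norm e = 1" "blinfun_apply X e = w *\<^sub>R g"
    and ee: "blinfun_apply (radj X) (blinfun_apply X e) = w\<^sup>2 *\<^sub>R e" and s: "s > 0"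
  shows "r (blinfun_apply (scaled_word (Suc k) s X []) e) e = (-1) ^ ((k + 2) div 2) * profile ((k + 2) div 2) (w / s)"
proof -
  let ?Y = "(1 / s) *\<^sub>R X" and ?t = "w / s"
  have XXe: "blinfun_apply X (blinfun_apply X e) = - (w\<^sup>2 *\<^sub>R e)"
    using ee unfolding skew_adjoint [OF X] blinfun.minus_left by (metis minus_minus)
  have Ye: "blinfun_apply ?Y e = ?t *\<^sub>R g" by (simp add: blinfun.scaleR_left e)
  have YYe: "blinfun_apply ?Y (blinfun_apply ?Y e) = - (?t\<^sup>2 *\<^sub>R e)"
    by (simp add: blinfun.scaleR_left blinfun.scaleR_right XXe power_divide power2_eq_square)
  have Y: "skew ?Y" by (rule skew_scaleR [OF X])
  have rYY: "r (blinfun_apply ?Y (blinfun_apply ?Y z)) e = - (?t\<^sup>2 * r z e)" for z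
    unfolding skew_r [OF Y] YYe by (simp add: r_simps)
  have ee1: "r e e = 1" by (simp add: r_self e)
  have ge: "?t * r g e = 0" using skew_r_self(1) [OF Y, of e] unfolding Ye by (simp add: r_simps)
  have gg: "?t * (?t * r g g) = ?t\<^sup>2"
    using skew_r [OF Y, of e "blinfun_apply ?Y e"] unfolding YYe unfolding Ye by (simp add: r_simps ee1)
  have cay: "blinfun_apply (cay ?Y) e = (?t\<^sup>2 / (1 + ?t\<^sup>2)) *\<^sub>R e + (?t / (1 + ?t\<^sup>2)) *\<^sub>R g"
    by (rule cay_scaled_eigenvector [OF X e(2) XXe s])
  define c where "c = 1 + ?t\<^sup>2"
  have base0: "r (blinfun_apply (scaled_word (Suc 0) s X []) e) e = - (?t\<^sup>2 / c)"
    unfolding scaled_word_Nil blinfun.minus_left cay c_def [symmetric] using ge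
    by (auto simp: r_simps ee1)
  have base1: "r (blinfun_apply (scaled_word (Suc (Suc 0)) s X []) e) e = - (?t\<^sup>2 / c)"
  proof -
    have "r (blinfun_apply (scaled_word (Suc (Suc 0)) s X []) e) e = r (blinfun_apply ?Y (blinfun_apply (cay ?Y) e)) e"
      unfolding scaled_word_Nil_Suc scaled_word_Nil by (simp only: blinfun.minus_left blinfun.minus_right blinfun_apply_blinfun_compose minus_minus)
    also have "\<dots> = - (?t * r e g * (?t\<^sup>2 / c) + ?t * (?t * r g g) / c)"
      unfolding skew_r [OF Y] cay Ye c_def [symmetric] by (simp add: r_simps algebra_simps)
    also have "\<dots> = - (?t\<^sup>2 / c)" unfolding gg using ge by (auto simp: r_commute)
    finally show ?thesis .
  qed
  have step: "r (blinfun_apply (scaled_word (Suc (Suc (Suc k))) s X []) e) e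
      = - (?t\<^sup>2 * r (blinfun_apply (scaled_word (Suc k) s X []) e) e)" for k
    unfolding scaled_word_Nil_Suc rYY [symmetric]
    by (simp only: blinfun.minus_left blinfun.minus_right blinfun_apply_blinfun_compose minus_minus)
  show ?thesis
  proof (induction k rule: induct_nat_012)
    case 0
    then show ?case using base0 by (simp add: profile_def c_def)
  next
    case 1
    then show ?case using base1 by (simp add: profile_def c_def)
  next
    case (ge2 k)
    have div: "(Suc (Suc k) + 2) div 2 = Suc ((k + 2) div 2)" by simp
    show ?case unfolding step ge2(1) div profile_def mult_Suc_right power_add power_Suc by (simp only: times_divide_eq_left times_divide_eq_right mult_minus_left mult_1_left mult_1_right) (simp only: mult_ac)
  qed
qed

end

context schatten_exponents
begin

text \<open>
  With \<open>\<phi> = profile l\<close>, summing \<open>\<integral> s\<^bsup>p-1\<^esup> \<phi>(w/s) ds = w\<^sup>p \<integral> s\<^bsup>p-1\<^esup> \<phi>(1/s) ds\<close> over the singular values \<open>w\<close> recovers the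
  \<open>p\<close>-th power of the Schatten norm from the integral of traces. Finiteness of the constant comes
  for free from integrability, as soon as some singular value is positive.
\<close>

lemma word_integral_singular_values:
  assumes m: "real m + \<theta> = p" and X: "skew X" "schatten p C X" and B: "onb B"
    and w: "\<And>e. 0 \<le> w e" and Xe: "\<And>e. e \<in> B \<Longrightarrow> blinfun_apply X e = w e *\<^sub>R g e"
    and XX: "\<And>e. e \<in> B \<Longrightarrow> blinfun_apply (radj X) (blinfun_apply X e) = (w e)\<^sup>2 *\<^sub>R e"
    and S: "((\<lambda>e. w e powr p) has_sum S) B"
  defines "l \<equiv> (m + 2) div 2"
  shows "ennreal ((-1) ^ l * word_integral p m X []) = ennreal S * profile_moment p l"
proof -
  let ?T = "\<lambda>s. optrace (scaled_word (Suc m) s X [])"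
  let ?I = "indicator {0<..} :: real \<Rightarrow> real"
  let ?F = "\<lambda>s e. ennreal (s powr (p - 1) * profile l (w e / s)) * indicator {0<..} s"
  have n1: "norm e = 1" if "e \<in> B" for e using B that by (simp add: R.orthonormal_basis_def)
  have l: "l \<ge> 1" by (simp add: l_def)
  have has: "((\<lambda>e. profile l (w e / s)) has_sum (-1) ^ l * ?T s) B" if s: "s > 0" for s
  proof -
    obtain C' where "schatten 1 C' (scaled_word (Suc m) s X [])"
      using scaled_word_trace_class [of m "[]", OF _ X _ s] m by (auto simp: tame_word_def)
    from has_sum_cmult_right [OF has_sum_optrace [OF this B], of "(-1) ^ l"]
    have "((\<lambda>e. (-1) ^ l * ((-1) ^ l * profile l (w e / s))) has_sum (-1) ^ l * ?T s) B"
      by (rule has_sum_cong [THEN iffD1, rotated])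
        (simp add: scaled_word_diagonal [OF X(1) n1 Xe XX s] l_def)
    then show ?thesis by (simp add: power_mult_distrib [symmetric] flip: mult.assoc)
  qed
  have nonneg: "0 \<le> (-1) ^ l * ?T s" if "s > 0" for s
    by (rule has_sum_nonneg [OF has [OF that] profile_nonneg])
  have int: "set_integrable lborel {0<..} (\<lambda>s. s powr (p - 1) * ?T s)"
    using word_integral_integrable [of m "[]", OF _ X] m by (simp add: tame_word_def)
  \<comment> \<open>A summable family is nonzero at countably many places only. This allows the
    counting measure on \<open>B'\<close> to be interchanged with Lebesgue measure, even if the
    space is not separable.\<close>
  define B' where "B' = {e \<in> B. w e powr p \<noteq> 0}"
  have count: "countable B'"
    unfolding B'_def by (rule summable_countable_real [OF has_sum_imp_summable [OF S]])
  have B': "w e > 0" if "e \<in> B'" for e using that w [of e] by (simp add: B'_def order_less_le)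
  have sub: "B' \<subseteq> B" by (auto simp: B'_def)
  have profile0: "profile l 0 = 0" using l by (simp add: profile_def)
  have w0: "w e = 0" if "e \<in> B - B'" for e using that by (auto simp: B'_def)
  have e1: "(-1) ^ l * word_integral p m X [] = (\<integral>s. ?I s * (s powr (p - 1) * ((-1) ^ l * ?T s)) \<partial>lborel)"
    unfolding word_integral_def set_lebesgue_integral_def
    by (subst integral_mult_right_zero [symmetric]) (simp add: mult_ac)
  have e2: "ennreal (\<integral>s. ?I s * (s powr (p - 1) * ((-1) ^ l * ?T s)) \<partial>lborel)
      = (\<integral>\<^sup>+s. ennreal (?I s * (s powr (p - 1) * ((-1) ^ l * ?T s))) \<partial>lborel)"
  proof (rule nn_integral_eq_integral [symmetric])
    have "integrable lborel (\<lambda>s. (-1) ^ l * (?I s *\<^sub>R (s powr (p - 1) * ?T s)))"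
      by (intro integrable_mult_right int [unfolded set_integrable_def])
    then show "integrable lborel (\<lambda>s. ?I s * (s powr (p - 1) * ((-1) ^ l * ?T s)))" by (simp add: mult_ac)
    have "0 \<le> ?I s * (s powr (p - 1) * ((-1) ^ l * ?T s))" for s
      by (cases "s > 0") (use nonneg [of s] in simp_all)
    then show "AE s in lborel. 0 \<le> ?I s * (s powr (p - 1) * ((-1) ^ l * ?T s))" by (rule AE_I2)
  qed
  have e3: "(\<integral>\<^sup>+s. ennreal (?I s * (s powr (p - 1) * ((-1) ^ l * ?T s))) \<partial>lborel)
      = (\<integral>\<^sup>+s. (\<integral>\<^sup>+e. ?F s e \<partial>count_space B') \<partial>lborel)"
  proof (rule nn_integral_cong)
    fix s :: real
    show "ennreal (?I s * (s powr (p - 1) * ((-1) ^ l * ?T s)))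
        = (\<integral>\<^sup>+e. ?F s e \<partial>count_space B')"
    proof (cases "s > 0")
      case True
      have "((\<lambda>e. profile l (w e / s)) has_sum (-1) ^ l * ?T s) B'"
        by (rule has_sum_restrict [OF has [OF True]]) (simp_all add: sub w0 profile0)
      from nn_integral_count_space_has_sum [OF has_sum_cmult_right [OF this, of "s powr (p - 1)"]]
      show ?thesis using True by (simp add: profile_nonneg)
    qed simp
  qed
  have e4: "(\<integral>\<^sup>+s. (\<integral>\<^sup>+e. ?F s e \<partial>count_space B') \<partial>lborel)
      = (\<integral>\<^sup>+e. (\<integral>\<^sup>+s. ?F s e \<partial>lborel) \<partial>count_space B')"
    by (rule nn_integral_count_space_nn_integral [OF count]) simp
  have e5: "(\<integral>\<^sup>+e. (\<integral>\<^sup>+s. ?F s e \<partial>lborel) \<partial>count_space B')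
      = (\<integral>\<^sup>+e. ennreal (w e powr p) * profile_moment p l \<partial>count_space B')"
    by (rule nn_integral_cong) (simp add: profile_moment_scale B')
  have e6: "(\<integral>\<^sup>+e. ennreal (w e powr p) * profile_moment p l \<partial>count_space B')
      = ennreal S * profile_moment p l"
  proof -
    have "((\<lambda>e. w e powr p) has_sum S) B'"
      by (rule has_sum_restrict [OF S]) (auto simp: B'_def)
    from nn_integral_count_space_has_sum [OF this]
    show ?thesis by (simp add: nn_integral_multc)
  qed
  show ?thesis unfolding e1 e2 e3 e4 e5 e6 ..
qed

lemma schatten_power_integral:
  assumes m: "real m + \<theta> = p" and X: "skew X" "schatten p C X" and B: "onb B"
    and w: "\<And>e. 0 \<le> w e" and Xe: "\<And>e. e \<in> B \<Longrightarrow> blinfun_apply X e = w e *\<^sub>R g e"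
    and XX: "\<And>e. e \<in> B \<Longrightarrow> blinfun_apply (radj X) (blinfun_apply X e) = (w e)\<^sup>2 *\<^sub>R e"
    and S: "((\<lambda>e. w e powr p) has_sum S) B" "S > 0"
  defines "l \<equiv> (m + 2) div 2"
  shows "S = (-1) ^ l / enn2real (profile_moment p l) * word_integral p m X []"
proof -
  define J where "J = enn2real (profile_moment p l)"
  have eq: "ennreal ((-1) ^ l * word_integral p m X []) = ennreal S * profile_moment p l"
    unfolding l_def by (rule word_integral_singular_values [OF m X B w Xe XX S(1)])
  have "profile_moment p l \<noteq> \<infinity>"
    using eq S(2) by (metis ennreal_mult_eq_top_iff ennreal_neq_top infinity_ennreal_def ennreal_eq_0_iff not_le)
  then have J: "profile_moment p l = ennreal J" "J > 0"
    using profile_moment_pos [of p l] unfolding J_def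
    by (simp_all add: enn2real_positive_iff less_top zero_less_iff_neq_zero)
  have "ennreal ((-1) ^ l * word_integral p m X []) = ennreal (S * J)"
    using eq S(2) J by (simp add: ennreal_mult)
  moreover have "S * J > 0" using S(2) J by simp
  \<comment> \<open>\<open>ennreal\<close> sends negative numbers to 0, so the real equation is
    recovered by means of S * J > 0.\<close>
  ultimately have "(-1) ^ l * word_integral p m X [] = S * J"
    by (metis ennreal_eq_0_iff ennreal_inj le_cases not_le)
  then have "S = (-1) ^ l / J * word_integral p m X []" using J(2) by (simp add: field_simps)
  then show ?thesis unfolding J_def .
qed

end


section \<open>Reduction to a real Hilbert space\<close>

text \<open>Tonelli's theorem for unconditional sums. It transfers a sum over one orthonormal basis
  to a sum over another, which may belong to a different space, by means of a nonnegative double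
  array.\<close>

lemma has_sum_swap_nonneg:
  fixes f :: "'i \<Rightarrow> 'j \<Rightarrow> real"
  assumes f: "\<And>i j. i \<in> I \<Longrightarrow> j \<in> J \<Longrightarrow> 0 \<le> f i j"
    and rows: "\<And>i. i \<in> I \<Longrightarrow> ((\<lambda>j. f i j) has_sum g i) J"
    and columns: "\<And>j. j \<in> J \<Longrightarrow> ((\<lambda>i. f i j) has_sum h j) I"
    and g: "(g has_sum S) I"
  shows "(h has_sum S) J"
proof -
  have "(\<lambda>(i, j). f i j) summable_on I \<times> J"
    by (rule summable_on_SigmaI [OF _ has_sum_imp_summable [OF g]]) (simp_all add: rows f)
  then have "((\<lambda>(i, j). f i j) has_sum S) (I \<times> J)"
    by (intro has_sum_SigmaI [OF _ g]) (simp_all add: rows)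
  then have "((\<lambda>(j, i). f i j) has_sum S) (J \<times> I)"
    by (subst (asm) has_sum_swap) (simp add: case_prod_unfold)
  then show ?thesis by (rule has_sum_SigmaD) (simp add: columns)
qed

section \<open>Absolute values and powers of operators in a basis of singular vectors\<close>

context hilbert_space
begin

lemma K_linear_eq_on_basis:
  assumes B: "orthonormal_basis B" and S: "K_linear S" and T: "K_linear T"
    and eq: "\<And>e. e \<in> B \<Longrightarrow> blinfun_apply S e = blinfun_apply T e"
  shows "S = T"
proof (rule blinfun_eqI)
  fix x
  have "((\<lambda>e. scale (ip x e) (blinfun_apply A e)) has_sum blinfun_apply A x) B" if "K_linear A" for A
    using has_sum_bounded_linear [OF blinfun.bounded_linear_right fourier_expansion [OF B, of x], of A] that
    by (simp add: K_linear_def ip_in_scalars)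
  note sums = this
  have "((\<lambda>e. scale (ip x e) (blinfun_apply S e)) has_sum blinfun_apply T x) B"
    using sums [OF T] by (simp add: eq cong: has_sum_cong)
  with sums [OF S] show "blinfun_apply S x = blinfun_apply T x" by (rule has_sum_unique)
qed

lemma diagonal_form_finite:
  fixes w :: "'a \<Rightarrow> real"
  assumes B: "orthonormal_basis B" and w: "\<And>e. e \<in> B \<Longrightarrow> \<bar>w e\<bar> \<le> M" and M: "0 \<le> M"
    and F: "finite F" "F \<subseteq> B"
  shows "(\<Sum>e\<in>F. cmod (w e * (ip x e * ip e y))) \<le> M * norm x * norm y"
proof -
  have "(\<Sum>e\<in>F. cmod (w e * (ip x e * ip e y))) \<le> (\<Sum>e\<in>F. M * (cmod (ip x e) * cmod (ip y e)))"
  proof (rule sum_mono)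
    fix e assume "e \<in> F"
    moreover have "cmod (ip e y) = cmod (ip y e)" using ip_commute [of y e] by simp
    ultimately show "cmod (w e * (ip x e * ip e y)) \<le> M * (cmod (ip x e) * cmod (ip y e))"
      using w F by (auto simp: norm_mult intro!: mult_right_mono)
  qed
  also have "\<dots> = M * (\<Sum>e\<in>F. \<bar>cmod (ip x e)\<bar> * \<bar>cmod (ip y e)\<bar>)" by (simp add: sum_distrib_left)
  also have "\<dots> \<le> M * (L2_set (\<lambda>e. cmod (ip x e)) F * L2_set (\<lambda>e. cmod (ip y e)) F)"
    by (intro mult_left_mono L2_set_mult_ineq M)
  also have "\<dots> \<le> M * (norm x * norm y)"
  proof (intro mult_left_mono mult_mono M)
    have "L2_set (\<lambda>e. cmod (ip z e)) F \<le> norm z" for z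
      unfolding L2_set_def using bessel [OF orthonormal_basis_set [OF B] F] by (simp add: real_le_lsqrt)
    then show "L2_set (\<lambda>e. cmod (ip x e)) F \<le> norm x" "L2_set (\<lambda>e. cmod (ip y e)) F \<le> norm y" by auto
  qed (auto simp: L2_set_nonneg)
  finally show ?thesis by (simp add: mult.assoc)
qed

text \<open>The operator is obtained from its bounded sesquilinear form by the Riesz representation;
  the form converges absolutely by Cauchy's and Bessel's inequalities.\<close>

lemma diagonal_op_exists:
  fixes w :: "'a \<Rightarrow> real"
  assumes B: "orthonormal_basis B" and w: "\<And>e. e \<in> B \<Longrightarrow> \<bar>w e\<bar> \<le> M" and M: "0 \<le> M"
  obtains T where "K_linear T" "\<And>x y. ((\<lambda>e. w e * (ip x e * ip e y)) has_sum ip x (blinfun_apply T y)) B"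
proof -
  let ?f = "\<lambda>x y e. w e * (ip x e * ip e y)"
  define Q where "Q x y = infsum (?f x y) B" for x y
  note finite = diagonal_form_finite [OF B w M]
  have abs: "(\<lambda>e. cmod (?f x y e)) summable_on B" for x y
    by (rule nonneg_bdd_above_summable_on) (auto intro!: bdd_aboveI2 finite)
  have Q: "(?f x y has_sum Q x y) B" for x y
    unfolding Q_def by (rule has_sum_infsum [OF abs_summable_summable [OF abs]])
  have bound: "cmod (Q x y) \<le> M * norm x * norm y" for x y
  proof -
    have "cmod (Q x y) \<le> (\<Sum>\<^sub>\<infinity>e\<in>B. cmod (?f x y e))" unfolding Q_def by (rule norm_infsum_bound [OF abs])
    also have "\<dots> \<le> M * norm x * norm y" by (rule infsum_le_finite_sums [OF abs finite])
    finally show ?thesis .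
  qed
  have add_left: "Q (x + x') y = Q x y + Q x' y" for x x' y
    using has_sum_add [OF Q [of x y] Q [of x' y]]
    by (intro has_sum_unique [OF Q]) (simp add: ip_add_left algebra_simps)
  have scale_left: "Q (scale c x) y = c * Q x y" if "c \<in> K" for c x y
    using has_sum_cmult_right [OF Q [of x y], of c] that
    by (intro has_sum_unique [OF Q]) (simp add: ip_scale_left mult_ac)
  have add_right: "Q x (y + y') = Q x y + Q x y'" for x y y'
    using has_sum_add [OF Q [of x y] Q [of x y']]
    by (intro has_sum_unique [OF Q]) (simp add: ip_add_right algebra_simps)
  have scale_right: "Q x (scale c y) = cnj c * Q x y" if "c \<in> K" for c x y
    using has_sum_cmult_right [OF Q [of x y], of "cnj c"] that
    by (intro has_sum_unique [OF Q]) (simp add: ip_scale_right mult_ac)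
  \<comment> \<open>\<open>riesz\<close> requires values in \<open>K\<close>. In the real case all
    terms are real, so the imaginary part of their sum is 0.\<close>
  have QK: "Q x y \<in> K" for x y
  proof -
    have "Q x y \<in> \<real>" if "K = \<real>"
    proof -
      have "((\<lambda>e. Im (?f x y e)) has_sum Im (Q x y)) B" by (rule has_sum_Im [OF Q])
      moreover have "ip a b \<in> \<real>" for a b using ip_in_scalars that by blast
      then have "Im (ip a b) = 0" for a b using complex_is_Real_iff by blast
      ultimately have "((\<lambda>e. 0) has_sum Im (Q x y)) B" by simp
      then have "Im (Q x y) = 0" using has_sum_0 [of B "\<lambda>e. 0 :: real"] has_sum_unique by blast
      then show ?thesis by (simp add: complex_is_Real_iff)
    qed
    then show ?thesis using scalars by auto
  qed
  have "\<exists>z. \<forall>x. Q x y = ip x z" for y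
  proof (rule riesz)
    show "bounded_linear (\<lambda>x. Q x y)"
    proof (rule bounded_linear_intro)
      show "norm (Q x y) \<le> norm x * (M * norm y)" for x using bound [of x y] by (simp add: mult_ac)
      show "Q (c *\<^sub>R x) y = c *\<^sub>R Q x y" for c x
        using scale_left [of "complex_of_real c" x y] by (simp add: scale_of_real scaleR_conv_of_real)
    qed (rule add_left)
  qed (simp_all add: scale_left QK)
  then obtain T where T: "Q x y = ip x (T y)" for x y by metis
  have "bounded_linear T"
  proof (rule bounded_linear_intro [where K = M])
    show "T (y + y') = T y + T y'" for y y'
      by (rule ip_eqI_right) (simp add: T [symmetric] ip_add_right add_right)
    show "T (c *\<^sub>R y) = c *\<^sub>R T y" for c y
      using scale_right [of "complex_of_real c" _ y]
      by (intro ip_eqI_right) (simp add: T [symmetric] ip_scaleR_right scale_of_real scaleR_conv_of_real)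
    fix y
    have "(norm (T y))\<^sup>2 \<le> M * norm (T y) * norm y"
      using bound [of "T y" y] unfolding T ip_self norm_of_real by simp
    then have "norm (T y) * norm (T y) \<le> norm (T y) * (norm y * M)" by (simp add: power2_eq_square mult_ac)
    then show "norm (T y) \<le> norm y * M"
      using M by (cases "norm (T y) = 0") (auto simp: mult_le_cancel_left)
  qed
  then have ap: "blinfun_apply (Blinfun T) = T" by (rule bounded_linear_Blinfun_apply)
  have "K_linear (Blinfun T)"
    unfolding K_linear_def ap
    by (intro ballI allI ip_eqI_right) (simp add: T [symmetric] ip_scale_right scale_right)
  moreover have "(?f x y has_sum ip x (blinfun_apply (Blinfun T) y)) B" for x y
    using Q [of x y] by (simp add: ap T)
  ultimately show ?thesis by (rule that)
qed

text \<open>For l > 0 the vector y = (T - l) x satisfies T y = - l y, which positivity permits only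
  for y = 0; for l = 0 symmetry gives that the norm of T x vanishes. This yields the uniqueness of
  positive square roots.\<close>

lemma positive_sqrt_eigenvector:
  assumes T: "positive_op T" and l: "l \<ge> 0" and x: "blinfun_apply T (blinfun_apply T x) = l\<^sup>2 *\<^sub>R x"
  shows "blinfun_apply T x = l *\<^sub>R x"
proof -
  have sym: "ip (blinfun_apply T u) v = ip u (blinfun_apply T v)" for u v using T by (simp add: positive_op_def)
  show ?thesis
  proof (cases "l = 0")
    case True
    have "ip (blinfun_apply T x) (blinfun_apply T x) = ip (blinfun_apply T (blinfun_apply T x)) x" by (simp add: sym)
    also have "\<dots> = 0" using x True by simp
    finally show ?thesis using True by (simp add: ip_self_zero_iff)
  next
    case False
    define y where "y = blinfun_apply T x - l *\<^sub>R x"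
    have "blinfun_apply T y = - (l *\<^sub>R y)"
      by (simp add: y_def blinfun.diff_right blinfun.scaleR_right x power2_eq_square scaleR_diff_right)
    moreover have "0 \<le> Re (ip (blinfun_apply T y) y)" using T unfolding positive_op_def by blast
    ultimately have "l * (norm y)\<^sup>2 \<le> 0" by (simp add: ip_minus_left ip_scaleR_left ip_self)
    then have "y = 0" using l False by (auto simp: mult_le_0_iff)
    then show ?thesis by (simp add: y_def)
  qed
qed

text \<open>Evaluates the definite description in \<open>abs_op\<close>: the diagonal operator with
  entries \<open>w e\<close> is a positive square root, and by
  \<open>positive_sqrt_eigenvector\<close> any other one agrees with it on the basis.\<close>

lemma abs_op_eigenvector:
  assumes H: "K_linear H" and A: "orthonormal_basis A" and w: "\<And>e. w e \<ge> (0::real)"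
    and AA: "\<And>e. e \<in> A \<Longrightarrow> blinfun_apply (adj H) (blinfun_apply H e) = (w e)\<^sup>2 *\<^sub>R e"
  shows "positive_op (abs_op H)" "e \<in> A \<Longrightarrow> blinfun_apply (abs_op H) e = w e *\<^sub>R e"
proof -
  note S = orthonormal_basis_set [OF A]
  have wM: "\<bar>w e\<bar> \<le> norm H" if e: "e \<in> A" for e
  proof (rule power2_le_imp_le)
    have "(norm (blinfun_apply H e))\<^sup>2 = Re (ip (blinfun_apply (adj H) (blinfun_apply H e)) e)"
      by (simp add: ip_adj' [OF H] ip_self)
    also have "\<dots> = (w e)\<^sup>2" using orthonormal_ip [OF S e e] by (simp add: AA [OF e] ip_scaleR_left)
    finally have "(w e)\<^sup>2 = (norm (blinfun_apply H e))\<^sup>2" by simp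
    also have "\<dots> \<le> (norm H * norm e)\<^sup>2" by (intro power_mono norm_blinfun) simp
    finally show "\<bar>w e\<bar>\<^sup>2 \<le> (norm H)\<^sup>2" using e A by (simp add: orthonormal_basis_def)
  qed simp
  obtain T where T: "K_linear T" and Tsum: "\<And>x y. ((\<lambda>e. w e * (ip x e * ip e y)) has_sum ip x (blinfun_apply T y)) A"
    by (rule diagonal_op_exists [where w = w, OF A _ norm_ge_zero [of H]]) (auto intro: wM that)
  have Te: "blinfun_apply T e = w e *\<^sub>R e" if e: "e \<in> A" for e
  proof (rule ip_eqI_right)
    fix z
    have "((\<lambda>f. w f * (ip z f * ip f e)) has_sum ip z (blinfun_apply T e)) {e}"
      by (rule has_sum_restrict [OF Tsum]) (use e in \<open>auto simp: orthonormal_ip [OF S]\<close>)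
    then have "w e * (ip z e * ip e e) = ip z (blinfun_apply T e)" by (simp add: has_sum_finite_iff)
    then show "ip z (blinfun_apply T e) = ip z (w e *\<^sub>R e)"
      by (simp add: orthonormal_ip [OF S e e] ip_scaleR_right scaleR_conv_of_real)
  qed
  have sym: "ip (blinfun_apply T x) y = ip x (blinfun_apply T y)" for x y
  proof (rule has_sum_unique [OF _ Tsum])
    have "((\<lambda>e. cnj (w e * (ip y e * ip e x))) has_sum cnj (ip y (blinfun_apply T x))) A"
      by (simp only: has_sum_cnj_iff Tsum)
    then show "((\<lambda>e. w e * (ip x e * ip e y)) has_sum ip (blinfun_apply T x) y) A"
      by (simp add: ip_commute [symmetric] mult.commute)
  qed
  have pos: "0 \<le> Re (ip (blinfun_apply T x) x)" for x
  proof -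
    have "((\<lambda>e. Re (w e * (ip x e * ip e x))) has_sum Re (ip x (blinfun_apply T x))) A" by (rule has_sum_Re [OF Tsum])
    moreover have "ip x e * ip e x = complex_of_real ((cmod (ip x e))\<^sup>2)" for e
      using ip_commute [of e x] complex_norm_square [of "ip x e"] by simp
    ultimately have "((\<lambda>e. w e * (cmod (ip x e))\<^sup>2) has_sum Re (ip x (blinfun_apply T x))) A" by simp
    then show ?thesis unfolding sym by (rule has_sum_nonneg) (simp add: w)
  qed
  have pT: "positive_op T" using T sym pos by (simp add: positive_op_def)
  have "T o\<^sub>L T = adj H o\<^sub>L H"
  proof (rule K_linear_eq_on_basis [OF A])
    show "K_linear (T o\<^sub>L T)" using T by (simp add: K_linear_def)
    show "K_linear (adj H o\<^sub>L H)" using H K_linear_adj [OF H] by (simp add: K_linear_def)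
  qed (simp add: AA Te blinfun.scaleR_right power2_eq_square)
  moreover have "T' = T" if "positive_op T'" "T' o\<^sub>L T' = adj H o\<^sub>L H" for T'
  proof (rule K_linear_eq_on_basis [OF A])
    show "K_linear T'" using that by (simp add: positive_op_def)
    fix e assume e: "e \<in> A"
    have "blinfun_apply T' (blinfun_apply T' e) = blinfun_apply (T' o\<^sub>L T') e" by simp
    also have "\<dots> = (w e)\<^sup>2 *\<^sub>R e" unfolding that(2) by (simp add: AA e)
    finally show "blinfun_apply T' e = blinfun_apply T e"
      using positive_sqrt_eigenvector [OF that(1) w] by (simp add: Te e)
  qed (rule T)
  ultimately have "abs_op H = T" unfolding abs_op_def using pT by (blast intro: the_equality)
  then show "positive_op (abs_op H)" "e \<in> A \<Longrightarrow> blinfun_apply (abs_op H) e = w e *\<^sub>R e"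
    by (simp_all only: pT Te)
qed

text \<open>Eigenspaces of a symmetric operator for different eigenvalues are orthogonal, so at most
  one summand survives. For l = 0 none does, in agreement with 0 powr p = 0.\<close>

lemma op_powr_eigenvector:
  assumes T: "positive_op T" and l: "l \<ge> 0" and x: "blinfun_apply T x = l *\<^sub>R x"
  shows "op_powr T p x = (l powr p) *\<^sub>R x"
proof -
  have sym: "ip (blinfun_apply T u) v = ip u (blinfun_apply T v)" for u v using T by (simp add: positive_op_def)
  have TK: "K_linear T" using T by (simp add: positive_op_def)
  have sub: "K_subspace (eigenspace T k)" for k
    unfolding K_subspace_def eigenspace_def
  proof (intro conjI ballI)
    fix c x assume c: "c \<in> K" and x: "x \<in> {x. blinfun_apply T x = k *\<^sub>R x}"
    interpret s: bounded_linear "scale c" by (rule bounded_linear_scale [OF c])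
    show "scale c x \<in> {x. blinfun_apply T x = k *\<^sub>R x}"
      using TK c x by (simp add: K_linear_def s.scaleR)
  qed (auto simp: blinfun.zero_right blinfun.add_right scaleR_add_right)
  have proj: "orth_proj (eigenspace T k) x = (if k = l then x else 0)" for k
  proof (rule orth_proj_eqI [OF sub])
    show "(if k = l then x else 0) \<in> eigenspace T k" using x by (simp add: eigenspace_def blinfun.zero_right)
    show "\<forall>z\<in>eigenspace T k. ip (x - (if k = l then x else 0)) z = 0"
    proof
      fix z assume "z \<in> eigenspace T k"
      then have "l *\<^sub>R ip x z = k *\<^sub>R ip x z" using sym [of x z] by (simp add: x eigenspace_def ip_scaleR_left ip_scaleR_right)
      then show "ip (x - (if k = l then x else 0)) z = 0" by auto
    qed
  qed
  have "op_powr T p x = (\<Sum>\<^sub>\<infinity>k\<in>{0<..}. if k = l then (l powr p) *\<^sub>R x else 0)"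
    unfolding op_powr_def proj by (rule infsum_cong) simp
  also have "\<dots> = (\<Sum>\<^sub>\<infinity>k\<in>{l} \<inter> {0<..}. (l powr p) *\<^sub>R x)"
    by (rule infsum_cong_neutral) auto
  also have "\<dots> = (l powr p) *\<^sub>R x" using l by (cases "l = 0") simp_all
  finally show ?thesis .
qed

text \<open>In a basis of right singular vectors the operator whose trace defines the norm is
  diagonal, and the trace may be computed in any basis.\<close>

lemma schatten_norm_singular_values:
  assumes H: "H \<in> schatten_class p" and p: "p \<noteq> 0" and A: "orthonormal_basis A" and w: "\<And>e. w e \<ge> (0::real)"
    and AA: "\<And>e. e \<in> A \<Longrightarrow> blinfun_apply (adj H) (blinfun_apply H e) = (w e)\<^sup>2 *\<^sub>R e"
  shows "((\<lambda>e. w e powr p) has_sum schatten_norm p H powr p) A"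
proof -
  have "K_linear H" using H by (simp add: schatten_class_def compact_op_def)
  note T = abs_op_eigenvector [OF this A w AA]
  obtain t where t: "has_trace (op_powr (abs_op H) p) t" using H by (auto simp: schatten_class_def)
  have "trace (op_powr (abs_op H) p) = t"
    unfolding trace_def
  proof (rule the_equality)
    fix t' assume "has_trace (op_powr (abs_op H) p) t'"
    with t A show "t' = t" unfolding has_trace_def by (blast intro: has_sum_unique)
  qed (rule t)
  moreover have "((\<lambda>e. w e powr p) has_sum Re t) A"
  proof -
    have "((\<lambda>e. ip (op_powr (abs_op H) p e) e) has_sum t) A" using t A by (simp add: has_trace_def)
    from has_sum_Re [OF this] show ?thesis
      by (rule has_sum_cong [THEN iffD1, rotated])
        (simp add: op_powr_eigenvector [OF T(1) w T(2)] ip_scaleR_left orthonormal_ip [OF orthonormal_basis_set [OF A]])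
  qed
  moreover from this have "0 \<le> Re t" by (rule has_sum_nonneg) simp
  ultimately show ?thesis using p by (simp add: schatten_norm_def powr_powr)
qed

end

text \<open>The exponent p - 2 may be negative; at l = 0 both sides vanish, since
  \<open>powr\<close> with base 0 is 0.\<close>

lemma powr_minus_two: "(0::real) \<le> l \<Longrightarrow> l powr (p - 2) * l\<^sup>2 = l powr p"
proof (cases "l = 0")
  case False
  assume "0 \<le> l"
  with False have l: "l > 0" by simp
  then have "l powr (p - 2) * l\<^sup>2 = l powr (p - 2) * l powr 2" by (simp add: powr_numeral)
  also have "\<dots> = l powr p" by (simp only: powr_add [symmetric]) simp
  finally show ?thesis .
qed simp

section \<open>The skew dilation and its singular values\<close>

context hilbert_space
begin

definition pair_ip :: "'a \<times> 'a \<Rightarrow> 'a \<times> 'a \<Rightarrow> real" where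
  "pair_ip x y = Re (ip (fst x) (fst y)) + Re (ip (snd x) (snd y))"

lemma real_hilbert_Re: "real_hilbert (\<lambda>x y. Re (ip x y))"
  by unfold_locales (simp_all add: ip_add_left ip_scaleR_left ip_Re_commute ip_self)

lemma real_hilbert_pair: "real_hilbert pair_ip"
  by unfold_locales
    (simp_all add: pair_ip_def ip_add_left ip_scaleR_left ip_Re_commute ip_self norm_prod_def algebra_simps)

interpretation A: real_hilbert "\<lambda>x y. Re (ip x y)" by (rule real_hilbert_Re)
interpretation E: real_hilbert pair_ip by (rule real_hilbert_pair)

text \<open>The skew dilation \<open>(x, y) \<mapsto> (H y, - H\<^sup>* x)\<close>, whose singular values are those of \<open>H\<close>, repeated.\<close>

definition dilation :: "('a \<Rightarrow>\<^sub>L 'a) \<Rightarrow> (('a \<times> 'a) \<Rightarrow>\<^sub>L ('a \<times> 'a))" where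
  "dilation H = (Blinfun (\<lambda>x. (x, 0)) o\<^sub>L (H o\<^sub>L Blinfun snd)) - (Blinfun (\<lambda>x. (0, x)) o\<^sub>L (adj H o\<^sub>L Blinfun fst))"

lemma dilation_apply: "blinfun_apply (dilation H) z = (blinfun_apply H (snd z), - blinfun_apply (adj H) (fst z))"
proof -
  have "bounded_linear (\<lambda>x::'a. (x, 0::'a))" "bounded_linear (\<lambda>x::'a. (0::'a, x))"
    by (intro bounded_linear_Pair bounded_linear_ident bounded_linear_zero)+
  then show ?thesis
    by (simp add: dilation_def blinfun.diff_left bounded_linear_Blinfun_apply bounded_linear_fst bounded_linear_snd)
qed

lemma skew_dilation: "K_linear H \<Longrightarrow> E.skew (dilation H)"
  by (simp add: E.skew_def pair_ip_def dilation_apply ip_adj ip_adj' ip_minus_left ip_minus_right)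

lemma dilation_lincomb:
  "K_linear G \<Longrightarrow> K_linear H \<Longrightarrow> dilation (a *\<^sub>R G + b *\<^sub>R H) = a *\<^sub>R dilation G + b *\<^sub>R dilation H"
  by (rule blinfun_eqI)
    (simp add: dilation_apply adj_lincomb blinfun.add_left blinfun.scaleR_left)

lemma inj_dilation: "inj dilation"
proof (rule injI)
  fix G H assume eq: "dilation G = dilation H"
  show "G = H"
  proof (rule blinfun_eqI)
    fix y
    show "blinfun_apply G y = blinfun_apply H y"
      using dilation_apply [of G "(0, y)"] dilation_apply [of H "(0, y)"] eq by simp
  qed
qed

lemma compact_dilation:
  assumes "K_linear H" "compact_map H"
  shows "compact_map (dilation H)"
proof -
  have "A.radj H = adj H" by (rule A.adjoint_eqI) (simp add: ip_adj [OF assms(1)])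
  then have "compact_map (adj H)" using A.compact_map_adjoint [OF assms(2)] by simp
  then have "compact_map ((Blinfun (\<lambda>x. (x, 0 :: 'a)) o\<^sub>L (H o\<^sub>L Blinfun snd))
      + (-1) *\<^sub>R (Blinfun (\<lambda>x. (0 :: 'a, x)) o\<^sub>L (adj H o\<^sub>L Blinfun fst)))"
    by (intro compact_map_add compact_map_scaleR compact_map_compose_left compact_map_compose_right assms(2))
  then show ?thesis by (simp add: dilation_def)
qed

text \<open>The dimension of \<open>K\<close> over the reals: the factor by which multiplicities
  grow when the complex structure is forgotten.\<close>

definition scalar_dim :: real where
  "scalar_dim = (if K = \<real> then 1 else 2)"

lemma scalar_dim_pos: "scalar_dim > 0"
  by (simp add: scalar_dim_def)

text \<open>Parseval's identity of the real space, applied to vectors supported in one component. In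
  the complex case u and \<i> u yield the real and the imaginary parts of the inner products, each
  with total (\<open>norm u\<close>)^2.\<close>

lemma pair_parseval:
  assumes B: "E.onb B"
  shows "((\<lambda>e. (cmod (ip u (fst e)))\<^sup>2) has_sum scalar_dim * (norm u)\<^sup>2) B"
    and "((\<lambda>e. (cmod (ip u (snd e)))\<^sup>2) has_sum scalar_dim * (norm u)\<^sup>2) B"
proof -
  have fst: "((\<lambda>e. (Re (ip v (fst e)))\<^sup>2) has_sum (norm v)\<^sup>2) B" for v
    using E.parseval_norm_r [OF B, of "(v, 0)"] by (simp add: pair_ip_def norm_prod_def)
  have snd: "((\<lambda>e. (Re (ip v (snd e)))\<^sup>2) has_sum (norm v)\<^sup>2) B" for v
    using E.parseval_norm_r [OF B, of "(0, v)"] by (simp add: pair_ip_def norm_prod_def)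
  have both: "((\<lambda>e. (cmod (ip u (\<pi> e)))\<^sup>2) has_sum scalar_dim * (norm u)\<^sup>2) B"
    if \<pi>: "\<And>v. ((\<lambda>e. (Re (ip v (\<pi> e)))\<^sup>2) has_sum (norm v)\<^sup>2) B" for \<pi> :: "'a \<times> 'a \<Rightarrow> 'a"
  proof (cases "K = \<real>")
    case True
    then have "Im (ip x y) = 0" for x y using ip_in_scalars [of x y] by (simp add: complex_is_Real_iff)
    moreover have "scalar_dim = 1" unfolding scalar_dim_def if_P [OF True] ..
    ultimately show ?thesis using \<pi> [of u] by (simp add: cmod_power2)
  next
    case False
    then have i: "\<i> \<in> K" using scalars by auto
    have "((\<lambda>e. (Re (ip u (\<pi> e)))\<^sup>2 + (Re (ip (scale \<i> u) (\<pi> e)))\<^sup>2) has_sum (norm u)\<^sup>2 + (norm (scale \<i> u))\<^sup>2) B"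
      by (intro has_sum_add \<pi>)
    then show ?thesis using False by (simp add: scalar_dim_def cmod_power2 ip_scale_left [OF i] norm_scale [OF i])
  qed
  show "((\<lambda>e. (cmod (ip u (fst e)))\<^sup>2) has_sum scalar_dim * (norm u)\<^sup>2) B" by (rule both [OF fst])
  show "((\<lambda>e. (cmod (ip u (snd e)))\<^sup>2) has_sum scalar_dim * (norm u)\<^sup>2) B" by (rule both [OF snd])
qed

text \<open>
  The bases \<open>A\<close> and \<open>B\<close> are compared by double sums over \<open>A \<times> B\<close>: an entry can be nonzero only where
  the two singular values agree.
\<close>

lemma dilation_singular_values:
  assumes H: "K_linear H" and A: "orthonormal_basis A" and l: "\<And>a. l a \<ge> (0::real)"
    and HA: "\<And>a. a \<in> A \<Longrightarrow> blinfun_apply (adj H) (blinfun_apply H a) = (l a)\<^sup>2 *\<^sub>R a"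
    and B: "E.onb B" and w: "\<And>e. w e \<ge> (0::real)"
    and XB: "\<And>e. e \<in> B \<Longrightarrow> blinfun_apply (E.radj (dilation H)) (blinfun_apply (dilation H) e) = (w e)\<^sup>2 *\<^sub>R e"
    and S: "((\<lambda>a. l a powr p) has_sum S) A"
  shows "((\<lambda>e. w e powr p) has_sum 2 * scalar_dim * S) B"
proof -
  have na: "norm a = 1" if "a \<in> A" for a using A that by (simp add: orthonormal_basis_def)
  have ne: "(norm (fst e))\<^sup>2 + (norm (snd e))\<^sup>2 = 1" if "e \<in> B" for e
  proof -
    have "norm e = 1" using B that by (simp add: E.R.orthonormal_basis_def)
    then show ?thesis by (simp add: norm_prod_def)
  qed
  have HB: "blinfun_apply H (blinfun_apply (adj H) (fst e)) = (w e)\<^sup>2 *\<^sub>R fst e"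
    "blinfun_apply (adj H) (blinfun_apply H (snd e)) = (w e)\<^sup>2 *\<^sub>R snd e" if "e \<in> B" for e
    using XB [OF that] unfolding E.skew_adjoint [OF skew_dilation [OF H]]
    by (auto simp: dilation_apply blinfun.minus_left blinfun.minus_right prod_eq_iff)
  have sym: "cmod (ip x y) = cmod (ip y x)" for x y using ip_commute [of x y] by simp
  have HHa: "blinfun_apply H (blinfun_apply (adj H) (blinfun_apply H a)) = (l a)\<^sup>2 *\<^sub>R blinfun_apply H a" if "a \<in> A" for a
    by (simp add: HA that blinfun.scaleR_right)
  have match_fst: "l a powr q * (cmod (ip (blinfun_apply H a) (fst e)))\<^sup>2 = w e powr q * (cmod (ip (blinfun_apply H a) (fst e)))\<^sup>2"
    if "a \<in> A" "e \<in> B" for a e q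
  proof (cases "ip (blinfun_apply H a) (fst e) = 0")
    case False
    have "(l a)\<^sup>2 *\<^sub>R ip (blinfun_apply H a) (fst e) = ip (blinfun_apply H (blinfun_apply (adj H) (blinfun_apply H a))) (fst e)"
      by (simp add: HHa that ip_scaleR_left)
    also have "\<dots> = ip (blinfun_apply H a) (blinfun_apply H (blinfun_apply (adj H) (fst e)))"
      by (simp only: ip_adj [OF H] ip_adj' [OF H])
    also have "\<dots> = (w e)\<^sup>2 *\<^sub>R ip (blinfun_apply H a) (fst e)" by (simp add: HB that ip_scaleR_right)
    finally have "(l a)\<^sup>2 *\<^sub>R ip (blinfun_apply H a) (fst e) = (w e)\<^sup>2 *\<^sub>R ip (blinfun_apply H a) (fst e)" .
    then have "(l a)\<^sup>2 = (w e)\<^sup>2" using False by simp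
    then show ?thesis using l [of a] w [of e] by simp
  qed simp
  have match_snd: "l a powr q * (cmod (ip a (snd e)))\<^sup>2 = w e powr q * (cmod (ip a (snd e)))\<^sup>2"
    if "a \<in> A" "e \<in> B" for a e q
  proof (cases "ip a (snd e) = 0")
    case False
    have "(l a)\<^sup>2 *\<^sub>R ip a (snd e) = ip (blinfun_apply (adj H) (blinfun_apply H a)) (snd e)"
      by (simp add: HA that ip_scaleR_left)
    also have "\<dots> = ip a (blinfun_apply (adj H) (blinfun_apply H (snd e)))"
      by (simp only: ip_adj [OF H] ip_adj' [OF H])
    also have "\<dots> = (w e)\<^sup>2 *\<^sub>R ip a (snd e)" by (simp add: HB that ip_scaleR_right)
    finally have "(l a)\<^sup>2 *\<^sub>R ip a (snd e) = (w e)\<^sup>2 *\<^sub>R ip a (snd e)" .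
    then have "(l a)\<^sup>2 = (w e)\<^sup>2" using False by simp
    then show ?thesis using l [of a] w [of e] by simp
  qed simp
  \<comment> \<open>The vectors \<open>fst e\<close> belong to \<open>H\<close> times its adjoint,
    for which \<open>A\<close> is no eigenbasis. The images of the vectors of \<open>A\<close> under
    \<open>H\<close>, of norm \<open>l a\<close>, take its place, and the exponent p - 2 compensates
    for their squared norm.\<close>
  have fst: "((\<lambda>e. w e powr p * (norm (fst e))\<^sup>2) has_sum scalar_dim * S) B"
  proof (rule has_sum_swap_nonneg [where f = "\<lambda>a e. l a powr (p - 2) * (cmod (ip (blinfun_apply H a) (fst e)))\<^sup>2"
        and g = "\<lambda>a. scalar_dim * l a powr p" and I = A])
    fix a assume a: "a \<in> A"
    have "(norm (blinfun_apply H a))\<^sup>2 = Re (ip (blinfun_apply (adj H) (blinfun_apply H a)) a)"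
      by (simp add: ip_adj' H ip_self)
    also have "\<dots> = (l a)\<^sup>2" by (simp add: HA a ip_scaleR_left ip_self na)
    finally show "((\<lambda>e. l a powr (p - 2) * (cmod (ip (blinfun_apply H a) (fst e)))\<^sup>2) has_sum scalar_dim * l a powr p) B"
      using has_sum_cmult_right [OF pair_parseval(1) [OF B, of "blinfun_apply H a"], of "l a powr (p - 2)"] powr_minus_two [OF l, of a p]
      by (simp add: mult.left_commute)
  next
    fix e assume e: "e \<in> B"
    let ?u = "blinfun_apply (adj H) (fst e)"
    have "(norm ?u)\<^sup>2 = Re (ip (blinfun_apply H ?u) (fst e))" by (simp add: ip_adj H ip_self)
    also have "\<dots> = (w e)\<^sup>2 * (norm (fst e))\<^sup>2" by (simp add: HB e ip_scaleR_left ip_self)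
    finally have u: "w e powr (p - 2) * (norm ?u)\<^sup>2 = w e powr p * (norm (fst e))\<^sup>2"
      using powr_minus_two [OF w, of e p] by (simp flip: mult.assoc)
    have "((\<lambda>a. w e powr (p - 2) * (cmod (ip ?u a))\<^sup>2) has_sum w e powr p * (norm (fst e))\<^sup>2) A"
      using has_sum_cmult_right [OF parseval_norm [OF A, of ?u], of "w e powr (p - 2)"] unfolding u .
    then show "((\<lambda>a. l a powr (p - 2) * (cmod (ip (blinfun_apply H a) (fst e)))\<^sup>2) has_sum w e powr p * (norm (fst e))\<^sup>2) A"
    proof (rule has_sum_cong [THEN iffD1, rotated])
      fix a assume "a \<in> A"
      from match_fst [OF this e, of "p - 2"] show "w e powr (p - 2) * (cmod (ip ?u a))\<^sup>2 = l a powr (p - 2) * (cmod (ip (blinfun_apply H a) (fst e)))\<^sup>2"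
        by (auto simp: ip_adj [OF H] sym [of ?u])
    qed
  qed (auto intro: has_sum_cmult_right S)
  have snd: "((\<lambda>e. w e powr p * (norm (snd e))\<^sup>2) has_sum scalar_dim * S) B"
  proof (rule has_sum_swap_nonneg [where f = "\<lambda>a e. l a powr p * (cmod (ip a (snd e)))\<^sup>2"
        and g = "\<lambda>a. scalar_dim * l a powr p" and I = A])
    fix a assume a: "a \<in> A"
    show "((\<lambda>e. l a powr p * (cmod (ip a (snd e)))\<^sup>2) has_sum scalar_dim * l a powr p) B"
      using has_sum_cmult_right [OF pair_parseval(2) [OF B, of a], of "l a powr p"] by (simp add: na a mult.commute)
  next
    fix e assume e: "e \<in> B"
    have "((\<lambda>a. w e powr p * (cmod (ip (snd e) a))\<^sup>2) has_sum w e powr p * (norm (snd e))\<^sup>2) A"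
      by (rule has_sum_cmult_right [OF parseval_norm [OF A]])
    then show "((\<lambda>a. l a powr p * (cmod (ip a (snd e)))\<^sup>2) has_sum w e powr p * (norm (snd e))\<^sup>2) A"
      by (rule has_sum_cong [THEN iffD1, rotated]) (simp add: match_snd e sym [of "snd e"])
  qed (auto intro: has_sum_cmult_right S)
  have "((\<lambda>e. w e powr p * (norm (fst e))\<^sup>2 + w e powr p * (norm (snd e))\<^sup>2) has_sum scalar_dim * S + scalar_dim * S) B"
    by (rule has_sum_add [OF fst snd])
  then show ?thesis
    by (rule has_sum_cong [THEN iffD1, rotated, THEN back_subst [of "\<lambda>s. (_ has_sum s) _"]])
      (simp_all add: ne flip: distrib_left)
qed

section \<open>Differentiability of the Schatten norm\<close>

lemma schatten_classD:
  assumes "H \<in> schatten_class p"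
  shows "K_linear H" "compact_map H"
  using assms by (auto simp: schatten_class_def compact_op_def intro: compact_mapI)

lemma schatten_norm_nonneg: "0 \<le> schatten_norm p H"
  by (simp add: schatten_norm_def)

text \<open>If all singular values vanish, \<open>H\<close> kills a basis and is 0. Positivity of
  the total is what allows the finiteness of \<open>profile_moment\<close> to be inferred from the
  trace integral.\<close>

lemma schatten_norm_pos:
  assumes H: "H \<in> schatten_class p" "H \<noteq> 0" and p: "p \<noteq> 0"
  shows "0 < schatten_norm p H powr p"
proof (rule ccontr)
  note HK = schatten_classD [OF H(1)]
  obtain A l where A: "orthonormal_basis A" "\<And>a. l a \<ge> (0::real)"
    "\<And>a. a \<in> A \<Longrightarrow> blinfun_apply (adj H) (blinfun_apply H a) = (l a)\<^sup>2 *\<^sub>R a"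
    by (rule singular_basis [OF HK]) (rule that)
  assume "\<not> 0 < schatten_norm p H powr p"
  then have "schatten_norm p H powr p \<le> 0" by simp
  moreover have "((\<lambda>a. l a powr p) has_sum schatten_norm p H powr p) A"
    by (rule schatten_norm_singular_values [OF H(1) p A])
  ultimately have l0: "l a = 0" if "a \<in> A" for a using nonneg_has_sum_le_0D [OF _ _ _ that] by fastforce
  have "H = 0"
  proof (rule K_linear_eq_on_basis [OF A(1) HK(1)])
    show "K_linear 0" by (simp add: K_linear_def linear_0 [OF bounded_linear.linear [OF bounded_linear_scale]])
    fix a assume a: "a \<in> A"
    have "ip (blinfun_apply H a) (blinfun_apply H a) = 0"
      using A(3) [OF a] l0 [OF a] by (simp add: ip_adj' [OF HK(1), symmetric])
    then show "blinfun_apply H a = blinfun_apply 0 a" by (simp add: ip_self_zero_iff)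
  qed
  with H(2) show False by simp
qed

lemma dilation_svd:
  assumes H: "H \<in> schatten_class p" and p: "p \<noteq> 0"
  obtains B w g where "E.onb B" "\<And>e. w e \<ge> (0::real)"
    "\<And>e. e \<in> B \<Longrightarrow> blinfun_apply (dilation H) e = w e *\<^sub>R g e"
    "\<And>e. e \<in> B \<Longrightarrow> blinfun_apply (E.radj (dilation H)) (blinfun_apply (dilation H) e) = (w e)\<^sup>2 *\<^sub>R e"
    "\<And>F. finite F \<Longrightarrow> F \<subseteq> B \<Longrightarrow> E.bessel_on F g"
    "((\<lambda>e. w e powr p) has_sum 2 * scalar_dim * schatten_norm p H powr p) B"
proof -
  note HK = schatten_classD [OF H]
  obtain A l where A: "orthonormal_basis A" "\<And>a. l a \<ge> (0::real)"
    "\<And>a. a \<in> A \<Longrightarrow> blinfun_apply (adj H) (blinfun_apply H a) = (l a)\<^sup>2 *\<^sub>R a"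
    by (rule singular_basis [OF HK]) (rule that)
  obtain B w g where B: "E.onb B" "\<And>e. w e \<ge> (0::real)"
    "\<And>e. e \<in> B \<Longrightarrow> blinfun_apply (dilation H) e = w e *\<^sub>R g e"
    "\<And>e. e \<in> B \<Longrightarrow> blinfun_apply (E.radj (dilation H)) (blinfun_apply (dilation H) e) = (w e)\<^sup>2 *\<^sub>R e"
    "\<And>F. finite F \<Longrightarrow> F \<subseteq> B \<Longrightarrow> E.bessel_on F g"
    by (rule E.svd [OF compact_dilation [OF HK]]) (rule that)
  have "((\<lambda>e. w e powr p) has_sum 2 * scalar_dim * schatten_norm p H powr p) B"
    by (rule dilation_singular_values [OF HK(1) A B(1,2,4) schatten_norm_singular_values [OF H p A]])
  with B show ?thesis by (rule that)
qed

text \<open>The p-th powers of the singular values of the dilation add up to 2 *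
  \<open>scalar_dim\<close> times those of \<open>H\<close>: the factor 2 for the two components,
  \<open>scalar_dim\<close> for the passage to real scalars.\<close>

lemma schatten_dilation:
  assumes H: "H \<in> schatten_class p" and p: "p \<ge> 1"
  shows "E.schatten p ((2 * scalar_dim) powr (1 / p) * schatten_norm p H) (dilation H)"
proof -
  have p0: "p \<noteq> 0" using p by simp
  obtain B w g where B: "E.onb B" "\<And>e. w e \<ge> (0::real)"
    "\<And>e. e \<in> B \<Longrightarrow> blinfun_apply (dilation H) e = w e *\<^sub>R g e"
    "\<And>e. e \<in> B \<Longrightarrow> blinfun_apply (E.radj (dilation H)) (blinfun_apply (dilation H) e) = (w e)\<^sup>2 *\<^sub>R e"
    "\<And>F. finite F \<Longrightarrow> F \<subseteq> B \<Longrightarrow> E.bessel_on F g"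
    "((\<lambda>e. w e powr p) has_sum 2 * scalar_dim * schatten_norm p H powr p) B"
    by (rule dilation_svd [OF H]) (rule p0, rule that)
  show ?thesis
  proof (rule E.schatten_of_diagonal [OF compact_dilation [OF schatten_classD [OF H]] B(1,3,5)])
    fix F assume F: "finite F" "F \<subseteq> B"
    have "(\<Sum>e\<in>F. \<bar>w e\<bar> powr p) \<le> 2 * scalar_dim * schatten_norm p H powr p"
      using finite_sum_le_has_sum [OF B(6) F] B(2) by simp
    also have "\<dots> = ((2 * scalar_dim) powr (1 / p) * schatten_norm p H) powr p"
      using p scalar_dim_pos by (simp add: powr_mult powr_powr schatten_norm_nonneg)
    finally show "(\<Sum>e\<in>F. \<bar>w e\<bar> powr p) \<le> ((2 * scalar_dim) powr (1 / p) * schatten_norm p H) powr p" .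
  qed (use p in \<open>simp_all add: schatten_norm_nonneg\<close>)
qed

lemma times_frechet_differentiable_schatten_norm:
  assumes p: "1 < p" "real m < p" "p < real m + 1"
  shows "times_frechet_differentiable_on m (schatten_class p) (schatten_norm p) (schatten_class p - {0})
    (\<lambda>H. schatten_norm p H powr p)"
proof -
  interpret E: schatten_exponents pair_ip p "p - real m"
    by unfold_locales (use p in auto)
  have m: "real m + (p - real m) = p" by simp
  have p0: "p \<noteq> 0" using p by simp
  define l where "l = (m + 2) div 2"
  \<comment> \<open>The factor between the trace integral and the sum of the p-th powers of the
    singular values of the dilation. It depends on p and m only; division by the multiplicity 2 *
    \<open>scalar_dim\<close> gives the factor for \<open>H\<close>.\<close>
  define a where "a = (-1) ^ l / enn2real (profile_moment p l)"
  show ?thesis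
  proof (rule E.times_frechet_differentiable_form [where \<iota> = dilation and c = "(2 * scalar_dim) powr (1 / p)"
        and \<gamma> = "a / (2 * scalar_dim)", OF _ _ _ _ _ m])
    show "0 < (2 * scalar_dim) powr (1 / p)" using scalar_dim_pos by simp
    show "E.skew (dilation H)" if "H \<in> schatten_class p" for H
      by (rule skew_dilation [OF schatten_classD(1) [OF that]])
    show "E.schatten p ((2 * scalar_dim) powr (1 / p) * schatten_norm p H) (dilation H)" if "H \<in> schatten_class p" for H
      by (rule schatten_dilation [OF that]) (use p in simp)
    show "inj_on dilation (schatten_class p)" by (rule inj_on_subset [OF inj_dilation]) simp
    show "dilation (b *\<^sub>R G + c *\<^sub>R H) = b *\<^sub>R dilation G + c *\<^sub>R dilation H"
      if "G \<in> schatten_class p" "H \<in> schatten_class p" for G H b c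
      by (rule dilation_lincomb [OF that [THEN schatten_classD(1)]])
    fix H assume "H \<in> schatten_class p - {0}"
    then have H: "H \<in> schatten_class p" "H \<noteq> 0" by auto
    obtain B w g where B: "E.onb B" "\<And>e. w e \<ge> (0::real)"
      "\<And>e. e \<in> B \<Longrightarrow> blinfun_apply (dilation H) e = w e *\<^sub>R g e"
      "\<And>e. e \<in> B \<Longrightarrow> blinfun_apply (E.radj (dilation H)) (blinfun_apply (dilation H) e) = (w e)\<^sup>2 *\<^sub>R e"
      "\<And>F. finite F \<Longrightarrow> F \<subseteq> B \<Longrightarrow> E.bessel_on F g"
      "((\<lambda>e. w e powr p) has_sum 2 * scalar_dim * schatten_norm p H powr p) B"
      by (rule dilation_svd [OF H(1)]) (rule p0, rule that)
    have "2 * scalar_dim * schatten_norm p H powr p = a * E.word_integral p m (dilation H) []"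
      unfolding a_def l_def
    proof (rule E.schatten_power_integral [OF m skew_dilation [OF schatten_classD(1) [OF H(1)]] schatten_dilation [OF H(1)] B(1-4) B(6)])
      show "0 < 2 * scalar_dim * schatten_norm p H powr p"
        using schatten_norm_pos [OF H p0] scalar_dim_pos by simp
    qed (use p in simp)
    then show "schatten_norm p H powr p = a / (2 * scalar_dim) * E.word_integral p m (dilation H) []"
      using scalar_dim_pos by (simp add: field_simps)
  qed auto
qed

end

theorem theorem1:
  fixes K :: "complex set"
    and scale :: "complex \<Rightarrow> 'a::banach \<Rightarrow> 'a"
    and ip :: "'a \<Rightarrow> 'a \<Rightarrow> complex"
    and p :: real and m :: nat
  assumes "hilbert_space K scale ip"
    and "1 < p" and "p \<notin> \<nat>"
    and "m = nat \<lfloor>p\<rfloor>"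
  shows "times_frechet_differentiable_on m
           (hilbert_space.schatten_class K scale ip p)
           (hilbert_space.schatten_norm K scale ip p)
           (hilbert_space.schatten_class K scale ip p - {0})
           (\<lambda>H. hilbert_space.schatten_norm K scale ip p H powr p)"
proof (rule hilbert_space.times_frechet_differentiable_schatten_norm [OF assms(1,2)])
  have m: "real m = of_int \<lfloor>p\<rfloor>" using assms by simp
  \<comment> \<open>Non-integrality makes \<theta> = p - m strictly positive.\<close>
  have "real m \<noteq> p" using assms(3) by (metis of_nat_in_Nats)
  then show "real m < p" using m of_int_floor_le [of p] by linarith
  show "p < real m + 1" using m by linarith
qed

end
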